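(* For every $p\in(1,2)$ and every $\varepsilon>0$ there exist compact metric measure spaces $X$ and $Y$, a closed set $E\subset X$, and a homeomorphism $f\colon X\to Y$ such that (i) $X$ is compact, geodesic, and Ahlfors $2$-regular; (ii) $Y$ is locally Ahlfors $2$-regular off $f(E)$; (iii) $0<\mathcal H^{2-p}(E)<\infty$; (iv) $H_f(x)=1$ at every $x\in X\setminus E$; (v) $X$ supports a $(p+\varepsilon)$-Poincar\'e inequality; but for every $q\ge p+\varepsilon$ there exists a family of paths in $X$ with positive $q$-modulus such that $f$ is not absolutely continuous on any path of the family. In particular, $f\notin N^{1,q}_{loc}(X,Y)$ for every $q\ge p+\varepsilon$. Moreover, $X$ and $Y$ can be chosen to be compact subsets of $\mathbb R^2$ equipped with the restriction of Lebesgue measure, where $Y$ carries the Euclidean metric and $X$ carries the length metric induced by the Euclidean metric, this length metric being bi-Lipschitz equivalent to the Euclidean metric on $X$.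
   Context: Metric measure spaces are metric spaces $(X,d)$ without isolated points with a Borel measure $\mu$. Paths are defined on compact intervals; a path is rectifiable if it has finite length $\ell(\gamma)$. $X$ is geodesic if any two points $x,y$ are joined by a path of length $d(x,y)$. $\mathcal H^{\alpha}$ is $\alpha$-dimensional Hausdorff measure. $X$ is Ahlfors $Q$-regular if there is $C>0$ with $C^{-1}r^Q\le\mu(B(x,r))\le Cr^Q$ for all $x\in X$, $0<r<\operatorname{diam}X$. For non-empty $F\subset X$, $X$ is (locally) Ahlfors $Q$-regular off $F$ if there is a constant $C>0$ such that for every $x\in X\setminus F$ there is $r_x>0$ with $C^{-1}r^Q\le\mu(B(x,r))\le Cr^Q$ for all $r\in(0,r_x)$. For a homeomorphism $f\colon X\to Y$: $L_f(x,r)=\sup\{d(f(y),f(x)):d(y,x)\le r\}$, $l_f(x,r)=\inf\{d(f(y),f(x)):d(y,x)\ge r\}$, $H_f(x)=\limsup_{r\to0}L_f(x,r)/l_f(x,r)$. For a rectifiable path $\gamma$ with arc-length parametrization $\gamma_s\colon[0,\ell(\gamma)]\to X$ and Borel $g\ge0$, $\int_\gamma g\,ds=\int_0^{\ell(\gamma)}g(\gamma_s(t))\,dt$. A map $u\colon X\to Y$ is absolutely continuous on a rectifiable path $\gamma$ if $u\circ\gamma_s$ is absolutely continuous. A Borel $g\colon X\to[0,\infty]$ is an upper gradient of a continuous $u\colon X\to Y$ if $d(u(x),u(y))\le\int_\gamma g\,ds$ for all $x,y$ and every rectifiable $\gamma$ joining $x$ and $y$; upper gradients on a subset $U$ are defined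 using the rectifiable curves in $U$. A continuous $u$ is in $N^{1,q}_{loc}(X,Y)$ if it has an upper gradient in $L^q_{loc}(X)$. The $q$-modulus of a path family $\Gamma$ is $\operatorname{Mod}_q(\Gamma)=\inf\int_Xg^q\,d\mu$ over Borel $g\colon X\to[0,\infty]$ with $\int_\gamma g\,ds\ge1$ for all rectifiable $\gamma\in\Gamma$. $X$ supports a $p$-Poincar\'e inequality ($1\le p<\infty$) if there are $\kappa\ge1$, $C>0$ such that for every ball $B$, every bounded continuous $u\colon\kappa B\to\mathbb R$ and every upper gradient $g$ of $u$ on $\kappa B$, $\frac1{\mu(B)}\int_B|u-u_B|\,d\mu\le C(\operatorname{diam}B)\Bigl(\frac1{\mu(\kappa B)}\int_{\kappa B}g^p\,d\mu\Bigr)^{1/p}$, where $u_B=\frac1{\mu(B)}\int_Bu\,d\mu$ and $\kappa B(x,r)=B(x,\kappa r)$. *)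

theory Defs
  imports "HOL-Analysis.Analysis"
begin

text \<open>
  Metric spaces are elements of the library type \<open>'a metric\<close> (carrier \<open>mspace\<close>, distance
  \<open>mdist\<close>), balls are open, and quantities that may be infinite (lengths, diameters, measures,
  line integrals, upper gradients) take values in \<open>ennreal\<close>.  Points of the ambient type
  outside the carrier play no role.
\<close>

section \<open>Metric measure spaces\<close>

definition mborel :: "'a metric \<Rightarrow> 'a measure" where
  "mborel X = sigma (mspace X) {U. openin (mtopology_of X) U}"

definition metric_measure_space :: "'a metric \<Rightarrow> 'a measure \<Rightarrow> bool" where
  "metric_measure_space X \<mu> \<longleftrightarrow>
     space \<mu> = mspace X \<and> sets \<mu> = sets (mborel X) \<and>
     (\<forall>x\<in>mspace X. \<not> openin (mtopology_of X) {x})"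

definition mdiam :: "'a metric \<Rightarrow> 'a set \<Rightarrow> ennreal" where
  "mdiam X S = (SUP x\<in>S. SUP y\<in>S. ennreal (mdist X x y))"

text \<open>The power \<open>x^a\<close> of \<open>x \<in> [0,\<infinity>]\<close>; only used for exponents \<open>a > 0\<close>
  (note \<open>0 powr 0 = 0\<close>).\<close>

definition epowr :: "ennreal \<Rightarrow> real \<Rightarrow> ennreal" where
  "epowr x a = (if x = top then top else ennreal (enn2real x powr a))"

definition ahlfors_regular :: "'a metric \<Rightarrow> 'a measure \<Rightarrow> real \<Rightarrow> bool" where
  "ahlfors_regular X \<mu> Q \<longleftrightarrow>
     (\<exists>C>0. \<forall>x\<in>mspace X. \<forall>r>0. ennreal r < mdiam X (mspace X) \<longrightarrow>
        ennreal (r powr Q / C) \<le> emeasure \<mu> (mball_of X x r) \<and>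
        emeasure \<mu> (mball_of X x r) \<le> ennreal (C * r powr Q))"

definition ahlfors_regular_off :: "'a metric \<Rightarrow> 'a measure \<Rightarrow> real \<Rightarrow> 'a set \<Rightarrow> bool" where
  "ahlfors_regular_off X \<mu> Q F \<longleftrightarrow>
     F \<noteq> {} \<and> F \<subseteq> mspace X \<and>
     (\<exists>C>0. \<forall>x\<in>mspace X - F. \<exists>r\<^sub>x>0. \<forall>r. 0 < r \<and> r < r\<^sub>x \<longrightarrow>
        ennreal (r powr Q / C) \<le> emeasure \<mu> (mball_of X x r) \<and>
        emeasure \<mu> (mball_of X x r) \<le> ennreal (C * r powr Q))"

text \<open>Hausdorff measure of dimension \<open>\<alpha> > 0\<close>, without normalising constant.\<close>

definition hausdorff_content :: "'a metric \<Rightarrow> real \<Rightarrow> real \<Rightarrow> 'a set \<Rightarrow> ennreal" where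
  "hausdorff_content X \<alpha> \<delta> E =
     (INF A \<in> {A :: nat \<Rightarrow> 'a set.
                (\<forall>n. A n \<subseteq> mspace X \<and> mdiam X (A n) \<le> ennreal \<delta>) \<and> E \<subseteq> (\<Union>n. A n)}.
        \<Sum>n. epowr (mdiam X (A n)) \<alpha>)"

definition hausdorff_measure :: "'a metric \<Rightarrow> real \<Rightarrow> 'a set \<Rightarrow> ennreal" where
  "hausdorff_measure X \<alpha> E = (SUP \<delta>\<in>{0<..}. hausdorff_content X \<alpha> \<delta> E)"

section \<open>Paths\<close>

text \<open>The triple \<open>(a, b, c)\<close> is the path \<open>c\<close> on \<open>[a, b]\<close>; values of \<open>c\<close> outside the interval
  are irrelevant.\<close>

type_synonym 'a cpath = "real \<times> real \<times> (real \<Rightarrow> 'a)"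

fun path_in :: "'a metric \<Rightarrow> 'a cpath \<Rightarrow> bool" where
  "path_in X (a, b, c) \<longleftrightarrow>
     a \<le> b \<and> continuous_map (top_of_set {a..b}) (mtopology_of X) c"

fun path_joins :: "'a cpath \<Rightarrow> 'a \<Rightarrow> 'a \<Rightarrow> bool" where
  "path_joins (a, b, c) x y \<longleftrightarrow> c a = x \<and> c b = y"

fun path_len :: "'a metric \<Rightarrow> 'a cpath \<Rightarrow> ennreal" where
  "path_len X (a, b, c) =
     (SUP (n, t) \<in> {(n, t :: nat \<Rightarrow> real). mono_on {..n} t \<and> t 0 = a \<and> t n = b}.
        \<Sum>i<n. ennreal (mdist X (c (t i)) (c (t (Suc i)))))"

definition rectifiable :: "'a metric \<Rightarrow> 'a cpath \<Rightarrow> bool" where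
  "rectifiable X \<gamma> \<longleftrightarrow> path_in X \<gamma> \<and> path_len X \<gamma> < top"

text \<open>Arc-length parametrization on \<open>[0, \<ell>(\<gamma>)]\<close>: the value at \<open>s\<close> is \<open>c t\<close> for any \<open>t\<close> such that
  \<open>c\<close> restricted to \<open>[a, t]\<close> has length \<open>s\<close>; the choice of \<open>t\<close> does not matter, since \<open>c\<close> is
  constant on the set of these \<open>t\<close>.\<close>

fun arclength_param :: "'a metric \<Rightarrow> 'a cpath \<Rightarrow> real \<Rightarrow> 'a" where
  "arclength_param X (a, b, c) s =
     c (SOME t. t \<in> {a..b} \<and> path_len X (a, t, c) = ennreal s)"

definition line_integral :: "'a metric \<Rightarrow> 'a cpath \<Rightarrow> ('a \<Rightarrow> ennreal) \<Rightarrow> ennreal" where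
  "line_integral X \<gamma> g =
     (\<integral>\<^sup>+ t \<in> {0..enn2real (path_len X \<gamma>)}. g (arclength_param X \<gamma> t) \<partial>lborel)"

definition geodesic_space :: "'a metric \<Rightarrow> bool" where
  "geodesic_space X \<longleftrightarrow>
     (\<forall>x\<in>mspace X. \<forall>y\<in>mspace X.
        \<exists>\<gamma>. path_in X \<gamma> \<and> path_joins \<gamma> x y \<and> path_len X \<gamma> = ennreal (mdist X x y))"

text \<open>Distance of the induced length metric; \<open>\<infinity>\<close> if no rectifiable path joins the points.\<close>

definition length_dist :: "'a metric \<Rightarrow> 'a \<Rightarrow> 'a \<Rightarrow> ennreal" where
  "length_dist X x y = (INF \<gamma> \<in> {\<gamma>. path_in X \<gamma> \<and> path_joins \<gamma> x y}. path_len X \<gamma>)"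

definition abs_continuous_interval :: "'b metric \<Rightarrow> real \<Rightarrow> real \<Rightarrow> (real \<Rightarrow> 'b) \<Rightarrow> bool" where
  "abs_continuous_interval Y a b h \<longleftrightarrow>
     (\<forall>\<epsilon>>0. \<exists>\<delta>>0. \<forall>(n::nat) s t.
        (\<forall>i<n. a \<le> s i \<and> s i \<le> t i \<and> t i \<le> b) \<and>
        (\<forall>i<n. \<forall>j<n. i \<noteq> j \<longrightarrow> {s i<..<t i} \<inter> {s j<..<t j} = {}) \<and>
        (\<Sum>i<n. t i - s i) < \<delta> \<longrightarrow>
        (\<Sum>i<n. mdist Y (h (s i)) (h (t i))) < \<epsilon>)"

text \<open>Meaningful for rectifiable \<open>\<gamma>\<close> only.\<close>

definition abs_continuous_path :: "'a metric \<Rightarrow> 'b metric \<Rightarrow> ('a \<Rightarrow> 'b) \<Rightarrow> 'a cpath \<Rightarrow> bool" where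
  "abs_continuous_path X Y u \<gamma> \<longleftrightarrow>
     abs_continuous_interval Y 0 (enn2real (path_len X \<gamma>)) (u \<circ> arclength_param X \<gamma>)"

section \<open>Upper gradients, modulus, Poincare inequality\<close>

text \<open>Upper gradients on a subset \<open>U\<close> are those of the space \<open>submetric X U\<close>, whose paths are
  the paths of \<open>X\<close> that lie in \<open>U\<close>.\<close>

definition upper_gradient ::
    "'a metric \<Rightarrow> 'b metric \<Rightarrow> ('a \<Rightarrow> 'b) \<Rightarrow> ('a \<Rightarrow> ennreal) \<Rightarrow> bool" where
  "upper_gradient X Y u g \<longleftrightarrow>
     g \<in> borel_measurable (mborel X) \<and>
     (\<forall>x\<in>mspace X. \<forall>y\<in>mspace X. \<forall>\<gamma>. rectifiable X \<gamma> \<and> path_joins \<gamma> x y \<longrightarrow>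
        ennreal (mdist Y (u x) (u y)) \<le> line_integral X \<gamma> g)"

definition Lq_loc :: "'a metric \<Rightarrow> 'a measure \<Rightarrow> real \<Rightarrow> ('a \<Rightarrow> ennreal) \<Rightarrow> bool" where
  "Lq_loc X \<mu> q g \<longleftrightarrow>
     g \<in> borel_measurable (mborel X) \<and>
     (\<forall>x\<in>mspace X. \<exists>r>0. (\<integral>\<^sup>+ y \<in> mball_of X x r. epowr (g y) q \<partial>\<mu>) < top)"

definition N1q_loc ::
    "'a metric \<Rightarrow> 'a measure \<Rightarrow> 'b metric \<Rightarrow> real \<Rightarrow> ('a \<Rightarrow> 'b) set" where
  "N1q_loc X \<mu> Y q =
     {u. continuous_map (mtopology_of X) (mtopology_of Y) u \<and>
         (\<exists>g. upper_gradient X Y u g \<and> Lq_loc X \<mu> q g)}"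

definition modulus :: "'a metric \<Rightarrow> 'a measure \<Rightarrow> real \<Rightarrow> 'a cpath set \<Rightarrow> ennreal" where
  "modulus X \<mu> q \<Gamma> =
     (INF g \<in> {g. g \<in> borel_measurable (mborel X) \<and>
                  (\<forall>\<gamma>\<in>\<Gamma>. rectifiable X \<gamma> \<longrightarrow> 1 \<le> line_integral X \<gamma> g)}.
        \<integral>\<^sup>+ x. epowr (g x) q \<partial>\<mu>)"

text \<open>The averages are meaningful when balls have positive finite measure, as in Ahlfors
  regular spaces.\<close>

definition poincare_inequality :: "'a metric \<Rightarrow> 'a measure \<Rightarrow> real \<Rightarrow> bool" where
  "poincare_inequality X \<mu> p \<longleftrightarrow>
     1 \<le> p \<and>
     (\<exists>\<kappa>\<ge>1. \<exists>C>0. \<forall>x\<in>mspace X. \<forall>r>0. \<forall>u :: 'a \<Rightarrow> real. \<forall>g.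
        (let B = mball_of X x r; \<kappa>B = mball_of X x (\<kappa> * r);
             u\<^sub>B = (LINT y:B|\<mu>. u y) / measure \<mu> B
         in continuous_map (mtopology_of (submetric X \<kappa>B)) euclidean u \<longrightarrow>
            bounded (u ` \<kappa>B) \<longrightarrow>
            upper_gradient (submetric X \<kappa>B) euclidean_metric u g \<longrightarrow>
            ennreal ((LINT y:B|\<mu>. \<bar>u y - u\<^sub>B\<bar>) / measure \<mu> B)
              \<le> ennreal C * mdiam X B *
                epowr ((\<integral>\<^sup>+ y \<in> \<kappa>B. epowr (g y) p \<partial>\<mu>) / emeasure \<mu> \<kappa>B) (1 / p)))"

section \<open>Metric distortion\<close>

definition upper_dilation ::
    "'a metric \<Rightarrow> 'b metric \<Rightarrow> ('a \<Rightarrow> 'b) \<Rightarrow> 'a \<Rightarrow> real \<Rightarrow> ennreal" where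
  "upper_dilation X Y f x r =
     (SUP y \<in> {y \<in> mspace X. mdist X y x \<le> r}. ennreal (mdist Y (f y) (f x)))"

definition lower_dilation ::
    "'a metric \<Rightarrow> 'b metric \<Rightarrow> ('a \<Rightarrow> 'b) \<Rightarrow> 'a \<Rightarrow> real \<Rightarrow> ennreal" where
  "lower_dilation X Y f x r =
     (INF y \<in> {y \<in> mspace X. mdist X y x \<ge> r}. ennreal (mdist Y (f y) (f x)))"

definition metric_distortion :: "'a metric \<Rightarrow> 'b metric \<Rightarrow> ('a \<Rightarrow> 'b) \<Rightarrow> 'a \<Rightarrow> ennreal" where
  "metric_distortion X Y f x =
     Limsup (at_right 0) (\<lambda>r. upper_dilation X Y f x r / lower_dilation X Y f x r)"

end

theory Submission
  imports Defs "HOL-Complex_Analysis.Great_Picard"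
begin

text \<open>
  Let \<open>K\<close> and \<open>C\<close> be self-similar Cantor sets on the two axes whose dimensions \<open>s\<^sub>K\<close>, \<open>s\<^sub>C\<close> add up
  to \<open>2 - p\<close>, with \<open>s\<^sub>K\<close> very small, and let \<open>S\<close> be the set of all \<open>(x, y)\<close> with \<open>0 \<le> x \<le> 1\<close> and
  \<open>d(y, C) \<le> d(x, K)\<close>, so that \<open>S\<close> meets the lines over \<open>K\<close> exactly in \<open>E = K \<times> C\<close>.  The map is
  \<open>f (x, y) = (x + F x, y)\<close> with the Cantor function \<open>F\<close> of \<open>K\<close>.  Over a gap of \<open>K\<close> it is a
  translation, and there \<open>S\<close> is locally star-shaped, so \<open>f\<close> is a local isometry off \<open>E\<close>.

  The curves \<open>x \<mapsto> (x, c + \<tau> d(x, K))\<close> with \<open>c \<in> C\<close> and \<open>\<bar>\<tau>\<bar> \<le> 1/2\<close> all cross \<open>K\<close>, where \<open>f\<close>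
  stretches a set of length zero to length one; hence \<open>f\<close> is absolutely continuous on none of them.
  Averaging the integral of \<open>g\<close> along these curves over the Cantor measure of \<open>C\<close> and over \<open>\<tau>\<close> gives
  at most a multiple of the integral of \<open>g (x, y) d(x, K) powr (s\<^sub>C - 1)\<close> over \<open>S\<close>.  By Hoelder's
  inequality this is controlled by the \<open>L\<^sup>q\<close> norm of \<open>g\<close> as soon as
  \<open>1 - s\<^sub>C < (1 - s\<^sub>K) (q - 1)\<close>, a condition that tends to \<open>q > p\<close> as \<open>s\<^sub>K\<close> tends to zero.  This
  yields the positive modulus and, localised to balls, the Poincare inequality.
\<close>

section \<open>Length of paths and arc length\<close>

text \<open>The exponent condition balances two powers of d(x, K). The pencil produces the weight
  d(x, K)^(s_C - 1). Its power q/(q - 1) is integrated over vertical fibres of length about d(x,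
  K)^(1 - s_C), which leaves d(x, K)^(-sigma) with sigma = (1 - s_C)/(q - 1); this is locally
  integrable when sigma < 1 - s_K. For s_K = 0 and s_C = 2 - p it would read p - 1 < q - 1. The
  obstacle is pinching. Inside gaps both d(x, K) and d(y, C) are tents. If a gap of K and a gap of C
  had equal length, then near the pair of midpoints S would be a double cone |x| <= |y|, whose
  halves meet in a single point; almost equal lengths would give a narrow passage. The gap lengths
  are therefore kept apart by a fixed ratio. Every estimate then splits at the scale theta d(x,
  K)/100: below it a short axis-parallel shift leads into a full square contained in S, above it a
  gap of K of comparable size provides full vertical columns.\<close>

lemma mdist_self [simp]: "x \<in> mspace M \<Longrightarrow> mdist M x x = 0"
  by simp

definition partition_of :: "real \<Rightarrow> real \<Rightarrow> nat \<Rightarrow> (nat \<Rightarrow> real) \<Rightarrow> bool" where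
  "partition_of a b n u \<longleftrightarrow> mono_on {..n} u \<and> u 0 = a \<and> u n = b"

definition chain_sum :: "'a metric \<Rightarrow> (real \<Rightarrow> 'a) \<Rightarrow> nat \<Rightarrow> (nat \<Rightarrow> real) \<Rightarrow> real" where
  "chain_sum M c n u = (\<Sum>i<n. mdist M (c (u i)) (c (u (Suc i))))"

lemma chain_sum_nonneg: "0 \<le> chain_sum M c n u"
  by (simp add: chain_sum_def sum_nonneg)

lemma path_len_eq_SUP:
  "path_len M (a, b, c) = (SUP p \<in> {p. partition_of a b (fst p) (snd p)}. ennreal (chain_sum M c (fst p) (snd p)))"
  by (simp add: partition_of_def chain_sum_def case_prod_unfold)

declare path_len.simps [simp del] arclength_param.simps [simp del]

lemma chain_sum_le_path_len:
  "partition_of a b n u \<Longrightarrow> ennreal (chain_sum M c n u) \<le> path_len M (a, b, c)"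
  unfolding path_len_eq_SUP by (rule SUP_upper2[of "(n, u)"]) auto

lemma path_len_leI:
  assumes "\<And>n u. partition_of a b n u \<Longrightarrow> ennreal (chain_sum M c n u) \<le> B"
  shows "path_len M (a, b, c) \<le> B"
  unfolding path_len_eq_SUP by (rule SUP_least) (use assms in auto)

lemma partition_of_in:
  assumes "partition_of a b n u" "i \<le> n"
  shows "u i \<in> {a..b}"
  using assms by (auto simp: partition_of_def mono_on_def)

lemma partition_of_mono:
  assumes "partition_of a b n u" "i < n"
  shows "u i \<le> u (Suc i)"
  using assms by (auto simp: partition_of_def mono_on_def)

lemma partition_of_two: "a \<le> b \<Longrightarrow> partition_of a b 1 (\<lambda>i. if i = 0 then a else b)"
  by (auto simp: partition_of_def mono_on_def)

lemma path_len_ge_mdist: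
  "a \<le> b \<Longrightarrow> ennreal (mdist M (c a) (c b)) \<le> path_len M (a, b, c)"
  using chain_sum_le_path_len[OF partition_of_two, of a b M c] by (simp add: chain_sum_def)

lemma partition_of_append:
  assumes u: "partition_of a t n u" and v: "partition_of t b m v"
  shows "partition_of a b (n + m) (\<lambda>i. if i \<le> n then u i else v (i - n))"
    and "chain_sum M c (n + m) (\<lambda>i. if i \<le> n then u i else v (i - n))
       = chain_sum M c n u + chain_sum M c m v"
proof -
  let ?w = "\<lambda>i. if i \<le> n then u i else v (i - n)"
  show "partition_of a b (n + m) ?w"
    unfolding partition_of_def
  proof (intro conjI mono_onI)
    fix i j assume ij: "i \<in> {..n+m}" "j \<in> {..n+m}" "i \<le> j"
    show "?w i \<le> ?w j"
    proof (cases "i \<le> n \<and> \<not> j \<le> n")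
      case True
      then have "u i \<le> t" using partition_of_in[OF u, of i] by auto
      moreover have "t \<le> v (j - n)" using partition_of_in[OF v, of "j - n"] ij by auto
      ultimately show ?thesis using True by auto
    next
      case False
      then have "v (i - n) \<le> v (j - n)" if "\<not> i \<le> n"
        using v ij that unfolding partition_of_def by (intro mono_onD[of "{..m}" v]) auto
      then show ?thesis using u ij False by (auto simp: partition_of_def mono_on_def)
    qed
  qed (use u v in \<open>auto simp: partition_of_def\<close>)
  have "chain_sum M c (n + m) ?w =
      (\<Sum>i<n. mdist M (c (?w i)) (c (?w (Suc i)))) + (\<Sum>i=n..<n+m. mdist M (c (?w i)) (c (?w (Suc i))))"
    unfolding chain_sum_def lessThan_atLeast0 by (subst sum.atLeastLessThan_concat) auto
  also have "(\<Sum>i=n..<n+m. mdist M (c (?w i)) (c (?w (Suc i)))) = (\<Sum>i=0..<m. mdist M (c (?w (i + n))) (c (?w (Suc (i + n)))))"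
    using sum.shift_bounds_nat_ivl[of "\<lambda>i. mdist M (c (?w i)) (c (?w (Suc i)))" 0 n m] by (simp add: add.commute)
  also have "\<dots> = chain_sum M c m v"
    unfolding chain_sum_def lessThan_atLeast0
    using u v by (intro sum.cong) (auto simp: partition_of_def)
  finally show "chain_sum M c (n + m) ?w = chain_sum M c n u + chain_sum M c m v"
    by (simp add: chain_sum_def)
qed

lemma partition_of_min:
  "partition_of a b n u \<Longrightarrow> a \<le> t \<Longrightarrow> t \<le> b \<Longrightarrow> partition_of a t n (\<lambda>i. min (u i) t)"
  by (auto simp: partition_of_def mono_on_def min_def) (metis order_trans)

lemma partition_of_max:
  "partition_of a b n u \<Longrightarrow> a \<le> t \<Longrightarrow> t \<le> b \<Longrightarrow> partition_of t b n (\<lambda>i. max (u i) t)"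
  by (auto simp: partition_of_def mono_on_def max_def) (metis order_trans)

text \<open>Truncating a partition with \<open>min\<close> and \<open>max\<close> cuts it at
  \<open>t\<close> without locating the index of the cut; only a term straddling \<open>t\<close>
  needs the triangle inequality. For the reverse bound, partitions of the two halves are
  concatenated.\<close>

lemma path_len_append:
  assumes t: "a \<le> t" "t \<le> b" and c: "\<And>t. t \<in> {a..b} \<Longrightarrow> c t \<in> mspace M"
  shows "path_len M (a, b, c) = path_len M (a, t, c) + path_len M (t, b, c)"
proof (rule antisym)
  show "path_len M (a, b, c) \<le> path_len M (a, t, c) + path_len M (t, b, c)"
  proof (rule path_len_leI)
    fix n u assume u: "partition_of a b n u"
    have "chain_sum M c n u \<le> chain_sum M c n (\<lambda>i. min (u i) t) + chain_sum M c n (\<lambda>i. max (u i) t)"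
      unfolding chain_sum_def sum.distrib[symmetric]
    proof (rule sum_mono)
      fix i assume i: "i \<in> {..<n}"
      have 1: "u i \<le> u (Suc i)" using partition_of_mono[OF u] i by auto
      have 2: "c (u i) \<in> mspace M" "c (u (Suc i)) \<in> mspace M" "c t \<in> mspace M"
        using c partition_of_in[OF u, of i] partition_of_in[OF u, of "Suc i"] i t by auto
      consider "u (Suc i) \<le> t" | "t \<le> u i" | "u i < t" "t < u (Suc i)" by linarith
      then show "mdist M (c (u i)) (c (u (Suc i)))
          \<le> mdist M (c (min (u i) t)) (c (min (u (Suc i)) t)) + mdist M (c (max (u i) t)) (c (max (u (Suc i)) t))"
      proof cases
        case 3
        then show ?thesis using mdist_triangle[OF 2(1) 2(3) 2(2)] by (simp add: min_def max_def)
      qed (use 1 2 in \<open>auto simp: min_def max_def\<close>)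
    qed
    then have "ennreal (chain_sum M c n u)
        \<le> ennreal (chain_sum M c n (\<lambda>i. min (u i) t)) + ennreal (chain_sum M c n (\<lambda>i. max (u i) t))"
      by (simp add: ennreal_plus[symmetric] chain_sum_nonneg del: ennreal_plus)
    also have "\<dots> \<le> path_len M (a, t, c) + path_len M (t, b, c)"
      by (intro add_mono chain_sum_le_path_len partition_of_min[OF u] partition_of_max[OF u] t)
    finally show "ennreal (chain_sum M c n u) \<le> path_len M (a, t, c) + path_len M (t, b, c)" .
  qed
  have ne: "{p. partition_of x y (fst p) (snd p)} \<noteq> {}" if "x \<le> y" for x y
    using partition_of_two[OF that] by (metis (mono_tags, lifting) empty_iff fst_conv mem_Collect_eq snd_conv)
  have "path_len M (a, t, c) + path_len M (t, b, c) =
      (SUP p \<in> {p. partition_of a t (fst p) (snd p)}. ennreal (chain_sum M c (fst p) (snd p)) + path_len M (t, b, c))"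
    using ne[OF t(1)] by (subst ennreal_SUP_add_left) (auto simp: path_len_eq_SUP)
  also have "\<dots> \<le> path_len M (a, b, c)"
  proof (rule SUP_least, clarsimp)
    fix n u assume u: "partition_of a t n u"
    have "ennreal (chain_sum M c n u) + path_len M (t, b, c) =
       (SUP p \<in> {p. partition_of t b (fst p) (snd p)}. ennreal (chain_sum M c n u) + ennreal (chain_sum M c (fst p) (snd p)))"
      using ne[OF t(2)] by (simp add: path_len_eq_SUP ennreal_SUP_add_right)
    also have "\<dots> \<le> path_len M (a, b, c)"
    proof (rule SUP_least, clarsimp)
      fix m v assume v: "partition_of t b m v"
      show "ennreal (chain_sum M c n u) + ennreal (chain_sum M c m v) \<le> path_len M (a, b, c)"
        using chain_sum_le_path_len[OF partition_of_append(1)[OF u v], of M c]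
        unfolding partition_of_append(2)[OF u v] by (simp add: chain_sum_nonneg)
    qed
    finally show "ennreal (chain_sum M c n u) + path_len M (t, b, c) \<le> path_len M (a, b, c)" .
  qed
  finally show "path_len M (a, t, c) + path_len M (t, b, c) \<le> path_len M (a, b, c)" .
qed

lemma path_len_refl: "c a \<in> mspace M \<Longrightarrow> path_len M (a, a, c) = 0"
proof -
  assume "c a \<in> mspace M"
  have "path_len M (a, a, c) \<le> 0"
  proof (rule path_len_leI)
    fix n u assume "partition_of a a n u"
    then have "u i = a" if "i \<le> n" for i using partition_of_in[of a a n u i] that by auto
    then show "ennreal (chain_sum M c n u) \<le> 0" using \<open>c a \<in> mspace M\<close> by (simp add: chain_sum_def)
  qed
  then show ?thesis by simp
qed

text \<open>Only \<open>mdist\<close> enters, and \<open>submetric\<close> does not change it. Upper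
  gradients on a ball therefore involve the same line integrals as those on the whole space.\<close>

lemma path_len_submetric [simp]: "path_len (submetric M U) \<gamma> = path_len M \<gamma>"
  by (cases \<gamma>) (simp add: path_len.simps)

lemma arclength_param_submetric [simp]: "arclength_param (submetric M U) \<gamma> = arclength_param M \<gamma>"
  by (cases \<gamma>) (auto simp: arclength_param.simps)

text \<open>The curves constructed below are all Lipschitz. Carrying the constant \<open>L\<close>
  along bounds lengths and line integrals at once and spares the computation of arc length.\<close>

definition lip_curve :: "'a metric \<Rightarrow> real \<Rightarrow> real \<Rightarrow> real \<Rightarrow> (real \<Rightarrow> 'a) \<Rightarrow> bool" where
  "lip_curve M L a b c \<longleftrightarrow> a \<le> b \<and> 0 \<le> L \<and> (\<forall>t\<in>{a..b}. c t \<in> mspace M) \<and>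
     (\<forall>s\<in>{a..b}. \<forall>t\<in>{a..b}. mdist M (c s) (c t) \<le> L * \<bar>s - t\<bar>)"

lemma path_len_lip_curve:
  assumes "lip_curve M L a b c"
  shows "path_len M (a, b, c) \<le> ennreal (L * (b - a))"
proof (rule path_len_leI)
  fix n u assume u: "partition_of a b n u"
  have "chain_sum M c n u \<le> (\<Sum>i<n. L * (u (Suc i) - u i))"
    unfolding chain_sum_def
  proof (rule sum_mono)
    fix i assume "i \<in> {..<n}"
    then show "mdist M (c (u i)) (c (u (Suc i))) \<le> L * (u (Suc i) - u i)"
      using partition_of_in[OF u, of i] partition_of_in[OF u, of "Suc i"] partition_of_mono[OF u, of i] assms
      unfolding lip_curve_def by (smt (verit) Suc_leI lessThan_iff less_imp_le)
  qed
  also have "\<dots> = L * (b - a)"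
    using u by (simp add: sum_distrib_left[symmetric] sum_lessThan_telescope partition_of_def)
  finally show "ennreal (chain_sum M c n u) \<le> ennreal (L * (b - a))" by (rule ennreal_leI)
qed

lemma continuous_map_mtopology_of:
  "continuous_map (mtopology_of M) (mtopology_of N) f \<longleftrightarrow>
     f ` mspace M \<subseteq> mspace N \<and>
     (\<forall>x\<in>mspace M. \<forall>e>0. \<exists>d>0. \<forall>y. y \<in> mspace M \<and> mdist M x y < d \<longrightarrow> mdist N (f x) (f y) < e)"
  unfolding mtopology_of_def
  by (rule Metric_space.metric_continuous_map) auto

lemma continuous_map_interval_metric:
  "continuous_map (top_of_set {a..b}) (mtopology_of M) c \<longleftrightarrow>
     (\<forall>t\<in>{a..b}. c t \<in> mspace M) \<and>
     (\<forall>t\<in>{a..b}. \<forall>e>0. \<exists>d>0. \<forall>t'\<in>{a..b::real}. \<bar>t - t'\<bar> < d \<longrightarrow> mdist M (c t) (c t') < e)"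
proof -
  have eq: "top_of_set {a..b} = mtopology_of (submetric euclidean_metric {a..b})"
    by (simp add: mtopology_of_submetric)
  show ?thesis
    unfolding eq continuous_map_mtopology_of
    by (simp add: dist_real_def image_subset_iff Ball_def imp_conjL)
qed

lemma lip_curve_continuous_map:
  assumes "lip_curve M L a b c"
  shows "continuous_map (top_of_set {a..b}) (mtopology_of M) c"
  unfolding continuous_map_interval_metric
proof (intro conjI ballI allI impI)
  fix t and e :: real assume t: "t \<in> {a..b}" and e: "0 < e"
  have L: "0 \<le> L" using assms by (simp add: lip_curve_def)
  show "\<exists>d>0. \<forall>t'\<in>{a..b}. \<bar>t - t'\<bar> < d \<longrightarrow> mdist M (c t) (c t') < e"
  proof (intro exI conjI ballI impI)
    show "0 < e / (L + 1)" using e L by simp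
    fix t' assume t': "t' \<in> {a..b}" "\<bar>t - t'\<bar> < e / (L + 1)"
    have "mdist M (c t) (c t') \<le> L * \<bar>t - t'\<bar>" using assms t t' by (auto simp: lip_curve_def)
    also have "\<dots> \<le> (L + 1) * \<bar>t - t'\<bar>" by (simp add: algebra_simps)
    also have "\<dots> < e" using t'(2) L by (simp add: field_simps)
    finally show "mdist M (c t) (c t') < e" .
  qed
qed (use assms in \<open>auto simp: lip_curve_def\<close>)

lemma lip_curve_rectifiable:
  assumes "lip_curve M L a b c"
  shows "rectifiable M (a, b, c)"
  using lip_curve_continuous_map[OF assms] path_len_lip_curve[OF assms] assms
  by (auto simp: rectifiable_def lip_curve_def le_less_trans)

lemma lip_curve_subinterval:
  "lip_curve M L a b c \<Longrightarrow> a \<le> s \<Longrightarrow> s \<le> t \<Longrightarrow> t \<le> b \<Longrightarrow> lip_curve M L s t c"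
  by (auto simp: lip_curve_def)

lemma chain_sum_perturb:
  assumes "\<And>i. i \<le> n \<Longrightarrow> c (u i) \<in> mspace M \<and> c (v i) \<in> mspace M \<and> mdist M (c (u i)) (c (v i)) \<le> e"
  shows "chain_sum M c n u \<le> chain_sum M c n v + 2 * real n * e"
proof -
  have "chain_sum M c n u \<le> (\<Sum>i<n. mdist M (c (v i)) (c (v (Suc i))) + 2 * e)"
    unfolding chain_sum_def
  proof (rule sum_mono)
    fix i assume i: "i \<in> {..<n}"
    have in_M: "c (u i) \<in> mspace M" "c (v i) \<in> mspace M" "c (u (Suc i)) \<in> mspace M" "c (v (Suc i)) \<in> mspace M"
      and e: "mdist M (c (u i)) (c (v i)) \<le> e" "mdist M (c (u (Suc i))) (c (v (Suc i))) \<le> e"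
      using assms[of i] assms[of "Suc i"] i by auto
    show "mdist M (c (u i)) (c (u (Suc i))) \<le> mdist M (c (v i)) (c (v (Suc i))) + 2 * e"
      using mdist_triangle[of "c (u i)" M "c (v i)" "c (u (Suc i))"]
        mdist_triangle[of "c (v i)" M "c (v (Suc i))" "c (u (Suc i))"] in_M e
        mdist_commute[of M "c (u (Suc i))" "c (v (Suc i))"] by linarith
  qed
  also have "\<dots> = chain_sum M c n v + 2 * real n * e"
    by (simp add: chain_sum_def sum.distrib)
  finally show ?thesis .
qed

text \<open>A partition is truncated at a nearby point, and its chain sum depends continuously on that
  point.\<close>

lemma path_len_lsc:
  assumes c: "continuous_map (top_of_set {a..b}) (mtopology_of M) c" and t: "t \<in> {a..b}"
  shows "B < path_len M (a, t, c) \<Longrightarrow>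
           \<exists>d>0. \<forall>t'. a \<le> t' \<and> t' \<le> t \<and> t - t' < d \<longrightarrow> B < path_len M (a, t', c)"
    and "B < path_len M (t, b, c) \<Longrightarrow>
           \<exists>d>0. \<forall>t'. t \<le> t' \<and> t' \<le> b \<and> t' - t < d \<longrightarrow> B < path_len M (t', b, c)"
proof -
  have cont: "\<And>t. t\<in>{a..b} \<Longrightarrow> c t \<in> mspace M"
     "\<And>t e. t\<in>{a..b} \<Longrightarrow> e>0 \<Longrightarrow> \<exists>d>0. \<forall>t'\<in>{a..b::real}. \<bar>t - t'\<bar> < d \<longrightarrow> mdist M (c t) (c t') < e"
    using c by (auto simp: continuous_map_interval_metric)
  have key: "\<exists>d>0. \<forall>v. (\<forall>i\<le>n. u i \<in> {a..b} \<and> v i \<in> {a..b} \<and> (v i = u i \<or> \<bar>t - u i\<bar> < d \<and> \<bar>t - v i\<bar> < d))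
       \<longrightarrow> B < ennreal (chain_sum M c n v)"
    if less: "B < ennreal (chain_sum M c n u)" for n u
  proof -
    obtain r where r: "B = ennreal r" "0 \<le> r" using less_trans[OF less ennreal_less_top] by (cases B) auto
    then have rl: "r < chain_sum M c n u" using less by (simp add: ennreal_less_iff)
    \<comment> \<open>Each term has two end points, each moved by at most \<open>2 * e\<close>, so
      the chain sum drops by at most \<open>4 * n * e\<close>, which is less than the excess over
      \<open>r\<close>.\<close>
    define e where "e = (chain_sum M c n u - r) / (8 * real n + 8)"
    have e: "e > 0" using rl by (simp add: e_def)
    obtain d where d: "d > 0" "\<And>t'. t' \<in> {a..b} \<Longrightarrow> \<bar>t - t'\<bar> < d \<Longrightarrow> mdist M (c t) (c t') < e"
      using cont(2)[of t e] e t by auto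
    show ?thesis
    proof (intro exI[of _ d] conjI d(1) allI impI)
      fix v assume uv: "\<forall>i\<le>n. u i \<in> {a..b} \<and> v i \<in> {a..b} \<and> (v i = u i \<or> \<bar>t - u i\<bar> < d \<and> \<bar>t - v i\<bar> < d)"
      have "chain_sum M c n u \<le> chain_sum M c n v + 2 * real n * (2 * e)"
      proof (rule chain_sum_perturb)
        fix i assume i: "i \<le> n"
        have m: "c (u i) \<in> mspace M" "c (v i) \<in> mspace M" "c t \<in> mspace M" using uv i cont(1) t by auto
        have "mdist M (c (u i)) (c (v i)) \<le> 2 * e"
        proof (cases "v i = u i")
          case True then show ?thesis using m e by simp
        next
          case False
          then have "mdist M (c t) (c (u i)) < e" "mdist M (c t) (c (v i)) < e" using uv i d(2) by auto
          then show ?thesis using mdist_triangle[of "c (u i)" M "c t" "c (v i)"] m mdist_commute[of M "c t" "c (u i)"] by simp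
        qed
        then show "c (u i) \<in> mspace M \<and> c (v i) \<in> mspace M \<and> mdist M (c (u i)) (c (v i)) \<le> 2 * e"
          using m by simp
      qed
      moreover have "2 * real n * (2 * e) < chain_sum M c n u - r"
      proof -
        have "chain_sum M c n u - r = (8 * real n + 8) * e" unfolding e_def by simp
        moreover have "0 < (4 * real n + 8) * e" using e by (simp add: add_nonneg_pos)
        ultimately show ?thesis using uv by (simp add: algebra_simps)
      qed
      ultimately have "r < chain_sum M c n v" using uv by simp
      then show "B < ennreal (chain_sum M c n v)" using r by (simp add: ennreal_less_iff)
    qed
  qed
  {
    assume less: "B < path_len M (a, t, c)"
    obtain n u where u: "partition_of a t n u" "B < ennreal (chain_sum M c n u)"
      using less unfolding path_len_eq_SUP less_SUP_iff by auto
    obtain d where d: "d > 0" "\<And>v. (\<forall>i\<le>n. u i \<in> {a..b} \<and> v i \<in> {a..b} \<and> (v i = u i \<or> \<bar>t - u i\<bar> < d \<and> \<bar>t - v i\<bar> < d)) \<Longrightarrow> B < ennreal (chain_sum M c n v)"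
      using key[OF u(2)] by blast
    show "\<exists>d>0. \<forall>t'. a \<le> t' \<and> t' \<le> t \<and> t - t' < d \<longrightarrow> B < path_len M (a, t', c)"
    proof (intro exI[of _ d] conjI d(1) allI impI)
      fix t' assume t': "a \<le> t' \<and> t' \<le> t \<and> t - t' < d"
      have "B < ennreal (chain_sum M c n (\<lambda>i. min (u i) t'))"
      proof (rule d(2), intro allI impI)
        fix i assume "i \<le> n"
        from partition_of_in[OF u(1) this] show "u i \<in> {a..b} \<and> min (u i) t' \<in> {a..b} \<and>
            (min (u i) t' = u i \<or> \<bar>t - u i\<bar> < d \<and> \<bar>t - min (u i) t'\<bar> < d)"
          using t t' by (auto simp: min_def)
      qed
      also have "\<dots> \<le> path_len M (a, t', c)"
        by (rule chain_sum_le_path_len, rule partition_of_min[OF u(1)]) (use t' in auto)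
      finally show "B < path_len M (a, t', c)" .
    qed
  next
    assume less: "B < path_len M (t, b, c)"
    obtain n u where u: "partition_of t b n u" "B < ennreal (chain_sum M c n u)"
      using less unfolding path_len_eq_SUP less_SUP_iff by auto
    obtain d where d: "d > 0" "\<And>v. (\<forall>i\<le>n. u i \<in> {a..b} \<and> v i \<in> {a..b} \<and> (v i = u i \<or> \<bar>t - u i\<bar> < d \<and> \<bar>t - v i\<bar> < d)) \<Longrightarrow> B < ennreal (chain_sum M c n v)"
      using key[OF u(2)] by blast
    show "\<exists>d>0. \<forall>t'. t \<le> t' \<and> t' \<le> b \<and> t' - t < d \<longrightarrow> B < path_len M (t', b, c)"
    proof (intro exI[of _ d] conjI d(1) allI impI)
      fix t' assume t': "t \<le> t' \<and> t' \<le> b \<and> t' - t < d"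
      have "B < ennreal (chain_sum M c n (\<lambda>i. max (u i) t'))"
      proof (rule d(2), intro allI impI)
        fix i assume "i \<le> n"
        from partition_of_in[OF u(1) this] show "u i \<in> {a..b} \<and> max (u i) t' \<in> {a..b} \<and>
            (max (u i) t' = u i \<or> \<bar>t - u i\<bar> < d \<and> \<bar>t - max (u i) t'\<bar> < d)"
          using t t' by (auto simp: max_def)
      qed
      also have "\<dots> \<le> path_len M (t', b, c)"
        by (rule chain_sum_le_path_len, rule partition_of_max[OF u(1)]) (use t' in auto)
      finally show "B < path_len M (t', b, c)" .
    qed
  }
qed

locale rectifiable_path =
  fixes M :: "'a metric" and a b :: real and c :: "real \<Rightarrow> 'a"
  assumes rect: "rectifiable M (a, b, c)"
begin

definition arc :: "real \<Rightarrow> real" where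
  "arc t = enn2real (path_len M (a, t, c))"

lemma ab: "a \<le> b" and cont: "continuous_map (top_of_set {a..b}) (mtopology_of M) c"
  and fin: "path_len M (a, b, c) < top"
  using rect by (auto simp: rectifiable_def)

lemma c_in: "t \<in> {a..b} \<Longrightarrow> c t \<in> mspace M"
  using cont by (auto simp: continuous_map_interval_metric)

lemma path_len_split:
  "a \<le> s \<Longrightarrow> s \<le> t \<Longrightarrow> t \<le> b \<Longrightarrow> path_len M (a, t, c) = path_len M (a, s, c) + path_len M (s, t, c)"
  by (rule path_len_append) (auto intro: c_in)

lemma path_len_arc: "t \<in> {a..b} \<Longrightarrow> path_len M (a, t, c) = ennreal (arc t)"
proof -
  assume t: "t \<in> {a..b}"
  have "path_len M (a, t, c) \<le> path_len M (a, b, c)"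
    using path_len_split[of t b] t by auto
  then show ?thesis using fin by (auto simp: arc_def less_top intro: ennreal_enn2real[symmetric] le_less_trans)
qed

lemma arc_nonneg [simp]: "0 \<le> arc t" by (simp add: arc_def)

lemma path_len_between: "a \<le> s \<Longrightarrow> s \<le> t \<Longrightarrow> t \<le> b \<Longrightarrow> path_len M (s, t, c) = ennreal (arc t - arc s)"
proof -
  assume st: "a \<le> s" "s \<le> t" "t \<le> b"
  have "ennreal (arc t) = ennreal (arc s) + path_len M (s, t, c)"
    using path_len_split[OF st] st by (simp add: path_len_arc)
  then show ?thesis
    by (cases "path_len M (s, t, c)") (auto simp: ennreal_plus[symmetric] simp del: ennreal_plus)
qed

lemma arc_mono: "a \<le> s \<Longrightarrow> s \<le> t \<Longrightarrow> t \<le> b \<Longrightarrow> arc s \<le> arc t"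
proof -
  assume st: "a \<le> s" "s \<le> t" "t \<le> b"
  have "ennreal (arc s) \<le> ennreal (arc t)"
    using path_len_split[OF st] st by (simp add: path_len_arc)
  then show ?thesis by simp
qed

lemma arc_start: "arc a = 0"
  using path_len_refl[of c a M] c_in[of a] ab by (simp add: arc_def)

lemma mdist_le_arc: "a \<le> s \<Longrightarrow> s \<le> t \<Longrightarrow> t \<le> b \<Longrightarrow> mdist M (c s) (c t) \<le> arc t - arc s"
  using path_len_ge_mdist[of s t M c] path_len_between[of s t] arc_mono[of s t] by simp

text \<open>The lengths over \<open>[a, t]\<close> and over \<open>[t, b]\<close> are both lower
  semicontinuous in \<open>t\<close> by \<open>path_len_lsc\<close>. Their sum is constant, so each
  of them is upper semicontinuous as well.\<close>

lemma continuous_on_arc: "continuous_on {a..b} arc"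
proof -
  have "\<exists>d>0. \<forall>t'\<in>{a..b}. dist t' t < d \<longrightarrow> dist (arc t') (arc t) < e"
    if t: "t \<in> {a..b}" and e: "0 < e" for t e
  proof -
    have "\<exists>d>0. \<forall>t'. a \<le> t' \<and> t' \<le> t \<and> t - t' < d \<longrightarrow> arc t - e < arc t'"
    proof (cases "arc t - e \<ge> 0")
      case True
      then have "ennreal (arc t - e) < path_len M (a, t, c)" using t e by (simp add: path_len_arc ennreal_less_iff)
      from path_len_lsc(1)[OF cont t this] obtain d where "d > 0"
         "\<forall>t'. a \<le> t' \<and> t' \<le> t \<and> t - t' < d \<longrightarrow> ennreal (arc t - e) < path_len M (a, t', c)" by auto
      then show ?thesis using True t by (intro exI[of _ d]) (auto simp: path_len_arc ennreal_less_iff)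
    next
      case False
      then show ?thesis by (smt (verit) arc_nonneg zero_less_one)
    qed
    then obtain d1 where d1: "d1 > 0" "\<And>t'. a \<le> t' \<Longrightarrow> t' \<le> t \<Longrightarrow> t - t' < d1 \<Longrightarrow> arc t - e < arc t'" by auto
    have "\<exists>d>0. \<forall>t'. t \<le> t' \<and> t' \<le> b \<and> t' - t < d \<longrightarrow> arc b - arc t - e < arc b - arc t'"
    proof (cases "arc b - arc t - e \<ge> 0")
      case True
      then have "ennreal (arc b - arc t - e) < path_len M (t, b, c)" using t e by (simp add: path_len_between ennreal_less_iff)
      from path_len_lsc(2)[OF cont t this] obtain d where "d > 0"
         "\<forall>t'. t \<le> t' \<and> t' \<le> b \<and> t' - t < d \<longrightarrow> ennreal (arc b - arc t - e) < path_len M (t', b, c)" by auto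
      then show ?thesis using True t by (intro exI[of _ d]) (auto simp: path_len_between ennreal_less_iff)
    next
      case False
      then show ?thesis using arc_mono t by (intro exI[of _ 1]) (smt (verit) atLeastAtMost_iff)
    qed
    then obtain d2 where d2: "d2 > 0" "\<And>t'. t \<le> t' \<Longrightarrow> t' \<le> b \<Longrightarrow> t' - t < d2 \<Longrightarrow> arc t' < arc t + e"
      by (auto simp: algebra_simps)
    show ?thesis
    proof (intro exI[of _ "min d1 d2"] conjI ballI impI)
      fix t' assume t': "t' \<in> {a..b}" "dist t' t < min d1 d2"
      show "dist (arc t') (arc t) < e"
      proof (cases "t' \<le> t")
        case True
        then show ?thesis using d1(2)[of t'] arc_mono[of t' t] t t' by (auto simp: dist_real_def)
      next
        case False
        then show ?thesis using d2(2)[of t'] arc_mono[of t t'] t t' by (auto simp: dist_real_def)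
      qed
    qed (use d1 d2 in auto)
  qed
  then show ?thesis by (simp add: continuous_on_iff)
qed

lemma arc_surj:
  assumes "0 \<le> \<sigma>" "\<sigma> \<le> arc b"
  obtains t where "t \<in> {a..b}" "arc t = \<sigma>"
  using IVT'[of arc a \<sigma> b] assms continuous_on_arc ab arc_start by auto

text \<open>The \<open>SOME\<close> in the definition may return another time with the same arc
  length; the curve has length zero between the two times, so it is at the same point.\<close>

lemma arclength_param_arc: "t \<in> {a..b} \<Longrightarrow> arclength_param M (a, b, c) (arc t) = c t"
proof -
  assume t: "t \<in> {a..b}"
  define r where "r = (SOME r. r \<in> {a..b} \<and> path_len M (a, r, c) = ennreal (arc t))"
  have "r \<in> {a..b} \<and> path_len M (a, r, c) = ennreal (arc t)"
    unfolding r_def by (rule someI[of _ t]) (use t path_len_arc in auto)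
  then have r: "r \<in> {a..b}" "arc r = arc t" by (auto simp: path_len_arc)
  have "mdist M (c r) (c t) \<le> 0"
  proof (cases "r \<le> t")
    case True
    have "mdist M (c r) (c t) \<le> arc t - arc r" by (rule mdist_le_arc) (use True r t in auto)
    with r show ?thesis by simp
  next
    case False
    have "mdist M (c t) (c r) \<le> arc r - arc t" by (rule mdist_le_arc) (use False r t in auto)
    with r show ?thesis by (simp add: mdist_commute[of M "c r"])
  qed
  then have "mdist M (c r) (c t) = 0" using mdist_nonneg[of M "c r" "c t"] by linarith
  then have "c r = c t" using mdist_zero[OF c_in[OF r(1)] c_in[OF t]] by blast
  then show ?thesis by (simp add: r_def arclength_param.simps)
qed

lemma path_len_total: "enn2real (path_len M (a, b, c)) = arc b"
  by (simp add: arc_def)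

lemma lip_curve_arclength_param: "lip_curve M 1 0 (arc b) (arclength_param M (a, b, c))"
  unfolding lip_curve_def
proof (intro conjI ballI)
  fix s t assume st: "s \<in> {0..arc b}" "t \<in> {0..arc b}"
  obtain s' where s': "s' \<in> {a..b}" "arc s' = s" by (rule arc_surj[of s]) (use st in auto)
  obtain t' where t': "t' \<in> {a..b}" "arc t' = t" by (rule arc_surj[of t]) (use st in auto)
  show "mdist M (arclength_param M (a, b, c) s) (arclength_param M (a, b, c) t) \<le> 1 * \<bar>s - t\<bar>"
    using arclength_param_arc[OF s'(1)] arclength_param_arc[OF t'(1)] s' t'
      mdist_le_arc[of s' t'] mdist_le_arc[of t' s'] mdist_commute[of M "c t'" "c s'"]
      arc_mono[of s' t'] arc_mono[of t' s'] by (cases "s' \<le> t'") auto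
next
  fix s assume s: "s \<in> {0..arc b}"
  obtain s' where s': "s' \<in> {a..b}" "arc s' = s" by (rule arc_surj[of s]) (use s in auto)
  then show "arclength_param M (a, b, c) s \<in> mspace M" using arclength_param_arc c_in by metis
qed simp_all

lemma arclength_param_ends:
  "arclength_param M (a, b, c) 0 = c a" "arclength_param M (a, b, c) (arc b) = c b"
  using arclength_param_arc[of a] arclength_param_arc[of b] arc_start ab by auto

end

section \<open>Line integrals along Lipschitz curves\<close>

lemma measurable_into_mborel:
  assumes c: "continuous_map (top_of_set S) (mtopology_of M) c"
  shows "c \<in> measurable (restrict_space borel S) (mborel M)"
  unfolding mborel_def
proof (rule measurable_measure_of)
  show "{U. openin (mtopology_of M) U} \<subseteq> Pow (mspace M)" by (auto dest!: openin_subset)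
  show "c \<in> space (restrict_space borel S) \<rightarrow> mspace M"
    using c by (auto simp: continuous_map_def space_restrict_space)
  fix U assume "U \<in> {U. openin (mtopology_of M) U}"
  then have "openin (top_of_set S) {x \<in> S. c x \<in> U}"
    using c by (auto simp: continuous_map_def)
  then obtain T where "open T" "{x \<in> S. c x \<in> U} = S \<inter> T" by (auto simp: openin_open)
  then have "open T" and eq: "c -` U \<inter> space (restrict_space borel S) = S \<inter> T"
    by (auto simp: space_restrict_space)
  then show "c -` U \<inter> space (restrict_space borel S) \<in> sets (restrict_space borel S)"
    unfolding eq sets_restrict_space by (intro imageI) auto
qed

lemma measurable_along_curve:
  assumes "lip_curve M L a b c" and g: "g \<in> borel_measurable (mborel M)"
  shows "(\<lambda>t. g (c t) * indicator {a..b} t :: ennreal) \<in> borel_measurable borel"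
proof -
  have "c \<in> measurable (restrict_space borel {a..b}) (mborel M)"
    by (rule measurable_into_mborel, rule lip_curve_continuous_map, rule assms)
  then have "(\<lambda>t. g (c t)) \<in> borel_measurable (restrict_space borel {a..b})"
    using g by (rule measurable_compose)
  then show ?thesis by (subst (asm) borel_measurable_restrict_space_iff_ennreal) auto
qed

text \<open>Half-lines identify a Borel measure through \<open>measure_eqI_lessThan\<close>,
  provided their masses are finite; constancy of \<open>F\<close> beyond \<open>b\<close> ensures
  this.\<close>

lemma emeasure_interval_measure_Ioi:
  assumes F: "\<And>x y. x \<le> y \<Longrightarrow> F x \<le> F y" "continuous_on UNIV F"
    and const: "\<And>y. b \<le> y \<Longrightarrow> F y = F b"
  shows "emeasure (interval_measure F) {x<..} = ennreal (F b - F x)"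
proof -
  have rc: "continuous (at_right a) F" for a
    using F(2) by (meson UNIV_I continuous_at_imp_continuous_at_within continuous_on_eq_continuous_at open_UNIV)
  have U: "{x<..} = (\<Union>n. {x<..max x b + real n})"
  proof (intro set_eqI iffI)
    fix y assume "y \<in> {x<..}"
    moreover obtain n where "y - max x b \<le> real n" using real_arch_simple by blast
    ultimately show "y \<in> (\<Union>n. {x<..max x b + real n})" by (auto intro!: exI[of _ n])
  qed auto
  have "F (max x b + real n) - F x = F b - F x" for n using const[of "max x b + real n"] by simp
  then have "emeasure (interval_measure F) {x<..max x b + real n} = ennreal (F b - F x)" for n
    by (subst emeasure_interval_measure_Ioc[OF _ F(1) rc]) auto
  moreover have "(\<lambda>n. emeasure (interval_measure F) {x<..max x b + real n}) \<longlonglongrightarrow> emeasure (interval_measure F) {x<..}"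
    unfolding U by (rule Lim_emeasure_incseq) (auto simp: incseq_def)
  ultimately show ?thesis by (simp add: LIMSEQ_const_iff)
qed

lemma emeasure_interval_measure_UNIV:
  assumes F: "\<And>x y. x \<le> y \<Longrightarrow> F x \<le> F y" "continuous_on UNIV F"
    and const: "\<And>y. y \<le> a \<Longrightarrow> F y = F a" "\<And>y. b \<le> y \<Longrightarrow> F y = F b"
  shows "emeasure (interval_measure F) UNIV = ennreal (F b - F a)"
proof -
  have U: "UNIV = (\<Union>n. {a - real n<..})"
  proof (intro set_eqI iffI)
    fix y
    obtain n where "a - y < real n" using reals_Archimedean2 by blast
    then show "y \<in> (\<Union>n. {a - real n<..})" by (auto intro!: exI[of _ n])
  qed auto
  have "emeasure (interval_measure F) {a - real n<..} = ennreal (F b - F a)" for n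
    using emeasure_interval_measure_Ioi[OF F const(2), of "a - real n"] const(1)[of "a - real n"] by simp
  moreover have "(\<lambda>n. emeasure (interval_measure F) {a - real n<..}) \<longlonglongrightarrow> emeasure (interval_measure F) UNIV"
    unfolding U by (rule Lim_emeasure_incseq) (auto simp: incseq_def)
  ultimately show ?thesis by (simp add: LIMSEQ_const_iff)
qed

lemma nn_integral_measure_mono:
  assumes sets: "sets M = sets N" and le: "\<And>A. A \<in> sets M \<Longrightarrow> emeasure M A \<le> emeasure N A"
  shows "(\<integral>\<^sup>+x. f x \<partial>M) \<le> (\<integral>\<^sup>+x. f x \<partial>N)"
  unfolding nn_integral_def
proof (rule SUP_mono)
  fix g assume g: "g \<in> {g. simple_function M g \<and> g \<le> f}"
  have sp: "space M = space N" using sets by (rule sets_eq_imp_space_eq)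
  have "simple_function N g" using g sets sp by (simp add: simple_function_def)
  moreover have "integral\<^sup>S M g \<le> integral\<^sup>S N g"
    unfolding simple_integral_def sp
    using g sp by (intro sum_mono mult_left_mono le) (auto simp: simple_function_def)
  ultimately show "\<exists>m\<in>{g. simple_function N g \<and> g \<le> f}. integral\<^sup>S M g \<le> integral\<^sup>S N m"
    using g by auto
qed

text \<open>The difference of the two distribution functions is monotone, so the second measure is the
  sum of the first one and another measure.\<close>

lemma emeasure_interval_measure_mono:
  assumes F: "\<And>x y. x \<le> y \<Longrightarrow> F x \<le> F y" "continuous_on UNIV F"
    and G: "\<And>x y. x \<le> y \<Longrightarrow> F y - F x \<le> G y - G x" "continuous_on UNIV G"
    and const: "\<And>y. b \<le> y \<Longrightarrow> F y = F b" "\<And>y. b \<le> y \<Longrightarrow> G y = G b" and A: "A \<in> sets borel"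
  shows "emeasure (interval_measure F) A \<le> emeasure (interval_measure G) A"
proof -
  let ?H = "\<lambda>x. G x - F x"
  let ?M = "interval_measure F" and ?N = "interval_measure ?H" and ?P = "interval_measure G"
  let ?S = "measure_of UNIV (sets borel) (\<lambda>A. emeasure ?M A + emeasure ?N A)"
  have H: "x \<le> y \<Longrightarrow> ?H x \<le> ?H y" "continuous_on UNIV ?H" for x y
    using G(1)[of x y] F(2) G(2) by (auto intro: continuous_on_diff)
  have Gm: "x \<le> y \<Longrightarrow> G x \<le> G y" for x y using F(1)[of x y] G(1)[of x y] by linarith
  have sets_S: "sets ?S = sets borel" by (simp add: sets.sigma_sets_eq[of borel, simplified])
  have S: "emeasure ?S A = emeasure ?M A + emeasure ?N A" if "A \<in> sets borel" for A
  proof (rule emeasure_measure_of)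
    show "countably_additive (sets ?S) (\<lambda>A. emeasure ?M A + emeasure ?N A)"
      unfolding sets_S
    proof (rule countably_additiveI)
      fix X :: "nat \<Rightarrow> real set" assume X: "range X \<subseteq> sets borel" "disjoint_family X"
      have "(\<Sum>i. emeasure ?M (X i) + emeasure ?N (X i)) = (\<Sum>i. emeasure ?M (X i)) + (\<Sum>i. emeasure ?N (X i))"
        by (rule suminf_add[symmetric]) auto
      also have "\<dots> = emeasure ?M (\<Union> (range X)) + emeasure ?N (\<Union> (range X))"
        using X by (simp add: suminf_emeasure)
      finally show "(\<Sum>i. emeasure ?M (X i) + emeasure ?N (X i)) = emeasure ?M (\<Union> (range X)) + emeasure ?N (\<Union> (range X))" .
    qed
  qed (use that sets_S in \<open>auto simp: positive_def\<close>)
  have "?P = ?S"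
  proof (rule measure_eqI_lessThan)
    fix x
    show "emeasure ?P {x<..} < \<infinity>"
      by (subst emeasure_interval_measure_Ioi[OF Gm G(2) const(2)]) auto
    have le: "F x \<le> F b" "?H x \<le> ?H b"
      using F(1)[of x b] H(1)[of x b] const(1)[of x] const(2)[of x] by (metis linear order_refl)+
    have Hb: "?H y = ?H b" if "b \<le> y" for y using const(1)[OF that] const(2)[OF that] by simp
    have "emeasure ?S {x<..} = ennreal (F b - F x) + ennreal (?H b - ?H x)"
      using S[of "{x<..}"] emeasure_interval_measure_Ioi[OF F const(1), of x]
        emeasure_interval_measure_Ioi[OF H Hb, of x] by simp
    also have "\<dots> = ennreal (G b - G x)"
      using le by (simp add: ennreal_plus[symmetric] del: ennreal_plus)
    also have "\<dots> = emeasure ?P {x<..}"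
      using emeasure_interval_measure_Ioi[OF Gm G(2) const(2), of x] by simp
    finally show "emeasure ?P {x<..} = emeasure ?S {x<..}" ..
  qed (use sets_S in auto)
  then show ?thesis using S[OF A] by simp
qed

text \<open>The Stieltjes measure of \<open>s\<close> is pushed to Lebesgue measure by \<open>s\<close> and is at most \<open>L\<close>
  times Lebesgue measure.\<close>

lemma nn_integral_lipschitz_substitution:
  fixes s :: "real \<Rightarrow> real" and h :: "real \<Rightarrow> ennreal"
  assumes ab: "a \<le> b" and s: "\<And>x y. a \<le> x \<Longrightarrow> x \<le> y \<Longrightarrow> y \<le> b \<Longrightarrow> s x \<le> s y"
    and lip: "\<And>x y. a \<le> x \<Longrightarrow> x \<le> y \<Longrightarrow> y \<le> b \<Longrightarrow> s y - s x \<le> L * (y - x)" and L: "0 \<le> L"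
    and h: "h \<in> borel_measurable borel"
  shows "(\<integral>\<^sup>+x\<in>{s a..s b}. h x \<partial>lborel) \<le> ennreal L * (\<integral>\<^sup>+t\<in>{a..b}. h (s t) \<partial>lborel)"
proof -
  \<comment> \<open>Clamping extends \<open>s\<close> by constants to the whole line, so that the
    extension has a finite Stieltjes measure.\<close>
  define cl where "cl t = max a (min b t)" for t
  define F where "F t = s (cl t)" for t
  define G where "G t = L * cl t" for t
  have cl: "cl t \<in> {a..b}" "t \<in> {a..b} \<Longrightarrow> cl t = t" "x \<le> y \<Longrightarrow> cl x \<le> cl y" "b \<le> y \<Longrightarrow> cl y = cl b" for t x y
    using ab by (auto simp: cl_def)
  have cl_lip: "\<bar>cl x - cl y\<bar> \<le> \<bar>x - y\<bar>" for x y by (auto simp: cl_def)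
  have F1: "x \<le> y \<Longrightarrow> F x \<le> F y" and FG: "x \<le> y \<Longrightarrow> F y - F x \<le> G y - G x" for x y
    using s[of "cl x" "cl y"] lip[of "cl x" "cl y"] cl(1)[of x] cl(1)[of y] cl(3)[of x y]
    unfolding F_def G_def right_diff_distrib by simp_all
  have G2: "continuous_on UNIV G" unfolding G_def cl_def by (intro continuous_intros)
  have "\<bar>F x - F y\<bar> \<le> L * \<bar>x - y\<bar>" for x y
  proof -
    have "\<bar>F x - F y\<bar> \<le> \<bar>G x - G y\<bar>" using F1[of x y] F1[of y x] FG[of x y] FG[of y x] by linarith
    also have "\<dots> = L * \<bar>cl x - cl y\<bar>" using L by (simp add: G_def right_diff_distrib[symmetric] abs_mult)
    also have "\<dots> \<le> L * \<bar>x - y\<bar>" using cl_lip L by (simp add: mult_left_mono)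
    finally show ?thesis .
  qed
  then have "L-lipschitz_on UNIV F" using L by (intro lipschitz_onI) (auto simp: dist_real_def)
  then have F2: "continuous_on UNIV F" by (rule lipschitz_on_continuous_on)
  note F = F1 F2
  have const: "b \<le> y \<Longrightarrow> F y = F b" "b \<le> y \<Longrightarrow> G y = G b" for y using cl(4)[of y] by (simp_all add: F_def G_def)
  have [measurable]: "F \<in> borel_measurable borel" using F2 by (rule borel_measurable_continuous_onI)
  note h[measurable]
  have F_ab: "F a = s a" "F b = s b" using cl(2) ab by (auto simp: F_def)
  let ?MF = "interval_measure F" and ?MG = "interval_measure G"
  have Gm: "x \<le> y \<Longrightarrow> G x \<le> G y" for x y using F1[of x y] FG[of x y] by linarith
  have MG: "?MG = density lborel (\<lambda>t. ennreal L * indicator {a..b} t)"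
  proof (rule measure_eqI_lessThan)
    fix x
    show "emeasure ?MG {x<..} < \<infinity>" by (subst emeasure_interval_measure_Ioi[OF Gm G2 const(2)]) auto
    have "emeasure (density lborel (\<lambda>t. ennreal L * indicator {a..b} t)) {x<..} =
       (\<integral>\<^sup>+t. ennreal L * indicator ({a..b} \<inter> {x<..}) t \<partial>lborel)"
      by (subst emeasure_density) (auto simp: indicator_inter_arith mult.assoc intro!: nn_integral_cong)
    also have "\<dots> = ennreal L * emeasure lborel ({a..b} \<inter> {x<..})"
      by (subst nn_integral_cmult_indicator) auto
    also have "emeasure lborel ({a..b} \<inter> {x<..}) = ennreal (cl b - cl x)"
    proof -
      consider "x < a" | "a \<le> x" "x \<le> b" | "b < x" by linarith
      then show ?thesis
      proof cases
        case 1 then have "{a..b} \<inter> {x<..} = {a..b}" by auto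
        then show ?thesis using 1 ab by (simp add: cl_def)
      next
        case 2 then have "{a..b} \<inter> {x<..} = {x<..b}" by auto
        then show ?thesis using 2 ab by (simp add: cl_def)
      next
        case 3 then have "{a..b} \<inter> {x<..} = {}" by auto
        then show ?thesis using 3 ab by (simp add: cl_def)
      qed
    qed
    also have "ennreal L * ennreal (cl b - cl x) = ennreal (G b - G x)"
      using L cl(1)[of x] cl(2)[of b] ab by (simp add: G_def ennreal_mult[symmetric] right_diff_distrib)
    also have "\<dots> = emeasure ?MG {x<..}"
      by (rule emeasure_interval_measure_Ioi[OF Gm G2 const(2), symmetric]) auto
    finally show "emeasure ?MG {x<..} = emeasure (density lborel (\<lambda>t. ennreal L * indicator {a..b} t)) {x<..}" ..
  qed auto
  have MF: "distr ?MF borel F = density lborel (indicator {s a..s b})"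
  proof (rule measure_eqI_lessThan[symmetric])
    fix x
    have dens: "emeasure (density lborel (indicator {s a..s b})) {x<..} = emeasure lborel ({s a..s b} \<inter> {x<..})"
    proof -
      have "emeasure (density lborel (indicator {s a..s b})) {x<..}
          = (\<integral>\<^sup>+y. indicator {s a..s b} y * indicator {x<..} y \<partial>lborel)"
        by (rule emeasure_density) auto
      also have "\<dots> = (\<integral>\<^sup>+y. indicator ({s a..s b} \<inter> {x<..}) y \<partial>lborel)"
        by (simp only: indicator_inter_arith)
      also have "\<dots> = emeasure lborel ({s a..s b} \<inter> {x<..})" by (rule nn_integral_indicator) auto
      finally show ?thesis .
    qed
    have "emeasure lborel ({s a..s b} \<inter> {x<..}) \<le> emeasure lborel {s a..s b}" by (rule emeasure_mono) auto
    also have "\<dots> < \<infinity>" by (simp add: emeasure_lborel_Icc_eq)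
    finally show "emeasure (density lborel (indicator {s a..s b})) {x<..} < \<infinity>" unfolding dens .
    note dens
    also have "emeasure lborel ({s a..s b} \<inter> {x<..}) = emeasure ?MF (F -` {x<..})"
    proof -
      have sab: "s a \<le> s b" using s ab by auto
      have Fr: "F y \<in> {s a..s b}" for y using s[of a "cl y"] s[of "cl y" b] cl(1)[of y] ab by (auto simp: F_def)
      consider "x < s a" | "s a \<le> x" "x < s b" | "s b \<le> x" by linarith
      then show ?thesis
      proof cases
        case 1
        then have e: "{s a..s b} \<inter> {x<..} = {s a..s b}" "F -` {x<..} = UNIV" using Fr by (auto intro: less_le_trans)
        have Fa: "F y = F a" if "y \<le> a" for y using that ab by (simp add: F_def cl_def)
        have "emeasure ?MF UNIV = ennreal (F b - F a)"
          by (rule emeasure_interval_measure_UNIV[OF F Fa const(1)])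
        moreover have "emeasure lborel {s a..s b} = ennreal (s b - s a)" using sab by simp
        ultimately show ?thesis unfolding e F_ab by simp
      next
        case 2
        \<comment> \<open>\<open>y\<close> is the last time at which \<open>F\<close> is at most
          \<open>x\<close>, found as the maximum of a compact set. By the intermediate value theorem
          \<open>F y = x\<close>, so the preimage of the half-line beyond \<open>x\<close> is the
          half-line beyond \<open>y\<close>.\<close>
        obtain y where y: "a \<le> y" "y \<le> b" "F y = x" "\<And>z. F z > x \<longleftrightarrow> z > y"
        proof -
          let ?Z = "{a..b} \<inter> F -` {..x}"
          have "closed ?Z" by (intro closed_Int closed_atLeastAtMost closed_vimage) (use F2 in auto)
          then have "compact ?Z" by (metis bounded_Int bounded_closed_interval compact_eq_bounded_closed box_real(2) bounded_cbox)
          moreover have "a \<in> ?Z" using ab 2 F_ab by auto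
          ultimately obtain y where y: "y \<in> ?Z" "\<And>z. z \<in> ?Z \<Longrightarrow> z \<le> y"
            using compact_attains_sup[of ?Z] by blast
          have gt: "F z > x" if "z > y" for z
          proof (cases "z \<le> b")
            case True then show ?thesis using y(1) y(2)[of z] that by (auto simp: not_less[symmetric])
          next
            case False
            then have "F z = F b" using const(1)[of z] by simp
            then show ?thesis using 2 F_ab by simp
          qed
          have "y \<noteq> b" using y(1) 2 F_ab by auto
          then have "y < b" using y(1) by auto
          have "\<not> F y < x"
          proof
            assume "F y < x"
            then obtain z where "y \<le> z" "z \<le> b" "F z = x"
              using IVT'[of F y x b] 2 F_ab \<open>y < b\<close> continuous_on_subset[OF F2] by auto
            then have "z \<le> y" using y by auto
            then show False using \<open>y \<le> z\<close> \<open>F z = x\<close> \<open>F y < x\<close> by auto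
          qed
          then have "F y = x" using y(1) by auto
          moreover have "F z > x \<longleftrightarrow> z > y" for z
            using gt[of z] F1[of z y] \<open>F y = x\<close> by linarith
          ultimately show ?thesis by (intro that[of y]) (use y(1) in auto)
        qed
        have e: "{s a..s b} \<inter> {x<..} = {x<..s b}" using 2 by auto
        have e': "F -` {x<..} = {y<..}" using y(4) by (simp add: vimage_def greaterThan_def)
        have "emeasure ?MF {y<..} = ennreal (s b - x)"
          using emeasure_interval_measure_Ioi[OF F const(1), of y] unfolding y(3) F_ab .
        then show ?thesis using 2 unfolding e e' by simp
      next
        case 3
        have "F y \<le> x" for y using Fr[of y] 3 by auto
        then have "F -` {x<..} = {}" by (auto simp: leD)
        moreover have "{s a..s b} \<inter> {x<..} = {}" using 3 by auto
        ultimately show ?thesis by simp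
      qed
    qed
    also have "\<dots> = emeasure (distr ?MF borel F) {x<..}" by (subst emeasure_distr) auto
    finally show "emeasure (density lborel (indicator {s a..s b})) {x<..} = emeasure (distr ?MF borel F) {x<..}" .
  qed auto
  have "(\<integral>\<^sup>+x\<in>{s a..s b}. h x \<partial>lborel) = (\<integral>\<^sup>+x. h x \<partial>density lborel (indicator {s a..s b}))"
    by (subst nn_integral_density) (auto simp: mult.commute)
  also have "\<dots> = (\<integral>\<^sup>+t. h (F t) \<partial>?MF)"
    unfolding MF[symmetric] by (subst nn_integral_distr) auto
  also have "\<dots> \<le> (\<integral>\<^sup>+t. h (F t) \<partial>?MG)"
    by (intro nn_integral_measure_mono emeasure_interval_measure_mono[OF F FG G2 const]) auto
  also have "\<dots> = (\<integral>\<^sup>+t. (ennreal L * indicator {a..b} t) * h (F t) \<partial>lborel)"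
    unfolding MG by (subst nn_integral_density) auto
  also have "\<dots> = (\<integral>\<^sup>+t. ennreal L * (h (s t) * indicator {a..b} t) \<partial>lborel)"
    using cl(2) by (intro nn_integral_cong) (auto simp: F_def indicator_def)
  also have "\<dots> = ennreal L * (\<integral>\<^sup>+t\<in>{a..b}. h (s t) \<partial>lborel)"
  proof (subst nn_integral_cmult)
    have "(\<lambda>t. h (F t) * indicator {a..b} t) \<in> borel_measurable lborel" by simp
    moreover have "h (F t) * indicator {a..b} t = h (s t) * indicator {a..b} t" for t
      using cl(2) by (auto simp: F_def indicator_def)
    ultimately show "(\<lambda>t. h (s t) * indicator {a..b} t) \<in> borel_measurable lborel" by simp
  qed simp
  finally show ?thesis .
qed

text \<open>Arc length is a monotone \<open>L\<close>-Lipschitz change of variables. An inequality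
  is enough, because line integrals only occur as upper bounds, of increments or of the constant
  1.\<close>

lemma line_integral_le_lip_curve:
  assumes lip: "lip_curve M L a b c" and g: "g \<in> borel_measurable (mborel M)"
  shows "line_integral M (a, b, c) g \<le> ennreal L * (\<integral>\<^sup>+t\<in>{a..b}. g (c t) \<partial>lborel)"
proof -
  interpret rectifiable_path M a b c
    by unfold_locales (rule lip_curve_rectifiable[OF lip])
  have L: "0 \<le> L" using lip by (simp add: lip_curve_def)
  let ?h = "\<lambda>x. g (arclength_param M (a, b, c) x) * indicator {0..arc b} x"
  have h: "?h \<in> borel_measurable borel"
    by (rule measurable_along_curve[OF lip_curve_arclength_param g])
  have lips: "arc y - arc x \<le> L * (y - x)" if "a \<le> x" "x \<le> y" "y \<le> b" for x y
  proof -
    have "ennreal (arc y - arc x) \<le> ennreal (L * (y - x))"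
      using path_len_lip_curve[OF lip_curve_subinterval[OF lip that]] path_len_between[OF that] by simp
    then show ?thesis using L that by (simp add: ennreal_le_iff)
  qed
  have "line_integral M (a, b, c) g = (\<integral>\<^sup>+x\<in>{arc a..arc b}. ?h x \<partial>lborel)"
    unfolding line_integral_def path_len_total arc_start
    by (intro nn_integral_cong) (auto simp: indicator_def)
  also have "\<dots> \<le> ennreal L * (\<integral>\<^sup>+t\<in>{a..b}. ?h (arc t) \<partial>lborel)"
    by (rule nn_integral_lipschitz_substitution[OF ab arc_mono lips L h])
  also have "(\<integral>\<^sup>+t\<in>{a..b}. ?h (arc t) \<partial>lborel) = (\<integral>\<^sup>+t\<in>{a..b}. g (c t) \<partial>lborel)"
    by (intro nn_integral_cong) (auto simp: indicator_def arclength_param_arc arc_mono ab)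
  finally show ?thesis .
qed

lemma upper_gradient_lip_curve:
  assumes ug: "upper_gradient M Y u g" and lip: "lip_curve M L a b c"
  shows "ennreal (mdist Y (u (c a)) (u (c b))) \<le> ennreal L * (\<integral>\<^sup>+t\<in>{a..b}. g (c t) \<partial>lborel)"
proof -
  have "c a \<in> mspace M" "c b \<in> mspace M" using lip by (auto simp: lip_curve_def)
  moreover have "rectifiable M (a, b, c)" by (rule lip_curve_rectifiable[OF lip])
  ultimately have "ennreal (mdist Y (u (c a)) (u (c b))) \<le> line_integral M (a, b, c) g"
    using ug unfolding upper_gradient_def by (metis path_joins.simps)
  also have "\<dots> \<le> ennreal L * (\<integral>\<^sup>+t\<in>{a..b}. g (c t) \<partial>lborel)"
    using ug by (intro line_integral_le_lip_curve[OF lip]) (auto simp: upper_gradient_def)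
  finally show ?thesis .
qed

section \<open>Cantor sets\<close>

text \<open>Left end points of the \<open>2 ^ n\<close> construction intervals of length
  \<open>a ^ n\<close>. The recursion applies the outer similarity last, which matches the recursion
  of \<open>cantor_approx\<close>.\<close>

primrec cantor_ends :: "real \<Rightarrow> nat \<Rightarrow> real set" where
  "cantor_ends a 0 = {0}"
| "cantor_ends a (Suc n) = (\<lambda>l. a * l) ` cantor_ends a n \<union> (\<lambda>l. a * l + (1 - a)) ` cantor_ends a n"

definition cantor_level :: "real \<Rightarrow> nat \<Rightarrow> real set" where
  "cantor_level a n = (\<Union>l\<in>cantor_ends a n. {l..l + a ^ n})"

definition cantor_set :: "real \<Rightarrow> real set" where
  "cantor_set a = (\<Inter>n. cantor_level a n)"

text \<open>Iterates of the self-similarity equation of the Cantor distribution function, started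
  from the uniform distribution on the unit interval.\<close>

primrec cantor_approx :: "real \<Rightarrow> nat \<Rightarrow> real \<Rightarrow> real" where
  "cantor_approx a 0 x = max 0 (min 1 x)"
| "cantor_approx a (Suc n) x = (cantor_approx a n (x / a) + cantor_approx a n ((x - (1 - a)) / a)) / 2"

definition cantor_fun :: "real \<Rightarrow> real \<Rightarrow> real" where
  "cantor_fun a x = lim (\<lambda>n. cantor_approx a n x)"

locale cantor =
  fixes a :: real
  assumes a: "0 < a" "a < 1/2"
begin

lemma finite_ends: "finite (cantor_ends a n)"
  by (induction n) auto

lemma ends_bounds: "l \<in> cantor_ends a n \<Longrightarrow> 0 \<le> l \<and> l + a ^ n \<le> 1"
proof (induction n arbitrary: l)
  case (Suc n)
  then obtain l' where l': "l' \<in> cantor_ends a n" "l = a * l' \<or> l = a * l' + (1 - a)" by auto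
  from Suc.IH[OF l'(1)] have "0 \<le> a * l'" "a * (l' + a ^ n) \<le> a * 1" using a by (auto intro: mult_left_mono)
  then show ?case using l'(2) a by (auto simp: algebra_simps)
qed simp

lemma ends_separated:
  "l \<in> cantor_ends a n \<Longrightarrow> l' \<in> cantor_ends a n \<Longrightarrow> l < l' \<Longrightarrow> l + a ^ n < l'"
proof (induction n arbitrary: l l')
  case (Suc n)
  obtain k where k: "k \<in> cantor_ends a n" "l = a * k \<or> l = a * k + (1 - a)" using Suc.prems by auto
  obtain k' where k': "k' \<in> cantor_ends a n" "l' = a * k' \<or> l' = a * k' + (1 - a)" using Suc.prems by auto
  have b: "0 \<le> k" "k + a ^ n \<le> 1" "0 \<le> k'" "k' + a ^ n \<le> 1" using ends_bounds k k' by auto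
  have m: "a * (k + a ^ n) \<le> a * 1" "0 \<le> a * k'" "a * (k' + a ^ n) \<le> a * 1" "0 \<le> a * k" "0 < a * a ^ n"
    using a b by (auto intro: mult_left_mono)
  have same: "a * k + a * a ^ n < a * k'" if "a * k < a * k'"
  proof -
    have "k + a ^ n < k'" using Suc.IH[OF k(1) k'(1)] that a by simp
    then have "a * (k + a ^ n) < a * k'" using a by simp
    then show ?thesis by (simp add: distrib_left)
  qed
  from k(2) k'(2) show ?case
    using Suc.prems(3) same m a by (elim disjE) (auto simp: distrib_left)
qed simp

lemma card_ends_eq: "card (cantor_ends a n) = 2 ^ n"
proof (induction n)
  case (Suc n)
  have disj: "(\<lambda>l. a * l) ` cantor_ends a n \<inter> (\<lambda>l. a * l + (1 - a)) ` cantor_ends a n = {}"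
  proof -
    have "a * l < a * l' + (1 - a)" if l: "l \<in> cantor_ends a n" "l' \<in> cantor_ends a n" for l l'
    proof -
      have "0 < a ^ n" using a by simp
      then have "0 \<le> l'" "l \<le> 1" using ends_bounds[OF l(1)] ends_bounds[OF l(2)] by linarith+
      then have "a * l \<le> a * 1" "0 \<le> a * l'" using a by (auto intro: mult_left_mono)
      then show ?thesis using a by linarith
    qed
    then show ?thesis by fastforce
  qed
  have "card (cantor_ends a (Suc n)) = card ((\<lambda>l. a * l) ` cantor_ends a n) + card ((\<lambda>l. a * l + (1 - a)) ` cantor_ends a n)"
    using disj finite_ends by (simp add: card_Un_disjoint)
  also have "\<dots> = card (cantor_ends a n) + card (cantor_ends a n)"
    using a by (subst (1 2) card_image) (auto simp: inj_on_def)
  finally show ?case using Suc by simp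
qed simp

text \<open>The recursion of \<open>cantor_ends\<close> acts from outside; this lemma and the next
  give the view from inside, where each interval splits into a left and a right child.\<close>

lemma ends_children:
  "l \<in> cantor_ends a n \<Longrightarrow> l \<in> cantor_ends a (Suc n) \<and> l + (1 - a) * a ^ n \<in> cantor_ends a (Suc n)"
proof (induction n arbitrary: l)
  case (Suc n)
  then obtain l' where l': "l' \<in> cantor_ends a n" "l = a * l' \<or> l = a * l' + (1 - a)" by auto
  from Suc.IH[OF l'(1)] have IH: "l' \<in> cantor_ends a (Suc n)" "l' + (1 - a) * a ^ n \<in> cantor_ends a (Suc n)" by auto
  have e: "a * l' + (1 - a) * a ^ Suc n = a * (l' + (1 - a) * a ^ n)"
     "a * l' + (1 - a) + (1 - a) * a ^ Suc n = a * (l' + (1 - a) * a ^ n) + (1 - a)" by (auto simp: algebra_simps)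
  from l'(2) show ?case
    unfolding cantor_ends.simps(2)[of a "Suc n"] using IH e by auto
qed simp

lemma ends_parent:
  "l \<in> cantor_ends a (Suc n) \<Longrightarrow> \<exists>l'\<in>cantor_ends a n. l = l' \<or> l = l' + (1 - a) * a ^ n"
proof (induction n arbitrary: l)
  case (Suc n)
  then obtain m where m: "m \<in> cantor_ends a (Suc n)" "l = a * m \<or> l = a * m + (1 - a)"
    unfolding cantor_ends.simps(2)[of a "Suc n"] by auto
  from Suc.IH[OF m(1)] obtain m' where m': "m' \<in> cantor_ends a n" "m = m' \<or> m = m' + (1 - a) * a ^ n" by auto
  have "a * m' \<in> cantor_ends a (Suc n)" "a * m' + (1 - a) \<in> cantor_ends a (Suc n)" using m'(1) by auto
  moreover have e: "a * (m' + (1 - a) * a ^ n) = a * m' + (1 - a) * a ^ Suc n" by (simp add: algebra_simps)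
  have "l = a * m' \<or> l = a * m' + (1 - a) * a ^ Suc n \<or> l = a * m' + (1 - a) \<or> l = a * m' + (1 - a) + (1 - a) * a ^ Suc n"
    using m(2) m'(2) e by (elim disjE) (simp_all add: add_ac del: power_Suc)
  ultimately show ?case by blast
qed auto

lemma level_decreasing: "cantor_level a (Suc n) \<subseteq> cantor_level a n"
proof
  fix x assume "x \<in> cantor_level a (Suc n)"
  then obtain l where l: "l \<in> cantor_ends a (Suc n)" "l \<le> x" "x \<le> l + a ^ Suc n"
    by (auto simp: cantor_level_def)
  obtain l' where l': "l' \<in> cantor_ends a n" "l = l' \<or> l = l' + (1 - a) * a ^ n" using ends_parent[OF l(1)] by auto
  have "a * a ^ n \<le> 1 * a ^ n" using a by (intro mult_right_mono) auto
  moreover have "0 \<le> a * a ^ n" using a by simp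
  ultimately have "l' \<le> x \<and> x \<le> l' + a ^ n" using l l'(2) by (auto simp: algebra_simps)
  then show "x \<in> cantor_level a n" using l'(1) by (auto simp: cantor_level_def)
qed

lemma level_antimono: "m \<le> n \<Longrightarrow> cantor_level a n \<subseteq> cantor_level a m"
  by (rule lift_Suc_antimono_le[of "cantor_level a"]) (use level_decreasing in auto)

lemma in_cantor_setI: "(\<And>n. m \<le> n \<Longrightarrow> x \<in> cantor_level a n) \<Longrightarrow> x \<in> cantor_set a"
  unfolding cantor_set_def using level_antimono by (metis INT_I linorder_le_cases order_refl subsetD)

lemma ends_in_cantor_set:
  assumes "l \<in> cantor_ends a n"
  shows "l \<in> cantor_set a" "l + a ^ n \<in> cantor_set a"
proof -
  have "l \<in> cantor_ends a (n + k)" for k by (induction k) (use assms ends_children in auto)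
  \<comment> \<open>At every later level the rightmost descendant of the interval starts here, so
    the right end point is never removed.\<close>
  moreover have "l + a ^ n - a ^ (n + k) \<in> cantor_ends a (n + k)" for k
  proof (induction k)
    case (Suc k)
    from ends_children[OF this] show ?case by (simp add: algebra_simps)
  qed (use assms in auto)
  moreover have "0 \<le> a ^ (n + k)" for k using a by simp
  ultimately have "l \<in> {l..l + a ^ (n + k)}" "l \<in> cantor_ends a (n + k)"
      "l + a ^ n \<in> {l + a ^ n - a ^ (n + k)..l + a ^ n - a ^ (n + k) + a ^ (n + k)}"
      "l + a ^ n - a ^ (n + k) \<in> cantor_ends a (n + k)" for k
    by (simp_all)
  then have "l \<in> cantor_level a (n + k)" "l + a ^ n \<in> cantor_level a (n + k)" for k
    unfolding cantor_level_def by blast+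
  then show "l \<in> cantor_set a" "l + a ^ n \<in> cantor_set a"
    by (auto intro!: in_cantor_setI[where m=n] simp: le_iff_add)
qed

lemma compact_cantor_set: "compact (cantor_set a)"
proof -
  have "closed (cantor_set a)"
    unfolding cantor_set_def cantor_level_def
    by (intro closed_INT ballI closed_UN finite_ends) auto
  moreover have "cantor_set a \<subseteq> {0..1}"
    unfolding cantor_set_def cantor_level_def by (auto dest!: INT_D[where a=0])
  ultimately show ?thesis
    by (meson bounded_closed_interval bounded_subset compact_eq_bounded_closed)
qed

lemma cantor_set_subset: "cantor_set a \<subseteq> {0..1}"
  unfolding cantor_set_def cantor_level_def by (auto dest!: INT_D[where a=0])

lemma zero_in_cantor_set: "0 \<in> cantor_set a" and one_in_cantor_set: "1 \<in> cantor_set a"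
  using ends_in_cantor_set[of 0 0] by auto

text \<open>The first level that misses \<open>x\<close> shows \<open>x\<close> in the removed
  middle part of an interval of the level before.\<close>

lemma cantor_gap:
  assumes "x \<in> {0..1}" "x \<notin> cantor_set a"
  obtains n l where "l \<in> cantor_ends a n" "l + a ^ Suc n < x" "x < l + a ^ n - a ^ Suc n"
proof -
  define N where "N = (LEAST n. x \<notin> cantor_level a n)"
  have ex: "\<exists>n. x \<notin> cantor_level a n" using assms by (auto simp: cantor_set_def)
  have N: "x \<notin> cantor_level a N" unfolding N_def by (rule LeastI_ex[OF ex])
  have "x \<in> cantor_level a 0" using assms by (auto simp: cantor_level_def)
  then obtain n where n: "N = Suc n" using N by (cases N) auto
  then have "x \<in> cantor_level a n" using not_less_Least[of n "\<lambda>n. x \<notin> cantor_level a n"] by (auto simp: N_def)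
  then obtain l where l: "l \<in> cantor_ends a n" "l \<le> x" "x \<le> l + a ^ n" by (auto simp: cantor_level_def)
  have "\<not> x \<le> l + a ^ Suc n" "\<not> l + a ^ n - a ^ Suc n \<le> x"
    using ends_children[OF l(1)] N l unfolding n cantor_level_def by (auto simp: algebra_simps)
  then show ?thesis using that[OF l(1)] by auto
qed

subsection \<open>The Cantor function\<close>

lemma approx_range: "0 \<le> cantor_approx a n x \<and> cantor_approx a n x \<le> 1"
proof (induction n arbitrary: x)
  case (Suc n)
  show ?case using Suc[of "x / a"] Suc[of "(x - (1 - a)) / a"] by simp
qed auto

lemma approx_outside:
  "x \<le> 0 \<Longrightarrow> cantor_approx a n x = 0" "1 \<le> x \<Longrightarrow> cantor_approx a n x = 1"
proof (induction n arbitrary: x)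
  case (Suc n)
  { case 1
    have "x / a \<le> 0" "(x - (1 - a)) / a \<le> 0" using 1 a by (auto simp: divide_nonpos_pos)
    then show ?case using Suc by simp }
  { case 2
    have "1 \<le> x / a" "1 \<le> (x - (1 - a)) / a" using 2 a by (auto simp: field_simps)
    then show ?case using Suc by simp }
qed auto

lemma approx_mono: "x \<le> y \<Longrightarrow> cantor_approx a n x \<le> cantor_approx a n y"
proof (induction n arbitrary: x y)
  case (Suc n)
  then have "x / a \<le> y / a" "(x - (1 - a)) / a \<le> (y - (1 - a)) / a" using a by (auto intro: divide_right_mono)
  from Suc.IH[OF this(1)] Suc.IH[OF this(2)] show ?case by simp
qed auto

text \<open>At most one of the two branches is not constant at a given point, so the recursion
  contracts the uniform distance by the factor \<open>1/2\<close>.\<close>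

lemma approx_diff: "\<bar>cantor_approx a (Suc n) x - cantor_approx a n x\<bar> \<le> (1/2) ^ n"
proof (induction n arbitrary: x)
  case 0
  show ?case using approx_range[of "Suc 0" x] approx_range[of 0 x] unfolding power_0 by linarith
next
  case (Suc n)
  let ?d = "\<lambda>x. cantor_approx a (Suc n) x - cantor_approx a n x"
  have e: "cantor_approx a (Suc (Suc n)) x - cantor_approx a (Suc n) x = (?d (x / a) + ?d ((x - (1 - a)) / a)) / 2"
    by (simp add: field_simps)
  have "?d (x / a) = 0 \<or> ?d ((x - (1 - a)) / a) = 0"
  proof (cases "x \<le> a")
    case True
    then have "(x - (1 - a)) / a \<le> 0" using a by (simp add: divide_nonpos_pos)
    then show ?thesis by (simp add: approx_outside del: cantor_approx.simps)
  next
    case False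
    then have "1 \<le> x / a" using a by simp
    then show ?thesis by (simp add: approx_outside del: cantor_approx.simps)
  qed
  then show ?case unfolding e using Suc.IH[of "x / a"] Suc.IH[of "(x - (1 - a)) / a"]
    by (auto simp del: cantor_approx.simps)
qed

lemma approx_tendsto: "(\<lambda>n. cantor_approx a n x) \<longlonglongrightarrow> cantor_fun a x"
proof -
  have "summable (\<lambda>n. cantor_approx a (Suc n) x - cantor_approx a n x)"
    by (rule summable_comparison_test'[of "\<lambda>n. (1/2) ^ n" 0]) (use approx_diff in auto)
  then obtain t where "(\<lambda>n. cantor_approx a (Suc n) x - cantor_approx a n x) sums t" by (auto simp: summable_def)
  then have "(\<lambda>n. cantor_approx a n x - cantor_approx a 0 x) \<longlonglongrightarrow> t"
    unfolding sums_def sum_lessThan_telescope[of "\<lambda>n. cantor_approx a n x"] .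
  from tendsto_add[OF this tendsto_const[of "cantor_approx a 0 x"]]
  have "convergent (\<lambda>n. cantor_approx a n x)" by (auto simp: convergent_def)
  then show ?thesis unfolding cantor_fun_def by (simp add: convergent_LIMSEQ_iff)
qed

lemma fun_range: "0 \<le> cantor_fun a x" "cantor_fun a x \<le> 1"
  using approx_range by (auto intro!: LIMSEQ_le_const[OF approx_tendsto] LIMSEQ_le_const2[OF approx_tendsto])

lemma fun_mono: "x \<le> y \<Longrightarrow> cantor_fun a x \<le> cantor_fun a y"
  by (rule LIMSEQ_le[OF approx_tendsto approx_tendsto]) (auto intro: approx_mono)

lemma fun_outside: "x \<le> 0 \<Longrightarrow> cantor_fun a x = 0" "1 \<le> x \<Longrightarrow> cantor_fun a x = 1"
  using approx_tendsto[of x] by (simp_all add: approx_outside LIMSEQ_const_iff)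

lemma fun_scale: "cantor_fun a x = (cantor_fun a (x / a) + cantor_fun a ((x - (1 - a)) / a)) / 2"
proof (rule LIMSEQ_unique)
  show "(\<lambda>n. cantor_approx a (Suc n) x) \<longlonglongrightarrow> cantor_fun a x"
    by (rule LIMSEQ_Suc[OF approx_tendsto])
  show "(\<lambda>n. cantor_approx a (Suc n) x) \<longlonglongrightarrow> (cantor_fun a (x / a) + cantor_fun a ((x - (1 - a)) / a)) / 2"
    unfolding cantor_approx.simps by (intro tendsto_divide tendsto_add approx_tendsto tendsto_const) auto
qed

lemma fun_ends: "l \<in> cantor_ends a n \<Longrightarrow> cantor_fun a (l + a ^ n) - cantor_fun a l = (1/2) ^ n"
proof (induction n arbitrary: l)
  case 0
  then show ?case by (simp add: fun_outside)
next
  case (Suc n)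
  then obtain l' where l': "l' \<in> cantor_ends a n" "l = a * l' \<or> l = a * l' + (1 - a)" by auto
  have b: "0 \<le> l'" "l' + a ^ n \<le> 1" using ends_bounds[OF l'(1)] by auto
  have an: "0 < a ^ n" using a by simp
  from l'(2) show ?case
  proof
    assume l: "l = a * l'"
    have e: "(l + a ^ Suc n) / a = l' + a ^ n" "l / a = l'" using a l by (auto simp: field_simps)
    have "a * (l' + a ^ n) \<le> a * 1" using a b by (intro mult_left_mono) auto
    moreover have "0 < a * a ^ n" using a an by simp
    ultimately have "l + a ^ Suc n - (1 - a) \<le> 0" "l - (1 - a) \<le> 0"
      using a l by (simp_all add: distrib_left, linarith)
    then have "(l + a ^ Suc n - (1 - a)) / a \<le> 0" "(l - (1 - a)) / a \<le> 0"
      using a by (metis divide_nonpos_pos)+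
    then show ?thesis
      using Suc.IH[OF l'(1)] fun_scale[of "l + a ^ Suc n", unfolded e] fun_scale[of l, unfolded e]
      unfolding power_Suc[of "1/2"] by (simp add: fun_outside(1) del: power_Suc)
  next
    assume l: "l = a * l' + (1 - a)"
    have e: "(l + a ^ Suc n - (1 - a)) / a = l' + a ^ n" "(l - (1 - a)) / a = l'" using a l by (auto simp: field_simps)
    have "0 \<le> a * l'" using a b by simp
    then have "1 \<le> l / a" using a l by (simp add: field_simps)
    moreover have "l / a \<le> (l + a ^ Suc n) / a" using a by (intro divide_right_mono) auto
    ultimately have "1 \<le> (l + a ^ Suc n) / a" "1 \<le> l / a" by auto
    then show ?thesis
      using Suc.IH[OF l'(1)] fun_scale[of "l + a ^ Suc n", unfolded e] fun_scale[of l, unfolded e]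
      unfolding power_Suc[of "1/2"] by (simp add: fun_outside(2) del: power_Suc)
  qed
qed

text \<open>The two children of the interval together already carry its whole mass, so nothing is
  left for the gap between them.\<close>

lemma fun_const_gap:
  assumes l: "l \<in> cantor_ends a n" and x: "l + a ^ Suc n \<le> x" "x \<le> l + a ^ n - a ^ Suc n"
  shows "cantor_fun a x = cantor_fun a (l + a ^ Suc n)"
proof -
  have "cantor_fun a (l + a ^ Suc n) - cantor_fun a l = (1/2) ^ Suc n"
    using fun_ends[of l "Suc n"] ends_children[OF l] by simp
  moreover have "cantor_fun a (l + a ^ n) - cantor_fun a (l + a ^ n - a ^ Suc n) = (1/2) ^ Suc n"
    using fun_ends[of "l + (1 - a) * a ^ n" "Suc n"] ends_children[OF l] by (simp add: algebra_simps)
  moreover note fun_ends[OF l]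
  ultimately have "cantor_fun a (l + a ^ Suc n) = cantor_fun a (l + a ^ n - a ^ Suc n)" by simp
  then show ?thesis using fun_mono[OF x(1)] fun_mono[OF x(2)] by simp
qed

text \<open>An interval no longer than the first gap \<open>1 - 2 * a\<close> cannot meet both
  halves, so one of the two branches of \<open>fun_scale\<close> is constant on it. The other branch
  is the same problem one level up, with length divided by \<open>a\<close> and mass
  doubled.\<close>

lemma fun_small_increment:
  "y - x \<le> (1 - 2 * a) * a ^ n \<Longrightarrow> x \<le> y \<Longrightarrow> cantor_fun a y - cantor_fun a x \<le> (1/2) ^ Suc n"
proof (induction n arbitrary: x y)
  case 0
  show ?case
  proof (cases "a \<le> x")
    case True
    then have "1 \<le> x / a" "1 \<le> y / a" using a 0 by auto
    then show ?thesis
      using fun_range[of "(y - (1 - a)) / a"] fun_range[of "(x - (1 - a)) / a"]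
      using fun_scale[of x] fun_scale[of y] \<open>1 \<le> x / a\<close> \<open>1 \<le> y / a\<close> by (simp add: fun_outside(2))
  next
    case False
    then have "(x - (1 - a)) / a \<le> 0" "(y - (1 - a)) / a \<le> 0" using a 0 by (auto intro!: divide_nonpos_pos)
    then show ?thesis
      using fun_range[of "y / a"] fun_range[of "x / a"]
      using fun_scale[of x] fun_scale[of y] \<open>(x - (1 - a)) / a \<le> 0\<close> \<open>(y - (1 - a)) / a \<le> 0\<close> by (simp add: fun_outside(1))
  qed
next
  case (Suc n)
  have an: "a ^ Suc n \<le> 1" using a by (intro power_le_one) auto
  then have "(1 - 2 * a) * a ^ Suc n \<le> 1 - 2 * a" using a by (intro mult_left_le) auto
  then have le: "y - x \<le> 1 - 2 * a" using Suc.prems by simp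
  have d: "y / a - x / a \<le> (1 - 2 * a) * a ^ n" "(y - (1 - a)) / a - (x - (1 - a)) / a \<le> (1 - 2 * a) * a ^ n"
    using divide_right_mono[OF Suc.prems(1), of a] a by (simp_all add: diff_divide_distrib)
  have m: "x / a \<le> y / a" "(x - (1 - a)) / a \<le> (y - (1 - a)) / a" using Suc.prems a by (auto intro: divide_right_mono)
  show ?case
  proof (cases "a \<le> x")
    case True
    then have "1 \<le> x / a" "1 \<le> y / a" using a Suc.prems by auto
    then show ?thesis
      using Suc.IH[OF d(2) m(2)] fun_scale[of x] fun_scale[of y] by (simp add: fun_outside(2))
  next
    case False
    then have "(x - (1 - a)) / a \<le> 0" "(y - (1 - a)) / a \<le> 0" using a le by (auto intro!: divide_nonpos_pos)
    then show ?thesis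
      using Suc.IH[OF d(1) m(1)] fun_scale[of x] fun_scale[of y] by (simp add: fun_outside(1))
  qed
qed

text \<open>The similarity dimension, that is, the solution of
  \<open>2 * a powr cdim = 1\<close>.\<close>

definition cdim :: real where "cdim = ln 2 / ln (1 / a)"

lemma a_powr_cdim: "a powr cdim = 1/2"
proof -
  have "ln (1/a) \<noteq> 0" using a by (simp add: ln_div)
  then have "a powr cdim = exp (- ln 2)"
    using a by (simp add: powr_def cdim_def ln_div field_simps)
  then show ?thesis by (simp add: exp_minus)
qed

lemma a_power_powr_cdim: "(a ^ n) powr cdim = (1/2) ^ n"
  using a by (simp add: powr_power a_powr_cdim[symmetric] powr_powr mult.commute powr_realpow[symmetric])

lemma cdim_bounds: "0 < cdim" "cdim < 1"
proof -
  have "ln 2 < ln (1/a)" using a by (subst ln_less_cancel_iff) (auto simp: field_simps)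
  moreover have "0 < ln (2::real)" by simp
  ultimately have "0 < ln (1/a)" by (rule less_trans[rotated])
  with \<open>ln 2 < ln (1/a)\<close> show "0 < cdim" "cdim < 1" unfolding cdim_def by (simp_all only: zero_less_divide_iff divide_less_eq_1, simp_all)
qed

lemma scale_between:
  assumes "0 < r" "r \<le> b"
  obtains n where "b * a ^ Suc n < r" "r \<le> b * a ^ n"
proof -
  have b: "0 < b" using assms by simp
  have "(\<lambda>n. b * a ^ n) \<longlonglongrightarrow> b * 0" using a by (intro tendsto_mult LIMSEQ_realpow_zero) auto
  then have "\<exists>n. b * a ^ n < r"
    using assms order_tendstoD(2)[of "\<lambda>n. b * a ^ n" 0 sequentially r] by (auto simp: eventually_sequentially)
  then have N: "b * a ^ (LEAST n. b * a ^ n < r) < r" (is "b * a ^ ?N < r") by (rule LeastI_ex)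
  then obtain n where n: "?N = Suc n" using assms by (cases ?N) auto
  then have "\<not> b * a ^ n < r" using not_less_Least[of n "\<lambda>n. b * a ^ n < r"] by simp
  then show ?thesis using that[of n] N n by simp
qed

text \<open>If \<open>y - x\<close> lies between \<open>(1 - 2 * a) * a ^ Suc n\<close> and
  \<open>(1 - 2 * a) * a ^ n\<close>, the increment is at most \<open>(1/2) ^ Suc n\<close>, which
  is \<open>(a ^ Suc n) powr cdim\<close>. Beyond the first gap length the total mass 1 is a
  sufficient bound.\<close>

lemma fun_holder:
  assumes "x \<le> y"
  shows "cantor_fun a y - cantor_fun a x \<le> (1 - 2 * a) powr (- cdim) * (y - x) powr cdim"
proof (cases "x = y")
  case False
  then have xy: "0 < y - x" using assms by simp
  have b: "0 < 1 - 2 * a" using a by simp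
  have s: "0 \<le> cdim" using cdim_bounds by simp
  have e: "(1 - 2 * a) powr (- cdim) * (y - x) powr cdim = ((y - x) / (1 - 2 * a)) powr cdim"
    using b xy by (simp add: powr_divide powr_minus field_simps)
  show ?thesis
  proof (cases "y - x \<le> 1 - 2 * a")
    case True
    obtain n where n: "(1 - 2 * a) * a ^ Suc n < y - x" "y - x \<le> (1 - 2 * a) * a ^ n"
      using scale_between[OF xy True] by blast
    have "cantor_fun a y - cantor_fun a x \<le> (1/2) ^ Suc n" by (rule fun_small_increment[OF n(2) assms])
    also have "\<dots> = (a ^ Suc n) powr cdim" by (rule a_power_powr_cdim[symmetric])
    also have "\<dots> \<le> ((y - x) / (1 - 2 * a)) powr cdim"
      using n(1) a b by (intro powr_mono2[OF s]) (auto simp: field_simps)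
    finally show ?thesis unfolding e .
  next
    case False
    have "cantor_fun a y - cantor_fun a x \<le> 1 powr cdim" using fun_range[of y] fun_range[of x] by simp
    also have "\<dots> \<le> ((y - x) / (1 - 2 * a)) powr cdim"
      using False b by (intro powr_mono2[OF s]) (auto simp: field_simps)
    finally show ?thesis unfolding e .
  qed
qed simp

text \<open>With \<open>a ^ Suc n < r \<le> a ^ n\<close>, the construction interval of level
  \<open>Suc n\<close> around \<open>c\<close> fits into the ball and carries mass
  \<open>(1/2) ^ Suc n\<close>. The factor \<open>1/2\<close> pays for passing from level
  \<open>n\<close> to the next.\<close>

lemma fun_mass_lower:
  assumes c: "c \<in> cantor_set a" and r: "0 < r" "r \<le> 1"
  shows "r powr cdim / 2 \<le> cantor_fun a (c + r) - cantor_fun a (c - r)"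
proof -
  obtain n where n: "1 * a ^ Suc n < r" "r \<le> 1 * a ^ n" using scale_between[OF r] by blast
  have s: "0 \<le> cdim" using cdim_bounds by simp
  have "c \<in> cantor_level a (Suc n)" using c by (auto simp: cantor_set_def)
  then obtain l where l: "l \<in> cantor_ends a (Suc n)" "l \<le> c" "c \<le> l + a ^ Suc n" by (auto simp: cantor_level_def)
  have "r powr cdim / 2 \<le> (a ^ n) powr cdim / 2" using n r by (intro divide_right_mono powr_mono2[OF s]) auto
  also have "\<dots> = cantor_fun a (l + a ^ Suc n) - cantor_fun a l"
    using fun_ends[OF l(1)] by (simp add: a_power_powr_cdim)
  also have "\<dots> \<le> cantor_fun a (c + r) - cantor_fun a (c - r)"
    using l n by (intro diff_mono fun_mono) auto
  finally show ?thesis .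
qed

text \<open>Small balls around a point of the Cantor set have positive mass, whereas
  \<open>cantor_fun\<close> is constant on a gap.\<close>

lemma gap_disjoint:
  assumes l: "l \<in> cantor_ends a n" and x: "l + a ^ Suc n < x" "x < l + a ^ n - a ^ Suc n"
  shows "x \<notin> cantor_set a"
proof
  assume c: "x \<in> cantor_set a"
  define r where "r = min 1 (min (x - (l + a ^ Suc n)) (l + a ^ n - a ^ Suc n - x))"
  have r: "0 < r" "r \<le> 1" using x by (auto simp: r_def)
  have "r \<le> x - (l + a ^ Suc n)" "r \<le> l + a ^ n - a ^ Suc n - x"
    unfolding r_def by (rule min.coboundedI2, rule min.cobounded1, rule min.coboundedI2, rule min.cobounded2)
  then have "cantor_fun a (x + r) = cantor_fun a (l + a ^ Suc n)" "cantor_fun a (x - r) = cantor_fun a (l + a ^ Suc n)"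
    by (intro fun_const_gap[OF l]; use r in linarith)+
  then show False using fun_mass_lower[OF c r] r by simp
qed

end

section \<open>Length metrics of compact quasiconvex sets\<close>

lemma lip_curve_euclidean:
  "lip_curve (submetric euclidean_metric S) L a b c \<longleftrightarrow> a \<le> b \<and> 0 \<le> L \<and> (\<forall>t\<in>{a..b}. c t \<in> S) \<and>
     (\<forall>s\<in>{a..b}. \<forall>t\<in>{a..b}. dist (c s) (c t) \<le> L * \<bar>s - t\<bar>)"
  by (simp add: lip_curve_def)

lemma lip_curve_rescale:
  assumes "lip_curve M L 0 d c" "0 \<le> d"
  shows "lip_curve M (L * d) 0 1 (\<lambda>t. c (t * d))"
  unfolding lip_curve_def
proof (intro conjI ballI)
  have L: "0 \<le> L" using assms by (auto simp: lip_curve_def)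
  show "0 \<le> L * d" using L assms(2) by simp
  have in_d: "t * d \<in> {0..d}" if "t \<in> {0..1}" for t using that assms(2) by (auto intro: mult_left_le_one_le)
  fix s assume s: "s \<in> {0..1::real}"
  show "c (s * d) \<in> mspace M" using assms(1) in_d[OF s] by (auto simp: lip_curve_def)
  fix t assume t: "t \<in> {0..1::real}"
  have "mdist M (c (s * d)) (c (t * d)) \<le> L * \<bar>s * d - t * d\<bar>"
    using assms(1) in_d[OF s] in_d[OF t] unfolding lip_curve_def by blast
  also have "\<dots> = L * d * \<bar>s - t\<bar>" using assms(2) by (simp add: left_diff_distrib[symmetric] abs_mult)
  finally show "mdist M (c (s * d)) (c (t * d)) \<le> L * d * \<bar>s - t\<bar>" .
qed simp

text \<open>The conclusion \<open>c (D / D) = c 1\<close> matters for \<open>D = 0\<close>, where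
  \<open>D / D\<close> is \<open>0\<close>: the curve is then constant, so its two ends
  agree.\<close>

lemma lip_curve_unit_speed:
  assumes "lip_curve M D 0 1 c"
  shows "lip_curve M 1 0 D (\<lambda>t. c (t / D)) \<and> c (D / D) = c 1"
proof (cases "D = 0")
  case True
  have in_M: "c 0 \<in> mspace M" "c 1 \<in> mspace M" using assms by (auto simp: lip_curve_def)
  have "mdist M (c 0) (c 1) \<le> 0" using assms True by (auto simp: lip_curve_def)
  then have "mdist M (c 0) (c 1) = 0" using mdist_nonneg[of M "c 0" "c 1"] by linarith
  then have "c 0 = c 1" using mdist_zero[OF in_M] by blast
  then show ?thesis using True in_M by (auto simp: lip_curve_def)
next
  case False
  then have D: "0 < D" using assms by (auto simp: lip_curve_def)
  have "lip_curve M 1 0 D (\<lambda>t. c (t / D))"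
    unfolding lip_curve_def
  proof (intro conjI ballI)
    have in_1: "t / D \<in> {0..1}" if "t \<in> {0..D}" for t using that D by auto
    fix s assume s: "s \<in> {0..D}"
    show "c (s / D) \<in> mspace M" using assms in_1[OF s] by (auto simp: lip_curve_def)
    fix t assume t: "t \<in> {0..D}"
    have "mdist M (c (s / D)) (c (t / D)) \<le> D * \<bar>s / D - t / D\<bar>"
      using assms in_1[OF s] in_1[OF t] unfolding lip_curve_def by blast
    also have "\<dots> = 1 * \<bar>s - t\<bar>" using D by (simp add: diff_divide_distrib[symmetric] abs_divide)
    finally show "mdist M (c (s / D)) (c (t / D)) \<le> 1 * \<bar>s - t\<bar>" .
  qed (use D in auto)
  then show ?thesis using D by simp
qed

lemma lip_curve_append:
  assumes c: "lip_curve M L a b c" and c': "lip_curve M L b d c'" and eq: "c b = c' b"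
  shows "lip_curve M L a d (\<lambda>t. if t \<le> b then c t else c' t)"
  unfolding lip_curve_def
proof (intro conjI ballI)
  let ?w = "\<lambda>t. if t \<le> b then c t else c' t"
  show "a \<le> d" "0 \<le> L" using c c' by (auto simp: lip_curve_def)
  show "?w t \<in> mspace M" if "t \<in> {a..d}" for t using that c c' by (auto simp: lip_curve_def)
  have ab: "a \<le> b" "b \<le> d" using c c' by (auto simp: lip_curve_def)
  have c2: "s \<in> {a..b} \<Longrightarrow> t \<in> {a..b} \<Longrightarrow> mdist M (c s) (c t) \<le> L * \<bar>s - t\<bar>"
    and c2': "s \<in> {b..d} \<Longrightarrow> t \<in> {b..d} \<Longrightarrow> mdist M (c' s) (c' t) \<le> L * \<bar>s - t\<bar>" for s t
    using c c' by (auto simp: lip_curve_def)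
  have *: "mdist M (?w s) (?w t) \<le> L * (t - s)" if st: "a \<le> s" "s \<le> t" "t \<le> d" for s t
  proof -
    consider "t \<le> b" | "s \<le> b" "b < t" | "b < s" using st by linarith
    then show ?thesis
    proof cases
      case 1
      have "mdist M (c s) (c t) \<le> L * \<bar>s - t\<bar>" by (rule c2) (use st 1 in auto)
      then show ?thesis using 1 st by simp
    next
      case 2
      have in_M: "c s \<in> mspace M" "c' t \<in> mspace M" "c' b \<in> mspace M"
        using c c' st 2 ab unfolding lip_curve_def by auto
      have 1: "mdist M (c s) (c b) \<le> L * \<bar>s - b\<bar>" by (rule c2) (use st 2 ab in auto)
      have 3: "mdist M (c' b) (c' t) \<le> L * \<bar>b - t\<bar>" by (rule c2') (use st 2 ab in auto)
      have "mdist M (c s) (c' t) \<le> L * (b - s) + L * (t - b)"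
        using mdist_triangle[of "c s" M "c' b" "c' t"] in_M 1 3 eq 2 by simp
      then show ?thesis using 2 by (simp add: algebra_simps)
    next
      case 3
      have "mdist M (c' s) (c' t) \<le> L * \<bar>s - t\<bar>" by (rule c2') (use st 3 in auto)
      then show ?thesis using 3 st by simp
    qed
  qed
  fix s t assume "s \<in> {a..d}" "t \<in> {a..d}"
  then show "mdist M (?w s) (?w t) \<le> L * \<bar>s - t\<bar>"
    using *[of s t] *[of t s] mdist_commute[of M "?w s" "?w t"] by (cases "s \<le> t") auto
qed

lemma lip_curve_shift:
  "lip_curve M L a b c \<Longrightarrow> lip_curve M L (a + s) (b + s) (\<lambda>t. c (t - s))"
  unfolding lip_curve_def
proof (elim conjE, intro conjI ballI)
  assume c: "\<forall>t\<in>{a..b}. c t \<in> mspace M" "\<forall>s\<in>{a..b}. \<forall>t\<in>{a..b}. mdist M (c s) (c t) \<le> L * \<bar>s - t\<bar>"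
  fix x assume x: "x \<in> {a + s..b + s}"
  then have x': "x - s \<in> {a..b}" by auto
  then show "c (x - s) \<in> mspace M" using c by blast
  fix y assume "y \<in> {a + s..b + s}"
  then have "y - s \<in> {a..b}" by auto
  with c(2) x' have "mdist M (c (x - s)) (c (y - s)) \<le> L * \<bar>x - s - (y - s)\<bar>" by blast
  then show "mdist M (c (x - s)) (c (y - s)) \<le> L * \<bar>x - y\<bar>" by simp
qed auto

text \<open>Both pieces are run at unit speed, glued, and the result is rescaled to the unit
  interval; this is why the constants add instead of taking a maximum.\<close>

lemma lip_curve_join:
  assumes c: "lip_curve M D 0 1 c" and c': "lip_curve M D' 0 1 c'" and eq: "c 1 = c' 0"
  shows "\<exists>c''. lip_curve M (D + D') 0 1 c'' \<and> c'' 0 = c 0 \<and> c'' 1 = c' 1"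
proof -
  have D: "0 \<le> D" "0 \<le> D'" using c c' by (auto simp: lip_curve_def)
  let ?w = "\<lambda>t. if t \<le> D then c (t / D) else c' ((t - D) / D')"
  note u = lip_curve_unit_speed[OF c] and u' = lip_curve_unit_speed[OF c']
  have "lip_curve M 1 D (D' + D) (\<lambda>t. c' ((t - D) / D'))"
    using lip_curve_shift[OF conjunct1[OF u'], of D] by simp
  then have "lip_curve M 1 0 (D' + D) ?w"
    by (rule lip_curve_append[OF conjunct1[OF u]]) (use u eq in auto)
  then have "lip_curve M (1 * (D' + D)) 0 1 (\<lambda>t. ?w (t * (D' + D)))"
    by (rule lip_curve_rescale) (use D in auto)
  moreover have "?w (1 * (D' + D)) = c' 1"
  proof (cases "D' = 0")
    case True
    then have "c (D / D) = c' 1" using u u' eq by simp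
    then show ?thesis using True by simp
  next
    case False
    then show ?thesis using D by simp
  qed
  moreover have "?w (0 * (D' + D)) = c 0" using D by simp
  ultimately show ?thesis by (intro exI[of _ "\<lambda>t. ?w (t * (D' + D))"]) (simp add: add.commute)
qed

lemma lip_curve_reverse:
  "lip_curve M L 0 b c \<Longrightarrow> lip_curve M L 0 b (\<lambda>t. c (b - t))"
  unfolding lip_curve_def
proof (elim conjE, intro conjI ballI)
  assume c: "\<forall>t\<in>{0..b}. c t \<in> mspace M" "\<forall>s\<in>{0..b}. \<forall>t\<in>{0..b}. mdist M (c s) (c t) \<le> L * \<bar>s - t\<bar>"
  fix x assume x: "x \<in> {0..b}"
  then have x': "b - x \<in> {0..b}" by auto
  then show "c (b - x) \<in> mspace M" using c by blast
  fix y assume "y \<in> {0..b}"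
  then have "b - y \<in> {0..b}" by auto
  with c(2) x' have "mdist M (c (b - x)) (c (b - y)) \<le> L * \<bar>b - x - (b - y)\<bar>" by blast
  then show "mdist M (c (b - x)) (c (b - y)) \<le> L * \<bar>x - y\<bar>" by (simp add: abs_minus_commute)
qed auto

lemma sets_mborel_eq:
  assumes B: "B \<in> sets borel" and top: "mtopology_of M = top_of_set B"
  shows "sets (mborel M) = sets (restrict_space borel (B :: 'a::topological_space set))"
proof -
  have sp: "mspace M = B" using arg_cong[OF top, of topspace] by simp
  have "sets (mborel M) = sigma_sets B {U. openin (top_of_set B) U}"
    unfolding mborel_def sp top by (rule sets_measure_of) (auto dest!: openin_subset)
  also have "{U. openin (top_of_set B) U} = (\<inter>) B ` {U. open U}"
    by (auto simp: openin_open)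
  also have "sigma_sets B ((\<inter>) B ` {U. open U}) = (\<inter>) B ` sigma_sets UNIV {U. open U}"
    using B by (intro sigma_sets_Int[symmetric]) (auto simp: borel_def)
  also have "\<dots> = sets (restrict_space borel B)" by (auto simp: sets_restrict_space borel_def)
  finally show ?thesis .
qed

text \<open>Quasiconvexity makes the induced length metric finite and bi-Lipschitz to the Euclidean
  one; compactness provides shortest curves, hence a geodesic space.\<close>

locale quasiconvex_compact =
  fixes S :: "'a::euclidean_space set" and L :: real
  assumes compact_S: "compact S"
    and quasiconvex: "\<And>x y. x \<in> S \<Longrightarrow> y \<in> S \<Longrightarrow>
      \<exists>c. lip_curve (submetric euclidean_metric S) (L * dist x y) 0 1 c \<and> c 0 = x \<and> c 1 = y"
    and L_ge_1: "1 \<le> L"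
begin

abbreviation "N \<equiv> submetric euclidean_metric S"

definition ldist :: "'a \<Rightarrow> 'a \<Rightarrow> real" where
  "ldist x y = enn2real (length_dist N x y)"

lemma length_dist_le_lip:
  assumes "lip_curve N D a b c" "c a = x" "c b = y"
  shows "length_dist N x y \<le> ennreal (D * (b - a))"
proof -
  have "length_dist N x y \<le> path_len N (a, b, c)"
    unfolding length_dist_def
    by (rule INF_lower) (use lip_curve_rectifiable[OF assms(1)] assms in \<open>auto simp: rectifiable_def\<close>)
  also have "\<dots> \<le> ennreal (D * (b - a))" by (rule path_len_lip_curve[OF assms(1)])
  finally show ?thesis .
qed

lemma length_dist_le:
  assumes "x \<in> S" "y \<in> S"
  shows "length_dist N x y \<le> ennreal (L * dist x y)"
  using quasiconvex[OF assms] length_dist_le_lip by fastforce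

lemma length_dist_ge: "ennreal (dist x y) \<le> length_dist N x y"
  unfolding length_dist_def
proof (rule INF_greatest)
  fix \<gamma> assume "\<gamma> \<in> {\<gamma>. path_in N \<gamma> \<and> path_joins \<gamma> x y}"
  then obtain a b c where "\<gamma> = (a, b, c)" "a \<le> b" "c a = x" "c b = y" by (cases \<gamma>) auto
  then show "ennreal (dist x y) \<le> path_len N \<gamma>" using path_len_ge_mdist[of a b N c] by simp
qed

lemma length_dist_ldist:
  assumes "x \<in> S" "y \<in> S"
  shows "length_dist N x y = ennreal (ldist x y)"
  using le_less_trans[OF length_dist_le[OF assms] ennreal_less_top] by (simp add: ldist_def)

lemma ldist_nonneg [simp]: "0 \<le> ldist x y" by (simp add: ldist_def)

lemma ldist_bounds:
  assumes "x \<in> S" "y \<in> S"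
  shows "dist x y \<le> ldist x y" "ldist x y \<le> L * dist x y"
  using length_dist_ge[of x y] length_dist_le[OF assms] L_ge_1
  unfolding length_dist_ldist[OF assms] by auto

lemma ldist_le_lip:
  assumes "lip_curve N D a b c" "c a = x" "c b = y"
  shows "ldist x y \<le> D * (b - a)"
proof -
  have "x \<in> S" "y \<in> S" "0 \<le> D * (b - a)" using assms by (auto simp: lip_curve_def)
  then show ?thesis using length_dist_le_lip[OF assms] by (simp add: length_dist_ldist)
qed

lemma almost_minimal_curve:
  assumes x: "x \<in> S" "y \<in> S" and e: "0 < e"
  obtains c where "lip_curve N (ldist x y + e) 0 1 c" "c 0 = x" "c 1 = y"
proof -
  have "length_dist N x y < ennreal (ldist x y + e)"
    using e by (simp add: length_dist_ldist[OF x] ennreal_less_iff)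
  then obtain \<gamma> where \<gamma>: "path_in N \<gamma>" "path_joins \<gamma> x y" "path_len N \<gamma> < ennreal (ldist x y + e)"
    unfolding length_dist_def INF_less_iff by auto
  obtain a b c where abc: "\<gamma> = (a, b, c)" by (cases \<gamma>)
  interpret rectifiable_path N a b c
    by unfold_locales (use \<gamma> abc in \<open>auto simp: rectifiable_def intro: less_trans\<close>)
  let ?c = "arclength_param N (a, b, c)"
  have le: "arc b \<le> ldist x y + e"
    using \<gamma>(3) path_len_arc[of b] ab e by (simp add: abc ennreal_less_iff del: ennreal_plus)
  have "lip_curve N (1 * arc b) 0 1 (\<lambda>t. ?c (t * arc b))"
    by (rule lip_curve_rescale[OF lip_curve_arclength_param]) simp
  then have "lip_curve N (ldist x y + e) 0 1 (\<lambda>t. ?c (t * arc b))"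
    using le e unfolding lip_curve_def
    by (auto intro: order_trans[OF _ mult_right_mono[OF le]])
  then show ?thesis
    by (rule that) (use arclength_param_ends \<gamma>(2) abc in auto)
qed

text \<open>Almost shortest curves, parametrized with constants tending to \<open>ldist x y\<close>,
  are equicontinuous. A uniform limit from Arzela-Ascoli inherits the limiting Lipschitz constant
  and stays in the closed set \<open>S\<close>.\<close>

lemma minimal_curve:
  assumes x: "x \<in> S" "y \<in> S"
  obtains c where "lip_curve N (ldist x y) 0 1 c" "c 0 = x" "c 1 = y"
proof -
  let ?D = "\<lambda>n. ldist x y + inverse (real (Suc n))"
  have "\<exists>c. lip_curve N (?D n) 0 1 c \<and> c 0 = x \<and> c 1 = y" for n
    using almost_minimal_curve[OF x, of "inverse (real (Suc n))"] by (metis inverse_positive_iff_positive of_nat_0_less_iff zero_less_Suc)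
  then obtain F where F: "\<And>n. lip_curve N (?D n) 0 1 (F n)" "\<And>n. F n 0 = x" "\<And>n. F n 1 = y" by metis
  have F_in: "t \<in> {0..1} \<Longrightarrow> F n t \<in> S" for n t using F(1)[of n] by (auto simp: lip_curve_euclidean)
  have F_lip: "s \<in> {0..1} \<Longrightarrow> t \<in> {0..1} \<Longrightarrow> dist (F n s) (F n t) \<le> ?D n * \<bar>s - t\<bar>" for n s t
    using F(1)[of n] by (auto simp: lip_curve_euclidean)
  have D1: "?D n \<le> ldist x y + 1" for n
    by (simp add: inverse_eq_divide)
  obtain B where B: "\<And>z. z \<in> S \<Longrightarrow> norm z \<le> B" using compact_imp_bounded[OF compact_S] by (auto simp: bounded_iff)
  obtain g k where g: "continuous_on {0..1::real} g" "strict_mono (k :: nat \<Rightarrow> nat)"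
      "\<And>e. 0 < e \<Longrightarrow> \<exists>N. \<forall>n t. n \<ge> N \<and> t \<in> {0..1} \<longrightarrow> norm (F (k n) t - g t) < e"
  proof (rule Arzela_Ascoli[of "{0..1::real}" F B])
    fix s :: real and e :: real assume s: "s \<in> {0..1}" and e: "0 < e"
    show "\<exists>d>0. \<forall>n t. t \<in> {0..1} \<and> norm (s - t) < d \<longrightarrow> norm (F n s - F n t) < e"
    proof (intro exI[of _ "e / (ldist x y + 1)"] conjI allI impI)
      show "0 < e / (ldist x y + 1)" using e by (simp add: add_nonneg_pos)
      fix n t assume t: "t \<in> {0..1} \<and> norm (s - t) < e / (ldist x y + 1)"
      have pos: "0 < ldist x y + 1" by (simp add: add_nonneg_pos)
      have "norm (F n s - F n t) \<le> ?D n * \<bar>s - t\<bar>" using F_lip[of s t n] s t by (simp add: dist_norm)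
      also have "\<dots> \<le> (ldist x y + 1) * \<bar>s - t\<bar>" by (intro mult_right_mono D1) auto
      also have "\<dots> < e" using t pos by (simp add: field_simps)
      finally show "norm (F n s - F n t) < e" .
    qed
  qed (use B F_in in auto)
  have lim: "(\<lambda>n. F (k n) t) \<longlonglongrightarrow> g t" if "t \<in> {0..1}" for t
    unfolding LIMSEQ_iff using g(3) that by blast
  have "lip_curve N (ldist x y) 0 1 g"
    unfolding lip_curve_euclidean
  proof (intro conjI ballI)
    fix s :: real assume s: "s \<in> {0..1}"
    show "g s \<in> S"
      using closed_sequentially[OF compact_imp_closed[OF compact_S] _ lim[OF s]] F_in[OF s] by blast
    fix t :: real assume t: "t \<in> {0..1}"
    have "(\<lambda>n. ?D (k n) * \<bar>s - t\<bar>) \<longlonglongrightarrow> (ldist x y + 0) * \<bar>s - t\<bar>"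
      by (intro tendsto_intros LIMSEQ_subseq_LIMSEQ[OF LIMSEQ_inverse_real_of_nat g(2), unfolded comp_def])
    then show "dist (g s) (g t) \<le> ldist x y * \<bar>s - t\<bar>"
      using LIMSEQ_le[OF tendsto_dist[OF lim[OF s] lim[OF t]]] F_lip[OF s t] by auto
  qed simp_all
  moreover have "g 0 = x" "g 1 = y"
    using LIMSEQ_unique[OF lim[of 0], of x] LIMSEQ_unique[OF lim[of 1], of y] F by auto
  ultimately show ?thesis using that by blast
qed

lemma unit_speed_geodesic:
  assumes x: "x \<in> S" "y \<in> S"
  obtains c where "lip_curve N 1 0 (ldist x y) c" "c 0 = x" "c (ldist x y) = y"
proof -
  obtain c where c: "lip_curve N (ldist x y) 0 1 c" "c 0 = x" "c 1 = y" by (rule minimal_curve[OF x])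
  show ?thesis
    by (rule that[of "\<lambda>t. c (t / ldist x y)"]) (use lip_curve_unit_speed[OF c(1)] c in auto)
qed

lemma Metric_space_ldist: "Metric_space S ldist"
proof
  have comm: "ldist y x \<le> ldist x y" if x: "x \<in> S" "y \<in> S" for x y
  proof -
    obtain c where c: "lip_curve N 1 0 (ldist x y) c" "c 0 = x" "c (ldist x y) = y" by (rule unit_speed_geodesic[OF x])
    show ?thesis using ldist_le_lip[OF lip_curve_reverse[OF c(1)]] c by simp
  qed
  \<comment> \<open>\<open>Metric_space\<close> demands symmetry for all points of the type. Outside
    \<open>S\<close> there are no paths, the infimum over the empty set is \<open>top\<close>, and
    \<open>enn2real\<close> sends it to \<open>0\<close>.\<close>
  have out: "ldist x y = 0" if "x \<notin> S \<or> y \<notin> S" for x y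
  proof -
    have "{\<gamma>. path_in N \<gamma> \<and> path_joins \<gamma> x y} = {}"
      using that by (auto simp: continuous_map_def Pi_def)
    then have "ldist x y = enn2real (Inf (path_len N ` {}))" unfolding ldist_def length_dist_def by (rule arg_cong)
    then show ?thesis by simp
  qed
  show "ldist x y = ldist y x" for x y
    using comm[of x y] comm[of y x] out[of x y] out[of y x] by (cases "x \<in> S \<and> y \<in> S") auto
  show "ldist x y = 0 \<longleftrightarrow> x = y" if "x \<in> S" "y \<in> S" for x y
  proof (cases "x = y")
    case True
    then have "ldist x y \<le> 0" using ldist_bounds(2)[OF that] by simp
    then have "ldist x y = 0" using ldist_nonneg by (rule antisym)
    then show ?thesis using True by blast
  next
    case False
    then have "0 < dist x y" by simp
    then show ?thesis using ldist_bounds(1)[OF that] False by linarith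
  qed
  show "ldist x z \<le> ldist x y + ldist y z" if xyz: "x \<in> S" "y \<in> S" "z \<in> S" for x y z
  proof -
    obtain c where c: "lip_curve N (ldist x y) 0 1 c" "c 0 = x" "c 1 = y"
      by (rule minimal_curve[OF xyz(1,2)])
    obtain c' where c': "lip_curve N (ldist y z) 0 1 c'" "c' 0 = y" "c' 1 = z"
      by (rule minimal_curve[OF xyz(2,3)])
    obtain c'' where "lip_curve N (ldist x y + ldist y z) 0 1 c''" "c'' 0 = x" "c'' 1 = z"
      using lip_curve_join[OF c(1) c'(1)] c c' by auto
    then show ?thesis using ldist_le_lip by fastforce
  qed
qed simp

definition X :: "'a metric" where "X = metric (S, ldist)"

lemma mspace_X [simp]: "mspace X = S" and mdist_X [simp]: "mdist X = ldist"
  unfolding X_def using Metric_space.mspace_metric[OF Metric_space_ldist] Metric_space.mdist_metric[OF Metric_space_ldist] by auto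

text \<open>Each subarc is itself a competitor in the infimum defining \<open>ldist\<close>, so
  passing to the length metric does not worsen the Lipschitz constant.\<close>

lemma lip_curve_X:
  assumes "lip_curve N D a b c"
  shows "lip_curve X D a b c"
proof -
  have *: "ldist (c s) (c t) \<le> D * (t - s)" if "a \<le> s" "s \<le> t" "t \<le> b" for s t
    using ldist_le_lip[OF lip_curve_subinterval[OF assms that]] by simp
  show ?thesis unfolding lip_curve_def
  proof (intro conjI ballI)
    fix s t assume st: "s \<in> {a..b}" "t \<in> {a..b}"
    show "mdist X (c s) (c t) \<le> D * \<bar>s - t\<bar>"
    proof (cases "s \<le> t")
      case True then show ?thesis using *[of s t] st by simp
    next
      case False then show ?thesis using *[of t s] st mdist_commute[of X "c s" "c t"] by simp
    qed
  qed (use assms in \<open>auto simp: lip_curve_def\<close>)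
qed

lemma geodesic_X: "geodesic_space X"
  unfolding geodesic_space_def
proof (intro ballI)
  fix x y assume "x \<in> mspace X" "y \<in> mspace X"
  then have xy: "x \<in> S" "y \<in> S" by auto
  obtain c where c: "lip_curve N 1 0 (ldist x y) c" "c 0 = x" "c (ldist x y) = y"
    by (rule unit_speed_geodesic[OF xy])
  note cX = lip_curve_X[OF c(1)]
  have "path_len X (0, ldist x y, c) = ennreal (ldist x y)"
    using path_len_lip_curve[OF cX] path_len_ge_mdist[of 0 "ldist x y" X c] c by (simp add: order.antisym)
  then show "\<exists>\<gamma>. path_in X \<gamma> \<and> path_joins \<gamma> x y \<and> path_len X \<gamma> = ennreal (mdist X x y)"
    using lip_curve_rectifiable[OF cX] c by (intro exI[of _ "(0, ldist x y, c)"]) (auto simp: rectifiable_def)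
qed

lemma mtopology_X: "mtopology_of X = top_of_set S"
proof -
  have N: "mtopology_of N = top_of_set S" by (simp add: mtopology_of_submetric)
  have 1: "continuous_map (mtopology_of X) (mtopology_of N) id"
    unfolding continuous_map_mtopology_of
  proof (intro conjI ballI allI impI)
    fix x :: 'a and e :: real assume "x \<in> mspace X" "0 < e"
    then show "\<exists>d>0. \<forall>y. y \<in> mspace X \<and> mdist X x y < d \<longrightarrow> mdist N (id x) (id y) < e"
      using ldist_bounds(1) by (intro exI[of _ e]) (auto intro: le_less_trans)
  qed auto
  have 2: "continuous_map (mtopology_of N) (mtopology_of X) id"
    unfolding continuous_map_mtopology_of
  proof (intro conjI ballI allI impI)
    fix x :: 'a and e :: real assume x: "x \<in> mspace N" and e: "0 < e"
    show "\<exists>d>0. \<forall>y. y \<in> mspace N \<and> mdist N x y < d \<longrightarrow> mdist X (id x) (id y) < e"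
    proof (intro exI[of _ "e / L"] conjI allI impI)
      fix y assume y: "y \<in> mspace N \<and> mdist N x y < e / L"
      have "ldist x y \<le> L * dist x y" using ldist_bounds x y by auto
      also have "\<dots> < e" using y L_ge_1 by (simp add: field_simps)
      finally show "mdist X (id x) (id y) < e" by simp
    qed (use e L_ge_1 in auto)
  qed auto
  have "openin (mtopology_of X) U \<longleftrightarrow> openin (mtopology_of N) U" for U
  proof
    assume U: "openin (mtopology_of X) U"
    then have "U \<subseteq> S" using openin_subset by fastforce
    then have "{x \<in> S. x \<in> U} = U" by auto
    then show "openin (mtopology_of N) U" using 2 U by (force simp: continuous_map_def)
  next
    assume U: "openin (mtopology_of N) U"
    then have "U \<subseteq> S" using openin_subset by fastforce
    then have "{x \<in> S. x \<in> U} = U" by auto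
    then show "openin (mtopology_of X) U" using 1 U by (force simp: continuous_map_def)
  qed
  then show ?thesis using N by (simp add: topology_eq)
qed

lemma compact_space_X: "compact_space (mtopology_of X)"
  unfolding mtopology_X using compact_S by (simp add: compact_space_subtopology compactin_euclidean_iff)

lemma sets_mborel_X: "sets (mborel X) = sets (restrict_space borel S)"
  using compact_imp_closed[OF compact_S] by (intro sets_mborel_eq mtopology_X) auto

end

lemma ennreal_le_divideI:
  assumes "ennreal c * x \<le> y" "0 < c"
  shows "x \<le> y / ennreal c"
proof -
  have "x = x * ennreal c / ennreal c" using assms(2) by (simp add: mult_divide_eq_ennreal)
  also have "\<dots> \<le> y / ennreal c" using assms(1) by (intro divide_right_mono_ennreal) (simp add: mult.commute)
  finally show ?thesis .
qed

lemma power_powr_commute: "0 < x \<Longrightarrow> (x ^ n) powr e = (x powr e) ^ n" for x :: real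
  by (induction n) (simp_all add: powr_mult)

section \<open>Neighbourhoods of regular subsets of the line\<close>

text \<open>\<open>F\<close> is the distribution function of an \<open>s\<close>-regular measure on \<open>C\<close>.\<close>

locale regular_line_set =
  fixes C :: "real set" and F :: "real \<Rightarrow> real" and s A \<kappa> R :: real
  assumes compact_C: "compact C" and C_nonempty: "C \<noteq> {}"
    and F_mono: "x \<le> y \<Longrightarrow> F x \<le> F y"
    and F_holder: "x \<le> y \<Longrightarrow> F y - F x \<le> A * (y - x) powr s"
    and F_lower: "c \<in> C \<Longrightarrow> 0 < r \<Longrightarrow> r \<le> R \<Longrightarrow> \<kappa> * r powr s \<le> F (c + r) - F (c - r)"
    and F_const: "x \<notin> C \<Longrightarrow> \<exists>e>0. F (x + e) = F (x - e)"
    and s: "0 < s" "s < 1" and A: "0 < A" and \<kappa>: "0 < \<kappa>" and R: "0 < R"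
begin

lemma closed_C: "closed C" using compact_C by (rule compact_imp_closed)

lemma F_holder_abs: "\<bar>F y - F x\<bar> \<le> A * \<bar>y - x\<bar> powr s"
  using F_holder[of x y] F_holder[of y x] F_mono[of x y] F_mono[of y x] by (cases "x \<le> y") auto

lemma F_cont: "continuous_on UNIV F"
  unfolding continuous_on_eq_continuous_within
proof
  fix x :: real
  have "((\<lambda>y. A * \<bar>y - x\<bar> powr s) \<longlongrightarrow> A * \<bar>x - x\<bar> powr s) (at x)"
    using s by (intro tendsto_intros) auto
  then have "((\<lambda>y. A * \<bar>y - x\<bar> powr s) \<longlongrightarrow> 0) (at x)" by simp
  then have "((\<lambda>y. F y - F x) \<longlongrightarrow> 0) (at x)"
    by (rule Lim_null_comparison[rotated]) (use F_holder_abs in auto)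
  then show "continuous (at x) F" unfolding continuous_at by (rule LIM_zero_cancel)
qed

lemma F_cont_at: "isCont F x"
  using F_cont by (simp add: continuous_on_eq_continuous_at)

lemma nearest:
  obtains c where "c \<in> C" "\<bar>x - c\<bar> = infdist x C"
proof -
  obtain c where "c \<in> C" "infdist x C = dist x c" by (rule infdist_attains_inf[OF closed_C C_nonempty])
  then show ?thesis by (intro that[of c]) (simp_all add: dist_real_def)
qed

lemma infdist_le: "c \<in> C \<Longrightarrow> infdist x C \<le> \<bar>x - c\<bar>"
  using infdist_le[of c C x] by (simp add: dist_real_def)

lemma infdist_lipschitz: "infdist x C \<le> infdist y C + \<bar>x - y\<bar>"
  using infdist_triangle[of x C y] by (simp add: dist_real_def)

lemma infdist_zero_iff: "infdist x C = 0 \<longleftrightarrow> x \<in> C"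
  using in_closed_iff_infdist_zero[OF closed_C C_nonempty] by simp

lemma borel_infdist [measurable]: "(\<lambda>x. infdist x C) \<in> borel_measurable borel"
  by (intro borel_measurable_continuous_onI continuous_intros)

text \<open>With a primitive \<open>\<Phi>\<close> of \<open>F\<close>, the integral is the
  increment of \<open>\<Phi> (x + t) - \<Phi> (x - t)\<close> between \<open>p\<close> and
  \<open>q\<close>, and the mean value theorem bounds both values. In terms of the Stieltjes measure
  this is Fubini: each point is counted on a set of length at most \<open>2 * t\<close>.\<close>

lemma increment_integral:
  assumes t: "0 \<le> t" and pq: "p \<le> q"
  shows "(\<integral>\<^sup>+x\<in>{p..q}. ennreal (F (x + t) - F (x - t)) \<partial>lborel) \<le> ennreal (2 * t * (F (q + t) - F (p - t)))"
proof -
  define \<Phi> where "\<Phi> x = integral {p - t - 1..x} F" for x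
  have D: "DERIV \<Phi> x :> F x" if "p - t \<le> x" "x \<le> q + t" for x
  proof -
    have "(\<Phi> has_real_derivative F x) (at x within {p - t - 1..q + t + 1})"
      unfolding \<Phi>_def by (rule integral_has_real_derivative) (use that continuous_on_subset[OF F_cont] in auto)
    then show ?thesis using that by (subst (asm) at_within_interior) (auto simp: interior_atLeastAtMost_real)
  qed
  have mvt: "2 * t * F (x - t) \<le> \<Phi> (x + t) - \<Phi> (x - t) \<and> \<Phi> (x + t) - \<Phi> (x - t) \<le> 2 * t * F (x + t)" if x: "p \<le> x" "x \<le> q" for x
  proof (cases "t = 0")
    case False
    then have "x - t < x + t" using t by simp
    moreover have "\<And>z. x - t \<le> z \<Longrightarrow> z \<le> x + t \<Longrightarrow> DERIV \<Phi> z :> F z" by (rule D) (use x in auto)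
    ultimately obtain z where z: "x - t < z" "z < x + t" "\<Phi> (x + t) - \<Phi> (x - t) = (x + t - (x - t)) * F z"
      using MVT2[of "x - t" "x + t" \<Phi> F] by blast
    have "F (x - t) \<le> F z" "F z \<le> F (x + t)" using z F_mono by auto
    then show ?thesis using z t by (auto intro: mult_left_mono)
  qed auto
  have "(\<integral>\<^sup>+x\<in>{p..q}. ennreal (F (x + t) - F (x - t)) \<partial>lborel)
      = ennreal ((\<Phi> (q + t) - \<Phi> (q - t)) - (\<Phi> (p + t) - \<Phi> (p - t)))"
  proof (rule nn_integral_FTC_Icc)
    show "(\<lambda>x. F (x + t) - F (x - t)) \<in> borel_measurable borel"
      by (intro borel_measurable_continuous_onI continuous_intros continuous_on_compose2[OF F_cont]) auto
    show "DERIV (\<lambda>x. \<Phi> (x + t) - \<Phi> (x - t)) x :> F (x + t) - F (x - t)" if "x \<in> {p..q}" for x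
    proof -
      have "DERIV (\<lambda>x. \<Phi> (x + t)) x :> F (x + t)"
        using DERIV_shift[of \<Phi> "F (x + t)" x t] D[of "x + t"] that t by auto
      moreover have "DERIV (\<lambda>x. \<Phi> (x - t)) x :> F (x - t)"
        using DERIV_shift[of \<Phi> "F (x - t)" x "- t"] D[of "x - t"] that t by auto
      ultimately show ?thesis by (rule DERIV_diff)
    qed
    show "0 \<le> F (x + t) - F (x - t)" for x using F_mono[of "x - t" "x + t"] t by simp
  qed (use pq in auto)
  also have "\<dots> \<le> ennreal (2 * t * (F (q + t) - F (p - t)))"
    using mvt[of p] mvt[of q] pq by (intro ennreal_leI) (simp add: algebra_simps)
  finally show ?thesis .
qed

text \<open>A point within \<open>t\<close> of \<open>C\<close> sees mass at least
  \<open>\<kappa> * t powr s\<close> within distance \<open>2 * t\<close>. Integrating this and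
  inserting the Hoelder bound for the mass near the interval gives the estimate.\<close>

lemma neighbourhood_measure:
  assumes t: "0 < t" "t \<le> R" and pq: "p \<le> q"
  shows "emeasure lborel {x\<in>{p..q}. infdist x C \<le> t}
     \<le> ennreal (4 * A / \<kappa> * t powr (1 - s) * (q - p + 4 * t) powr s)"
proof -
  let ?N = "{x\<in>{p..q}. infdist x C \<le> t}"
  have [measurable]: "?N \<in> sets lborel" by measurable
  have pos: "0 < \<kappa> * t powr s" using \<kappa> t by simp
  have "ennreal (\<kappa> * t powr s) * emeasure lborel ?N = (\<integral>\<^sup>+x. ennreal (\<kappa> * t powr s) * indicator ?N x \<partial>lborel)"
    by (rule nn_integral_cmult_indicator[symmetric]) simp
  also have "\<dots> \<le> (\<integral>\<^sup>+x\<in>{p..q}. ennreal (F (x + 2 * t) - F (x - 2 * t)) \<partial>lborel)"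
  proof (rule nn_integral_mono)
    fix x
    show "ennreal (\<kappa> * t powr s) * indicator ?N x \<le> ennreal (F (x + 2 * t) - F (x - 2 * t)) * indicator {p..q} x"
    proof (cases "x \<in> ?N")
      case True
      obtain c where c: "c \<in> C" "\<bar>x - c\<bar> = infdist x C" by (rule nearest)
      have "\<kappa> * t powr s \<le> F (c + t) - F (c - t)" by (rule F_lower[OF c(1) t])
      moreover have "\<bar>x - c\<bar> \<le> t" using c True by simp
      then have "c + t \<le> x + 2 * t" "x - 2 * t \<le> c - t" by linarith+
      then have "F (c + t) - F (c - t) \<le> F (x + 2 * t) - F (x - 2 * t)" by (rule diff_mono[OF F_mono F_mono])
      ultimately show ?thesis using True by (auto intro: ennreal_leI)
    qed simp
  qed
  also have "\<dots> \<le> ennreal (2 * (2 * t) * (F (q + 2 * t) - F (p - 2 * t)))"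
    by (rule increment_integral) (use t pq in auto)
  also have "\<dots> \<le> ennreal (2 * (2 * t) * (A * (q - p + 4 * t) powr s))"
    using F_holder[of "p - 2 * t" "q + 2 * t"] t pq
    by (intro ennreal_leI mult_left_mono) (auto simp: algebra_simps)
  finally have "ennreal (\<kappa> * t powr s) * emeasure lborel ?N \<le> ennreal (2 * (2 * t) * (A * (q - p + 4 * t) powr s))" .
  then have "emeasure lborel ?N \<le> ennreal (2 * (2 * t) * (A * (q - p + 4 * t) powr s)) / ennreal (\<kappa> * t powr s)"
    using pos by (rule ennreal_le_divideI)
  also have "\<dots> = ennreal (2 * (2 * t) * (A * (q - p + 4 * t) powr s) / (\<kappa> * t powr s))"
    using pos t A by (intro divide_ennreal) auto
  also have "2 * (2 * t) * (A * (q - p + 4 * t) powr s) / (\<kappa> * t powr s)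
     = 4 * A / \<kappa> * t powr (1 - s) * (q - p + 4 * t) powr s"
    using t by (simp add: powr_diff)
  finally show ?thesis .
qed

text \<open>The bound for the \<open>t\<close>-neighbourhood carries the factor
  \<open>t powr (1 - s)\<close> and vanishes as \<open>t\<close> tends to zero.\<close>

lemma null_C: "emeasure lborel C = 0"
proof -
  obtain p q where pq: "C \<subseteq> {p..q}" "p \<le> q"
  proof -
    obtain B where "\<forall>x\<in>C. norm x \<le> B" using compact_imp_bounded[OF compact_C] by (auto simp: bounded_iff)
    then have "C \<subseteq> {- \<bar>B\<bar>..\<bar>B\<bar>}" by force
    then show ?thesis by (rule that) simp
  qed
  have lim: "((\<lambda>t. ennreal (4 * A / \<kappa> * t powr (1 - s) * (q - p + 4 * t) powr s)) \<longlongrightarrow>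
     ennreal (4 * A / \<kappa> * 0 powr (1 - s) * (q - p + 4 * 0) powr s)) (at_right 0)"
  proof (rule tendsto_ennrealI, rule tendsto_mult, rule tendsto_mult[OF tendsto_const])
    show "((\<lambda>t. t powr (1 - s)) \<longlongrightarrow> 0 powr (1 - s)) (at_right 0)"
      using s by (intro tendsto_powr' tendsto_intros) (auto simp: eventually_at_right_field intro: exI[of _ 1])
    show "((\<lambda>t. (q - p + 4 * t) powr s) \<longlongrightarrow> (q - p + 4 * 0) powr s) (at_right 0)"
      using s pq by (intro tendsto_powr' tendsto_intros) (auto simp: eventually_at_right_field intro!: exI[of _ 1])
  qed
  have "emeasure lborel C \<le> ennreal (4 * A / \<kappa> * 0 powr (1 - s) * (q - p + 4 * 0) powr s)"
  proof (rule tendsto_lowerbound[OF lim])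
    show "\<forall>\<^sub>F t in at_right 0. emeasure lborel C \<le> ennreal (4 * A / \<kappa> * t powr (1 - s) * (q - p + 4 * t) powr s)"
      unfolding eventually_at_right_field
    proof (intro exI[of _ R] conjI allI impI)
      fix t assume t: "0 < t" "t < R"
      have "emeasure lborel C \<le> emeasure lborel {x\<in>{p..q}. infdist x C \<le> t}"
        using pq t by (intro emeasure_mono) (auto simp: infdist_zero_iff[symmetric])
      then show "emeasure lborel C \<le> ennreal (4 * A / \<kappa> * t powr (1 - s) * (q - p + 4 * t) powr s)"
        using neighbourhood_measure[of t p q] t pq by simp
    qed (use R in simp)
  qed simp
  then show ?thesis by simp
qed

lemma AE_notin_C: "AE x in lborel. infdist x C > 0"
proof -
  have "C \<in> null_sets lborel" using null_C closed_C by auto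
  then show ?thesis
    by (rule AE_I') (use infdist_zero_iff infdist_nonneg in \<open>auto simp: not_less intro: antisym\<close>)
qed

lemma dyadic_scale:
  assumes "0 < d" "d \<le> (r::real)"
  obtains n where "r * (1/2) ^ Suc n < d" "d \<le> r * (1/2) ^ n"
proof -
  have r: "0 < r" using assms by simp
  obtain n where "(1/2::real) ^ n < d / r" using real_arch_pow_inv[of "d / r" "1/2"] assms r by auto
  then have ex: "\<exists>n. r * (1/2) ^ n < d" using r by (auto simp: field_simps)
  then have N: "r * (1/2) ^ (LEAST n. r * (1/2) ^ n < d) < d" (is "r * (1/2) ^ ?N < d") by (rule LeastI_ex)
  then obtain n where n: "?N = Suc n" using assms by (cases ?N) auto
  then have "\<not> r * (1/2) ^ n < d" using not_less_Least[of n "\<lambda>n. r * (1/2) ^ n < d"] by simp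
  then show ?thesis using that[of n] N n by simp
qed

text \<open>Dyadic layers around \<open>C\<close>: the layer at distance about
  \<open>r * (1/2) ^ n\<close> has measure of order \<open>(1/2) ^ (n * (1 - s))\<close> and weight
  of order \<open>(1/2) ^ (- n * \<sigma>)\<close> relative to the scale \<open>r\<close>, which
  sums geometrically because \<open>\<sigma> < 1 - s\<close>.\<close>

lemma integral_infdist_powr:
  assumes \<sigma>: "0 \<le> \<sigma>" "\<sigma> < 1 - s" and \<Lambda>: "0 < \<Lambda>"
  shows "\<exists>B>0. \<forall>r p q. 0 < r \<and> r \<le> R \<and> p \<le> q \<and> q - p \<le> \<Lambda> * r \<longrightarrow>
    (\<integral>\<^sup>+x\<in>{p..q}. ennreal (infdist x C powr (- \<sigma>)) \<partial>lborel) \<le> ennreal (B * r powr (1 - \<sigma>))"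
proof -
  \<comment> \<open>The constant of \<open>neighbourhood_measure\<close> for intervals with
    \<open>q - p + 4 * t \<le> (\<Lambda> + 4) * r\<close>. The factor
    \<open>2 powr \<sigma>\<close> appears because the weight is evaluated at the inner edge of a
    dyadic layer; \<open>\<beta>\<close> is the ratio of the geometric series.\<close>
  define M where "M = 4 * A / \<kappa> * (\<Lambda> + 4) powr s * 2 powr \<sigma>"
  define \<beta> where "\<beta> = (1/2::real) powr (1 - s - \<sigma>)"
  have M: "0 < M" using A \<kappa> \<Lambda> by (simp add: M_def)
  have \<beta>: "0 < \<beta>" "\<beta> < 1" using \<sigma> by (simp_all add: \<beta>_def powr_def ln_div mult_less_0_iff)
  define B where "B = \<Lambda> + M / (1 - \<beta>)"
  have B: "0 < B" using M \<beta> \<Lambda> by (simp add: B_def add_pos_pos)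
  show ?thesis
  proof (intro exI[of _ B] conjI B allI impI)
    fix r p q assume "0 < r \<and> r \<le> R \<and> p \<le> q \<and> q - p \<le> \<Lambda> * r"
    then have r: "0 < r" "r \<le> R" and pq: "p \<le> q" "q - p \<le> \<Lambda> * r" by auto
    let ?d = "\<lambda>x. infdist x C"
    let ?N = "\<lambda>n. {x\<in>{p..q}. ?d x \<le> r * (1/2) ^ n}"
    let ?c = "\<lambda>n. ennreal ((r * (1/2) ^ Suc n) powr (- \<sigma>))"
    have [measurable]: "?N n \<in> sets lborel" for n by measurable
    have point: "ennreal (?d x powr (- \<sigma>)) * indicator {p..q} x
        \<le> ennreal (r powr (- \<sigma>)) * indicator {p..q} x + (\<Sum>n. ?c n * indicator (?N n) x)" for x
    proof (cases "x \<in> {p..q}")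
      case True
      \<comment> \<open>On \<open>C\<close> itself the integrand is zero, since
        \<open>0 powr y = 0\<close>.\<close>
      consider "?d x = 0" | "r \<le> ?d x" | "0 < ?d x" "?d x \<le> r"
        using infdist_nonneg[of x C] by linarith
      then show ?thesis
      proof cases
        case 2
        then have "?d x powr (- \<sigma>) \<le> r powr (- \<sigma>)" using r \<sigma> by (intro powr_mono2') auto
        then have "ennreal (?d x powr (- \<sigma>)) \<le> ennreal (r powr (- \<sigma>))" by (rule ennreal_leI)
        then show ?thesis using True by (auto intro: add_increasing2)
      next
        case 3
        obtain n where n: "r * (1/2) ^ Suc n < ?d x" "?d x \<le> r * (1/2) ^ n" by (rule dyadic_scale[OF 3])
        have "?d x powr (- \<sigma>) \<le> (r * (1/2) ^ Suc n) powr (- \<sigma>)" using n r \<sigma> by (intro powr_mono2') auto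
        then have "ennreal (?d x powr (- \<sigma>)) \<le> ?c n * indicator (?N n) x" using True n by (auto intro: ennreal_leI)
        also have "\<dots> \<le> (\<Sum>n. ?c n * indicator (?N n) x)"
        proof -
          have "f n \<le> suminf f" for f :: "nat \<Rightarrow> ennreal" using sum_le_suminf[of f "{n}"] by simp
          then show ?thesis .
        qed
        finally show ?thesis using True by (auto intro: add_increasing)
      qed (use True in auto)
    qed simp
    have trm: "?c n * emeasure lborel (?N n) \<le> ennreal (M * r powr (1 - \<sigma>) * \<beta> ^ n)" for n
    proof -
      define t where "t = r * (1/2) ^ n"
      have t: "0 < t" "t \<le> r" using r by (auto simp: t_def power_le_one)
      have "emeasure lborel (?N n) \<le> ennreal (4 * A / \<kappa> * t powr (1 - s) * (q - p + 4 * t) powr s)"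
        using neighbourhood_measure[of t p q] t r(2) pq unfolding t_def[symmetric] by simp
      also have "\<dots> \<le> ennreal (4 * A / \<kappa> * t powr (1 - s) * ((\<Lambda> + 4) * r) powr s)"
        using A \<kappa> s t pq by (intro ennreal_leI mult_left_mono powr_mono2) (auto simp: algebra_simps)
      finally have "?c n * emeasure lborel (?N n) \<le> ?c n * ennreal (4 * A / \<kappa> * t powr (1 - s) * ((\<Lambda> + 4) * r) powr s)"
        by (rule mult_left_mono) simp
      also have "\<dots> = ennreal ((t / 2) powr (- \<sigma>) * (4 * A / \<kappa> * t powr (1 - s) * ((\<Lambda> + 4) * r) powr s))"
        using A \<kappa> by (simp add: t_def ennreal_mult[symmetric])
      also have "(t / 2) powr (- \<sigma>) * (4 * A / \<kappa> * t powr (1 - s) * ((\<Lambda> + 4) * r) powr s)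
          = M * (t powr (1 - s - \<sigma>) * r powr s)"
      proof -
        have e1: "(t / 2) powr (- \<sigma>) = t powr (- \<sigma>) * 2 powr \<sigma>" using t by (simp add: powr_divide powr_minus field_simps)
        have e2: "t powr (- \<sigma>) * t powr (1 - s) = t powr (1 - s - \<sigma>)"
          by (simp add: powr_add[symmetric] algebra_simps)
        have e3: "((\<Lambda> + 4) * r) powr s = (\<Lambda> + 4) powr s * r powr s" using \<Lambda> r by (simp add: powr_mult)
        show ?thesis by (simp only: e1 e3 e2[symmetric] M_def) (simp add: mult_ac)
      qed
      also have "t powr (1 - s - \<sigma>) * r powr s = r powr (1 - \<sigma>) * \<beta> ^ n"
      proof -
        have "t powr (1 - s - \<sigma>) = r powr (1 - s - \<sigma>) * \<beta> ^ n"
        proof -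
          have "t powr (1 - s - \<sigma>) = r powr (1 - s - \<sigma>) * ((1/2) ^ n) powr (1 - s - \<sigma>)"
            unfolding t_def by (rule powr_mult)
          also have "((1/2::real) ^ n) powr (1 - s - \<sigma>) = \<beta> ^ n"
            unfolding \<beta>_def by (rule power_powr_commute) simp
          finally show ?thesis .
        qed
        moreover have "r powr (1 - s - \<sigma>) * r powr s = r powr (1 - \<sigma>)" by (simp add: powr_add[symmetric])
        ultimately show ?thesis
          by (simp only: mult.assoc mult.commute[of "\<beta> ^ n"]) (simp only: mult.assoc[symmetric])
      qed
      finally show ?thesis by (simp add: mult.assoc)
    qed
    have "(\<integral>\<^sup>+x\<in>{p..q}. ennreal (?d x powr (- \<sigma>)) \<partial>lborel)
       \<le> (\<integral>\<^sup>+x. ennreal (r powr (- \<sigma>)) * indicator {p..q} x + (\<Sum>n. ?c n * indicator (?N n) x) \<partial>lborel)"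
      by (intro nn_integral_mono point)
    also have "\<dots> = (\<integral>\<^sup>+x. ennreal (r powr (- \<sigma>)) * indicator {p..q} x \<partial>lborel) + (\<integral>\<^sup>+x. (\<Sum>n. ?c n * indicator (?N n) x) \<partial>lborel)"
      by (rule nn_integral_add) auto
    also have "(\<integral>\<^sup>+x. ennreal (r powr (- \<sigma>)) * indicator {p..q} x \<partial>lborel) = ennreal (r powr (- \<sigma>)) * ennreal (q - p)"
      using pq by (subst nn_integral_cmult_indicator) auto
    also have "(\<integral>\<^sup>+x. (\<Sum>n. ?c n * indicator (?N n) x) \<partial>lborel) = (\<Sum>n. \<integral>\<^sup>+x. ?c n * indicator (?N n) x \<partial>lborel)"
      by (rule nn_integral_suminf) auto
    also have "\<dots> = (\<Sum>n. ?c n * emeasure lborel (?N n))"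
      by (subst nn_integral_cmult_indicator) auto
    also have "ennreal (r powr (- \<sigma>)) * ennreal (q - p) + \<dots> \<le> ennreal (\<Lambda> * r powr (1 - \<sigma>)) + ennreal (M * r powr (1 - \<sigma>) / (1 - \<beta>))"
    proof (rule add_mono)
      have "r powr (- \<sigma>) * (q - p) \<le> r powr (- \<sigma>) * (\<Lambda> * r)" using pq by (intro mult_left_mono) auto
      also have "\<dots> = \<Lambda> * r powr (1 - \<sigma>)" using r by (simp add: powr_diff powr_minus field_simps)
      finally show "ennreal (r powr (- \<sigma>)) * ennreal (q - p) \<le> ennreal (\<Lambda> * r powr (1 - \<sigma>))"
        using pq by (simp add: ennreal_mult[symmetric] ennreal_leI)
      have "(\<Sum>n. ?c n * emeasure lborel (?N n)) \<le> (\<Sum>n. ennreal (M * r powr (1 - \<sigma>) * \<beta> ^ n))"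
        by (intro suminf_le trm) auto
      also have "\<dots> = ennreal (\<Sum>n. M * r powr (1 - \<sigma>) * \<beta> ^ n)"
        using M \<beta> by (intro suminf_ennreal2) (auto intro: summable_mult)
      also have "(\<Sum>n. M * r powr (1 - \<sigma>) * \<beta> ^ n) = M * r powr (1 - \<sigma>) / (1 - \<beta>)"
        using \<beta> by (subst suminf_mult) (auto simp: suminf_geometric)
      finally show "(\<Sum>n. ?c n * emeasure lborel (?N n)) \<le> ennreal (M * r powr (1 - \<sigma>) / (1 - \<beta>))" .
    qed
    also have "\<dots> = ennreal (B * r powr (1 - \<sigma>))"
      using M \<beta> \<Lambda> by (simp add: B_def ennreal_plus[symmetric] field_simps del: ennreal_plus)
    finally show "(\<integral>\<^sup>+x\<in>{p..q}. ennreal (?d x powr (- \<sigma>)) \<partial>lborel) \<le> ennreal (B * r powr (1 - \<sigma>))" .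
  qed
qed

lemma right_cont_F: "continuous (at_right x) F"
  using F_cont_at by (rule continuous_at_imp_continuous_at_within)

lemma emeasure_Icc: "p \<le> q \<Longrightarrow> emeasure (interval_measure F) {p..q} = ennreal (F q - F p)"
  by (rule emeasure_interval_measure_Icc) (use F_mono F_cont in auto)

lemma sigma_finite_F: "sigma_finite_measure (interval_measure F)"
  by (rule sigma_finite_interval_measure) (use F_mono right_cont_F in auto)

lemma emeasure_ball: "0 \<le> t \<Longrightarrow> emeasure (interval_measure F) {y - t..y + t} \<le> ennreal (A * (2 * t) powr s)"
  using F_holder[of "y - t" "y + t"] by (simp add: emeasure_Icc ennreal_leI)

text \<open>The complement of \<open>C\<close> is covered by countably many intervals with rational
  end points on which \<open>F\<close> does not grow.\<close>

lemma AE_in_C: "AE c in interval_measure F. c \<in> C"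
proof -
  define \<F> where "\<F> = (\<lambda>(p, q). {p<..q}) ` {(p, q). p \<in> \<rat> \<and> q \<in> \<rat> \<and> p \<le> q \<and> F p = F q}"
  have count: "countable \<F>"
    unfolding \<F>_def by (intro countable_image countable_subset[OF _ countable_SIGMA[OF countable_rat countable_rat]]) auto
  have "I \<in> null_sets (interval_measure F)" if "I \<in> \<F>" for I
    using that emeasure_interval_measure_Ioc[of _ _ F, OF _ F_mono right_cont_F] by (auto simp: \<F>_def)
  then have null: "\<Union>\<F> \<in> null_sets (interval_measure F)" using null_sets_UN'[OF count, of "\<lambda>x. x"] by simp
  have "{c \<in> space (interval_measure F). c \<notin> C} \<subseteq> \<Union>\<F>"
  proof
    fix c assume "c \<in> {c \<in> space (interval_measure F). c \<notin> C}"
    then obtain e where e: "0 < e" "F (c + e) = F (c - e)" using F_const by blast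
    obtain p where p: "p \<in> \<rat>" "c - e < p" "p < c" using Rats_dense_in_real[of "c - e" c] e by auto
    obtain q where q: "q \<in> \<rat>" "c < q" "q < c + e" using Rats_dense_in_real[of c "c + e"] e by auto
    have "F p = F q" using F_mono[of "c - e" p] F_mono[of p q] F_mono[of q "c + e"] p q e by simp
    then have "{p<..q} \<in> \<F>" using p q unfolding \<F>_def by (intro image_eqI[of _ _ "(p, q)"]) auto
    moreover have "c \<in> {p<..q}" using p q by simp
    ultimately show "c \<in> \<Union>\<F>" by blast
  qed
  then show ?thesis by (rule AE_I'[OF null])
qed

end

section \<open>The geometry of the space\<close>

lemma infdist_in_gap:
  fixes p q x :: real
  assumes "p \<in> A" "q \<in> A" "A \<inter> {p<..<q} = {}" "p \<le> x" "x \<le> q"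
  shows "infdist x A = min (x - p) (q - x)"
proof (rule antisym)
  show "infdist x A \<le> min (x - p) (q - x)"
    using infdist_le[OF assms(1), of x] infdist_le[OF assms(2), of x] assms(4,5) by (auto simp: dist_real_def)
  have "min (x - p) (q - x) \<le> dist x c" if "c \<in> A" for c
  proof -
    have "c \<le> p \<or> q \<le> c" using that assms(3) by (metis disjoint_iff greaterThanLessThan_iff not_le)
    then show ?thesis using assms(4,5) by (auto simp: dist_real_def)
  qed
  then show "min (x - p) (q - x) \<le> infdist x A"
    using assms(1) by (auto simp: infdist_def intro!: cINF_greatest)
qed

lemma (in cantor) infdist_cantor_gap:
  assumes l: "l \<in> cantor_ends a n" and x: "l + a ^ Suc n \<le> x" "x \<le> l + a ^ n - a ^ Suc n"
  shows "infdist x (cantor_set a) = min (x - (l + a ^ Suc n)) (l + a ^ n - a ^ Suc n - x)"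
proof (rule infdist_in_gap)
  show "l + a ^ Suc n \<in> cantor_set a" "l + a ^ n - a ^ Suc n \<in> cantor_set a"
    using ends_in_cantor_set(2)[of l "Suc n"] ends_in_cantor_set(1)[of "l + (1 - a) * a ^ n" "Suc n"] ends_children[OF l]
    by (auto simp: algebra_simps)
qed (use gap_disjoint[OF l] x in auto)

locale construction =
  fixes a :: real and m :: nat
  assumes a: "0 < a" "a < 1/2" and m: "1 \<le> m"
begin

text \<open>Taking the ratio of \<open>K\<close> as the power \<open>a ^ m\<close> of the ratio of
  \<open>C\<close> makes the dimension of \<open>K\<close> the \<open>m\<close>-th part of that of
  \<open>C\<close>, and puts the interval lengths of both sets on one geometric scale.\<close>

definition lam :: real where "lam = a ^ m"
definition w0 :: real where "w0 = 1 - 2 * lam"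

text \<open>The scaling factor makes the gap lengths of \<open>K\<close> and of \<open>C\<close> differ by half-integral
  powers of \<open>a\<close>, so that they are never comparable.\<close>

definition bet :: real where "bet = sqrt a * w0 / (1 - 2 * a)"
definition K :: "real set" where "K = cantor_set lam"
definition C :: "real set" where "C = (\<lambda>x. bet * x) ` cantor_set a"
definition FK :: "real \<Rightarrow> real" where "FK = cantor_fun lam"
definition FC :: "real \<Rightarrow> real" where "FC y = cantor_fun a (y / bet)"
definition rho :: "real \<Rightarrow> real" where "rho x = infdist x K"
definition del :: "real \<Rightarrow> real" where "del y = infdist y C"
definition fib :: "real \<Rightarrow> real \<Rightarrow> bool" where "fib x y \<longleftrightarrow> 0 \<le> x \<and> x \<le> 1 \<and> del y \<le> rho x"
text \<open>The relative distance that is guaranteed between a gap length of \<open>K\<close> and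
  any gap length of \<open>C\<close>, see \<open>gaps_not_comparable\<close>.\<close>

definition \<theta> :: real where "\<theta> = 1 - sqrt a"

lemma lam: "0 < lam" "lam < 1/2"
proof -
  have "a ^ m \<le> a ^ 1" using a m by (intro power_decreasing) auto
  then show "0 < lam" "lam < 1/2" using a by (auto simp: lam_def)
qed

sublocale cK: cantor lam using lam by unfold_locales
sublocale cC: cantor a using a by unfold_locales

lemma w0: "0 < w0" "w0 < 1" using lam by (auto simp: w0_def)
lemma bet: "0 < bet" using a w0 by (simp add: bet_def)
lemma bet_gap: "bet * (1 - 2 * a) = sqrt a * w0" using a by (simp add: bet_def)
lemma \<theta>: "0 < \<theta>" "\<theta> < 1" using a by (auto simp: \<theta>_def real_sqrt_lt_1_iff)

lemma lam_pow: "lam ^ n = a ^ (m * n)" by (simp add: lam_def power_mult)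

lemma dim_relation: "cK.cdim * real m = cC.cdim"
proof -
  have "ln (1 / lam) = real m * ln (1 / a)" using a by (simp add: lam_def ln_div ln_realpow)
  moreover have "0 < ln (1 / a)" using a by (simp add: ln_div)
  ultimately show ?thesis using m by (simp add: cK.cdim_def cC.cdim_def)
qed

text \<open>The lower mass bound extends from radius 1 to radius \<open>R\<close> by comparing
  larger balls with the unit ball; this costs the factor \<open>R powr (- cK.cdim)\<close>.\<close>

lemma regular_K: "regular_line_set K FK cK.cdim ((1 - 2 * lam) powr (- cK.cdim)) (R powr (- cK.cdim) / 2) R"
  if R: "1 \<le> R"
proof
  show "compact K" unfolding K_def by (rule cK.compact_cantor_set)
  show "K \<noteq> {}" unfolding K_def using cK.zero_in_cantor_set by blast
  show "FK x \<le> FK y" if "x \<le> y" for x y unfolding FK_def by (rule cK.fun_mono[OF that])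
  show "FK y - FK x \<le> (1 - 2 * lam) powr (- cK.cdim) * (y - x) powr cK.cdim" if "x \<le> y" for x y
    unfolding FK_def by (rule cK.fun_holder[OF that])
  have s: "0 \<le> cK.cdim" using cK.cdim_bounds by simp
  show "R powr (- cK.cdim) / 2 * r powr cK.cdim \<le> FK (c + r) - FK (c - r)" if c: "c \<in> K" and r: "0 < r" "r \<le> R" for c r
  proof -
    have "R powr (- cK.cdim) * r powr cK.cdim = (r / R) powr cK.cdim"
      using R r by (simp add: powr_divide powr_minus field_simps)
    also have "\<dots> \<le> min r 1 powr cK.cdim"
      using R r by (intro powr_mono2[OF s]) (auto simp: field_simps min_def mult_left_le)
    also have "min r 1 powr cK.cdim / 2 \<le> FK (c + min r 1) - FK (c - min r 1)"
      unfolding FK_def by (rule cK.fun_mass_lower) (use c r in \<open>auto simp: K_def\<close>)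
    then have "min r 1 powr cK.cdim \<le> 2 * (FK (c + min r 1) - FK (c - min r 1))" by simp
    also have "\<dots> \<le> 2 * (FK (c + r) - FK (c - r))"
      unfolding FK_def by (intro mult_left_mono diff_mono cK.fun_mono) auto
    finally show ?thesis by simp
  qed
  show "\<exists>e>0. FK (x + e) = FK (x - e)" if x: "x \<notin> K" for x
  proof -
    consider "x < 0" | "1 < x" | "x \<in> {0..1}" by fastforce
    then show ?thesis
    proof cases
      case 1 then show ?thesis unfolding FK_def by (intro exI[of _ "-x"]) (simp add: cK.fun_outside)
    next
      case 2 then show ?thesis unfolding FK_def by (intro exI[of _ "x - 1"]) (simp add: cK.fun_outside)
    next
      case 3
      obtain n l where l: "l \<in> cantor_ends lam n" "l + lam ^ Suc n < x" "x < l + lam ^ n - lam ^ Suc n"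
        by (rule cK.cantor_gap[OF 3]) (use x in \<open>auto simp: K_def\<close>)
      let ?e = "min (x - (l + lam ^ Suc n)) (l + lam ^ n - lam ^ Suc n - x)"
      show ?thesis
        using cK.fun_const_gap[OF l(1), of "x + ?e"] cK.fun_const_gap[OF l(1), of "x - ?e"] l
        unfolding FK_def by (intro exI[of _ ?e]) (auto simp: min_def)
    qed
  qed
  show "0 < cK.cdim" "cK.cdim < 1" by (rule cK.cdim_bounds)+
qed (use lam R in auto)

lemma regular_C: "regular_line_set C FC cC.cdim ((1 - 2 * a) powr (- cC.cdim) * bet powr (- cC.cdim))
    (max R bet powr (- cC.cdim) / 2) R"
  if R: "0 < R"
proof
  have b: "0 < bet" by (rule bet)
  show "compact C" unfolding C_def
    by (intro compact_continuous_image cC.compact_cantor_set continuous_intros)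
  show "C \<noteq> {}" unfolding C_def using cC.zero_in_cantor_set by blast
  show "FC x \<le> FC y" if "x \<le> y" for x y unfolding FC_def using that b by (intro cC.fun_mono divide_right_mono) auto
  have s: "0 \<le> cC.cdim" using cC.cdim_bounds by simp
  show "FC y - FC x \<le> (1 - 2 * a) powr (- cC.cdim) * bet powr (- cC.cdim) * (y - x) powr cC.cdim" if "x \<le> y" for x y
  proof -
    have "x / bet \<le> y / bet" using that b by (intro divide_right_mono) auto
    from cC.fun_holder[OF this] have "FC y - FC x \<le> (1 - 2 * a) powr (- cC.cdim) * ((y - x) / bet) powr cC.cdim"
      unfolding FC_def by (simp add: diff_divide_distrib)
    also have "((y - x) / bet) powr cC.cdim = bet powr (- cC.cdim) * (y - x) powr cC.cdim"
      using that b by (simp add: powr_divide powr_minus field_simps)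
    finally show ?thesis by (simp add: mult.assoc)
  qed
  show "max R bet powr (- cC.cdim) / 2 * r powr cC.cdim \<le> FC (c + r) - FC (c - r)" if c: "c \<in> C" and r: "0 < r" "r \<le> R" for c r
  proof -
    obtain c' where c': "c' \<in> cantor_set a" "c = bet * c'" using c by (auto simp: C_def)
    let ?t = "min (r / bet) 1"
    have t: "0 < ?t" using r b by simp
    have "max R bet powr (- cC.cdim) * r powr cC.cdim = (r / max R bet) powr cC.cdim"
      using b r by (simp add: powr_divide powr_minus field_simps)
    also have "\<dots> \<le> ?t powr cC.cdim"
      using r b by (intro powr_mono2[OF s]) (auto simp: min_def max_def field_simps)
    also have "?t powr cC.cdim / 2 \<le> cantor_fun a (c' + ?t) - cantor_fun a (c' - ?t)"
      by (rule cC.fun_mass_lower) (use c' t in auto)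
    then have "?t powr cC.cdim \<le> 2 * (cantor_fun a (c' + ?t) - cantor_fun a (c' - ?t))" by simp
    also have "\<dots> \<le> 2 * (cantor_fun a (c' + r / bet) - cantor_fun a (c' - r / bet))"
      by (intro mult_left_mono diff_mono cC.fun_mono) auto
    also have "\<dots> = 2 * (FC (c + r) - FC (c - r))"
      using b by (simp add: FC_def c' add_divide_distrib diff_divide_distrib)
    finally show ?thesis by simp
  qed
  show "\<exists>e>0. FC (x + e) = FC (x - e)" if x: "x \<notin> C" for x
  proof -
    have x': "x / bet \<notin> cantor_set a" using x b by (auto simp: C_def image_iff)
    have "\<exists>e>0. cantor_fun a (x / bet + e) = cantor_fun a (x / bet - e)"
    proof -
      consider "x / bet < 0" | "1 < x / bet" | "x / bet \<in> {0..1}" by fastforce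
      then show ?thesis
      proof cases
        case 1 then show ?thesis by (intro exI[of _ "-(x / bet)"]) (simp add: cC.fun_outside)
      next
        case 2 then show ?thesis by (intro exI[of _ "x / bet - 1"]) (simp add: cC.fun_outside)
      next
        case 3
        obtain n l where l: "l \<in> cantor_ends a n" "l + a ^ Suc n < x / bet" "x / bet < l + a ^ n - a ^ Suc n"
          by (rule cC.cantor_gap[OF 3 x'])
        let ?e = "min (x / bet - (l + a ^ Suc n)) (l + a ^ n - a ^ Suc n - x / bet)"
        show ?thesis
          using cC.fun_const_gap[OF l(1), of "x / bet + ?e"] cC.fun_const_gap[OF l(1), of "x / bet - ?e"] l
          by (intro exI[of _ ?e]) (auto simp: min_def)
      qed
    qed
    then obtain e where e: "0 < e" "cantor_fun a (x / bet + e) = cantor_fun a (x / bet - e)" by blast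
    then show ?thesis using b
      by (intro exI[of _ "bet * e"]) (simp add: FC_def add_divide_distrib diff_divide_distrib)
  qed
  show "0 < cC.cdim" "cC.cdim < 1" by (rule cC.cdim_bounds)+
qed (use a bet R in auto)

sublocale RK: regular_line_set K FK cK.cdim "(1 - 2 * lam) powr (- cK.cdim)" "1 powr (- cK.cdim) / 2" 1
  by (rule regular_K) simp
sublocale RC: regular_line_set C FC cC.cdim "(1 - 2 * a) powr (- cC.cdim) * bet powr (- cC.cdim)"
    "max 1 bet powr (- cC.cdim) / 2" 1
  by (rule regular_C) simp

lemma rho_nonneg [simp]: "0 \<le> rho x" and del_nonneg [simp]: "0 \<le> del x"
  by (simp_all add: rho_def del_def infdist_nonneg)

lemma rho_lip: "\<bar>rho x - rho y\<bar> \<le> \<bar>x - y\<bar>"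
  using RK.infdist_lipschitz[of x y] RK.infdist_lipschitz[of y x] unfolding rho_def by linarith

lemma del_lip: "\<bar>del x - del y\<bar> \<le> \<bar>x - y\<bar>"
  using RC.infdist_lipschitz[of x y] RC.infdist_lipschitz[of y x] unfolding del_def by linarith

lemma rho_zero_iff: "rho x = 0 \<longleftrightarrow> x \<in> K" unfolding rho_def by (rule RK.infdist_zero_iff)
lemma del_zero_iff: "del y = 0 \<longleftrightarrow> y \<in> C" unfolding del_def by (rule RC.infdist_zero_iff)
lemma rho_pos_iff: "0 < rho x \<longleftrightarrow> x \<notin> K" using rho_zero_iff[of x] rho_nonneg[of x] by linarith

lemma del_le: "c \<in> C \<Longrightarrow> del y \<le> \<bar>y - c\<bar>" unfolding del_def by (rule RC.infdist_le)

lemma del_nearest: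
  obtains c where "c \<in> C" "\<bar>y - c\<bar> = del y"
  unfolding del_def by (rule RC.nearest)

text \<open>A gap of \<open>K\<close> of level \<open>n\<close>, with what is used about it: the
  tent shape of \<open>rho\<close> governs the geometry of the set, and the constancy of
  \<open>FK\<close> will make the map a translation over the gap.\<close>

definition gapK :: "real \<Rightarrow> nat \<Rightarrow> bool" where
  "gapK p n \<longleftrightarrow> 0 \<le> p \<and> p + w0 * lam ^ n \<le> 1 \<and> p \<in> K \<and> p + w0 * lam ^ n \<in> K \<and>
     (\<forall>x. p \<le> x \<and> x \<le> p + w0 * lam ^ n \<longrightarrow> rho x = min (x - p) (p + w0 * lam ^ n - x)
         \<and> FK x = FK p)"

text \<open>The length is \<open>bet * (1 - 2 * a) * a ^ n\<close>, rewritten by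
  \<open>bet_gap\<close> so that it can be compared with the gap lengths \<open>w0 * lam ^ n\<close>
  of \<open>K\<close>.\<close>

definition gapC :: "real \<Rightarrow> nat \<Rightarrow> bool" where
  "gapC p n \<longleftrightarrow> 0 \<le> p \<and> p + sqrt a * w0 * a ^ n \<le> bet \<and>
     (\<forall>x. p \<le> x \<and> x \<le> p + sqrt a * w0 * a ^ n \<longrightarrow> del x = min (x - p) (p + sqrt a * w0 * a ^ n - x))"

lemma gapK_ends:
  assumes l: "l \<in> cantor_ends lam n"
  shows "gapK (l + lam ^ Suc n) n"
proof -
  have e: "l + lam ^ Suc n + w0 * lam ^ n = l + lam ^ n - lam ^ Suc n" by (simp add: w0_def algebra_simps)
  have b: "0 \<le> l" "l + lam ^ n \<le> 1" using cK.ends_bounds[OF l] by auto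
  have pos: "0 \<le> lam ^ Suc n" using lam by simp
  have in_K: "l + lam ^ Suc n \<in> K" "l + lam ^ n - lam ^ Suc n \<in> K"
    using cK.ends_in_cantor_set(2)[of l "Suc n"] cK.ends_in_cantor_set(1)[of "l + (1 - lam) * lam ^ n" "Suc n"] cK.ends_children[OF l]
    by (auto simp: algebra_simps K_def)
  show ?thesis
    unfolding gapK_def e
  proof (intro conjI allI impI)
    show "0 \<le> l + lam ^ Suc n" "l + lam ^ n - lam ^ Suc n \<le> 1" using b pos by linarith+
    fix x assume x: "l + lam ^ Suc n \<le> x \<and> x \<le> l + lam ^ n - lam ^ Suc n"
    show "rho x = min (x - (l + lam ^ Suc n)) (l + lam ^ n - lam ^ Suc n - x)"
      unfolding rho_def K_def by (rule cK.infdist_cantor_gap[OF l]) (use x in auto)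
    show "FK x = FK (l + lam ^ Suc n)"
      unfolding FK_def by (rule cK.fun_const_gap[OF l]) (use x in auto)
  qed (fact in_K)+
qed

lemma gapK_obtain:
  assumes "0 \<le> x" "x \<le> 1" "0 < rho x"
  obtains p n where "gapK p n" "p < x" "x < p + w0 * lam ^ n"
proof -
  have x: "x \<notin> cantor_set lam" using assms rho_pos_iff by (simp add: K_def)
  obtain n l where l: "l \<in> cantor_ends lam n" "l + lam ^ Suc n < x" "x < l + lam ^ n - lam ^ Suc n"
    by (rule cK.cantor_gap[OF _ x]) (use assms in auto)
  show ?thesis by (rule that[OF gapK_ends[OF l(1)]]) (use l in \<open>auto simp: w0_def algebra_simps\<close>)
qed

text \<open>The gap in the middle of the level \<open>n\<close> interval around \<open>x\<close>;
  the interval and its gap have the same midpoint.\<close>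

lemma gapK_near:
  assumes "x \<in> K"
  obtains p where "gapK p n" "\<bar>p + w0 * lam ^ n / 2 - x\<bar> \<le> lam ^ n"
proof -
  have "x \<in> cantor_level lam n" using assms by (auto simp: K_def cantor_set_def)
  then obtain l where l: "l \<in> cantor_ends lam n" "l \<le> x" "x \<le> l + lam ^ n" by (auto simp: cantor_level_def)
  have "l + lam ^ Suc n + w0 * lam ^ n / 2 = l + lam ^ n / 2" by (simp add: w0_def field_simps)
  then show ?thesis by (intro that[OF gapK_ends[OF l(1)]]) (use l in auto)
qed

lemma zero_in_C: "0 \<in> C" and bet_in_C: "bet \<in> C"
  using cC.zero_in_cantor_set cC.one_in_cantor_set by (force simp: C_def)+

lemma C_subset: "C \<subseteq> {0..bet}"
  using cC.cantor_set_subset bet by (auto simp: C_def mult_left_le)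

lemma K_subset: "K \<subseteq> {0..1}" using cK.cantor_set_subset by (simp add: K_def)

lemma zero_in_K: "0 \<in> K" and one_in_K: "1 \<in> K"
  using cK.zero_in_cantor_set cK.one_in_cantor_set by (simp_all add: K_def)

lemma infdist_scale: "0 < c \<Longrightarrow> infdist (c * x) ((\<lambda>x. c * x) ` A) = c * infdist x (A :: real set)"
proof (cases "A = {}")
  case False
  assume c: "0 < c"
  have "(INF y\<in>A. dist (c * x) (c * y)) = (INF y\<in>A. c * dist x y)"
    using c by (intro INF_cong) (auto simp: dist_real_def right_diff_distrib[symmetric] abs_mult)
  also have "\<dots> = c * (INF y\<in>A. dist x y)"
  proof -
    have "mono ((*) c)" using c by (auto simp: mono_def intro: mult_left_mono)
    moreover have "continuous (at_right (INF y\<in>A. dist x y)) ((*) c)" by (intro continuous_intros)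
    ultimately show ?thesis
      using continuous_at_Inf_mono[of "(*) c" "(\<lambda>y. dist x y) ` A"] False by (simp add: image_image bdd_below_image_dist)
  qed
  finally show ?thesis using False by (simp add: infdist_def image_image)
qed (simp add: infdist_def)

lemma del_cases:
  assumes "0 < del y"
  obtains (below) "y < 0" | (above) "bet < y" | (gap) p n where "gapC p n" "p < y" "y < p + sqrt a * w0 * a ^ n"
proof -
  consider "y < 0" | "bet < y" | "y / bet \<in> {0..1}" using bet by (fastforce simp: field_simps)
  then show ?thesis
  proof cases
    case 3
    have "y / bet \<notin> cantor_set a" using assms del_zero_iff[of y] bet by (auto simp: C_def image_iff)
    then obtain n l where l: "l \<in> cantor_ends a n" "l + a ^ Suc n < y / bet" "y / bet < l + a ^ n - a ^ Suc n"
      by (rule cC.cantor_gap[OF 3])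
    have e: "bet * (l + a ^ Suc n) + sqrt a * w0 * a ^ n = bet * (l + a ^ n - a ^ Suc n)"
      unfolding bet_gap[symmetric] by (simp add: algebra_simps)
    have "gapC (bet * (l + a ^ Suc n)) n"
      unfolding gapC_def e
    proof (intro conjI allI impI)
      have "0 \<le> l" "l + a ^ n \<le> 1" using cC.ends_bounds[OF l(1)] by auto
      moreover have "0 \<le> a ^ Suc n" using a by simp
      ultimately show "0 \<le> bet * (l + a ^ Suc n)" "bet * (l + a ^ n - a ^ Suc n) \<le> bet"
        using bet by (auto simp del: power_Suc intro: mult_left_le)
      fix x assume x: "bet * (l + a ^ Suc n) \<le> x \<and> x \<le> bet * (l + a ^ n - a ^ Suc n)"
      then have x': "l + a ^ Suc n \<le> x / bet" "x / bet \<le> l + a ^ n - a ^ Suc n" using bet by (simp_all add: field_simps)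
      have "del x = bet * infdist (x / bet) (cantor_set a)"
        using infdist_scale[OF bet, of "x / bet" "cantor_set a"] bet by (simp add: del_def C_def)
      also have "\<dots> = min (bet * (x / bet - (l + a ^ Suc n))) (bet * (l + a ^ n - a ^ Suc n - x / bet))"
        using cC.infdist_cantor_gap[OF l(1) x'] bet by (auto simp: min_def simp del: power_Suc)
      also have "\<dots> = min (x - bet * (l + a ^ Suc n)) (bet * (l + a ^ n - a ^ Suc n) - x)"
        using bet by (simp add: right_diff_distrib del: power_Suc)
      finally show "del x = min (x - bet * (l + a ^ Suc n)) (bet * (l + a ^ n - a ^ Suc n) - x)" .
    qed
    moreover have "bet * (l + a ^ Suc n) < y" "y < bet * (l + a ^ Suc n) + sqrt a * w0 * a ^ n"
      unfolding e using l bet by (simp_all add: field_simps)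
    ultimately show ?thesis by (rule gap)
  qed (use below above in auto)
qed

lemma del_outside: "y \<le> 0 \<Longrightarrow> del y = - y" "bet \<le> y \<Longrightarrow> del y = y - bet"
proof -
  obtain c where c: "c \<in> C" "\<bar>y - c\<bar> = del y" by (rule del_nearest)
  have "c \<in> {0..bet}" using c(1) C_subset by auto
  then show "y \<le> 0 \<Longrightarrow> del y = - y" "bet \<le> y \<Longrightarrow> del y = y - bet"
    using c del_le[OF zero_in_C, of y] del_le[OF bet_in_C, of y] by auto
qed

text \<open>The quotient of \<open>g\<close> by \<open>w\<close> is \<open>a\<close> to an exponent
  that is an integer plus \<open>1/2\<close>, hence at most \<open>sqrt a\<close> or at least
  \<open>1 / sqrt a\<close>. Its distance from 1 is at least \<open>1 - sqrt a\<close> in both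
  cases.\<close>

lemma gaps_not_comparable:
  fixes n k :: nat
  defines "w \<equiv> w0 * lam ^ n" and "g \<equiv> sqrt a * w0 * a ^ k"
  shows "\<theta> * w \<le> \<bar>g - w\<bar>"
proof (cases "m * n \<le> k")
  case True
  have "a ^ k \<le> a ^ (m * n)" using a True by (intro power_decreasing) auto
  then have "g \<le> sqrt a * w" using w0 a by (simp add: g_def w_def lam_pow)
  then show ?thesis by (simp add: \<theta>_def algebra_simps abs_if)
next
  case False
  then have "Suc k \<le> m * n" by simp
  then have "a ^ (m * n) \<le> a ^ Suc k" using a by (intro power_decreasing) auto
  also have "\<dots> = sqrt a * (sqrt a * a ^ k)" using a by (simp add: mult.assoc[symmetric])
  finally have "w \<le> sqrt a * g" using w0 by (simp add: g_def w_def lam_pow mult.left_commute)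
  moreover have w: "0 < w" using w0 lam by (simp add: w_def)
  ultimately have "sqrt a * w + \<theta> * w \<le> sqrt a * g" by (simp add: \<theta>_def algebra_simps)
  moreover have sa: "0 < sqrt a" "sqrt a < 1" using a by auto
  have "sqrt a * (\<theta> * w) \<le> \<theta> * w" using w \<theta> sa by (intro mult_left_le_one_le) auto
  ultimately have "sqrt a * (w + \<theta> * w) \<le> sqrt a * g" by (simp add: distrib_left)
  then have "w + \<theta> * w \<le> g" using sa by simp
  then show ?thesis by simp
qed

text \<open>If \<open>del y0\<close> is well below \<open>rho x0\<close>, the point already has a
  full box around it. Otherwise the slack is created by a shift: away from the middle of its gap,
  \<open>x0\<close> moves towards the middle and \<open>rho\<close> increases; near the middle,
  \<open>y0\<close> moves towards \<open>C\<close> and \<open>del\<close> decreases. The second move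
  would fail only at the top of a tent of \<open>del\<close>, which is excluded because gap lengths
  are not comparable. Both functions change with slope one along these moves, so a shift by
  \<open>5 * r\<close> outweighs the size of the box, and the factor 100 keeps everything within the
  linear range.\<close>

lemma small_scale_shift:
  assumes z: "fib x0 y0" and r: "0 < r" "100 * r \<le> \<theta> * rho x0"
  shows "\<exists>v1 v2. \<bar>v1\<bar> \<le> 5 * r \<and> \<bar>v2\<bar> \<le> 5 * r \<and> (v1 = 0 \<or> v2 = 0) \<and>
    (\<forall>x y t. \<bar>x - x0\<bar> \<le> r \<and> \<bar>y - y0\<bar> \<le> r \<and> fib x y \<and> 0 \<le> t \<and> t \<le> 1 \<longrightarrow> fib (x + t * v1) (y + t * v2)) \<and>
    (\<forall>x y. \<bar>x - (x0 + v1)\<bar> \<le> r \<and> \<bar>y - (y0 + v2)\<bar> \<le> r \<longrightarrow> fib x y)"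
proof -
  have x0: "0 \<le> x0" "x0 \<le> 1" and d0: "del y0 \<le> rho x0" using z by (auto simp: fib_def)
  have "\<theta> * rho x0 \<le> 1 * rho x0" using \<theta> by (intro mult_right_mono) auto
  then have rr: "100 * r \<le> rho x0" using r by simp
  obtain p n where gap: "gapK p n" and xp: "p < x0" "x0 < p + w0 * lam ^ n"
    by (rule gapK_obtain[OF x0]) (use rr r in auto)
  define w where "w = w0 * lam ^ n"
  have p: "0 \<le> p" "p + w \<le> 1" and rho: "\<And>x. p \<le> x \<Longrightarrow> x \<le> p + w \<Longrightarrow> rho x = min (x - p) (p + w - x)"
    using gap by (auto simp: gapK_def w_def)
  have rho0: "rho x0 = min (x0 - p) (p + w - x0)" using rho[of x0] xp by (simp add: w_def)
  have in_gap: "p \<le> x \<and> x \<le> p + w \<and> 0 \<le> x \<and> x \<le> 1" if "\<bar>x - x0\<bar> \<le> 10 * r" for x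
    using that rho0 rr p r by (auto simp: min_def split: if_splits)
  have up: "rho x = x - p" if "p \<le> x" "x \<le> p + w / 2" for x using rho[of x] that by (simp add: min_def)
  have dn: "rho x = p + w - x" if "p + w / 2 \<le> x" "x \<le> p + w" for x using rho[of x] that by (simp add: min_def)
  have dl: "del y \<le> del y0 + \<bar>y - y0\<bar>" for y using del_lip[of y y0] by linarith
  have rl: "rho x0 - \<bar>x - x0\<bar> \<le> rho x" for x using rho_lip[of x x0] by linarith
  have tt: "0 \<le> t * r \<and> t * r \<le> r" if "0 \<le> t" "t \<le> (1::real)" for t using that r by (simp add: mult_left_le_one_le)
  consider (A) "del y0 \<le> rho x0 - 3 * r" | (B1) "rho x0 - 3 * r < del y0" "x0 \<le> p + w / 2 - 6 * r"
    | (B2) "rho x0 - 3 * r < del y0" "p + w / 2 + 6 * r \<le> x0"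
    | (B3) "rho x0 - 3 * r < del y0" "\<bar>x0 - (p + w / 2)\<bar> < 6 * r" by linarith
  then show ?thesis
  proof cases
    case A
    show ?thesis
    proof (rule exI[of _ 0], rule exI[of _ 0], intro conjI allI impI)
      fix x y assume "\<bar>x - (x0 + 0)\<bar> \<le> r \<and> \<bar>y - (y0 + 0)\<bar> \<le> r"
      then show "fib x y" using in_gap[of x] rl[of x] dl[of y] A r by (auto simp: fib_def)
    qed (use r in auto)
  next
    case B1
    show ?thesis
    proof (rule exI[of _ "5 * r"], rule exI[of _ 0], intro conjI allI impI)
      fix x y t :: real assume h: "\<bar>x - x0\<bar> \<le> r \<and> \<bar>y - y0\<bar> \<le> r \<and> fib x y \<and> 0 \<le> t \<and> t \<le> 1"
      have e: "t * (5 * r) = 5 * (t * r)" "0 \<le> t * r" "t * r \<le> r" using tt[of t] h by auto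
      have n: "\<bar>x - x0\<bar> \<le> 10 * r" "\<bar>x + 5 * (t * r) - x0\<bar> \<le> 10 * r" using h e r by linarith+
      note g = in_gap[OF n(1)] in_gap[OF n(2)]
      have "rho x \<le> rho (x + 5 * (t * r))"
        using up[of x] up[of "x + 5 * (t * r)"] g h e(2,3) B1 by linarith
      then show "fib (x + t * (5 * r)) (y + t * 0)"
        using h g(2) unfolding e(1) by (simp add: fib_def)
    next
      fix x y assume h: "\<bar>x - (x0 + 5 * r)\<bar> \<le> r \<and> \<bar>y - (y0 + 0)\<bar> \<le> r"
      have n: "\<bar>x - x0\<bar> \<le> 10 * r" "\<bar>x0 - x0\<bar> \<le> 10 * r" using h r by linarith+
      note g = in_gap[OF n(1)] in_gap[OF n(2)]
      have "rho x0 + 4 * r \<le> rho x"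
        using up[of x] up[of x0] g h B1 r by linarith
      then show "fib x y" using g dl[of y] d0 h r by (simp add: fib_def)
    qed (use r in auto)
  next
    case B2
    show ?thesis
    proof (rule exI[of _ "- 5 * r"], rule exI[of _ 0], intro conjI allI impI)
      fix x y t :: real assume h: "\<bar>x - x0\<bar> \<le> r \<and> \<bar>y - y0\<bar> \<le> r \<and> fib x y \<and> 0 \<le> t \<and> t \<le> 1"
      have e: "t * (- 5 * r) = - 5 * (t * r)" "0 \<le> t * r" "t * r \<le> r" using tt[of t] h by auto
      have n: "\<bar>x - x0\<bar> \<le> 10 * r" "\<bar>x + - 5 * (t * r) - x0\<bar> \<le> 10 * r" using h e r by linarith+
      note g = in_gap[OF n(1)] in_gap[OF n(2)]
      have "rho x \<le> rho (x + - 5 * (t * r))"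
        using dn[of x] dn[of "x + - 5 * (t * r)"] g h e(2,3) B2 by linarith
      then show "fib (x + t * (- 5 * r)) (y + t * 0)"
        using h g(2) unfolding e(1) by (simp add: fib_def)
    next
      fix x y assume h: "\<bar>x - (x0 + - 5 * r)\<bar> \<le> r \<and> \<bar>y - (y0 + 0)\<bar> \<le> r"
      have n: "\<bar>x - x0\<bar> \<le> 10 * r" "\<bar>x0 - x0\<bar> \<le> 10 * r" using h r by linarith+
      note g = in_gap[OF n(1)] in_gap[OF n(2)]
      have "rho x0 + 4 * r \<le> rho x"
        using dn[of x] dn[of x0] g h B2 r by linarith
      then show "fib x y" using g dl[of y] d0 h r by (simp add: fib_def)
    qed (use r in auto)
  next
    case B3
    have rw: "rho x0 \<le> w / 2" "w / 2 - 6 * r < rho x0" using rho0 B3 by (auto simp: min_def split: if_splits)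
    \<comment> \<open>Here \<open>del y0\<close> is within \<open>9 * r\<close> of half the gap
      length of \<open>K\<close>, which locates \<open>y0\<close> far from \<open>C\<close> at the
      scale \<open>r\<close>.\<close>
    then have dw: "w / 2 - 9 * r < del y0" "del y0 \<le> w / 2" "100 * r \<le> w / 2" using B3 d0 rr by auto
    \<comment> \<open>it suffices to move towards \<open>C\<close>\<close>
    have down: ?thesis if v: "\<bar>v\<bar> \<le> 5 * r"
        and mono: "\<And>y t. \<bar>y - y0\<bar> \<le> r \<Longrightarrow> 0 \<le> t \<Longrightarrow> t \<le> 1 \<Longrightarrow> del (y + t * v) \<le> del y"
        and box: "del (y0 + v) \<le> del y0 - 5 * r" for v
    proof (rule exI[of _ 0], rule exI[of _ v], intro conjI allI impI)
      fix x y t :: real assume h: "\<bar>x - x0\<bar> \<le> r \<and> \<bar>y - y0\<bar> \<le> r \<and> fib x y \<and> 0 \<le> t \<and> t \<le> 1"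
      then show "fib (x + t * 0) (y + t * v)" using mono[of y t] by (auto simp: fib_def)
    next
      fix x y assume h: "\<bar>x - (x0 + 0)\<bar> \<le> r \<and> \<bar>y - (y0 + v)\<bar> \<le> r"
      have "del y \<le> del (y0 + v) + r" using del_lip[of y "y0 + v"] h by linarith
      then show "fib x y" using box h in_gap[of x] rl[of x] d0 r by (auto simp: fib_def)
    qed (use r v in auto)
    have "0 < del y0" using dw r by linarith
    then show ?thesis
    proof (cases rule: del_cases)
      case below
      have "y0 < - 91 * r" using del_outside(1)[of y0] below dw r by linarith
      then show ?thesis
      proof (intro down[of "5 * r"])
        fix y t :: real assume h: "\<bar>y - y0\<bar> \<le> r" "0 \<le> t" "t \<le> 1"
        have e: "t * (5 * r) = 5 * (t * r)" "0 \<le> t * r" "t * r \<le> r" using tt[of t] h by auto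
        show "del (y + t * (5 * r)) \<le> del y"
          unfolding e(1) using del_outside(1)[of y] del_outside(1)[of "y + 5 * (t * r)"] h e(2,3) \<open>y0 < - 91 * r\<close> r by linarith
      next
        show "del (y0 + 5 * r) \<le> del y0 - 5 * r"
          using del_outside(1)[of y0] del_outside(1)[of "y0 + 5 * r"] \<open>y0 < - 91 * r\<close> r by linarith
      qed (use r in auto)
    next
      case above
      have "bet + 91 * r < y0" using del_outside(2)[of y0] above dw r by linarith
      then show ?thesis
      proof (intro down[of "- 5 * r"])
        fix y t :: real assume h: "\<bar>y - y0\<bar> \<le> r" "0 \<le> t" "t \<le> 1"
        have e: "t * (- 5 * r) = - 5 * (t * r)" "0 \<le> t * r" "t * r \<le> r" using tt[of t] h by auto
        show "del (y + t * (- 5 * r)) \<le> del y"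
          unfolding e(1) using del_outside(2)[of y] del_outside(2)[of "y + - 5 * (t * r)"] h e(2,3) \<open>bet + 91 * r < y0\<close> r by linarith
      next
        show "del (y0 + - 5 * r) \<le> del y0 - 5 * r"
          using del_outside(2)[of y0] del_outside(2)[of "y0 + - 5 * r"] \<open>bet + 91 * r < y0\<close> r by linarith
      qed (use r in auto)
    next
      case (gap q k)
      define g where "g = sqrt a * w0 * a ^ k"
      have del: "\<And>y. q \<le> y \<Longrightarrow> y \<le> q + g \<Longrightarrow> del y = min (y - q) (q + g - y)"
        using gap by (auto simp: gapC_def g_def)
      have del0: "del y0 = min (y0 - q) (q + g - y0)" using del[of y0] gap by (simp add: g_def)
      have in_gapC: "q \<le> y \<and> y \<le> q + g" if "\<bar>y - y0\<bar> \<le> 10 * r" for y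
        using that del0 dw r by (auto simp: min_def split: if_splits)
      have upC: "del y = y - q" if "q \<le> y" "y \<le> q + g / 2" for y using del[of y] that by (simp add: min_def)
      have dnC: "del y = q + g - y" if "q + g / 2 \<le> y" "y \<le> q + g" for y using del[of y] that by (simp add: min_def)
      consider "y0 \<le> q + g / 2 - 6 * r" | "q + g / 2 + 6 * r \<le> y0" | "\<bar>y0 - (q + g / 2)\<bar> < 6 * r" by linarith
      then show ?thesis
      proof cases
        case 1
        show ?thesis
        proof (intro down[of "- 5 * r"])
          fix y t :: real assume h: "\<bar>y - y0\<bar> \<le> r" "0 \<le> t" "t \<le> 1"
          have e: "t * (- 5 * r) = - 5 * (t * r)" "0 \<le> t * r" "t * r \<le> r" using tt[of t] h by auto
          have n: "\<bar>y - y0\<bar> \<le> 10 * r" "\<bar>y + - 5 * (t * r) - y0\<bar> \<le> 10 * r" using h e r by linarith+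
          note g = in_gapC[OF n(1)] in_gapC[OF n(2)]
          show "del (y + t * (- 5 * r)) \<le> del y"
            unfolding e(1) using upC[of y] upC[of "y + - 5 * (t * r)"] g h e(2,3) 1 by linarith
        next
          have n: "\<bar>y0 + - 5 * r - y0\<bar> \<le> 10 * r" "\<bar>y0 - y0\<bar> \<le> 10 * r" using r by linarith+
          show "del (y0 + - 5 * r) \<le> del y0 - 5 * r"
            using upC[of "y0 + - 5 * r"] upC[of y0] in_gapC[OF n(1)] in_gapC[OF n(2)] 1 r by linarith
        qed (use r in auto)
      next
        case 2
        show ?thesis
        proof (intro down[of "5 * r"])
          fix y t :: real assume h: "\<bar>y - y0\<bar> \<le> r" "0 \<le> t" "t \<le> 1"
          have e: "t * (5 * r) = 5 * (t * r)" "0 \<le> t * r" "t * r \<le> r" using tt[of t] h by auto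
          have n: "\<bar>y - y0\<bar> \<le> 10 * r" "\<bar>y + 5 * (t * r) - y0\<bar> \<le> 10 * r" using h e r by linarith+
          note g = in_gapC[OF n(1)] in_gapC[OF n(2)]
          show "del (y + t * (5 * r)) \<le> del y"
            unfolding e(1) using dnC[of y] dnC[of "y + 5 * (t * r)"] g h e(2,3) 2 by linarith
        next
          have n: "\<bar>y0 + 5 * r - y0\<bar> \<le> 10 * r" "\<bar>y0 - y0\<bar> \<le> 10 * r" using r by linarith+
          show "del (y0 + 5 * r) \<le> del y0 - 5 * r"
            using dnC[of "y0 + 5 * r"] dnC[of y0] in_gapC[OF n(1)] in_gapC[OF n(2)] 2 r by linarith
        qed (use r in auto)
      next
        case 3
        \<comment> \<open>If both coordinates were close to the middles of their gaps, the two gap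
          lengths would differ by less than \<open>20 * r\<close>, while they differ by at least
          \<open>\<theta> * w \<ge> 200 * r\<close>.\<close>
        have "del y0 \<le> g / 2" "g / 2 - 6 * r < del y0" using del0 3 by (auto simp: min_def split: if_splits)
        then have "\<bar>g - w\<bar> < 20 * r" using dw r by (auto simp: abs_less_iff)
        moreover have "\<theta> * w \<le> \<bar>g - w\<bar>" unfolding w_def g_def by (rule gaps_not_comparable)
        moreover have "\<theta> * (2 * rho x0) \<le> \<theta> * w" using rw \<theta> by (intro mult_left_mono) auto
        ultimately show ?thesis using r by linarith
      qed
    qed
  qed
qed

lemma small_scale_geometry:
  assumes z: "fib x0 y0" and r: "0 < r" "100 * r \<le> \<theta> * rho x0"
  obtains v1 v2 where "\<bar>v1\<bar> \<le> 5 * r" "\<bar>v2\<bar> \<le> 5 * r" "v1 = 0 \<or> v2 = 0"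
    "\<And>x y t. \<bar>x - x0\<bar> \<le> r \<Longrightarrow> \<bar>y - y0\<bar> \<le> r \<Longrightarrow> fib x y \<Longrightarrow> 0 \<le> t \<Longrightarrow> t \<le> 1 \<Longrightarrow> fib (x + t * v1) (y + t * v2)"
    "\<And>x y. \<bar>x - (x0 + v1)\<bar> \<le> r \<Longrightarrow> \<bar>y - (y0 + v2)\<bar> \<le> r \<Longrightarrow> fib x y"
proof -
  from small_scale_shift[OF assms] show thesis
    by (elim exE conjE, intro that) (assumption | blast)+
qed

end

section \<open>Coordinates in the plane\<close>

definition pt :: "real \<Rightarrow> real \<Rightarrow> real^2" where "pt x y = vector [x, y]"

lemma pt_nth [simp]: "pt x y $ 1 = x" "pt x y $ 2 = y"
  by (simp_all add: pt_def)

lemma pt_eta [simp]: "pt (z $ 1) (z $ 2) = z"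
  by (simp add: vec_eq_iff forall_2)

lemma dist_pt_le: "dist (pt x y) (pt x' y') \<le> \<bar>x - x'\<bar> + \<bar>y - y'\<bar>"
  using norm_le_l1_cart[of "pt x y - pt x' y'"] by (simp add: dist_norm sum_2)

lemma nth_diff_le_dist: "\<bar>z $ i - z' $ i\<bar> \<le> dist z (z' :: real^2)"
  using dist_vec_nth_le[of z i z'] by (simp add: dist_real_def)

context construction
begin

text \<open>The widest gap of \<open>C\<close> has length \<open>sqrt a * w0\<close>, shorter by the
  factor \<open>sqrt a\<close> than the widest gap of \<open>K\<close>.\<close>

lemma del_le_half_gap: "0 \<le> y \<Longrightarrow> y \<le> bet \<Longrightarrow> del y \<le> sqrt a * w0 / 2"
proof (cases "0 < del y")
  case True
  assume y: "0 \<le> y" "y \<le> bet"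
  from True show ?thesis
  proof (cases rule: del_cases)
    case (gap p n)
    then have "del y = min (y - p) (p + sqrt a * w0 * a ^ n - y)" by (auto simp: gapC_def)
    also have "\<dots> \<le> sqrt a * w0 * a ^ n / 2"
    proof -
      have "min (y - p) (p + g - y) \<le> g / 2" for g :: real by (auto simp: min_def)
      then show ?thesis .
    qed
    also have "\<dots> \<le> sqrt a * w0 * 1 / 2"
      using a w0 by (intro divide_right_mono mult_left_mono power_le_one) auto
    finally show ?thesis by simp
  qed (use y in auto)
next
  case False
  then show ?thesis using w0 a by (simp add: not_less order_trans[OF _ mult_nonneg_nonneg])
qed

text \<open>At distance of order \<open>r\<close> from \<open>x0\<close> there is a gap of
  \<open>K\<close> of length comparable with \<open>r\<close>, and its central strip consists of
  full columns. If the gap is so long that \<open>A1 * r \<le> w / 2\<close>, the bands of height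
  \<open>rho x\<close> around \<open>c1\<close> and \<open>c2\<close> overlap. If no gap is long
  enough, the widest one is taken; over its central strip \<open>rho\<close> exceeds half of the
  widest gap of \<open>C\<close>, so the column has no holes between \<open>0\<close> and
  \<open>bet\<close>.\<close>

lemma large_scale_geometry:
  assumes A1: "0 < A1" and R: "0 < R"
  obtains A where "1 \<le> A" and "\<And>x0 r. 0 \<le> x0 \<Longrightarrow> x0 \<le> 1 \<Longrightarrow> 0 < r \<Longrightarrow> r \<le> R \<Longrightarrow> \<theta> * rho x0 \<le> 100 * r \<Longrightarrow>
    \<exists>\<xi>. 0 \<le> \<xi> \<and> \<xi> + r / A \<le> 1 \<and> (\<forall>x. \<xi> \<le> x \<and> x \<le> \<xi> + r / A \<longrightarrow> \<bar>x - x0\<bar> \<le> A * r \<and> r / A \<le> rho x \<and>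
      (\<forall>c1\<in>C. \<forall>c2\<in>C. \<forall>y. c1 \<le> c2 \<and> c2 - c1 \<le> A1 * r \<and> c1 - rho x \<le> y \<and> y \<le> c2 + rho x \<longrightarrow> fib x y))"
proof -
  \<comment> \<open>Relative half-width of the central strip. The bound \<open>1/4\<close> keeps
    \<open>rho\<close> above a quarter of the gap length, and \<open>\<theta> / 2\<close> keeps it
    above half of the widest gap of \<open>C\<close> when \<open>n = 0\<close>.\<close>
  define \<theta>0 where "\<theta>0 = min (1/4) (\<theta> / 2)"
  have \<theta>0: "0 < \<theta>0" "\<theta>0 \<le> 1/4" "\<theta>0 \<le> \<theta> / 2" using \<theta> by (auto simp: \<theta>0_def)
  have sa: "0 < sqrt a" "sqrt a < 1" using a by auto
  \<comment> \<open>Each constant is one requirement on \<open>A\<close>: \<open>B1\<close> to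
    \<open>B4\<close> serve the case of a gap adapted to \<open>r\<close>, \<open>B5\<close> to
    \<open>B7\<close> the case of the widest gap.\<close>
  define B1 B2 B3 B4 B5 B6 B7 where "B1 = 1 / (4 * \<theta>0 * A1)" and "B2 = 4 * A1 / (lam * w0)" and "B3 = 100 / \<theta>"
    and "B4 = 2 / A1" and "B5 = 2 * A1 / w0" and "B6 = R / (2 * \<theta>0 * w0)" and "B7 = 4 * R / w0"
  note B_defs = B1_def B2_def B3_def B4_def B5_def B6_def B7_def
  have B: "0 < B1" "0 < B2" "0 < B3" "0 < B4" "0 < B5" "0 < B6" "0 < B7"
    using \<theta>0 A1 R lam w0 \<theta> by (auto simp: B_defs)
  define A where "A = 1 + B1 + B2 + B3 + B4 + B5 + B6 + B7"
  have A: "1 \<le> A" "B1 \<le> A" "B2 + B3 \<le> A" "B4 \<le> A" "B5 \<le> A" "B6 \<le> A" "B7 \<le> A"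
    using B by (auto simp: A_def)
  have rA: "r / A \<le> M" if "0 < b" "b \<le> A" "r \<le> b * M" "0 < r" for r b M
  proof -
    have "0 < M" using that by (smt (verit) mult_nonneg_nonpos)
    then have "r \<le> A * M" using that mult_right_mono[of b A M] by linarith
    then show ?thesis using A(1) by (simp add: divide_le_eq mult.commute)
  qed
  show ?thesis
  proof (rule that[OF A(1)])
    fix x0 r assume x0: "0 \<le> x0" "x0 \<le> 1" and r: "0 < r" "r \<le> R" and rho0: "\<theta> * rho x0 \<le> 100 * r"
    have rho0': "rho x0 \<le> B3 * r" using rho0 \<theta> by (simp add: B3_def field_simps)
    have "\<exists>p n. gapK p n \<and> \<theta>0 * (w0 * lam ^ n) * 2 \<ge> r / A \<and> r / A \<le> w0 * lam ^ n / 4 \<and>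
      (\<forall>x. \<bar>x - (p + w0 * lam ^ n / 2)\<bar> \<le> \<theta>0 * (w0 * lam ^ n) \<longrightarrow> \<bar>x - x0\<bar> \<le> A * r) \<and>
      (A1 * r \<le> w0 * lam ^ n / 2 \<or> n = 0)"
    proof (cases "A1 * r \<le> w0 / 2")
      case True
      have "0 < A1 * r" using A1 r by simp
      then obtain n where n: "w0 / 2 * lam ^ Suc n < A1 * r" "A1 * r \<le> w0 / 2 * lam ^ n"
        using cK.scale_between True by blast
      obtain k where k: "k \<in> K" "\<bar>x0 - k\<bar> = rho x0" unfolding rho_def by (rule RK.nearest)
      obtain p where p: "gapK p n" "\<bar>p + w0 * lam ^ n / 2 - k\<bar> \<le> lam ^ n" by (rule gapK_near[OF k(1)])
      have ln: "0 < lam ^ n" using lam by simp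
      have ln2: "2 * lam ^ n \<le> B2 * r" using n(1) lam w0 by (simp add: B2_def field_simps)
      have "w0 * lam ^ n \<le> lam ^ n" using w0 ln by simp
      then have w: "\<theta>0 * (w0 * lam ^ n) \<le> lam ^ n"
      proof -
        have "\<theta>0 * (w0 * lam ^ n) \<le> 1 * (w0 * lam ^ n)" using \<theta>0 w0 ln by (intro mult_right_mono) auto
        then show ?thesis using \<open>w0 * lam ^ n \<le> lam ^ n\<close> by linarith
      qed
      show ?thesis
      proof (intro exI[of _ p] exI[of _ n] conjI allI impI)
        have "r = B1 * (4 * \<theta>0 * (A1 * r))" using \<theta>0 A1 by (simp add: B1_def)
        also have "\<dots> \<le> B1 * (4 * \<theta>0 * (w0 / 2 * lam ^ n))"
          using n(2) B(1) \<theta>0 by (intro mult_left_mono) auto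
        also have "\<dots> = B1 * (\<theta>0 * (w0 * lam ^ n) * 2)" by simp
        finally show "r / A \<le> \<theta>0 * (w0 * lam ^ n) * 2" using B(1) A(2) r by (intro rA[of B1]) auto
        have "r = B4 * (A1 * r / 2)" using A1 by (simp add: B4_def)
        also have "\<dots> \<le> B4 * (w0 * lam ^ n / 4)" using n(2) B(4) by (intro mult_left_mono) auto
        finally show "r / A \<le> w0 * lam ^ n / 4" using B(4) A(4) r by (intro rA[of B4]) auto
        fix x assume x: "\<bar>x - (p + w0 * lam ^ n / 2)\<bar> \<le> \<theta>0 * (w0 * lam ^ n)"
        have "\<bar>x - x0\<bar> \<le> B2 * r + B3 * r" using x w p(2) k(2) rho0' ln2 by linarith
        also have "\<dots> \<le> A * r" using A(3) r by (simp add: distrib_right[symmetric])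
        finally show "\<bar>x - x0\<bar> \<le> A * r" .
      qed (use p n in auto)
    next
      case False
      show ?thesis
      proof (intro exI[of _ "0 + lam ^ Suc 0"] exI[of _ "0::nat"] conjI allI impI)
        show "gapK (0 + lam ^ Suc 0) 0" by (rule gapK_ends) simp
        have "r \<le> B6 * (\<theta>0 * (w0 * lam ^ 0) * 2)" using r \<theta>0 w0 by (simp add: B6_def)
        then show "r / A \<le> \<theta>0 * (w0 * lam ^ 0) * 2" using B(6) A(6) r by (intro rA[of B6]) auto
        have "r \<le> B7 * (w0 * lam ^ 0 / 4)" using r w0 by (simp add: B7_def)
        then show "r / A \<le> w0 * lam ^ 0 / 4" using B(7) A(7) r by (intro rA[of B7]) auto
        fix x assume x: "\<bar>x - (0 + lam ^ Suc 0 + w0 * lam ^ 0 / 2)\<bar> \<le> \<theta>0 * (w0 * lam ^ 0)"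
        have "\<theta>0 * w0 \<le> w0 / 4" using \<theta>0 w0 mult_right_mono[of \<theta>0 "1/4" w0] by simp
        moreover have "lam + w0 / 2 = 1/2" by (simp add: w0_def field_simps)
        moreover have "\<bar>x - (lam + w0 / 2)\<bar> \<le> \<theta>0 * w0" using x by simp
        ultimately have "0 \<le> x" "x \<le> 1" using w0 by linarith+
        then have "\<bar>x - x0\<bar> \<le> 1" using x0 by auto
        also have "1 \<le> B5 * r" using False w0 by (simp add: B5_def field_simps)
        also have "\<dots> \<le> A * r" using A(5) r by simp
        finally show "\<bar>x - x0\<bar> \<le> A * r" .
      qed simp
    qed
    then obtain p n where gap: "gapK p n" and len: "r / A \<le> \<theta>0 * (w0 * lam ^ n) * 2" "r / A \<le> w0 * lam ^ n / 4"
      and near: "\<And>x. \<bar>x - (p + w0 * lam ^ n / 2)\<bar> \<le> \<theta>0 * (w0 * lam ^ n) \<Longrightarrow> \<bar>x - x0\<bar> \<le> A * r"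
      and alt: "A1 * r \<le> w0 * lam ^ n / 2 \<or> n = 0" by blast
    define w where "w = w0 * lam ^ n"
    have w: "0 < w" using w0 lam by (simp add: w_def)
    have tw: "\<theta>0 * w \<le> w / 4" "\<theta>0 * w \<le> \<theta> / 2 * w" "0 < \<theta>0 * w"
      using \<theta>0 w mult_right_mono[of \<theta>0 "1/4" w] mult_right_mono[of \<theta>0 "\<theta> / 2" w] by auto
    have p: "0 \<le> p" "p + w \<le> 1" and rho: "\<And>x. p \<le> x \<Longrightarrow> x \<le> p + w \<Longrightarrow> rho x = min (x - p) (p + w - x)"
      using gap by (auto simp: gapK_def w_def)
    note len = len[folded w_def] and near = near[folded w_def] and alt = alt[folded w_def]
    show "\<exists>\<xi>. 0 \<le> \<xi> \<and> \<xi> + r / A \<le> 1 \<and> (\<forall>x. \<xi> \<le> x \<and> x \<le> \<xi> + r / A \<longrightarrow> \<bar>x - x0\<bar> \<le> A * r \<and> r / A \<le> rho x \<and>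
      (\<forall>c1\<in>C. \<forall>c2\<in>C. \<forall>y. c1 \<le> c2 \<and> c2 - c1 \<le> A1 * r \<and> c1 - rho x \<le> y \<and> y \<le> c2 + rho x \<longrightarrow> fib x y))"
    proof (intro exI[of _ "p + w / 2 - \<theta>0 * w"] conjI allI impI)
      show "0 \<le> p + w / 2 - \<theta>0 * w" "p + w / 2 - \<theta>0 * w + r / A \<le> 1" using p tw len w by linarith+
      fix x assume x: "p + w / 2 - \<theta>0 * w \<le> x \<and> x \<le> p + w / 2 - \<theta>0 * w + r / A"
      then have x': "\<bar>x - (p + w / 2)\<bar> \<le> \<theta>0 * w" using len by linarith
      then show "\<bar>x - x0\<bar> \<le> A * r" by (rule near)
      have xp: "p \<le> x" "x \<le> p + w" using x' tw w by linarith+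
      have rx: "w / 2 - \<theta>0 * w \<le> rho x" using rho[OF xp] x' by (simp add: min_def) linarith
      show "r / A \<le> rho x" using rx tw len by linarith
      show "\<forall>c1\<in>C. \<forall>c2\<in>C. \<forall>y. c1 \<le> c2 \<and> c2 - c1 \<le> A1 * r \<and> c1 - rho x \<le> y \<and> y \<le> c2 + rho x \<longrightarrow> fib x y"
      proof (intro ballI allI impI)
        fix c1 c2 y assume c: "c1 \<in> C" "c2 \<in> C" and y: "c1 \<le> c2 \<and> c2 - c1 \<le> A1 * r \<and> c1 - rho x \<le> y \<and> y \<le> c2 + rho x"
        have d: "del y \<le> \<bar>y - c1\<bar>" "del y \<le> \<bar>y - c2\<bar>" using c by (auto intro: del_le)
        have "del y \<le> rho x"
        proof (cases "y \<le> c1 + rho x \<or> c2 - rho x \<le> y")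
          case True
          then show ?thesis using d y by linarith
        next
          case False
          \<comment> \<open>Between the two bands one has
            \<open>c2 - c1 > 2 * rho x \<ge> w / 2\<close>, which leaves only the widest
            gap.\<close>
          then have "\<not> A1 * r \<le> w / 2" using y rx tw by linarith
          then have "n = 0" using alt by simp
          then have "w = w0" by (simp add: w_def)
          have "c1 \<in> {0..bet}" "c2 \<in> {0..bet}" using c C_subset by auto
          then have "0 \<le> y" "y \<le> bet" using False rho_nonneg[of x] unfolding atLeastAtMost_iff by linarith+
          then have "del y \<le> sqrt a * w0 / 2" by (rule del_le_half_gap)
          also have "\<dots> = w / 2 - \<theta> / 2 * w" by (simp add: \<open>w = w0\<close> \<theta>_def field_simps)
          also have "\<dots> \<le> rho x" using rx tw by linarith
          finally show ?thesis .
        qed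
        then show "fib x y" using xp p by (auto simp: fib_def)
      qed
    qed
  qed
qed

lemma rho_le_1: "0 \<le> x \<Longrightarrow> x \<le> 1 \<Longrightarrow> rho x \<le> 1"
  using RK.infdist_le[OF zero_in_K, of x] by (simp add: rho_def)

lemma continuous_rho: "continuous_on UNIV rho" and continuous_del: "continuous_on UNIV del"
  unfolding rho_def[abs_def] del_def[abs_def] by (intro continuous_intros)+

lemma borel_rho [measurable]: "rho \<in> borel_measurable borel" and borel_del [measurable]: "del \<in> borel_measurable borel"
  by (intro borel_measurable_continuous_onI continuous_rho continuous_del)+

section \<open>The compact set and its quasiconvexity\<close>

definition S :: "(real^2) set" where "S = {z. fib (z $ 1) (z $ 2)}"

lemma pt_in_S [simp]: "pt x y \<in> S \<longleftrightarrow> fib x y" by (simp add: S_def)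

lemma fib_bounds:
  assumes "fib x y"
  shows "0 \<le> x" "x \<le> 1" "- 1 \<le> y" "y \<le> bet + 1"
proof -
  show x: "0 \<le> x" "x \<le> 1" using assms by (auto simp: fib_def)
  have "del y \<le> 1" using assms rho_le_1[OF x] by (simp add: fib_def)
  then show "- 1 \<le> y" "y \<le> bet + 1" using del_outside(1)[of y] del_outside(2)[of y] bet by linarith+
qed

lemma compact_S: "compact S"
proof -
  have "closed S"
  proof -
    have S: "S = {z. 0 \<le> z $ 1} \<inter> {z. z $ 1 \<le> 1} \<inter> {z. del (z $ 2) \<le> rho (z $ 1)}"
      by (auto simp: S_def fib_def)
    show ?thesis unfolding S
      by (intro closed_Int closed_Collect_le continuous_intros
          continuous_on_compose2[OF continuous_rho] continuous_on_compose2[OF continuous_del]) auto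
  qed
  moreover have "bounded S"
  proof (rule boundedI)
    fix z assume "z \<in> S"
    then have b: "0 \<le> z $ 1" "z $ 1 \<le> 1" "- 1 \<le> z $ 2" "z $ 2 \<le> bet + 1" using fib_bounds by (auto simp: S_def)
    have "norm z \<le> \<bar>z $ 1\<bar> + \<bar>z $ 2\<bar>" using norm_le_l1_cart[of z] by (simp add: sum_2)
    then show "norm z \<le> bet + 2" using b bet by linarith
  qed
  ultimately show ?thesis by (simp add: compact_eq_bounded_closed)
qed

lemma borel_S [measurable]: "S \<in> sets borel" using compact_imp_closed[OF compact_S] by simp

text \<open>Dividing the offset from a nearest point of \<open>C\<close> by \<open>rho x\<close>
  puts the point on a graph that can be followed within the set to any other abscissa in the unit
  interval, see \<open>fib_graph\<close>.\<close>

lemma fib_coordinates: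
  assumes "fib x y"
  obtains c \<tau> where "c \<in> C" "\<bar>\<tau>\<bar> \<le> 1" "y = c + \<tau> * rho x" "\<bar>y - c\<bar> = del y"
proof -
  obtain c where c: "c \<in> C" "\<bar>y - c\<bar> = del y" by (rule del_nearest)
  have le: "\<bar>y - c\<bar> \<le> rho x" using assms c by (simp add: fib_def)
  show ?thesis
  proof (cases "rho x = 0")
    case True
    have "y = c" using le True by linarith
    then show ?thesis by (intro that[of c 0]) (use c in auto)
  next
    case False
    then have "0 < rho x" using rho_nonneg[of x] by linarith
    show ?thesis
      by (rule that[of c "(y - c) / rho x"]) (use c le \<open>0 < rho x\<close> in \<open>auto simp: abs_divide divide_le_eq_1\<close>)
  qed
qed

lemma fib_graph: "c \<in> C \<Longrightarrow> \<bar>\<tau>\<bar> \<le> 1 \<Longrightarrow> 0 \<le> x \<Longrightarrow> x \<le> 1 \<Longrightarrow> fib x (c + \<tau> * rho x)"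
proof -
  assume h: "c \<in> C" "\<bar>\<tau>\<bar> \<le> 1" "0 \<le> x" "x \<le> 1"
  have "del (c + \<tau> * rho x) \<le> \<bar>\<tau>\<bar> * rho x" using del_le[OF h(1), of "c + \<tau> * rho x"] by (simp add: abs_mult)
  also have "\<dots> \<le> rho x" using h(2) by (simp add: mult_left_le_one_le)
  finally show ?thesis using h by (simp add: fib_def)
qed

abbreviation NS where "NS \<equiv> submetric euclidean_metric S"

lemma graph_curve:
  assumes c: "c \<in> C" and t: "\<bar>\<tau>\<bar> \<le> 1" and x: "0 \<le> x1" "x1 \<le> x2" "x2 \<le> 1"
  shows "lip_curve NS 2 x1 x2 (\<lambda>x. pt x (c + \<tau> * rho x))"
  unfolding lip_curve_euclidean
proof (intro conjI ballI)
  fix s assume "s \<in> {x1..x2}"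
  then show "pt s (c + \<tau> * rho s) \<in> S" using x fib_graph[OF c t] by simp
  fix t' assume "t' \<in> {x1..x2}"
  have "dist (pt s (c + \<tau> * rho s)) (pt t' (c + \<tau> * rho t')) \<le> \<bar>s - t'\<bar> + \<bar>\<tau> * (rho s - rho t')\<bar>"
    using dist_pt_le[of s "c + \<tau> * rho s" t' "c + \<tau> * rho t'"] by (simp add: right_diff_distrib)
  also have "\<bar>\<tau> * (rho s - rho t')\<bar> \<le> 1 * \<bar>rho s - rho t'\<bar>" unfolding abs_mult using t by (intro mult_right_mono) auto
  also have "1 * \<bar>rho s - rho t'\<bar> \<le> \<bar>s - t'\<bar>" using rho_lip[of s t'] by simp
  finally show "dist (pt s (c + \<tau> * rho s)) (pt t' (c + \<tau> * rho t')) \<le> 2 * \<bar>s - t'\<bar>" by simp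
qed (use x in auto)

lemma segment_curve:
  assumes "\<And>t. p \<le> t \<Longrightarrow> t \<le> q \<Longrightarrow> fib (x + t * v1) (y + t * v2)" "p \<le> q"
  shows "lip_curve NS (\<bar>v1\<bar> + \<bar>v2\<bar>) p q (\<lambda>t. pt (x + t * v1) (y + t * v2))"
  unfolding lip_curve_euclidean
proof (intro conjI ballI)
  fix s assume "s \<in> {p..q}"
  then show "pt (x + s * v1) (y + s * v2) \<in> S" using assms by simp
  fix t
  show "dist (pt (x + s * v1) (y + s * v2)) (pt (x + t * v1) (y + t * v2)) \<le> (\<bar>v1\<bar> + \<bar>v2\<bar>) * \<bar>s - t\<bar>"
    using dist_pt_le[of "x + s * v1" "y + s * v2" "x + t * v1" "y + t * v2"]
    by (simp add: left_diff_distrib[symmetric] abs_mult) (simp add: algebra_simps)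
qed (use assms in auto)

lemma vertical_curve:
  assumes "\<And>y. p \<le> y \<Longrightarrow> y \<le> q \<Longrightarrow> fib x y" "p \<le> q"
  shows "lip_curve NS 1 p q (\<lambda>y. pt x y)"
  using segment_curve[of p q x 0 0 1] assms by simp

lemma horizontal_curve:
  assumes "\<And>x. p \<le> x \<Longrightarrow> x \<le> q \<Longrightarrow> fib x y" "p \<le> q"
  shows "lip_curve NS 1 p q (\<lambda>x. pt x y)"
  using segment_curve[of p q 0 1 y 0] assms by simp

definition joinable :: "real \<Rightarrow> real^2 \<Rightarrow> real^2 \<Rightarrow> bool" where
  "joinable D z z' \<longleftrightarrow> (\<exists>c. lip_curve NS D 0 1 c \<and> c 0 = z \<and> c 1 = z')"

lemma joinable_trans: "joinable D z z' \<Longrightarrow> joinable D' z' z'' \<Longrightarrow> joinable (D + D') z z''"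
  unfolding joinable_def using lip_curve_join by metis

lemma joinable_sym: "joinable D z z' \<Longrightarrow> joinable D z' z"
  unfolding joinable_def using lip_curve_reverse[of NS D 1] by fastforce

lemma joinable_mono: "joinable D z z' \<Longrightarrow> D \<le> D' \<Longrightarrow> joinable D' z z'"
proof -
  assume "joinable D z z'" and le: "D \<le> D'"
  then obtain c where c: "lip_curve NS D 0 1 c" "c 0 = z" "c 1 = z'" by (auto simp: joinable_def)
  have "lip_curve NS D' 0 1 c"
    using c(1) le mult_right_mono[OF le] unfolding lip_curve_def by (meson abs_ge_zero order_trans)
  then show ?thesis using c by (auto simp: joinable_def)
qed

lemma joinableI:
  assumes "lip_curve NS L p q c" "L * (q - p) \<le> D"
  shows "joinable D (c p) (c q)"
proof -
  have "p \<le> q" using assms by (simp add: lip_curve_def)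
  have "lip_curve NS L (p + - p) (q + - p) (\<lambda>t. c (t - - p))" by (rule lip_curve_shift[OF assms(1)])
  then have "lip_curve NS L 0 (q - p) (\<lambda>t. c (t + p))" by simp
  then have "lip_curve NS (L * (q - p)) 0 1 (\<lambda>t. c (t * (q - p) + p))"
    using lip_curve_rescale[of NS L "q - p" "\<lambda>t. c (t + p)"] \<open>p \<le> q\<close> by simp
  then have "joinable (L * (q - p)) (c p) (c q)"
    unfolding joinable_def by (intro exI[of _ "\<lambda>t. c (t * (q - p) + p)"]) simp
  then show ?thesis using assms(2) by (rule joinable_mono)
qed

lemma joinable_graph:
  assumes c: "c \<in> C" and t: "\<bar>\<tau>\<bar> \<le> 1" and x: "0 \<le> x1" "x1 \<le> 1" "0 \<le> x2" "x2 \<le> 1" and D: "2 * \<bar>x1 - x2\<bar> \<le> D"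
  shows "joinable D (pt x1 (c + \<tau> * rho x1)) (pt x2 (c + \<tau> * rho x2))"
proof (cases "x1 \<le> x2")
  case True
  show ?thesis by (rule joinableI[OF graph_curve[OF c t]]) (use True x D in auto)
next
  case False
  show ?thesis by (rule joinable_sym, rule joinableI[OF graph_curve[OF c t]]) (use False x D in auto)
qed

lemma joinable_vertical:
  assumes "\<And>y. min y1 y2 \<le> y \<Longrightarrow> y \<le> max y1 y2 \<Longrightarrow> fib x y" and D: "\<bar>y1 - y2\<bar> \<le> D"
  shows "joinable D (pt x y1) (pt x y2)"
proof (cases "y1 \<le> y2")
  case True
  show ?thesis by (rule joinableI[OF vertical_curve]) (use True assms in auto)
next
  case False
  show ?thesis by (rule joinable_sym, rule joinableI[OF vertical_curve]) (use False assms in auto)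
qed

lemma joinable_horizontal:
  assumes "\<And>x. min x1 x2 \<le> x \<Longrightarrow> x \<le> max x1 x2 \<Longrightarrow> fib x y" and D: "\<bar>x1 - x2\<bar> \<le> D"
  shows "joinable D (pt x1 y) (pt x2 y)"
proof (cases "x1 \<le> x2")
  case True
  show ?thesis by (rule joinableI[OF horizontal_curve]) (use True assms in auto)
next
  case False
  show ?thesis by (rule joinable_sym, rule joinableI[OF horizontal_curve]) (use False assms in auto)
qed

text \<open>At small scales both points are shifted into a common full square and joined along its
  sides. At large scales each point follows its own graph to a full column, where a vertical segment
  joins the two graphs.\<close>

lemma quasiconvex_S: "\<exists>L\<ge>1. \<forall>z\<in>S. \<forall>z'\<in>S. joinable (L * dist z z') z z'"
proof -
  define R where "R = bet + 10"
  have R: "0 < R" using bet by (simp add: R_def)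
  \<comment> \<open>The base points of the two graphs differ by at most
    \<open>r + rho x0 + rho x1\<close>, where \<open>rho x0 \<le> 100 / \<theta> * r\<close> and
    \<open>rho x1\<close> exceeds this bound by at most \<open>r\<close>.\<close>
  define A1 where "A1 = 2 + 200 / \<theta>"
  have A1: "0 < A1" using \<theta> by (simp add: A1_def add_pos_pos)
  obtain A where A: "1 \<le> A" and large: "\<And>x0 r. 0 \<le> x0 \<Longrightarrow> x0 \<le> 1 \<Longrightarrow> 0 < r \<Longrightarrow> r \<le> R \<Longrightarrow> \<theta> * rho x0 \<le> 100 * r \<Longrightarrow>
    \<exists>\<xi>. 0 \<le> \<xi> \<and> \<xi> + r / A \<le> 1 \<and> (\<forall>x. \<xi> \<le> x \<and> x \<le> \<xi> + r / A \<longrightarrow> \<bar>x - x0\<bar> \<le> A * r \<and> r / A \<le> rho x \<and>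
      (\<forall>c1\<in>C. \<forall>c2\<in>C. \<forall>y. c1 \<le> c2 \<and> c2 - c1 \<le> A1 * r \<and> c1 - rho x \<le> y \<and> y \<le> c2 + rho x \<longrightarrow> fib x y))"
    by (rule large_scale_geometry[OF A1 R]) blast
  \<comment> \<open>The term 22 covers the four legs of the small-scale route; the rest adds the two
    graphs and the vertical segment of the large-scale route.\<close>
  define L where "L = 22 + 2 * A + (A1 + 2 * (100 / \<theta> + A)) + 2 * (A + 1)"
  have t0: "0 < 100 / \<theta>" using \<theta> by simp
  have L: "1 \<le> L" using A A1 t0 by (simp add: L_def)
  show ?thesis
  proof (intro exI[of _ L] conjI L ballI)
    fix z z' assume z: "z \<in> S" "z' \<in> S"
    obtain x0 y0 x1 y1 where zz: "z = pt x0 y0" "z' = pt x1 y1" by (metis pt_eta)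
    have fib: "fib x0 y0" "fib x1 y1" using z zz by auto
    define r where "r = dist z z'"
    have d: "\<bar>x1 - x0\<bar> \<le> r" "\<bar>y1 - y0\<bar> \<le> r"
      using nth_diff_le_dist[of z 1 z'] nth_diff_le_dist[of z 2 z'] by (auto simp: r_def zz)
    have "joinable (L * r) z z'"
    proof (cases "r = 0")
      case True
      then have "z = z'" by (simp add: r_def)
      moreover have "joinable 0 z z" unfolding joinable_def
        using z by (intro exI[of _ "\<lambda>_. z"]) (simp add: lip_curve_euclidean)
      ultimately show ?thesis using True by simp
    next
      case False
      then have r: "0 < r" by (simp add: r_def)
      show ?thesis
      proof (cases "100 * r \<le> \<theta> * rho x0")
        case True
        obtain v1 v2 where
          v: "\<bar>v1\<bar> \<le> 5 * r" "\<bar>v2\<bar> \<le> 5 * r" and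
          move: "\<And>x y t. \<bar>x - x0\<bar> \<le> r \<Longrightarrow> \<bar>y - y0\<bar> \<le> r \<Longrightarrow> fib x y \<Longrightarrow> 0 \<le> t \<Longrightarrow> t \<le> 1 \<Longrightarrow> fib (x + t * v1) (y + t * v2)" and
          box: "\<And>x y. \<bar>x - (x0 + v1)\<bar> \<le> r \<Longrightarrow> \<bar>y - (y0 + v2)\<bar> \<le> r \<Longrightarrow> fib x y"
          by (rule small_scale_geometry[OF fib(1) r True]) blast
        have mv: "joinable (10 * r) (pt x y) (pt (x + v1) (y + v2))" if "\<bar>x - x0\<bar> \<le> r" "\<bar>y - y0\<bar> \<le> r" "fib x y" for x y
          using joinableI[OF segment_curve[of 0 1 x v1 y v2], of "10 * r"] move[OF that] v by simp
        have "joinable (10 * r) z (pt (x0 + v1) (y0 + v2))" unfolding zz by (rule mv) (use r fib in auto)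
        moreover have "joinable r (pt (x0 + v1) (y0 + v2)) (pt (x1 + v1) (y0 + v2))"
          by (rule joinable_horizontal) (use d r in \<open>auto intro!: box\<close>)
        moreover have "joinable r (pt (x1 + v1) (y0 + v2)) (pt (x1 + v1) (y1 + v2))"
          by (rule joinable_vertical) (use d r in \<open>auto intro!: box\<close>)
        moreover have "joinable (10 * r) (pt (x1 + v1) (y1 + v2)) z'"
          unfolding zz by (rule joinable_sym, rule mv) (use d fib in auto)
        ultimately have "joinable (10 * r + r + r + 10 * r) z z'" by (meson joinable_trans)
        moreover have "22 * r \<le> L * r" using r A A1 t0 by (intro mult_right_mono) (auto simp: L_def)
        ultimately show ?thesis by (elim joinable_mono) simp
      next
        case False
        have x: "0 \<le> x0" "x0 \<le> 1" "0 \<le> x1" "x1 \<le> 1" using fib fib_bounds by blast+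
        have "r \<le> \<bar>x0 - x1\<bar> + \<bar>y0 - y1\<bar>" unfolding r_def zz by (rule dist_pt_le)
        also have "\<dots> \<le> R" using fib_bounds(3,4)[OF fib(1)] fib_bounds(3,4)[OF fib(2)] x bet unfolding R_def by linarith
        finally have rR: "r \<le> R" .
        from large[OF x(1,2) r rR] False obtain \<xi> where \<xi>: "0 \<le> \<xi>" "\<xi> + r / A \<le> 1"
          and \<xi>': "\<And>x. \<xi> \<le> x \<Longrightarrow> x \<le> \<xi> + r / A \<Longrightarrow> \<bar>x - x0\<bar> \<le> A * r \<and>
            (\<forall>c1\<in>C. \<forall>c2\<in>C. \<forall>y. c1 \<le> c2 \<and> c2 - c1 \<le> A1 * r \<and> c1 - rho x \<le> y \<and> y \<le> c2 + rho x \<longrightarrow> fib x y)"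
          by (metis linorder_le_cases)
        have rA: "0 \<le> r / A" using r A by simp
        have \<xi>x: "\<bar>\<xi> - x0\<bar> \<le> A * r" and \<xi>fib: "\<And>c1 c2 y. c1 \<in> C \<Longrightarrow> c2 \<in> C \<Longrightarrow> c1 \<le> c2 \<Longrightarrow> c2 - c1 \<le> A1 * r \<Longrightarrow> c1 - rho \<xi> \<le> y \<Longrightarrow> y \<le> c2 + rho \<xi> \<Longrightarrow> fib \<xi> y"
          using \<xi>'[of \<xi>] rA by auto
        obtain c0 \<tau>0 where c0: "c0 \<in> C" "\<bar>\<tau>0\<bar> \<le> 1" "y0 = c0 + \<tau>0 * rho x0" "\<bar>y0 - c0\<bar> = del y0" by (rule fib_coordinates[OF fib(1)])
        obtain c1 \<tau>1 where c1: "c1 \<in> C" "\<bar>\<tau>1\<bar> \<le> 1" "y1 = c1 + \<tau>1 * rho x1" "\<bar>y1 - c1\<bar> = del y1" by (rule fib_coordinates[OF fib(2)])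
        have rho0: "rho x0 \<le> 100 / \<theta> * r" using False \<theta> by (simp add: field_simps)
        have rho1: "rho x1 \<le> 100 / \<theta> * r + r" using rho0 rho_lip[of x1 x0] d by linarith
        have del: "del y0 \<le> rho x0" "del y1 \<le> rho x1" using fib by (auto simp: fib_def)
        have cc: "\<bar>c0 - c1\<bar> \<le> A1 * r"
        proof -
          have "\<bar>c0 - c1\<bar> \<le> r + 100 / \<theta> * r + (100 / \<theta> * r + r)" using c0(4) c1(4) del rho0 rho1 d by linarith
          also have "\<dots> = A1 * r" by (simp add: A1_def algebra_simps)
          finally show ?thesis .
        qed
        have tr: "\<bar>\<tau>0 * rho \<xi>\<bar> \<le> rho \<xi>" "\<bar>\<tau>1 * rho \<xi>\<bar> \<le> rho \<xi>"
          using c0(2) c1(2) by (auto simp: abs_mult mult_left_le_one_le)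
        have rho\<xi>: "rho \<xi> \<le> (100 / \<theta> + A) * r" using rho0 rho_lip[of \<xi> x0] \<xi>x unfolding distrib_right by linarith
        have \<xi>1: "\<xi> \<le> 1" using \<xi> rA by linarith
        have J1: "joinable (2 * (A * r)) z (pt \<xi> (c0 + \<tau>0 * rho \<xi>))"
          unfolding zz c0(3) by (rule joinable_graph[OF c0(1,2)]) (use x \<xi> \<xi>1 \<xi>x in auto)
        have J2: "joinable (A1 * r + 2 * ((100 / \<theta> + A) * r)) (pt \<xi> (c0 + \<tau>0 * rho \<xi>)) (pt \<xi> (c1 + \<tau>1 * rho \<xi>))"
        proof (rule joinable_vertical)
          show "\<bar>c0 + \<tau>0 * rho \<xi> - (c1 + \<tau>1 * rho \<xi>)\<bar> \<le> A1 * r + 2 * ((100 / \<theta> + A) * r)"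
            using tr cc rho\<xi> by linarith
          fix y assume y: "min (c0 + \<tau>0 * rho \<xi>) (c1 + \<tau>1 * rho \<xi>) \<le> y" "y \<le> max (c0 + \<tau>0 * rho \<xi>) (c1 + \<tau>1 * rho \<xi>)"
          have "min c0 c1 - rho \<xi> \<le> y" "y \<le> max c0 c1 + rho \<xi>" using y tr by linarith+
          then show "fib \<xi> y" using \<xi>fib[of "min c0 c1" "max c0 c1" y] c0(1) c1(1) cc by (auto simp: min_def max_def split: if_splits)
        qed
        have J3: "joinable (2 * ((A + 1) * r)) (pt \<xi> (c1 + \<tau>1 * rho \<xi>)) z'"
          unfolding zz c1(3)
        proof (rule joinable_graph[OF c1(1,2)])
          have "\<bar>\<xi> - x1\<bar> \<le> A * r + r" using \<xi>x d(1) by linarith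
          then show "2 * \<bar>\<xi> - x1\<bar> \<le> 2 * ((A + 1) * r)" by (simp add: distrib_right)
        qed (use x \<xi> \<xi>1 in auto)
        have "joinable (2 * (A * r) + (A1 * r + 2 * ((100 / \<theta> + A) * r)) + 2 * ((A + 1) * r)) z z'"
          by (rule joinable_trans[OF joinable_trans[OF J1 J2] J3])
        then show ?thesis by (rule joinable_mono) (use r in \<open>simp add: L_def algebra_simps\<close>)
      qed
    qed
    then show "joinable (L * dist z z') z z'" by (simp add: r_def)
  qed
qed

text \<open>The same two scales: a full box after the shift, or a square just above a base point
  within the strip of full columns. This is the source of the lower volume bound.\<close>

lemma interior_square:
  assumes R: "0 < R"
  shows "\<exists>B\<ge>1. \<forall>x0 y0 r. fib x0 y0 \<and> 0 < r \<and> r \<le> R \<longrightarrow> (\<exists>x1 y1. \<forall>x y. x1 \<le> x \<and> x \<le> x1 + r / B \<and> y1 \<le> y \<and> y \<le> y1 + r / B \<longrightarrow>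
     fib x y \<and> \<bar>x - x0\<bar> \<le> B * r \<and> \<bar>y - y0\<bar> \<le> B * r)"
proof -
  obtain A where A: "1 \<le> A" and large: "\<And>x0 r. 0 \<le> x0 \<Longrightarrow> x0 \<le> 1 \<Longrightarrow> 0 < r \<Longrightarrow> r \<le> R \<Longrightarrow> \<theta> * rho x0 \<le> 100 * r \<Longrightarrow>
    \<exists>\<xi>. 0 \<le> \<xi> \<and> \<xi> + r / A \<le> 1 \<and> (\<forall>x. \<xi> \<le> x \<and> x \<le> \<xi> + r / A \<longrightarrow> \<bar>x - x0\<bar> \<le> A * r \<and> r / A \<le> rho x \<and>
      (\<forall>c1\<in>C. \<forall>c2\<in>C. \<forall>y. c1 \<le> c2 \<and> c2 - c1 \<le> 1 * r \<and> c1 - rho x \<le> y \<and> y \<le> c2 + rho x \<longrightarrow> fib x y))"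
    by (rule large_scale_geometry[OF zero_less_one R]) blast
  have t0: "0 < 100 / \<theta>" using \<theta> by simp
  define B where "B = A + 100 / \<theta> + 6"
  have B: "1 \<le> B" "6 \<le> B" "A \<le> B" "100 / \<theta> + 1 \<le> B" using A t0 by (auto simp: B_def)
  show ?thesis
  proof (rule exI[of _ B], intro conjI B(1) allI impI)
    fix x0 y0 r assume h: "fib x0 y0 \<and> 0 < r \<and> r \<le> R"
    then have fib: "fib x0 y0" and r: "0 < r" "r \<le> R" by auto
    have "r / B \<le> r / A" "r / A \<le> r / 1" using r A B by (intro divide_left_mono; simp)+
    then have rB: "0 \<le> r / B" "r / B \<le> r" "r / B \<le> r / A" using r B by simp_all
    have Br: "6 * r \<le> B * r" "A * r \<le> B * r" "(100 / \<theta> + 1) * r \<le> B * r" using r B by (auto intro!: mult_right_mono)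
    show "\<exists>x1 y1. \<forall>x y. x1 \<le> x \<and> x \<le> x1 + r / B \<and> y1 \<le> y \<and> y \<le> y1 + r / B \<longrightarrow>
       fib x y \<and> \<bar>x - x0\<bar> \<le> B * r \<and> \<bar>y - y0\<bar> \<le> B * r"
    proof (cases "100 * r \<le> \<theta> * rho x0")
      case True
      obtain v1 v2 where
          v: "\<bar>v1\<bar> \<le> 5 * r" "\<bar>v2\<bar> \<le> 5 * r" and
          box: "\<And>x y. \<bar>x - (x0 + v1)\<bar> \<le> r \<Longrightarrow> \<bar>y - (y0 + v2)\<bar> \<le> r \<Longrightarrow> fib x y"
        by (rule small_scale_geometry[OF fib r(1) True]) blast
      show ?thesis
      proof (rule exI[of _ "x0 + v1"], rule exI[of _ "y0 + v2"], intro allI impI)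
        fix x y assume xy: "x0 + v1 \<le> x \<and> x \<le> x0 + v1 + r / B \<and> y0 + v2 \<le> y \<and> y \<le> y0 + v2 + r / B"
        then show "fib x y \<and> \<bar>x - x0\<bar> \<le> B * r \<and> \<bar>y - y0\<bar> \<le> B * r"
          using v Br rB r by (intro conjI box) linarith+
      qed
    next
      case False
      have x: "0 \<le> x0" "x0 \<le> 1" using fib fib_bounds by blast+
      from large[OF x r] False obtain \<xi> where \<xi>: "0 \<le> \<xi>" "\<xi> + r / A \<le> 1"
          and \<xi>': "\<And>x. \<xi> \<le> x \<Longrightarrow> x \<le> \<xi> + r / A \<Longrightarrow> \<bar>x - x0\<bar> \<le> A * r \<and> r / A \<le> rho x" by auto
      obtain c0 \<tau>0 where c0: "c0 \<in> C" "\<bar>y0 - c0\<bar> = del y0" by (rule fib_coordinates[OF fib]) blast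
      have "rho x0 \<le> 100 / \<theta> * r" using False \<theta> by (simp add: field_simps)
      then have y0: "\<bar>y0 - c0\<bar> \<le> 100 / \<theta> * r" using c0 fib by (simp add: fib_def)
      show ?thesis
      proof (rule exI[of _ \<xi>], rule exI[of _ c0], intro allI impI)
        fix x y assume xy: "\<xi> \<le> x \<and> x \<le> \<xi> + r / B \<and> c0 \<le> y \<and> y \<le> c0 + r / B"
        then have x': "\<bar>x - x0\<bar> \<le> A * r" "r / A \<le> rho x" "x \<le> 1" "0 \<le> x" using \<xi>'[of x] \<xi> rB by auto
        have "del y \<le> rho x" using del_le[OF c0(1), of y] xy x' rB by linarith
        moreover have "\<bar>y - y0\<bar> \<le> (100 / \<theta> + 1) * r" using y0 xy rB unfolding distrib_right by linarith
        ultimately show "fib x y \<and> \<bar>x - x0\<bar> \<le> B * r \<and> \<bar>y - y0\<bar> \<le> B * r"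
          using x' Br by (auto simp: fib_def)
      qed
    qed
  qed
qed

end

section \<open>Integration in the plane\<close>

lemma pt_eq_axis: "pt x y = x *\<^sub>R axis 1 1 + y *\<^sub>R axis 2 1"
  by (simp add: vec_eq_iff forall_2 axis_def)

lemma measurable_pt [measurable]:
  assumes "f \<in> borel_measurable M" "g \<in> borel_measurable M"
  shows "(\<lambda>x. pt (f x) (g x)) \<in> borel_measurable M"
  unfolding pt_eq_axis using assms by measurable

lemma measurable_nth [measurable]: "(\<lambda>z :: real^2. z $ i) \<in> borel_measurable borel"
  by (intro borel_measurable_continuous_onI continuous_intros)

lemma Basis_real2: "(Basis :: (real^2) set) = {axis 1 1, axis 2 1}"
  by (auto simp: Basis_vec_def UNIV_2)

lemma lborel_real2: "lborel = distr (lborel \<Otimes>\<^sub>M lborel) borel (\<lambda>(x, y). pt x y)"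
proof (rule lborel_eqI)
  fix l u :: "real^2" assume lu: "\<And>b. b \<in> Basis \<Longrightarrow> l \<bullet> b \<le> u \<bullet> b"
  have le: "l $ 1 \<le> u $ 1" "l $ 2 \<le> u $ 2"
    using lu[of "axis 1 1"] lu[of "axis 2 1"] by (auto simp: Basis_real2 inner_axis)
  have box: "(\<lambda>(x, y). pt x y) -` box l u \<inter> space (lborel \<Otimes>\<^sub>M lborel) = {l $ 1<..<u $ 1} \<times> {l $ 2<..<u $ 2}"
    by (auto simp: mem_box_cart forall_2 space_pair_measure)
  have "emeasure (distr (lborel \<Otimes>\<^sub>M lborel) borel (\<lambda>(x, y). pt x y)) (box l u)
      = emeasure (lborel \<Otimes>\<^sub>M lborel) ({l $ 1<..<u $ 1} \<times> {l $ 2<..<u $ 2})"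
    by (subst emeasure_distr) (auto simp: box)
  also have "\<dots> = ennreal (u $ 1 - l $ 1) * ennreal (u $ 2 - l $ 2)"
    using le by (subst lborel.emeasure_pair_measure_Times) auto
  also have "\<dots> = (\<Prod>b\<in>Basis. (u - l) \<bullet> b)"
    using le by (simp add: Basis_real2 inner_axis axis_eq_axis ennreal_mult)
  finally show "emeasure (distr (lborel \<Otimes>\<^sub>M lborel) borel (\<lambda>(x, y). pt x y)) (box l u) = (\<Prod>b\<in>Basis. (u - l) \<bullet> b)" .
qed simp

lemma nn_integral_real2:
  assumes [measurable]: "f \<in> borel_measurable (borel :: (real^2) measure)"
  shows "(\<integral>\<^sup>+z. f z \<partial>lborel) = (\<integral>\<^sup>+x. \<integral>\<^sup>+y. f (pt x y) \<partial>lborel \<partial>lborel)"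
    and "(\<integral>\<^sup>+z. f z \<partial>lborel) = (\<integral>\<^sup>+y. \<integral>\<^sup>+x. f (pt x y) \<partial>lborel \<partial>lborel)"
proof -
  have "(\<integral>\<^sup>+z. f z \<partial>lborel) = (\<integral>\<^sup>+p. f (case p of (x, y) \<Rightarrow> pt x y) \<partial>(lborel \<Otimes>\<^sub>M lborel))"
    by (subst lborel_real2, subst nn_integral_distr) auto
  also have "\<dots> = (\<integral>\<^sup>+x. \<integral>\<^sup>+y. f (pt x y) \<partial>lborel \<partial>lborel)"
    by (subst lborel.nn_integral_fst[symmetric]) auto
  finally show 1: "(\<integral>\<^sup>+z. f z \<partial>lborel) = (\<integral>\<^sup>+x. \<integral>\<^sup>+y. f (pt x y) \<partial>lborel \<partial>lborel)" .
  then show "(\<integral>\<^sup>+z. f z \<partial>lborel) = (\<integral>\<^sup>+y. \<integral>\<^sup>+x. f (pt x y) \<partial>lborel \<partial>lborel)"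
    using lborel_pair.Fubini'[of "\<lambda>x y. f (pt x y)"] by simp
qed

text \<open>Otherwise \<open>f\<close> exceeds twice its average everywhere on \<open>A\<close>. The
  factor 2 makes the comparison of integrals contradictory without strict inequalities; a vanishing
  integral needs its own argument.\<close>

lemma exists_le_average:
  assumes A: "A \<in> sets M" and m: "ennreal m \<le> emeasure M A" "0 < m" and [measurable]: "f \<in> borel_measurable M"
  shows "\<exists>x\<in>A. f x \<le> ennreal (2 / m) * (\<integral>\<^sup>+x\<in>A. f x \<partial>M)"
proof (rule ccontr)
  assume "\<not> ?thesis"
  then have gt: "\<And>x. x \<in> A \<Longrightarrow> ennreal (2 / m) * (\<integral>\<^sup>+x\<in>A. f x \<partial>M) < f x" by (auto simp: not_le)
  let ?I = "\<integral>\<^sup>+x\<in>A. f x \<partial>M"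
  have "0 < emeasure M A" using m by (metis ennreal_less_zero_iff less_le_trans)
  then have "A \<noteq> {}" by auto
  then obtain x0 where "x0 \<in> A" by auto
  from gt[OF this] have "ennreal (2 / m) * ?I < top" by (rule less_le_trans) simp
  then have I: "?I < top" using m by (auto simp: ennreal_mult_less_top)
  show False
  proof (cases "?I = 0")
    case True
    have [measurable]: "A \<in> sets M" by (rule A)
    have "AE x in M. f x * indicator A x = 0"
      using True by (subst (asm) nn_integral_0_iff_AE) auto
    then have "AE x in M. x \<notin> A"
    proof eventually_elim
      case (elim x)
      show ?case
      proof
        assume "x \<in> A"
        then have "f x = 0" using elim by simp
        then show False using gt[OF \<open>x \<in> A\<close>] by simp
      qed
    qed
    then have "emeasure M A = 0"
      using sets.sets_into_space[OF A] by (subst (asm) AE_iff_measurable[OF A]) auto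
    then show False using \<open>0 < emeasure M A\<close> by simp
  next
    case False
    have "2 * ?I = ennreal (2 / m) * ?I * ennreal m"
      using m by (simp add: mult.commute mult.left_commute ennreal_mult[symmetric] flip: mult.assoc)
    also have "\<dots> \<le> ennreal (2 / m) * ?I * emeasure M A" by (rule mult_left_mono[OF m(1)]) simp
    also have "\<dots> = (\<integral>\<^sup>+x. ennreal (2 / m) * ?I * indicator A x \<partial>M)" by (rule nn_integral_cmult_indicator[OF A, symmetric])
    also have "\<dots> \<le> ?I" by (intro nn_integral_mono) (use gt in \<open>auto simp: indicator_def less_imp_le\<close>)
    finally have "2 * ?I \<le> ?I" .
    moreover obtain i where i: "?I = ennreal i" "0 \<le> i" using I by (cases ?I) auto
    ultimately have "2 * i \<le> i" by (simp add: ennreal_mult[symmetric] flip: ennreal_numeral)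
    then show False using False i by simp
  qed
qed

text \<open>A crude form without the weights of Young's inequality: depending on which of
  \<open>y\<close> and \<open>k powr (1 / (q - 1))\<close> is larger, one summand alone
  dominates.\<close>

lemma young_powr:
  fixes y k q :: real
  assumes q: "1 < q" and y: "0 \<le> y" and k: "0 \<le> k"
  shows "y * k \<le> y powr q + k powr (q / (q - 1))"
proof (cases "y \<le> k powr (1 / (q - 1))")
  case True
  have "y * k \<le> k powr (1 / (q - 1)) * k powr 1" using True k by (intro mult_mono) (auto simp: powr_one)
  also have "\<dots> = k powr (q / (q - 1))"
    using q by (simp only: powr_add[symmetric]) (simp add: field_simps)
  finally show ?thesis by (simp add: add_increasing)
next
  case False
  have "k = (k powr (1 / (q - 1))) powr (q - 1)" using k q by (simp add: powr_powr powr_one)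
  also have "\<dots> \<le> y powr (q - 1)" using False q by (intro powr_mono2) auto
  finally have "y * k \<le> y powr 1 * y powr (q - 1)" using y by (simp add: powr_one mult_left_mono)
  also have "\<dots> = y powr q" by (simp only: powr_add[symmetric]) simp
  finally show ?thesis by (simp add: add_increasing2)
qed

lemma young_ennreal:
  fixes g :: ennreal
  assumes q: "1 < q" and t: "0 < t" and k: "0 \<le> k"
  shows "g * ennreal k \<le> ennreal (t powr (1 - q)) * epowr g q + ennreal t * ennreal (k powr (q / (q - 1)))"
proof (cases g)
  case (real x)
  have "x * k = t * (x / t * k)" using t by simp
  also have "\<dots> \<le> t * ((x / t) powr q + k powr (q / (q - 1)))"
    using t real q k by (intro mult_left_mono young_powr) auto
  also have "\<dots> = t powr (1 - q) * x powr q + t * k powr (q / (q - 1))"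
    using t real by (simp add: powr_divide powr_diff powr_one field_simps)
  finally have "ennreal (x * k) \<le> ennreal (t powr (1 - q) * x powr q + t * k powr (q / (q - 1)))" by (rule ennreal_leI)
  then show ?thesis using real t k by (simp add: epowr_def ennreal_mult)
next
  case top
  then show ?thesis using t by (simp add: epowr_def ennreal_mult_top)
qed

lemma borel_measurable_epowr [measurable]:
  assumes [measurable]: "g \<in> borel_measurable M"
  shows "(\<lambda>x. epowr (g x) q) \<in> borel_measurable M"
  unfolding epowr_def by measurable

text \<open>Optimising \<open>t\<close> gives Hoelder's inequality.\<close>

lemma nn_integral_young:
  assumes q: "1 < q" and t: "0 < t" and [measurable]: "g \<in> borel_measurable M" "k \<in> borel_measurable M"
    and k: "\<And>x. 0 \<le> k x"
  shows "(\<integral>\<^sup>+x. g x * ennreal (k x) \<partial>M) \<le> ennreal (t powr (1 - q)) * (\<integral>\<^sup>+x. epowr (g x) q \<partial>M)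
     + ennreal t * (\<integral>\<^sup>+x. ennreal (k x powr (q / (q - 1))) \<partial>M)"
proof -
  have "(\<integral>\<^sup>+x. g x * ennreal (k x) \<partial>M) \<le> (\<integral>\<^sup>+x. ennreal (t powr (1 - q)) * epowr (g x) q + ennreal t * ennreal (k x powr (q / (q - 1))) \<partial>M)"
    by (intro nn_integral_mono young_ennreal q t k)
  also have "\<dots> = ennreal (t powr (1 - q)) * (\<integral>\<^sup>+x. epowr (g x) q \<partial>M) + ennreal t * (\<integral>\<^sup>+x. ennreal (k x powr (q / (q - 1))) \<partial>M)"
    by (subst nn_integral_add) (simp_all add: nn_integral_cmult)
  finally show ?thesis .
qed

section \<open>Averages over the pencil of curves\<close>

context construction
begin

abbreviation MC :: "real measure" where "MC \<equiv> interval_measure FC"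

abbreviation sC :: real where "sC \<equiv> cC.cdim"
abbreviation sK :: real where "sK \<equiv> cK.cdim"

definition AC :: real where "AC = (1 - 2 * a) powr (- sC) * bet powr (- sC)"

lemma AC: "0 < AC" using a bet by (simp add: AC_def)

lemma emeasure_MC_Icc: "p \<le> q \<Longrightarrow> emeasure MC {p..q} = ennreal (FC q - FC p)"
  by (rule RC.emeasure_Icc)

lemma sigma_finite_MC: "sigma_finite_measure MC"
  by (rule RC.sigma_finite_F)

lemma emeasure_MC_ball: "0 \<le> t \<Longrightarrow> emeasure MC {y - t..y + t} \<le> ennreal (AC * (2 * t) powr sC)"
  unfolding AC_def by (rule RC.emeasure_ball)

definition kapC :: real where "kapC = max 1 bet powr (- sC) / 2"

lemma kapC: "0 < kapC" by (simp add: kapC_def)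

lemma emeasure_MC_ball_ge: "c \<in> C \<Longrightarrow> 0 < t \<Longrightarrow> t \<le> 1 \<Longrightarrow> ennreal (kapC * t powr sC) \<le> emeasure MC {c - t..c + t}"
  using RC.F_lower[of c t] by (simp add: emeasure_MC_Icc kapC_def ennreal_leI)

lemma AE_MC_in_C: "AE c in MC. c \<in> C"
  by (rule RC.AE_in_C)

text \<open>The substitution \<open>y = c + \<tau> * t\<close> contributes the factor
  \<open>1 / t\<close>. After Fubini, a given \<open>y\<close> is reached from the points
  \<open>c\<close> within \<open>t / 2\<close>, whose mass is at most
  \<open>AC * t powr sC\<close>.\<close>

lemma pencil_inner:
  assumes [measurable]: "G \<in> borel_measurable borel" and t: "0 < t"
  shows "(\<integral>\<^sup>+c. (\<integral>\<^sup>+\<tau>\<in>{-1/2..1/2}. G (c + \<tau> * t) \<partial>lborel) \<partial>MC) \<le> ennreal (AC * t powr (sC - 1)) * (\<integral>\<^sup>+y. G y \<partial>lborel)"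
proof -
  interpret MC: sigma_finite_measure MC by (rule sigma_finite_MC)
  interpret P: pair_sigma_finite MC lborel ..
  have inner: "(\<integral>\<^sup>+\<tau>\<in>{-1/2..1/2}. G (c + \<tau> * t) \<partial>lborel) = ennreal (1 / t) * (\<integral>\<^sup>+y. G y * indicator {c - t/2..c + t/2} y \<partial>lborel)" for c
  proof -
    have "(\<integral>\<^sup>+y. G y * indicator {c - t/2..c + t/2} y \<partial>lborel)
        = ennreal \<bar>t\<bar> * (\<integral>\<^sup>+\<tau>. G (c + t * \<tau>) * indicator {c - t/2..c + t/2} (c + t * \<tau>) \<partial>lborel)"
      by (rule nn_integral_real_affine) (use t in auto)
    also have "(\<integral>\<^sup>+\<tau>. G (c + t * \<tau>) * indicator {c - t/2..c + t/2} (c + t * \<tau>) \<partial>lborel)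
        = (\<integral>\<^sup>+\<tau>\<in>{-1/2..1/2}. G (c + \<tau> * t) \<partial>lborel)"
    proof (intro nn_integral_cong)
      fix \<tau> :: real
      have "(c - t / 2 \<le> c + t * \<tau>) = (t * (- 1 / 2) \<le> t * \<tau>)" "(c + t * \<tau> \<le> c + t / 2) = (t * \<tau> \<le> t * (1 / 2))" by auto
      then have "c + t * \<tau> \<in> {c - t / 2..c + t / 2} \<longleftrightarrow> \<tau> \<in> {- 1 / 2..1 / 2}"
        unfolding mult_le_cancel_left_pos[OF t] by simp
      then show "G (c + t * \<tau>) * indicator {c - t/2..c + t/2} (c + t * \<tau>) = G (c + \<tau> * t) * indicator {- 1/2..1/2} \<tau>"
        by (simp add: indicator_def mult.commute)
    qed
    finally have "ennreal (1 / t) * (\<integral>\<^sup>+y. G y * indicator {c - t/2..c + t/2} y \<partial>lborel)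
       = (ennreal (1 / t) * ennreal t) * (\<integral>\<^sup>+\<tau>\<in>{-1/2..1/2}. G (c + \<tau> * t) \<partial>lborel)" using t by (simp add: mult.assoc)
    also have "ennreal (1 / t) * ennreal t = 1" using t by (simp add: ennreal_mult[symmetric])
    finally show ?thesis by simp
  qed
  \<comment> \<open>The indicator of a moving interval is rewritten as a condition on both
    variables, which exhibits its joint measurability.\<close>
  define W where "W c y = G y * (if \<bar>y - c\<bar> \<le> t / 2 then 1 else 0)" for c y
  have W1: "G y * indicator {c - t/2..c + t/2} y = W c y" and W2: "W c y = G y * indicator {y - t/2..y + t/2} c" for c y
  proof -
    have "y \<in> {c - t/2..c + t/2} \<longleftrightarrow> \<bar>y - c\<bar> \<le> t / 2" "c \<in> {y - t/2..y + t/2} \<longleftrightarrow> \<bar>y - c\<bar> \<le> t / 2"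
      unfolding atLeastAtMost_iff by linarith+
    then show "G y * indicator {c - t/2..c + t/2} y = W c y" "W c y = G y * indicator {y - t/2..y + t/2} c"
      by (simp_all only: W_def indicator_def of_bool_def)
  qed
  have [measurable]: "case_prod W \<in> borel_measurable (borel \<Otimes>\<^sub>M borel)" unfolding W_def by measurable
  have "(\<integral>\<^sup>+c. (\<integral>\<^sup>+\<tau>\<in>{-1/2..1/2}. G (c + \<tau> * t) \<partial>lborel) \<partial>MC)
     = (\<integral>\<^sup>+c. ennreal (1 / t) * (\<integral>\<^sup>+y. W c y \<partial>lborel) \<partial>MC)"
    unfolding inner W1 ..
  also have "\<dots> = ennreal (1 / t) * (\<integral>\<^sup>+c. \<integral>\<^sup>+y. W c y \<partial>lborel \<partial>MC)"
    by (rule nn_integral_cmult) measurable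
  also have "(\<integral>\<^sup>+c. \<integral>\<^sup>+y. W c y \<partial>lborel \<partial>MC) = (\<integral>\<^sup>+y. \<integral>\<^sup>+c. W c y \<partial>MC \<partial>lborel)"
    by (rule P.Fubini'[symmetric]) measurable
  also have "\<dots> = (\<integral>\<^sup>+y. G y * emeasure MC {y - t/2..y + t/2} \<partial>lborel)"
    unfolding W2 by (intro nn_integral_cong nn_integral_cmult_indicator) auto
  also have "\<dots> \<le> (\<integral>\<^sup>+y. ennreal (AC * t powr sC) * G y \<partial>lborel)"
  proof (rule nn_integral_mono)
    fix y
    have "emeasure MC {y - t/2..y + t/2} \<le> ennreal (AC * t powr sC)" using emeasure_MC_ball[of "t / 2" y] t by simp
    then show "G y * emeasure MC {y - t/2..y + t/2} \<le> ennreal (AC * t powr sC) * G y"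
      by (subst mult.commute) (intro mult_right_mono, auto)
  qed
  also have "\<dots> = ennreal (AC * t powr sC) * (\<integral>\<^sup>+y. G y \<partial>lborel)" by (rule nn_integral_cmult) simp
  finally have "(\<integral>\<^sup>+c. (\<integral>\<^sup>+\<tau>\<in>{-1/2..1/2}. G (c + \<tau> * t) \<partial>lborel) \<partial>MC)
     \<le> ennreal (1 / t) * (ennreal (AC * t powr sC) * (\<integral>\<^sup>+y. G y \<partial>lborel))" by (simp add: mult_left_mono)
  also have "\<dots> = ennreal (AC * t powr (sC - 1)) * (\<integral>\<^sup>+y. G y \<partial>lborel)"
    using t AC by (simp add: mult.assoc[symmetric] ennreal_mult[symmetric] powr_diff powr_one)
  finally show ?thesis .
qed

text \<open>Fubini reduces this to \<open>pencil_inner\<close> on almost every vertical line, with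
  \<open>t = rho x\<close>; the lines with \<open>rho x = 0\<close> form a null set.\<close>

lemma pencil:
  assumes [measurable]: "case_prod G \<in> borel_measurable (borel \<Otimes>\<^sub>M borel)"
  shows "(\<integral>\<^sup>+c. (\<integral>\<^sup>+\<tau>\<in>{-1/2..1/2}. (\<integral>\<^sup>+x\<in>{0..1}. G x (c + \<tau> * rho x) \<partial>lborel) \<partial>lborel) \<partial>MC)
     \<le> ennreal AC * (\<integral>\<^sup>+x\<in>{0..1}. ennreal (rho x powr (sC - 1)) * (\<integral>\<^sup>+y. G x y \<partial>lborel) \<partial>lborel)"
proof -
  interpret MC: sigma_finite_measure MC by (rule sigma_finite_MC)
  interpret P: pair_sigma_finite MC lborel ..
  let ?f = "\<lambda>c \<tau> x. G x (c + \<tau> * rho x) * indicator {0..1} x * indicator {-1/2..1/2::real} \<tau>"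
  have "(\<integral>\<^sup>+c. (\<integral>\<^sup>+\<tau>\<in>{-1/2..1/2}. (\<integral>\<^sup>+x\<in>{0..1}. G x (c + \<tau> * rho x) \<partial>lborel) \<partial>lborel) \<partial>MC)
      = (\<integral>\<^sup>+c. \<integral>\<^sup>+\<tau>. \<integral>\<^sup>+x. ?f c \<tau> x \<partial>lborel \<partial>lborel \<partial>MC)"
    by (intro nn_integral_cong nn_integral_multc[symmetric]) measurable
  also have "\<dots> = (\<integral>\<^sup>+c. \<integral>\<^sup>+x. \<integral>\<^sup>+\<tau>. ?f c \<tau> x \<partial>lborel \<partial>lborel \<partial>MC)"
    by (intro nn_integral_cong lborel_pair.Fubini'[symmetric]) measurable
  also have "\<dots> = (\<integral>\<^sup>+x. \<integral>\<^sup>+c. \<integral>\<^sup>+\<tau>. ?f c \<tau> x \<partial>lborel \<partial>MC \<partial>lborel)"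
    by (intro P.Fubini'[symmetric]) measurable
  also have "\<dots> \<le> (\<integral>\<^sup>+x. ennreal AC * (ennreal (rho x powr (sC - 1)) * (\<integral>\<^sup>+y. G x y \<partial>lborel) * indicator {0..1} x) \<partial>lborel)"
  proof (rule nn_integral_mono_AE)
    have "AE x in lborel. 0 < rho x" unfolding rho_def by (rule RK.AE_notin_C)
    then show "AE x in lborel. (\<integral>\<^sup>+c. \<integral>\<^sup>+\<tau>. ?f c \<tau> x \<partial>lborel \<partial>MC)
       \<le> ennreal AC * (ennreal (rho x powr (sC - 1)) * (\<integral>\<^sup>+y. G x y \<partial>lborel) * indicator {0..1} x)"
    proof eventually_elim
      case (elim x)
      show ?case
      proof (cases "x \<in> {0..1}")
        case True
        have "(\<integral>\<^sup>+c. \<integral>\<^sup>+\<tau>. ?f c \<tau> x \<partial>lborel \<partial>MC) = (\<integral>\<^sup>+c. (\<integral>\<^sup>+\<tau>\<in>{-1/2..1/2}. G x (c + \<tau> * rho x) \<partial>lborel) \<partial>MC)"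
          using True by simp
        also have "\<dots> \<le> ennreal (AC * rho x powr (sC - 1)) * (\<integral>\<^sup>+y. G x y \<partial>lborel)"
          by (rule pencil_inner) (use elim in measurable)
        finally show ?thesis using True AC by (simp add: ennreal_mult mult.assoc)
      qed simp
    qed
  qed
  also have "\<dots> = ennreal AC * (\<integral>\<^sup>+x\<in>{0..1}. ennreal (rho x powr (sC - 1)) * (\<integral>\<^sup>+y. G x y \<partial>lborel) \<partial>lborel)"
    by (rule nn_integral_cmult) measurable
  finally show ?thesis .
qed

text \<open>This is where the condition on \<open>q\<close> enters. With
  \<open>q' = q / (q - 1)\<close>, the fibre over \<open>x\<close> has length of order
  \<open>rho x powr (1 - sC) * r powr sC\<close>. Multiplied by the singular part of the weight to
  the power \<open>q'\<close> it gives
  \<open>r powr (1 + \<sigma>) * rho x powr (- \<sigma>)\<close> with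
  \<open>\<sigma> = (1 - sC) / (q - 1)\<close>, which is integrable across \<open>K\<close> because
  \<open>\<sigma> < 1 - sK\<close>.\<close>

lemma weight_integral:
  assumes q: "1 < q" "1 - sC < (1 - sK) * (q - 1)" and R: "0 < R" and \<Lambda>: "1 \<le> \<Lambda>"
  shows "\<exists>B>0. \<forall>x0 y0 r. fib x0 y0 \<and> 0 < r \<and> r \<le> R \<and> \<theta> * rho x0 \<le> 100 * r \<longrightarrow>
    (\<integral>\<^sup>+z\<in>{z\<in>S. \<bar>z $ 1 - x0\<bar> \<le> \<Lambda> * r \<and> \<bar>z $ 2 - y0\<bar> \<le> \<Lambda> * r}.
        ennreal ((1 + (r / rho (z $ 1)) powr (1 - sC)) powr (q / (q - 1))) \<partial>lborel) \<le> ennreal (B * r\<^sup>2)"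
proof -
  \<comment> \<open>Radii may exceed 1, so the regularity of \<open>K\<close> is instantiated again
    for the larger range.\<close>
  define R' where "R' = max 1 R"
  have R': "1 \<le> R'" "R \<le> R'" by (auto simp: R'_def)
  interpret RR: regular_line_set K FK sK "(1 - 2 * lam) powr (- sK)" "R' powr (- sK) / 2" R'
    by (rule regular_K[OF R'(1)])
  define q' where "q' = q / (q - 1)"
  define \<sigma> where "\<sigma> = (1 - sC) / (q - 1)"
  have sC: "0 < sC" "sC < 1" by (rule cC.cdim_bounds)+
  have q': "1 < q'" using q by (simp add: q'_def field_simps)
  have \<sigma>: "0 < \<sigma>" "\<sigma> < 1 - sK" using q sC by (auto simp: \<sigma>_def field_simps)
  have \<sigma>q: "(1 - sC) * q' = \<sigma> + (1 - sC)" using q by (simp add: \<sigma>_def q'_def field_simps)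
  obtain B1 where B1: "0 < B1" "\<And>r p q. 0 < r \<Longrightarrow> r \<le> R' \<Longrightarrow> p \<le> q \<Longrightarrow> q - p \<le> 2 * \<Lambda> * r \<Longrightarrow>
    (\<integral>\<^sup>+x\<in>{p..q}. ennreal (infdist x K powr (- \<sigma>)) \<partial>lborel) \<le> ennreal (B1 * r powr (1 - \<sigma>))"
    using RR.integral_infdist_powr[of \<sigma> "2 * \<Lambda>"] \<sigma> \<Lambda> by auto
  define M where "M = 100 / \<theta> + \<Lambda>"
  have "0 < 100 / \<theta>" using \<theta> by simp
  then have M: "1 \<le> M" using \<Lambda> unfolding M_def by linarith
  define B2 where "B2 = 4 * AC / kapC * (2 * \<Lambda> + 4 * M) powr sC"
  have B2: "0 < B2" using AC kapC \<Lambda> M by (simp add: B2_def)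
  define B where "B = 2 powr q' * B2 * (M * 2 * \<Lambda> + B1)"
  have B: "0 < B" using B2 B1 M \<Lambda> by (simp add: B_def add_pos_pos)
  show ?thesis
  proof (intro exI[of _ B] conjI B allI impI)
    fix x0 y0 r assume h: "fib x0 y0 \<and> 0 < r \<and> r \<le> R \<and> \<theta> * rho x0 \<le> 100 * r"
    then have fib: "fib x0 y0" and r: "0 < r" "r \<le> R" and near: "\<theta> * rho x0 \<le> 100 * r" by auto
    let ?D = "{z\<in>S. \<bar>z $ 1 - x0\<bar> \<le> \<Lambda> * r \<and> \<bar>z $ 2 - y0\<bar> \<le> \<Lambda> * r}"
    let ?k = "\<lambda>x. (1 + (r / rho x) powr (1 - sC)) powr q'"
    let ?J = "{x0 - \<Lambda> * r..x0 + \<Lambda> * r}"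
    let ?Y = "\<lambda>x. {y \<in> {y0 - \<Lambda> * r..y0 + \<Lambda> * r}. infdist y C \<le> rho x}"
    have \<Lambda>r: "0 \<le> \<Lambda> * r" using \<Lambda> r by simp
    have rhoM: "rho x \<le> M * r" if "x \<in> ?J" for x
    proof -
      have "rho x0 \<le> 100 / \<theta> * r" using near \<theta> by (simp add: field_simps)
      moreover have "rho x \<le> rho x0 + \<bar>x - x0\<bar>" using rho_lip[of x x0] by linarith
      moreover have "\<bar>x - x0\<bar> \<le> \<Lambda> * r" using that by auto
      ultimately show ?thesis by (simp add: M_def distrib_right)
    qed
    have point: "(\<integral>\<^sup>+y. ennreal (?k x) * indicator ?D (pt x y) \<partial>lborel)
        \<le> ennreal (2 powr q' * B2 * (M * r + r powr (1 + \<sigma>) * rho x powr (- \<sigma>))) * indicator ?J x" if pos: "0 < rho x" for x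
    proof (cases "x \<in> ?J \<and> 0 \<le> x \<and> x \<le> 1")
      case True
      have rx: "rho x \<le> 1" "rho x \<le> M * r" using rho_le_1 rhoM True by auto
      have "(\<integral>\<^sup>+y. ennreal (?k x) * indicator ?D (pt x y) \<partial>lborel) = (\<integral>\<^sup>+y. ennreal (?k x) * indicator (?Y x) y \<partial>lborel)"
        using True by (intro nn_integral_cong) (auto simp: indicator_def fib_def del_def)
      also have "\<dots> = ennreal (?k x) * emeasure lborel (?Y x)"
        by (intro nn_integral_cmult_indicator) measurable
      also have "\<dots> \<le> ennreal (?k x) * ennreal (B2 * (rho x powr (1 - sC) * r powr sC))"
      proof (intro mult_left_mono)
        have "emeasure lborel (?Y x) \<le> ennreal (4 * AC / kapC * rho x powr (1 - sC) * (y0 + \<Lambda> * r - (y0 - \<Lambda> * r) + 4 * rho x) powr sC)"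
          unfolding AC_def kapC_def by (rule RC.neighbourhood_measure) (use pos rx \<Lambda>r in auto)
        also have "\<dots> \<le> ennreal (4 * AC / kapC * rho x powr (1 - sC) * ((2 * \<Lambda> + 4 * M) * r) powr sC)"
          using AC kapC sC rx \<Lambda>r by (intro ennreal_leI mult_left_mono powr_mono2) (auto simp: algebra_simps)
        also have "\<dots> = ennreal (B2 * (rho x powr (1 - sC) * r powr sC))"
          by (simp add: B2_def powr_mult mult_ac)
        finally show "emeasure lborel (?Y x) \<le> ennreal (B2 * (rho x powr (1 - sC) * r powr sC))" .
      qed simp
      also have "\<dots> = ennreal (?k x * (B2 * (rho x powr (1 - sC) * r powr sC)))" using B2 by (simp add: ennreal_mult)
      also have "\<dots> \<le> ennreal (2 powr q' * (1 + (r / rho x) powr (\<sigma> + (1 - sC))) * (B2 * (rho x powr (1 - sC) * r powr sC)))"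
      proof (intro ennreal_leI mult_right_mono)
        let ?b = "(r / rho x) powr (1 - sC)"
        have b: "0 \<le> ?b" by simp
        have "?k x \<le> (2 * max 1 ?b) powr q'" using b q' by (intro powr_mono2) auto
        also have "\<dots> = 2 powr q' * (max 1 ?b) powr q'" by (simp add: powr_mult)
        also have "\<dots> \<le> 2 powr q' * (1 + ?b powr q')" by (intro mult_left_mono) (auto simp: max_def)
        also have "?b powr q' = (r / rho x) powr (\<sigma> + (1 - sC))" by (simp add: powr_powr \<sigma>q)
        finally show "?k x \<le> 2 powr q' * (1 + (r / rho x) powr (\<sigma> + (1 - sC)))" .
      qed (use B2 in auto)
      also have "2 powr q' * (1 + (r / rho x) powr (\<sigma> + (1 - sC))) * (B2 * (rho x powr (1 - sC) * r powr sC))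
         = 2 powr q' * B2 * (rho x powr (1 - sC) * r powr sC + (r / rho x) powr (\<sigma> + (1 - sC)) * (rho x powr (1 - sC) * r powr sC))"
        by (simp add: algebra_simps)
      also have "(r / rho x) powr (\<sigma> + (1 - sC)) * (rho x powr (1 - sC) * r powr sC) = r powr (1 + \<sigma>) * rho x powr (- \<sigma>)"
        using pos r by (simp add: powr_divide powr_add powr_diff powr_minus powr_one field_simps)
      also have "ennreal (2 powr q' * B2 * (rho x powr (1 - sC) * r powr sC + r powr (1 + \<sigma>) * rho x powr (- \<sigma>)))
         \<le> ennreal (2 powr q' * B2 * (M * r + r powr (1 + \<sigma>) * rho x powr (- \<sigma>)))"
      proof (intro ennreal_leI mult_left_mono add_right_mono)
        have "rho x powr (1 - sC) * r powr sC \<le> (M * r) powr (1 - sC) * (M * r) powr sC"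
          using rx pos r sC M by (intro mult_mono powr_mono2) (auto simp: mult_le_cancel_right1)
        also have "\<dots> = M * r" using M r by (simp add: powr_add[symmetric] powr_one)
        finally show "rho x powr (1 - sC) * r powr sC \<le> M * r" .
      qed (use B2 in auto)
      finally show ?thesis using True by simp
    next
      case False
      then have "pt x y \<notin> ?D" for y using fib_bounds(1,2)[of x y] by (auto simp: abs_le_iff)
      then show ?thesis by simp
    qed
    have [measurable]: "?D \<in> sets borel" by measurable
    have "(\<integral>\<^sup>+z\<in>?D. ennreal (?k (z $ 1)) \<partial>lborel) = (\<integral>\<^sup>+x. \<integral>\<^sup>+y. ennreal (?k x) * indicator ?D (pt x y) \<partial>lborel \<partial>lborel)"
      by (subst nn_integral_real2(1)) auto
    also have "\<dots> \<le> (\<integral>\<^sup>+x. ennreal (2 powr q' * B2 * (M * r + r powr (1 + \<sigma>) * rho x powr (- \<sigma>))) * indicator ?J x \<partial>lborel)"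
    proof (rule nn_integral_mono_AE)
      have "AE x in lborel. 0 < rho x" unfolding rho_def by (rule RK.AE_notin_C)
      then show "AE x in lborel. (\<integral>\<^sup>+y. ennreal (?k x) * indicator ?D (pt x y) \<partial>lborel)
         \<le> ennreal (2 powr q' * B2 * (M * r + r powr (1 + \<sigma>) * rho x powr (- \<sigma>))) * indicator ?J x"
        by eventually_elim (rule point)
    qed
    also have "\<dots> = (\<integral>\<^sup>+x. ennreal (2 powr q' * B2) * (ennreal (M * r) * indicator ?J x + ennreal (r powr (1 + \<sigma>)) * (ennreal (rho x powr (- \<sigma>)) * indicator ?J x)) \<partial>lborel)"
      using B2 M r by (intro nn_integral_cong) (simp add: indicator_def ennreal_mult ennreal_plus)
    also have "\<dots> = ennreal (2 powr q' * B2) * (ennreal (M * r) * emeasure lborel ?J + ennreal (r powr (1 + \<sigma>)) * (\<integral>\<^sup>+x\<in>?J. ennreal (infdist x K powr (- \<sigma>)) \<partial>lborel))"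
      by (subst nn_integral_cmult, measurable, subst nn_integral_add, measurable, subst nn_integral_cmult, measurable)
        (simp add: nn_integral_cmult_indicator rho_def)
    also have "\<dots> \<le> ennreal (2 powr q' * B2) * (ennreal (M * r) * ennreal (2 * \<Lambda> * r) + ennreal (r powr (1 + \<sigma>)) * ennreal (B1 * r powr (1 - \<sigma>)))"
      using \<Lambda>r r R' by (intro mult_left_mono add_mono B1(2)) auto
    also have "\<dots> = ennreal (2 powr q' * B2 * (M * r * (2 * \<Lambda> * r) + r powr (1 + \<sigma>) * (B1 * r powr (1 - \<sigma>))))"
      using B2 M r \<Lambda> B1 by (simp add: ennreal_mult ennreal_plus)
    also have "r powr (1 + \<sigma>) * (B1 * r powr (1 - \<sigma>)) = B1 * r\<^sup>2"
    proof -
      have "r powr (1 + \<sigma>) * r powr (1 - \<sigma>) = r powr 2" by (simp only: powr_add[symmetric]) simp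
      then show ?thesis using r by (simp add: powr_numeral)
    qed
    also have "2 powr q' * B2 * (M * r * (2 * \<Lambda> * r) + B1 * r\<^sup>2) = B * r\<^sup>2"
      by (simp add: B_def power2_eq_square algebra_simps)
    finally show "(\<integral>\<^sup>+z\<in>?D. ennreal ((1 + (r / rho (z $ 1)) powr (1 - sC)) powr (q / (q - 1))) \<partial>lborel) \<le> ennreal (B * r\<^sup>2)"
      by (simp only: q'_def)
  qed
qed

end

section \<open>Pencils of curves and the Poincare inequality\<close>

context construction
begin

definition bx :: "real \<Rightarrow> real \<Rightarrow> real \<Rightarrow> (real^2) set" where
  "bx x0 y0 r = {z\<in>S. \<bar>z $ 1 - x0\<bar> \<le> r \<and> \<bar>z $ 2 - y0\<bar> \<le> r}"

lemma borel_bx [measurable]: "bx x0 y0 r \<in> sets borel"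
  unfolding bx_def by measurable

lemma pt_in_bx [simp]: "pt x y \<in> bx x0 y0 r \<longleftrightarrow> fib x y \<and> \<bar>x - x0\<bar> \<le> r \<and> \<bar>y - y0\<bar> \<le> r"
  by (simp add: bx_def)

definition kw :: "real \<Rightarrow> real \<Rightarrow> real \<Rightarrow> real" where
  "kw x0 r x = (if \<theta> * rho x0 \<le> 100 * r then 1 + (r / rho x) powr (1 - sC) else 1)"

lemma kw_ge_1: "1 \<le> kw x0 r x" by (simp add: kw_def)

lemma borel_kw [measurable]: "kw x0 r \<in> borel_measurable borel"
  unfolding kw_def[abs_def] by measurable

text \<open>The part of the upper gradient property that the estimates use. Restricting the curves
  to \<open>D\<close> localises the argument to a ball, and plain integrals over the parameter
  replace line integrals.\<close>

definition upper_along :: "(real^2 \<Rightarrow> real) \<Rightarrow> (real^2 \<Rightarrow> ennreal) \<Rightarrow> (real^2) set \<Rightarrow> bool" where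
  "upper_along u g D \<longleftrightarrow> (\<forall>L p q c. lip_curve NS L p q c \<and> (\<forall>t\<in>{p..q}. c t \<in> D) \<longrightarrow>
      ennreal \<bar>u (c p) - u (c q)\<bar> \<le> ennreal L * (\<integral>\<^sup>+t\<in>{p..q}. g (c t) \<partial>lborel))"

lemma upper_alongD:
  "upper_along u g D \<Longrightarrow> lip_curve NS L p q c \<Longrightarrow> (\<And>t. p \<le> t \<Longrightarrow> t \<le> q \<Longrightarrow> c t \<in> D) \<Longrightarrow>
      ennreal \<bar>u (c p) - u (c q)\<bar> \<le> ennreal L * (\<integral>\<^sup>+t\<in>{p..q}. g (c t) \<partial>lborel)"
  unfolding upper_along_def by simp

text \<open>Integrating over the whole line makes the bound a function of the abscissa alone.
  Nothing is lost, since \<open>g\<close> will be cut off outside a box.\<close>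

lemma upper_along_vertical:
  assumes ug: "upper_along u g (bx x0 y0 r)"
    and between: "\<And>y. min y1 y2 \<le> y \<Longrightarrow> y \<le> max y1 y2 \<Longrightarrow> fib x y"
    and b: "\<bar>x - x0\<bar> \<le> r" "\<bar>y1 - y0\<bar> \<le> r" "\<bar>y2 - y0\<bar> \<le> r"
  shows "ennreal \<bar>u (pt x y1) - u (pt x y2)\<bar> \<le> (\<integral>\<^sup>+y. g (pt x y) \<partial>lborel)"
proof -
  have *: "ennreal \<bar>u (pt x p) - u (pt x q)\<bar> \<le> (\<integral>\<^sup>+y. g (pt x y) \<partial>lborel)"
    if "p \<le> q" "{p..q} \<subseteq> {min y1 y2..max y1 y2}" for p q
  proof -
    have "lip_curve NS 1 p q (\<lambda>y. pt x y)"
      using that by (intro vertical_curve between) auto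
    moreover have "pt x t \<in> bx x0 y0 r" if "p \<le> t" "t \<le> q" for t
    proof -
      have "t \<in> {min y1 y2..max y1 y2}" using that \<open>{p..q} \<subseteq> _\<close> by auto
      then show ?thesis using between[of t] b by (auto simp: min_def max_def split: if_splits)
    qed
    ultimately have "ennreal \<bar>u (pt x p) - u (pt x q)\<bar> \<le> ennreal 1 * (\<integral>\<^sup>+y\<in>{p..q}. g (pt x y) \<partial>lborel)"
      by (rule upper_alongD[OF ug])
    also have "\<dots> \<le> (\<integral>\<^sup>+y. g (pt x y) \<partial>lborel)"
      by (auto intro!: nn_integral_mono simp: indicator_def)
    finally show ?thesis .
  qed
  show ?thesis
  proof (cases "y1 \<le> y2")
    case True then show ?thesis using *[of y1 y2] by simp
  next
    case False then show ?thesis using *[of y2 y1] by (simp add: abs_minus_commute)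
  qed
qed

lemma upper_along_horizontal:
  assumes ug: "upper_along u g (bx x0 y0 r)"
    and between: "\<And>x. min x1 x2 \<le> x \<Longrightarrow> x \<le> max x1 x2 \<Longrightarrow> fib x y"
    and b: "\<bar>y - y0\<bar> \<le> r" "\<bar>x1 - x0\<bar> \<le> r" "\<bar>x2 - x0\<bar> \<le> r"
  shows "ennreal \<bar>u (pt x1 y) - u (pt x2 y)\<bar> \<le> (\<integral>\<^sup>+x. g (pt x y) \<partial>lborel)"
proof -
  have *: "ennreal \<bar>u (pt p y) - u (pt q y)\<bar> \<le> (\<integral>\<^sup>+x. g (pt x y) \<partial>lborel)"
    if "p \<le> q" "{p..q} \<subseteq> {min x1 x2..max x1 x2}" for p q
  proof -
    have "lip_curve NS 1 p q (\<lambda>x. pt x y)"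
      using that by (intro horizontal_curve between) auto
    moreover have "pt t y \<in> bx x0 y0 r" if "p \<le> t" "t \<le> q" for t
    proof -
      have "t \<in> {min x1 x2..max x1 x2}" using that \<open>{p..q} \<subseteq> _\<close> by auto
      then show ?thesis using between[of t] b by (auto simp: min_def max_def split: if_splits)
    qed
    ultimately have "ennreal \<bar>u (pt p y) - u (pt q y)\<bar> \<le> ennreal 1 * (\<integral>\<^sup>+x\<in>{p..q}. g (pt x y) \<partial>lborel)"
      by (rule upper_alongD[OF ug])
    also have "\<dots> \<le> (\<integral>\<^sup>+x. g (pt x y) \<partial>lborel)"
      by (auto intro!: nn_integral_mono simp: indicator_def)
    finally show ?thesis .
  qed
  show ?thesis
  proof (cases "x1 \<le> x2")
    case True then show ?thesis using *[of x1 x2] by simp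
  next
    case False then show ?thesis using *[of x2 x1] by (simp add: abs_minus_commute)
  qed
qed

text \<open>The factor 2 is the Lipschitz constant of the graph. Extending the integral to the unit
  interval makes the bound independent of the end points, so that it can be averaged over the
  pencil.\<close>

lemma upper_along_graph:
  assumes ug: "upper_along u g (bx x0 y0 r)" and c: "c \<in> C" and t: "\<bar>\<tau>\<bar> \<le> 1"
    and x: "0 \<le> x1" "x1 \<le> 1" "0 \<le> x2" "x2 \<le> 1" "\<bar>x1 - x0\<bar> \<le> r" "\<bar>x2 - x0\<bar> \<le> r"
    and y: "\<And>x. min x1 x2 \<le> x \<Longrightarrow> x \<le> max x1 x2 \<Longrightarrow> \<bar>c + \<tau> * rho x - y0\<bar> \<le> r"
  shows "ennreal \<bar>u (pt x1 (c + \<tau> * rho x1)) - u (pt x2 (c + \<tau> * rho x2))\<bar>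
     \<le> 2 * (\<integral>\<^sup>+x\<in>{0..1}. g (pt x (c + \<tau> * rho x)) \<partial>lborel)"
proof -
  have *: "ennreal \<bar>u (pt p (c + \<tau> * rho p)) - u (pt q (c + \<tau> * rho q))\<bar> \<le> 2 * (\<integral>\<^sup>+x\<in>{0..1}. g (pt x (c + \<tau> * rho x)) \<partial>lborel)"
    if pq: "p \<le> q" "{p..q} \<subseteq> {min x1 x2..max x1 x2}" for p q
  proof -
    have sub: "{p..q} \<subseteq> {0..1}" using pq x by auto
    have p01: "0 \<le> p" "q \<le> 1" using sub pq(1) by auto
    have "lip_curve NS 2 p q (\<lambda>x. pt x (c + \<tau> * rho x))"
      by (rule graph_curve[OF c t p01(1) pq(1) p01(2)])
    moreover have "pt s (c + \<tau> * rho s) \<in> bx x0 y0 r" if "p \<le> s" "s \<le> q" for s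
    proof -
      have s: "s \<in> {min x1 x2..max x1 x2}" using that pq(2) by auto
      moreover have "fib s (c + \<tau> * rho s)" using that sub by (intro fib_graph[OF c t]) auto
      ultimately show ?thesis using y[of s] x by (auto simp: min_def max_def split: if_splits)
    qed
    ultimately have "ennreal \<bar>u (pt p (c + \<tau> * rho p)) - u (pt q (c + \<tau> * rho q))\<bar> \<le> ennreal 2 * (\<integral>\<^sup>+x\<in>{p..q}. g (pt x (c + \<tau> * rho x)) \<partial>lborel)"
      by (rule upper_alongD[OF ug])
    also have "\<dots> \<le> 2 * (\<integral>\<^sup>+x\<in>{0..1}. g (pt x (c + \<tau> * rho x)) \<partial>lborel)"
      using sub by (auto intro!: mult_left_mono nn_integral_mono simp: indicator_def)
    finally show ?thesis .
  qed
  show ?thesis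
  proof (cases "x1 \<le> x2")
    case True then show ?thesis using *[of x1 x2] by simp
  next
    case False then show ?thesis using *[of x2 x1] by (simp add: abs_minus_commute)
  qed
qed

lemma bx_integral_le:
  assumes [measurable]: "f \<in> borel_measurable borel" and r: "0 \<le> r"
  shows "(\<integral>\<^sup>+z\<in>bx x0 y0 r. f (z $ 1 + v) \<partial>lborel) \<le> ennreal (2 * r) * (\<integral>\<^sup>+x. f x \<partial>lborel)"
    and "(\<integral>\<^sup>+z\<in>bx x0 y0 r. f (z $ 2 + v) \<partial>lborel) \<le> ennreal (2 * r) * (\<integral>\<^sup>+x. f x \<partial>lborel)"
proof -
  have shift: "(\<integral>\<^sup>+x. f (x + v) \<partial>lborel) = (\<integral>\<^sup>+x. f x \<partial>lborel)"
    using nn_integral_real_affine[of f 1 v] by (simp add: add.commute)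
  have "(\<integral>\<^sup>+z\<in>bx x0 y0 r. f (z $ 1 + v) \<partial>lborel) = (\<integral>\<^sup>+x. \<integral>\<^sup>+y. f (x + v) * indicator (bx x0 y0 r) (pt x y) \<partial>lborel \<partial>lborel)"
    by (subst nn_integral_real2(1)) auto
  also have "\<dots> \<le> (\<integral>\<^sup>+x. \<integral>\<^sup>+y. f (x + v) * indicator {y0 - r..y0 + r} y \<partial>lborel \<partial>lborel)"
    by (intro nn_integral_mono) (auto simp: indicator_def abs_le_iff)
  also have "\<dots> = (\<integral>\<^sup>+x. f (x + v) * ennreal (2 * r) \<partial>lborel)"
    using r by (simp add: nn_integral_cmult_indicator)
  finally show "(\<integral>\<^sup>+z\<in>bx x0 y0 r. f (z $ 1 + v) \<partial>lborel) \<le> ennreal (2 * r) * (\<integral>\<^sup>+x. f x \<partial>lborel)"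
    by (simp add: nn_integral_multc shift mult.commute)
  have "(\<integral>\<^sup>+z\<in>bx x0 y0 r. f (z $ 2 + v) \<partial>lborel) = (\<integral>\<^sup>+y. \<integral>\<^sup>+x. f (y + v) * indicator (bx x0 y0 r) (pt x y) \<partial>lborel \<partial>lborel)"
    by (subst nn_integral_real2(2)) auto
  also have "\<dots> \<le> (\<integral>\<^sup>+y. \<integral>\<^sup>+x. f (y + v) * indicator {x0 - r..x0 + r} x \<partial>lborel \<partial>lborel)"
    by (intro nn_integral_mono) (auto simp: indicator_def abs_le_iff)
  also have "\<dots> = (\<integral>\<^sup>+y. f (y + v) * ennreal (2 * r) \<partial>lborel)"
    using r by (simp add: nn_integral_cmult_indicator)
  finally show "(\<integral>\<^sup>+z\<in>bx x0 y0 r. f (z $ 2 + v) \<partial>lborel) \<le> ennreal (2 * r) * (\<integral>\<^sup>+x. f x \<partial>lborel)"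
    by (simp add: nn_integral_multc shift mult.commute)
qed

lemma ennreal_abs_triangle: "ennreal \<bar>x - z\<bar> \<le> ennreal \<bar>x - y\<bar> + ennreal \<bar>y - (z::real)\<bar>"
  by (simp add: ennreal_plus[symmetric] del: ennreal_plus)

text \<open>The points \<open>z\<close> and \<open>z'\<close> are joined by four axis-parallel legs:
  shift \<open>z\<close>, cross the full square horizontally, then vertically, and undo the shift of
  \<open>z'\<close>. Each leg costs an integral of \<open>g\<close> over a full line, and such a
  line integral averages over the box to at most \<open>2 * r\<close> times the integral of
  \<open>g\<close>.\<close>

lemma poincare_core_small:
  assumes fib0: "fib x0 y0" and r: "0 < r" "100 * r \<le> \<theta> * rho x0"
    and g [measurable]: "g \<in> borel_measurable borel" and ug: "upper_along u g (bx x0 y0 (\<Lambda> * r))" and \<Lambda>: "6 \<le> \<Lambda>"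
  shows "\<exists>\<Phi>. \<Phi> \<in> borel_measurable borel \<and>
    (\<forall>z\<in>bx x0 y0 r. \<forall>z'\<in>bx x0 y0 r. ennreal \<bar>u z - u z'\<bar> \<le> \<Phi> z + \<Phi> z') \<and>
    (\<integral>\<^sup>+z\<in>bx x0 y0 r. \<Phi> z \<partial>lborel) \<le> ennreal (8 * r) * (\<integral>\<^sup>+z. g z \<partial>lborel)"
proof -
  obtain v1 v2 where v: "\<bar>v1\<bar> \<le> 5 * r" "\<bar>v2\<bar> \<le> 5 * r" "v1 = 0 \<or> v2 = 0"
    and move: "\<And>x y t. \<bar>x - x0\<bar> \<le> r \<Longrightarrow> \<bar>y - y0\<bar> \<le> r \<Longrightarrow> fib x y \<Longrightarrow> 0 \<le> t \<Longrightarrow> t \<le> 1 \<Longrightarrow> fib (x + t * v1) (y + t * v2)"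
    and box: "\<And>x y. \<bar>x - (x0 + v1)\<bar> \<le> r \<Longrightarrow> \<bar>y - (y0 + v2)\<bar> \<le> r \<Longrightarrow> fib x y"
    by (rule small_scale_geometry[OF fib0 r]) blast
  define V where "V x = (\<integral>\<^sup>+y. g (pt x y) \<partial>lborel)" for x
  define H where "H y = (\<integral>\<^sup>+x. g (pt x y) \<partial>lborel)" for y
  have [measurable]: "V \<in> borel_measurable borel" "H \<in> borel_measurable borel"
    unfolding V_def[abs_def] H_def[abs_def] by measurable
  have VI: "(\<integral>\<^sup>+x. V x \<partial>lborel) = (\<integral>\<^sup>+z. g z \<partial>lborel)" "(\<integral>\<^sup>+x. H x \<partial>lborel) = (\<integral>\<^sup>+z. g z \<partial>lborel)"
    unfolding V_def H_def using nn_integral_real2[OF g] by simp_all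
  \<comment> \<open>Both axis-parallel lines through \<open>z\<close> and both through its shift are
    included, so that the same function serves at either end. The summands \<open>+ 0\<close> match
    the form of \<open>bx_integral_le\<close>.\<close>
  define \<Phi> :: "real^2 \<Rightarrow> ennreal" where "\<Phi> z = (H (z $ 2 + 0) + V (z $ 1 + 0)) + (H (z $ 2 + v2) + V (z $ 1 + v1))" for z
  have \<Lambda>r: "6 * r \<le> \<Lambda> * r" using \<Lambda> r by simp
  have step: "ennreal \<bar>u (pt x y) - u (pt (x + v1) (y + v2))\<bar> \<le> H y + V x"
    if xy: "fib x y" "\<bar>x - x0\<bar> \<le> r" "\<bar>y - y0\<bar> \<le> r" for x y
  proof -
    have par: "\<exists>t. 0 \<le> t \<and> t \<le> 1 \<and> s = p + t * w" if "min p (p + w) \<le> s" "s \<le> max p (p + w)" for s p w :: real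
    proof (cases "w = 0")
      case True
      then show ?thesis using that by (intro exI[of _ 0]) auto
    next
      case False
      then show ?thesis using that
        by (intro exI[of _ "(s - p) / w"]) (auto simp: min_def max_def divide_le_eq zero_le_divide_iff split: if_splits)
    qed
    from v(3) show ?thesis
    proof
      assume v0: "v2 = 0"
      have "ennreal \<bar>u (pt x y) - u (pt (x + v1) y)\<bar> \<le> (\<integral>\<^sup>+s. g (pt s y) \<partial>lborel)"
      proof (rule upper_along_horizontal[OF ug])
        fix s assume "min x (x + v1) \<le> s" "s \<le> max x (x + v1)"
        then obtain t where "0 \<le> t" "t \<le> 1" "s = x + t * v1" using par by blast
        then show "fib s y" using move[OF xy(2,3,1), of t] v0 by simp
      qed (use xy v r \<Lambda>r in linarith)+
      then show ?thesis using v0 by (simp add: H_def add_increasing2)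
    next
      assume v0: "v1 = 0"
      have "ennreal \<bar>u (pt x y) - u (pt x (y + v2))\<bar> \<le> (\<integral>\<^sup>+s. g (pt x s) \<partial>lborel)"
      proof (rule upper_along_vertical[OF ug])
        fix s assume "min y (y + v2) \<le> s" "s \<le> max y (y + v2)"
        then obtain t where "0 \<le> t" "t \<le> 1" "s = y + t * v2" using par by blast
        then show "fib x s" using move[OF xy(2,3,1), of t] v0 by simp
      qed (use xy v r \<Lambda>r in linarith)+
      then show ?thesis using v0 by (simp add: V_def add_increasing)
    qed
  qed
  show ?thesis
  proof (intro exI[of _ \<Phi>] conjI ballI)
    show "\<Phi> \<in> borel_measurable borel" unfolding \<Phi>_def[abs_def] by measurable
    fix z z' assume zz: "z \<in> bx x0 y0 r" "z' \<in> bx x0 y0 r"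
    obtain x y x' y' where z: "z = pt x y" "z' = pt x' y'" by (metis pt_eta)
    have xy: "fib x y" "\<bar>x - x0\<bar> \<le> r" "\<bar>y - y0\<bar> \<le> r" and xy': "fib x' y'" "\<bar>x' - x0\<bar> \<le> r" "\<bar>y' - y0\<bar> \<le> r"
      using zz by (auto simp: z)
    let ?a = "u (pt (x + v1) (y + v2))" and ?b = "u (pt (x' + v1) (y + v2))" and ?c = "u (pt (x' + v1) (y' + v2))"
    have 1: "ennreal \<bar>u z - ?a\<bar> \<le> H y + V x" unfolding z by (rule step[OF xy])
    have 2: "ennreal \<bar>?a - ?b\<bar> \<le> H (y + v2)"
      unfolding H_def
    proof (rule upper_along_horizontal[OF ug])
      fix s assume "min (x + v1) (x' + v1) \<le> s" "s \<le> max (x + v1) (x' + v1)"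
      then show "fib s (y + v2)" using xy xy' by (intro box) (auto simp: min_def max_def split: if_splits)
    qed (use xy xy' v r \<Lambda>r in linarith)+
    have 3: "ennreal \<bar>?b - ?c\<bar> \<le> V (x' + v1)"
      unfolding V_def
    proof (rule upper_along_vertical[OF ug])
      fix s assume "min (y + v2) (y' + v2) \<le> s" "s \<le> max (y + v2) (y' + v2)"
      then show "fib (x' + v1) s" using xy xy' by (intro box) (auto simp: min_def max_def split: if_splits)
    qed (use xy xy' v r \<Lambda>r in linarith)+
    have 4: "ennreal \<bar>?c - u z'\<bar> \<le> H y' + V x'" using step[OF xy'] unfolding z by (simp add: abs_minus_commute)
    have "ennreal \<bar>u z - u z'\<bar> \<le> ennreal \<bar>u z - ?a\<bar> + (ennreal \<bar>?a - ?b\<bar> + (ennreal \<bar>?b - ?c\<bar> + ennreal \<bar>?c - u z'\<bar>))"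
      by (meson add_left_mono ennreal_abs_triangle order_trans)
    also have "\<dots> \<le> (H y + V x) + (H (y + v2) + (V (x' + v1) + (H y' + V x')))"
      by (intro add_mono 1 2 3 4)
    also have "\<dots> \<le> (H y + V x) + (H (y + v2) + (V (x' + v1) + (H y' + V x'))) + (V (x + v1) + H (y' + v2))" by simp
    also have "\<dots> = \<Phi> z + \<Phi> z'" by (simp add: \<Phi>_def z ac_simps)
    finally show "ennreal \<bar>u z - u z'\<bar> \<le> \<Phi> z + \<Phi> z'" .
  next
    have bV: "(\<integral>\<^sup>+z\<in>bx x0 y0 r. V (z $ 1 + v) \<partial>lborel) \<le> ennreal (2 * r) * (\<integral>\<^sup>+z. g z \<partial>lborel)" for v
      using bx_integral_le(1)[of V r v x0 y0] r unfolding VI by simp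
    have bH: "(\<integral>\<^sup>+z\<in>bx x0 y0 r. H (z $ 2 + v) \<partial>lborel) \<le> ennreal (2 * r) * (\<integral>\<^sup>+z. g z \<partial>lborel)" for v
      using bx_integral_le(2)[of H r v x0 y0] r unfolding VI by simp
    have "(\<integral>\<^sup>+z\<in>bx x0 y0 r. \<Phi> z \<partial>lborel) =
      ((\<integral>\<^sup>+z\<in>bx x0 y0 r. H (z $ 2 + 0) \<partial>lborel) + (\<integral>\<^sup>+z\<in>bx x0 y0 r. V (z $ 1 + 0) \<partial>lborel)) +
      ((\<integral>\<^sup>+z\<in>bx x0 y0 r. H (z $ 2 + v2) \<partial>lborel) + (\<integral>\<^sup>+z\<in>bx x0 y0 r. V (z $ 1 + v1) \<partial>lborel))"
      unfolding \<Phi>_def distrib_right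
      by (subst nn_integral_add, measurable, subst nn_integral_add, measurable, subst nn_integral_add, measurable)
    also have "\<dots> \<le> (ennreal (2 * r) * (\<integral>\<^sup>+z. g z \<partial>lborel) + ennreal (2 * r) * (\<integral>\<^sup>+z. g z \<partial>lborel)) +
       (ennreal (2 * r) * (\<integral>\<^sup>+z. g z \<partial>lborel) + ennreal (2 * r) * (\<integral>\<^sup>+z. g z \<partial>lborel))"
      by (intro add_mono bV bH)
    also have "\<dots> = ennreal (8 * r) * (\<integral>\<^sup>+z. g z \<partial>lborel)"
      using r by (simp add: distrib_right[symmetric] ennreal_plus[symmetric] del: ennreal_plus)
    finally show "(\<integral>\<^sup>+z\<in>bx x0 y0 r. \<Phi> z \<partial>lborel) \<le> ennreal (8 * r) * (\<integral>\<^sup>+z. g z \<partial>lborel)" .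
  qed
qed

text \<open>Averaging first over base points near \<open>c0\<close> and then over slopes selects a
  cheap curve. The bounds \<open>rho x / 2\<close> for the base point and \<open>1/2\<close> for the
  slope add up to \<open>rho x\<close>, so the vertical segment from \<open>y\<close> to the curve
  stays in the band around \<open>c0\<close>. The window of width \<open>4 * rho x\<close> is
  centred at \<open>y\<close> instead of \<open>c0\<close> to make the bound an explicit function of
  the point.\<close>

lemma pencil_choice:
  fixes G1 :: "real \<Rightarrow> ennreal" and G2 :: "real \<Rightarrow> real \<Rightarrow> ennreal"
  assumes [measurable]: "case_prod G2 \<in> borel_measurable (borel \<Otimes>\<^sub>M borel)"
    and G1: "\<And>c. G1 c = (\<integral>\<^sup>+\<tau>\<in>{-1/2..1/2}. G2 c \<tau> \<partial>lborel)"
    and fib: "fib x y" and pos: "0 < rho x"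
  obtains c0 c \<tau> where "c0 \<in> C" "\<bar>y - c0\<bar> = del y" "c \<in> C" "\<bar>c - c0\<bar> \<le> rho x / 2" "\<bar>\<tau>\<bar> \<le> 1/2"
    "G2 c \<tau> \<le> 2 * (ennreal (2 / (kapC * (rho x / 2) powr sC)) * (\<integral>\<^sup>+c. G1 c * indicator {y - 2 * rho x..y + 2 * rho x} c \<partial>MC))"
proof -
  have [measurable]: "G1 \<in> borel_measurable borel" unfolding G1[abs_def] by measurable
  obtain c0 \<tau>0 where c0: "c0 \<in> C" "\<bar>y - c0\<bar> = del y" by (rule fib_coordinates[OF fib]) blast
  have dl: "del y \<le> rho x" and x: "0 \<le> x" "x \<le> 1" using fib by (auto simp: fib_def)
  let ?A = "C \<inter> {c0 - rho x / 2..c0 + rho x / 2}"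
  have [measurable]: "C \<in> sets borel" using RC.closed_C by simp
  have "\<exists>c\<in>?A. G1 c \<le> ennreal (2 / (kapC * (rho x / 2) powr sC)) * (\<integral>\<^sup>+c\<in>?A. G1 c \<partial>MC)"
  proof (rule exists_le_average)
    have "ennreal (kapC * (rho x / 2) powr sC) \<le> emeasure MC {c0 - rho x / 2..c0 + rho x / 2}"
      using rho_le_1[OF x] pos by (intro emeasure_MC_ball_ge c0) auto
    also have "\<dots> = emeasure MC ?A"
      by (rule emeasure_eq_AE) (use AE_MC_in_C in auto)
    finally show "ennreal (kapC * (rho x / 2) powr sC) \<le> emeasure MC ?A" .
    show "0 < kapC * (rho x / 2) powr sC" using pos kapC by simp
  qed auto
  then obtain c where c: "c \<in> ?A" "G1 c \<le> ennreal (2 / (kapC * (rho x / 2) powr sC)) * (\<integral>\<^sup>+c\<in>?A. G1 c \<partial>MC)" by blast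
  have "(\<integral>\<^sup>+c\<in>?A. G1 c \<partial>MC) \<le> (\<integral>\<^sup>+c. G1 c * indicator {y - 2 * rho x..y + 2 * rho x} c \<partial>MC)"
  proof (intro nn_integral_mono)
    fix c
    have "c \<in> {y - 2 * rho x..y + 2 * rho x}" if "c \<in> ?A"
    proof -
      have "c0 - rho x / 2 \<le> c" "c \<le> c0 + rho x / 2" using that by auto
      then show ?thesis using c0(2) dl unfolding atLeastAtMost_iff by linarith
    qed
    then show "G1 c * indicator ?A c \<le> G1 c * indicator {y - 2 * rho x..y + 2 * rho x} c"
      by (simp add: indicator_def)
  qed
  then have Gc: "G1 c \<le> ennreal (2 / (kapC * (rho x / 2) powr sC)) * (\<integral>\<^sup>+c. G1 c * indicator {y - 2 * rho x..y + 2 * rho x} c \<partial>MC)"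
    using c(2) by (meson mult_left_mono order_trans zero_le)
  have "\<exists>\<tau>\<in>{-1/2..1/2}. G2 c \<tau> \<le> ennreal (2 / 1) * (\<integral>\<^sup>+\<tau>\<in>{-1/2..1/2}. G2 c \<tau> \<partial>lborel)"
    by (rule exists_le_average) auto
  then obtain \<tau> where \<tau>: "\<tau> \<in> {-1/2..1/2}" "G2 c \<tau> \<le> 2 * G1 c" by (auto simp: G1)
  show ?thesis
  proof (rule that[OF c0])
    show "c \<in> C" using c(1) by simp
    show "\<bar>c - c0\<bar> \<le> rho x / 2" using c(1) unfolding Int_iff atLeastAtMost_iff by linarith
    show "\<bar>\<tau>\<bar> \<le> 1/2" using \<tau>(1) by (auto simp: abs_le_iff)
    show "G2 c \<tau> \<le> 2 * (ennreal (2 / (kapC * (rho x / 2) powr sC)) * (\<integral>\<^sup>+c. G1 c * indicator {y - 2 * rho x..y + 2 * rho x} c \<partial>MC))"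
      using \<tau>(2) Gc by (meson mult_left_mono order_trans zero_le)
  qed
qed

text \<open>After Fubini each base point \<open>c\<close> is seen from a set of ordinates of length
  \<open>4 * rho x\<close>. Together with the kernel this leaves a multiple of
  \<open>rho x powr (1 - sC)\<close>, at most of order \<open>(M * r) powr (1 - sC)\<close>, and the
  abscissa contributes \<open>2 * r\<close>.\<close>

lemma pencil_average_integral:
  assumes [measurable]: "G1 \<in> borel_measurable borel" and r: "0 < r" and M: "0 < M"
    and rhoM: "\<And>x. \<bar>x - x0\<bar> \<le> r \<Longrightarrow> rho x \<le> M * r"
  shows "(\<integral>\<^sup>+z\<in>bx x0 y0 r. ennreal (2 / (kapC * (rho (z $ 1) / 2) powr sC)) * (\<integral>\<^sup>+c. G1 c * indicator {z $ 2 - 2 * rho (z $ 1)..z $ 2 + 2 * rho (z $ 1)} c \<partial>MC) \<partial>lborel)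
    \<le> ennreal (32 / kapC * (M * r) powr (1 - sC) * r) * (\<integral>\<^sup>+c. G1 c \<partial>MC)"
proof -
  interpret MC: sigma_finite_measure MC by (rule sigma_finite_MC)
  interpret P: pair_sigma_finite MC lborel ..
  have sC: "0 < sC" "sC < 1" by (rule cC.cdim_bounds)+
  define Kx where "Kx x = 2 / (kapC * (rho x / 2) powr sC)" for x
  define W where "W x y c = G1 c * (if \<bar>c - y\<bar> \<le> 2 * rho x then 1 else 0)" for x y c
  have W: "G1 c * indicator {y - 2 * rho x..y + 2 * rho x} c = W x y c" for x y c
    unfolding W_def indicator_def of_bool_def atLeastAtMost_iff by (auto simp: abs_le_iff)
  have [measurable]: "(\<lambda>(z :: real^2, c). W (z $ 1) (z $ 2) c) \<in> borel_measurable (borel \<Otimes>\<^sub>M borel)"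
    unfolding W_def by measurable
  have [measurable]: "(\<lambda>(c, y). W x y c) \<in> borel_measurable (borel \<Otimes>\<^sub>M borel)" for x
    unfolding W_def by measurable
  have [measurable]: "Kx \<in> borel_measurable borel" unfolding Kx_def[abs_def] by measurable
  have Kx: "0 \<le> Kx x" for x using kapC by (simp add: Kx_def)
  have "(\<integral>\<^sup>+z\<in>bx x0 y0 r. ennreal (Kx (z $ 1)) * (\<integral>\<^sup>+c. W (z $ 1) (z $ 2) c \<partial>MC) \<partial>lborel)
     = (\<integral>\<^sup>+x. \<integral>\<^sup>+y. ennreal (Kx x) * (\<integral>\<^sup>+c. W x y c \<partial>MC) * indicator (bx x0 y0 r) (pt x y) \<partial>lborel \<partial>lborel)"
    by (subst nn_integral_real2(1)) auto
  also have "\<dots> \<le> (\<integral>\<^sup>+x. ennreal (16 / kapC * (M * r) powr (1 - sC)) * (\<integral>\<^sup>+c. G1 c \<partial>MC) * indicator {x0 - r..x0 + r} x \<partial>lborel)"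
  proof (intro nn_integral_mono)
    fix x
    show "(\<integral>\<^sup>+y. ennreal (Kx x) * (\<integral>\<^sup>+c. W x y c \<partial>MC) * indicator (bx x0 y0 r) (pt x y) \<partial>lborel)
      \<le> ennreal (16 / kapC * (M * r) powr (1 - sC)) * (\<integral>\<^sup>+c. G1 c \<partial>MC) * indicator {x0 - r..x0 + r} x"
    proof (cases "\<bar>x - x0\<bar> \<le> r")
      case True
      have "(\<integral>\<^sup>+y. ennreal (Kx x) * (\<integral>\<^sup>+c. W x y c \<partial>MC) * indicator (bx x0 y0 r) (pt x y) \<partial>lborel)
        \<le> (\<integral>\<^sup>+y. ennreal (Kx x) * (\<integral>\<^sup>+c. W x y c \<partial>MC) \<partial>lborel)"
        by (intro nn_integral_mono) (simp add: indicator_def)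
      also have "\<dots> = ennreal (Kx x) * (\<integral>\<^sup>+y. \<integral>\<^sup>+c. W x y c \<partial>MC \<partial>lborel)"
        by (rule nn_integral_cmult) measurable
      also have "(\<integral>\<^sup>+y. \<integral>\<^sup>+c. W x y c \<partial>MC \<partial>lborel) = (\<integral>\<^sup>+c. \<integral>\<^sup>+y. W x y c \<partial>lborel \<partial>MC)"
        by (rule P.Fubini') measurable
      also have "\<dots> = (\<integral>\<^sup>+c. G1 c * ennreal (4 * rho x) \<partial>MC)"
      proof (intro nn_integral_cong)
        fix c
        have "(\<integral>\<^sup>+y. W x y c \<partial>lborel) = (\<integral>\<^sup>+y. G1 c * indicator {c - 2 * rho x..c + 2 * rho x} y \<partial>lborel)"
          unfolding W_def indicator_def of_bool_def atLeastAtMost_iff by (intro nn_integral_cong) (auto simp: abs_le_iff)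
        also have "\<dots> = G1 c * ennreal (4 * rho x)" by (subst nn_integral_cmult_indicator) auto
        finally show "(\<integral>\<^sup>+y. W x y c \<partial>lborel) = G1 c * ennreal (4 * rho x)" .
      qed
      also have "ennreal (Kx x) * \<dots> = ennreal (Kx x * (4 * rho x)) * (\<integral>\<^sup>+c. G1 c \<partial>MC)"
        using Kx by (simp add: nn_integral_multc ennreal_mult mult_ac)
      also have "\<dots> \<le> ennreal (16 / kapC * (M * r) powr (1 - sC)) * (\<integral>\<^sup>+c. G1 c \<partial>MC)"
      proof (intro mult_right_mono ennreal_leI)
        show "Kx x * (4 * rho x) \<le> 16 / kapC * (M * r) powr (1 - sC)"
        proof (cases "rho x = 0")
          case True then show ?thesis using kapC by simp
        next
          case False
          then have pos: "0 < rho x" using rho_nonneg[of x] by linarith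
          have "Kx x * (4 * rho x) = 2 powr sC * (8 / kapC) * rho x powr (1 - sC)"
            using pos kapC by (simp add: Kx_def powr_divide powr_diff powr_one field_simps)
          also have "\<dots> \<le> 2 powr 1 * (8 / kapC) * (M * r) powr (1 - sC)"
            using pos kapC sC rhoM[OF True] by (intro mult_mono powr_mono2 powr_mono) auto
          finally show ?thesis by simp
        qed
      qed simp
      finally show ?thesis using True by (auto simp: indicator_def abs_le_iff)
    qed simp
  qed
  also have "\<dots> = ennreal (16 / kapC * (M * r) powr (1 - sC)) * (\<integral>\<^sup>+c. G1 c \<partial>MC) * ennreal (2 * r)"
    using r by (simp add: nn_integral_cmult_indicator)
  also have "\<dots> = ennreal (32 / kapC * (M * r) powr (1 - sC) * r) * (\<integral>\<^sup>+c. G1 c \<partial>MC)"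
  proof -
    have "32 / kapC * (M * r) powr (1 - sC) * r = 16 / kapC * (M * r) powr (1 - sC) * (2 * r)" by simp
    then have "ennreal (32 / kapC * (M * r) powr (1 - sC) * r) = ennreal (16 / kapC * (M * r) powr (1 - sC)) * ennreal (2 * r)"
      using kapC r by (simp only:) (rule ennreal_mult, auto)
    then show ?thesis by (simp only: mult_ac)
  qed
  finally show ?thesis unfolding Kx_def W .
qed

text \<open>Each point moves vertically to a cheap curve of the pencil, along it to a column common
  to all points, and there vertically to the curve of the other point. The common column gives the
  constant \<open>c0\<close>. Points over \<open>K\<close> are left out because the choice of the
  curve needs \<open>rho\<close> to be positive.\<close>

lemma poincare_core_large:
  assumes R: "0 < R"
  shows "\<exists>\<Lambda>\<ge>6. \<exists>B>0. \<forall>x0 y0 r u g. fib x0 y0 \<and> 0 < r \<and> r \<le> R \<and> \<theta> * rho x0 \<le> 100 * r \<and>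
    g \<in> borel_measurable borel \<and> upper_along u g (bx x0 y0 (\<Lambda> * r)) \<longrightarrow>
    (\<exists>\<Phi> c0. \<Phi> \<in> borel_measurable borel \<and>
      (\<forall>z\<in>bx x0 y0 r. \<forall>z'\<in>bx x0 y0 r. 0 < rho (z $ 1) \<and> 0 < rho (z' $ 1) \<longrightarrow> ennreal \<bar>u z - u z'\<bar> \<le> \<Phi> z + \<Phi> z' + c0) \<and>
      (\<integral>\<^sup>+z\<in>bx x0 y0 r. \<Phi> z \<partial>lborel) \<le> ennreal (B * r) * (\<integral>\<^sup>+z. g z * ennreal (kw x0 r (z $ 1)) \<partial>lborel) \<and>
      c0 \<le> ennreal (B / r) * (\<integral>\<^sup>+z. g z * ennreal (kw x0 r (z $ 1)) \<partial>lborel))"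
proof -
  have t0: "0 < 100 / \<theta>" using \<theta> by simp
  have sC: "0 < sC" "sC < 1" by (rule cC.cdim_bounds)+
  define M where "M = 100 / \<theta> + 1"
  have M: "1 \<le> M" using t0 by (simp add: M_def)
  \<comment> \<open>A chosen base point lies within \<open>3/2 * (M * r)\<close> of its ordinate,
    and two ordinates of the box differ by at most \<open>2 * r\<close>.\<close>
  define A1 where "A1 = 2 + 3 * M"
  have A1: "0 < A1" using M by (simp add: A1_def)
  obtain A where A: "1 \<le> A" and large: "\<And>x0 r. 0 \<le> x0 \<Longrightarrow> x0 \<le> 1 \<Longrightarrow> 0 < r \<Longrightarrow> r \<le> R \<Longrightarrow> \<theta> * rho x0 \<le> 100 * r \<Longrightarrow>
    \<exists>\<xi>. 0 \<le> \<xi> \<and> \<xi> + r / A \<le> 1 \<and> (\<forall>x. \<xi> \<le> x \<and> x \<le> \<xi> + r / A \<longrightarrow> \<bar>x - x0\<bar> \<le> A * r \<and> r / A \<le> rho x \<and>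
      (\<forall>c1\<in>C. \<forall>c2\<in>C. \<forall>y. c1 \<le> c2 \<and> c2 - c1 \<le> A1 * r \<and> c1 - rho x \<le> y \<and> y \<le> c2 + rho x \<longrightarrow> fib x y))"
    by (rule large_scale_geometry[OF A1 R]) blast
  \<comment> \<open>Large enough to contain the chosen curves over all abscissas within
    \<open>A * r\<close> of \<open>x0\<close>.\<close>
  define \<Lambda> where "\<Lambda> = 2 * M + A + 6"
  \<comment> \<open>The three terms stand for the first vertical leg, the curves of the pencil and
    the common column.\<close>
  define B where "B = 2 + 128 / kapC * M * AC + 2 * A"
  have \<Lambda>: "6 \<le> \<Lambda>" using M A by (simp add: \<Lambda>_def)
  have B: "0 < B" using kapC M AC A by (simp add: B_def add_pos_pos)
  show ?thesis
  proof (rule exI[of _ \<Lambda>], intro conjI \<Lambda>, rule exI[of _ B], intro conjI B allI impI)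
    fix x0 y0 r u g
    assume "fib x0 y0 \<and> 0 < r \<and> r \<le> R \<and> \<theta> * rho x0 \<le> 100 * r \<and>
      g \<in> borel_measurable borel \<and> upper_along u g (bx x0 y0 (\<Lambda> * r))"
    then have fib0: "fib x0 y0" and r: "0 < r" "r \<le> R" and near: "\<theta> * rho x0 \<le> 100 * r"
      and g [measurable]: "g \<in> borel_measurable borel" and ug: "upper_along u g (bx x0 y0 (\<Lambda> * r))" by auto
    have x0: "0 \<le> x0" "x0 \<le> 1" using fib0 by (auto simp: fib_def)
    have rho0: "rho x0 \<le> (M - 1) * r" using near \<theta> by (simp add: M_def field_simps)
    have rhoM: "rho x \<le> M * r" if "\<bar>x - x0\<bar> \<le> r" for x
      using rho0 rho_lip[of x x0] that unfolding left_diff_distrib by linarith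
    have rhoA: "rho x \<le> (M + A) * r" if "\<bar>x - x0\<bar> \<le> A * r" for x
      using rho0 rho_lip[of x x0] that r unfolding left_diff_distrib distrib_right by linarith
    define V where "V x = (\<integral>\<^sup>+y. g (pt x y) \<partial>lborel)" for x
    have [measurable]: "V \<in> borel_measurable borel" unfolding V_def[abs_def] by measurable
    define G2 where "G2 c \<tau> = (\<integral>\<^sup>+x\<in>{0..1}. g (pt x (c + \<tau> * rho x)) \<partial>lborel)" for c \<tau>
    have G2m [measurable]: "case_prod G2 \<in> borel_measurable (borel \<Otimes>\<^sub>M borel)" unfolding G2_def by measurable
    define G1 where "G1 c = (\<integral>\<^sup>+\<tau>\<in>{-1/2..1/2}. G2 c \<tau> \<partial>lborel)" for c
    have [measurable]: "G1 \<in> borel_measurable borel" unfolding G1_def[abs_def] by measurable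
    define Hh where "Hh x y = ennreal (2 / (kapC * (rho x / 2) powr sC)) * (\<integral>\<^sup>+c. G1 c * indicator {y - 2 * rho x..y + 2 * rho x} c \<partial>MC)" for x y
    define W where "W = (\<integral>\<^sup>+z. g z * ennreal (kw x0 r (z $ 1)) \<partial>lborel)"
    have W: "W = (\<integral>\<^sup>+x. V x * ennreal (kw x0 r x) \<partial>lborel)"
      unfolding W_def V_def by (subst nn_integral_real2(1)) (auto simp: nn_integral_multc)
    have VW: "(\<integral>\<^sup>+x. V x \<partial>lborel) \<le> W"
      unfolding W
    proof (intro nn_integral_mono)
      fix x
      have "V x * ennreal 1 \<le> V x * ennreal (kw x0 r x)" by (intro mult_left_mono ennreal_leI kw_ge_1) auto
      then show "V x \<le> V x * ennreal (kw x0 r x)" by simp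
    qed
    obtain \<xi> where \<xi>: "0 \<le> \<xi>" "\<xi> + r / A \<le> 1"
      and \<xi>': "\<And>x. \<xi> \<le> x \<Longrightarrow> x \<le> \<xi> + r / A \<Longrightarrow> \<bar>x - x0\<bar> \<le> A * r"
      and \<xi>'': "\<And>x c1 c2 y. \<xi> \<le> x \<Longrightarrow> x \<le> \<xi> + r / A \<Longrightarrow> c1 \<in> C \<Longrightarrow> c2 \<in> C \<Longrightarrow> c1 \<le> c2 \<Longrightarrow> c2 - c1 \<le> A1 * r \<Longrightarrow>
         c1 - rho x \<le> y \<Longrightarrow> y \<le> c2 + rho x \<Longrightarrow> fib x y"
      using large[OF x0 r near] by metis
    have rA: "0 < r / A" using r A by simp
    \<comment> \<open>The common column is found by averaging over the strip of full columns, whose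
      width is \<open>r / A\<close>.\<close>
    have "\<exists>\<zeta>\<in>{\<xi>..\<xi> + r / A}. V \<zeta> \<le> ennreal (2 / (r / A)) * (\<integral>\<^sup>+x\<in>{\<xi>..\<xi> + r / A}. V x \<partial>lborel)"
      by (rule exists_le_average) (use rA in auto)
    then obtain \<zeta> where \<zeta>: "\<xi> \<le> \<zeta>" "\<zeta> \<le> \<xi> + r / A"
      and V\<zeta>: "V \<zeta> \<le> ennreal (2 / (r / A)) * (\<integral>\<^sup>+x\<in>{\<xi>..\<xi> + r / A}. V x \<partial>lborel)" by auto
    have \<zeta>01: "0 \<le> \<zeta>" "\<zeta> \<le> 1" and \<zeta>x: "\<bar>\<zeta> - x0\<bar> \<le> A * r" using \<zeta> \<xi> \<xi>'[of \<zeta>] by auto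
    define \<Phi> :: "real^2 \<Rightarrow> ennreal" where "\<Phi> z = V (z $ 1 + 0) + 4 * Hh (z $ 1) (z $ 2)" for z
    have Ar: "r \<le> A * r" "r \<le> \<Lambda> * r" "A * r \<le> \<Lambda> * r" using A \<Lambda> r M by (auto simp: \<Lambda>_def)
    have \<Lambda>r: "\<Lambda> * r = 2 * (M * r) + A * r + 6 * r" by (simp add: \<Lambda>_def algebra_simps)
    have Mr: "0 \<le> M * r" using M r by simp
    have choose: "\<exists>c \<tau>. c \<in> C \<and> \<bar>\<tau>\<bar> \<le> 1/2 \<and> \<bar>c - y\<bar> \<le> 3/2 * (M * r) \<and>
        ennreal \<bar>u (pt x y) - u (pt \<zeta> (c + \<tau> * rho \<zeta>))\<bar> \<le> V x + 4 * Hh x y \<and> \<bar>c + \<tau> * rho \<zeta> - y0\<bar> \<le> \<Lambda> * r"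
      if xy: "fib x y" "\<bar>x - x0\<bar> \<le> r" "\<bar>y - y0\<bar> \<le> r" and pos: "0 < rho x" for x y
    proof -
      have x: "0 \<le> x" "x \<le> 1" using xy by (auto simp: fib_def)
      obtain c0 c \<tau> where c0: "c0 \<in> C" "\<bar>y - c0\<bar> = del y" and c: "c \<in> C" "\<bar>c - c0\<bar> \<le> rho x / 2" and \<tau>: "\<bar>\<tau>\<bar> \<le> 1/2"
        and G: "G2 c \<tau> \<le> 2 * Hh x y"
        unfolding Hh_def by (rule pencil_choice[OF G2m G1_def xy(1) pos]) blast
      have dl: "del y \<le> rho x" using xy by (simp add: fib_def)
      have cy: "\<bar>c - y\<bar> \<le> 3/2 * (M * r)" using c(2) c0(2) dl rhoM[OF xy(2)] by linarith
      have \<tau>r: "\<bar>\<tau> * rho s\<bar> \<le> rho s / 2" for s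
        using \<tau> mult_right_mono[OF \<tau> rho_nonneg[of s]] by (simp add: abs_mult)
      have inbox: "\<bar>c + \<tau> * rho s - y0\<bar> \<le> \<Lambda> * r" if "\<bar>s - x0\<bar> \<le> A * r" for s
        using \<tau>r[of s] rhoA[OF that] cy xy(3) Mr r Ar(1) unfolding \<Lambda>r distrib_right by linarith
      have "ennreal \<bar>u (pt x y) - u (pt x (c + \<tau> * rho x))\<bar> \<le> V x"
        unfolding V_def
      proof (rule upper_along_vertical[OF ug])
        show "\<bar>c + \<tau> * rho x - y0\<bar> \<le> \<Lambda> * r" by (rule inbox) (use xy(2) Ar in linarith)
        fix s assume s: "min y (c + \<tau> * rho x) \<le> s" "s \<le> max y (c + \<tau> * rho x)"
        have "\<bar>s - c0\<bar> \<le> rho x" using s c(2) c0(2) dl \<tau>r[of x] by linarith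
        then show "fib x s" using del_le[OF c0(1), of s] x by (simp add: fib_def)
      qed (use xy Ar in linarith)+
      moreover have "ennreal \<bar>u (pt x (c + \<tau> * rho x)) - u (pt \<zeta> (c + \<tau> * rho \<zeta>))\<bar> \<le> 2 * G2 c \<tau>"
        unfolding G2_def
      proof (rule upper_along_graph[OF ug c(1)])
        fix s assume "min x \<zeta> \<le> s" "s \<le> max x \<zeta>"
        then have "\<bar>s - x0\<bar> \<le> A * r" using xy(2) \<zeta>x Ar by linarith
        then show "\<bar>c + \<tau> * rho s - y0\<bar> \<le> \<Lambda> * r" by (rule inbox)
      qed (use \<tau> x \<zeta>01 xy(2) \<zeta>x Ar in linarith)+
      moreover have "2 * G2 c \<tau> \<le> 4 * Hh x y"
        using mult_left_mono[OF G, of 2] by (simp add: mult.assoc[symmetric])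
      ultimately have "ennreal \<bar>u (pt x y) - u (pt \<zeta> (c + \<tau> * rho \<zeta>))\<bar> \<le> V x + 4 * Hh x y"
        by (meson add_mono ennreal_abs_triangle order_trans)
      then show ?thesis using c(1) \<tau> cy inbox[OF \<zeta>x] by blast
    qed
    show "\<exists>\<Phi> c0. \<Phi> \<in> borel_measurable borel \<and>
      (\<forall>z\<in>bx x0 y0 r. \<forall>z'\<in>bx x0 y0 r. 0 < rho (z $ 1) \<and> 0 < rho (z' $ 1) \<longrightarrow> ennreal \<bar>u z - u z'\<bar> \<le> \<Phi> z + \<Phi> z' + c0) \<and>
      (\<integral>\<^sup>+z\<in>bx x0 y0 r. \<Phi> z \<partial>lborel) \<le> ennreal (B * r) * (\<integral>\<^sup>+z. g z * ennreal (kw x0 r (z $ 1)) \<partial>lborel) \<and>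
      c0 \<le> ennreal (B / r) * (\<integral>\<^sup>+z. g z * ennreal (kw x0 r (z $ 1)) \<partial>lborel)"
      unfolding W_def[symmetric]
    proof (rule exI[of _ \<Phi>], rule exI[of _ "V \<zeta>"], intro conjI ballI impI)
      interpret MC: sigma_finite_measure MC by (rule sigma_finite_MC)
      define W' where "W' x y c = G1 c * (if \<bar>c - y\<bar> \<le> 2 * rho x then 1 else 0)" for x y c
      have W': "G1 c * indicator {y - 2 * rho x..y + 2 * rho x} c = W' x y c" for x y c
        unfolding W'_def indicator_def of_bool_def atLeastAtMost_iff by (auto simp: abs_le_iff)
      have [measurable]: "(\<lambda>(z :: real^2, c). W' (z $ 1) (z $ 2) c) \<in> borel_measurable (borel \<Otimes>\<^sub>M borel)"
        unfolding W'_def by measurable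
      have Hm [measurable]: "(\<lambda>z :: real^2. Hh (z $ 1) (z $ 2)) \<in> borel_measurable borel"
        unfolding Hh_def W' by measurable
      show "\<Phi> \<in> borel_measurable borel" unfolding \<Phi>_def[abs_def] by measurable
      {
        fix z z' assume zz: "z \<in> bx x0 y0 r" "z' \<in> bx x0 y0 r" and pos: "0 < rho (z $ 1) \<and> 0 < rho (z' $ 1)"
        obtain x y x' y' where z: "z = pt x y" "z' = pt x' y'" by (metis pt_eta)
        have xy: "fib x y" "\<bar>x - x0\<bar> \<le> r" "\<bar>y - y0\<bar> \<le> r" and xy': "fib x' y'" "\<bar>x' - x0\<bar> \<le> r" "\<bar>y' - y0\<bar> \<le> r"
          and pos: "0 < rho x" "0 < rho x'" using zz pos by (auto simp: z)
        obtain c \<tau> where c: "c \<in> C" "\<bar>\<tau>\<bar> \<le> 1/2" "\<bar>c - y\<bar> \<le> 3/2 * (M * r)" "\<bar>c + \<tau> * rho \<zeta> - y0\<bar> \<le> \<Lambda> * r"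
          and 1: "ennreal \<bar>u (pt x y) - u (pt \<zeta> (c + \<tau> * rho \<zeta>))\<bar> \<le> V x + 4 * Hh x y" using choose[OF xy pos(1)] by blast
        obtain c' \<tau>' where c': "c' \<in> C" "\<bar>\<tau>'\<bar> \<le> 1/2" "\<bar>c' - y'\<bar> \<le> 3/2 * (M * r)" "\<bar>c' + \<tau>' * rho \<zeta> - y0\<bar> \<le> \<Lambda> * r"
          and 2: "ennreal \<bar>u (pt x' y') - u (pt \<zeta> (c' + \<tau>' * rho \<zeta>))\<bar> \<le> V x' + 4 * Hh x' y'" using choose[OF xy' pos(2)] by blast
        let ?a = "u (pt \<zeta> (c + \<tau> * rho \<zeta>))" and ?b = "u (pt \<zeta> (c' + \<tau>' * rho \<zeta>))"
        have 3: "ennreal \<bar>?a - ?b\<bar> \<le> V \<zeta>"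
          unfolding V_def
        proof (rule upper_along_vertical[OF ug])
          have "A1 * r = 2 * r + 3 * (M * r)" by (simp add: A1_def algebra_simps)
          then have cc: "\<bar>c - c'\<bar> \<le> A1 * r" using c(3) c'(3) xy(3) xy'(3) by linarith
          fix s assume s: "min (c + \<tau> * rho \<zeta>) (c' + \<tau>' * rho \<zeta>) \<le> s" "s \<le> max (c + \<tau> * rho \<zeta>) (c' + \<tau>' * rho \<zeta>)"
          have "\<bar>\<tau> * rho \<zeta>\<bar> \<le> 1 * rho \<zeta>" "\<bar>\<tau>' * rho \<zeta>\<bar> \<le> 1 * rho \<zeta>"
            unfolding abs_mult using c(2) c'(2) rho_nonneg[of \<zeta>] by (intro mult_mono; simp)+
          then have "min c c' - rho \<zeta> \<le> s" "s \<le> max c c' + rho \<zeta>" using s by linarith+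
          then show "fib \<zeta> s"
            using \<xi>''[OF \<zeta>, of "min c c'" "max c c'" s] c(1) c'(1) cc by (auto simp: min_def max_def split: if_splits)
        qed (use \<zeta>x Ar c(4) c'(4) in linarith)+
        have "ennreal \<bar>u z - u z'\<bar> \<le> ennreal \<bar>u z - ?a\<bar> + (ennreal \<bar>?a - ?b\<bar> + ennreal \<bar>?b - u z'\<bar>)"
          by (meson add_left_mono ennreal_abs_triangle order_trans)
        also have "\<dots> \<le> (V x + 4 * Hh x y) + (V \<zeta> + (V x' + 4 * Hh x' y'))"
          using 1 2 3 unfolding z by (intro add_mono) (simp_all add: abs_minus_commute)
        also have "\<dots> = \<Phi> z + \<Phi> z' + V \<zeta>" by (simp add: \<Phi>_def z ac_simps)
        finally show "ennreal \<bar>u z - u z'\<bar> \<le> \<Phi> z + \<Phi> z' + V \<zeta>" .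
      }
      have P: "(\<integral>\<^sup>+c. G1 c \<partial>MC) \<le> ennreal AC * (\<integral>\<^sup>+x\<in>{0..1}. ennreal (rho x powr (sC - 1)) * V x \<partial>lborel)"
        unfolding G1_def G2_def V_def by (rule pencil) measurable
      \<comment> \<open>The factor \<open>r powr (1 - sC)\<close> from averaging over base points
        and the weight \<open>rho x powr (sC - 1)\<close> from \<open>pencil\<close> combine to the
        singular part of \<open>kw\<close>.\<close>
      have rP: "ennreal (r powr (1 - sC)) * (\<integral>\<^sup>+x\<in>{0..1}. ennreal (rho x powr (sC - 1)) * V x \<partial>lborel) \<le> W"
      proof -
        have "ennreal (r powr (1 - sC)) * (\<integral>\<^sup>+x\<in>{0..1}. ennreal (rho x powr (sC - 1)) * V x \<partial>lborel)
           = (\<integral>\<^sup>+x. ennreal (r powr (1 - sC)) * (ennreal (rho x powr (sC - 1)) * V x * indicator {0..1} x) \<partial>lborel)"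
          by (rule nn_integral_cmult[symmetric]) measurable
        also have "\<dots> \<le> W"
          unfolding W
        proof (intro nn_integral_mono)
          fix x
          have "r powr (1 - sC) * rho x powr (sC - 1) \<le> kw x0 r x"
          proof (cases "rho x = 0")
            case True then show ?thesis using kw_ge_1[of x0 r x] by simp
          next
            case False
            then have "r powr (1 - sC) * rho x powr (sC - 1) = (r / rho x) powr (1 - sC)"
              using r rho_nonneg[of x] by (simp add: powr_divide powr_diff powr_one field_simps)
            then show ?thesis using near by (simp add: kw_def)
          qed
          then have "ennreal (r powr (1 - sC)) * ennreal (rho x powr (sC - 1)) \<le> ennreal (kw x0 r x)"
            by (simp add: ennreal_mult[symmetric] ennreal_leI)
          then have "ennreal (r powr (1 - sC)) * ennreal (rho x powr (sC - 1)) * (V x * indicator {0..1} x) \<le> ennreal (kw x0 r x) * (V x * 1)"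
            by (intro mult_mono) (auto simp: indicator_def)
          then show "ennreal (r powr (1 - sC)) * (ennreal (rho x powr (sC - 1)) * V x * indicator {0..1} x) \<le> V x * ennreal (kw x0 r x)"
            by (simp add: mult_ac)
        qed
        finally show ?thesis .
      qed
      have "(\<integral>\<^sup>+z\<in>bx x0 y0 r. \<Phi> z \<partial>lborel) = (\<integral>\<^sup>+z\<in>bx x0 y0 r. V (z $ 1 + 0) \<partial>lborel) + 4 * (\<integral>\<^sup>+z\<in>bx x0 y0 r. Hh (z $ 1) (z $ 2) \<partial>lborel)"
        unfolding \<Phi>_def distrib_right mult.assoc
        by (subst nn_integral_add, measurable, subst nn_integral_cmult, measurable)
      also have "\<dots> \<le> ennreal (2 * r) * W + 4 * (ennreal (32 / kapC * (M * r) powr (1 - sC) * r) * (ennreal AC * (\<integral>\<^sup>+x\<in>{0..1}. ennreal (rho x powr (sC - 1)) * V x \<partial>lborel)))"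
      proof (intro add_mono mult_left_mono)
        show "(\<integral>\<^sup>+z\<in>bx x0 y0 r. V (z $ 1 + 0) \<partial>lborel) \<le> ennreal (2 * r) * W"
          by (rule order_trans[OF bx_integral_le(1) mult_left_mono[OF VW]]) (use r in auto)
        have "(\<integral>\<^sup>+z\<in>bx x0 y0 r. Hh (z $ 1) (z $ 2) \<partial>lborel) \<le> ennreal (32 / kapC * (M * r) powr (1 - sC) * r) * (\<integral>\<^sup>+c. G1 c \<partial>MC)"
          unfolding Hh_def by (rule pencil_average_integral) (use r M rhoM in auto)
        also have "\<dots> \<le> ennreal (32 / kapC * (M * r) powr (1 - sC) * r) * (ennreal AC * (\<integral>\<^sup>+x\<in>{0..1}. ennreal (rho x powr (sC - 1)) * V x \<partial>lborel))"
          by (intro mult_left_mono P) simp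
        finally show "(\<integral>\<^sup>+z\<in>bx x0 y0 r. Hh (z $ 1) (z $ 2) \<partial>lborel) \<le> ennreal (32 / kapC * (M * r) powr (1 - sC) * r) * (ennreal AC * (\<integral>\<^sup>+x\<in>{0..1}. ennreal (rho x powr (sC - 1)) * V x \<partial>lborel))" .
      qed simp
      also have "4 * (ennreal (32 / kapC * (M * r) powr (1 - sC) * r) * (ennreal AC * (\<integral>\<^sup>+x\<in>{0..1}. ennreal (rho x powr (sC - 1)) * V x \<partial>lborel)))
         = ennreal (128 / kapC * M powr (1 - sC) * AC * r) * (ennreal (r powr (1 - sC)) * (\<integral>\<^sup>+x\<in>{0..1}. ennreal (rho x powr (sC - 1)) * V x \<partial>lborel))"
      proof -
        have "128 / kapC * M powr (1 - sC) * AC * r * r powr (1 - sC) = 4 * (32 / kapC * (M * r) powr (1 - sC) * r) * AC"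
          by (simp add: powr_mult)
        then have "ennreal (128 / kapC * M powr (1 - sC) * AC * r) * ennreal (r powr (1 - sC)) = 4 * ennreal (32 / kapC * (M * r) powr (1 - sC) * r) * ennreal AC"
          using kapC AC r by (simp add: ennreal_mult[symmetric] flip: ennreal_numeral)
        then show ?thesis by (simp add: mult.assoc[symmetric])
      qed
      also have "ennreal (2 * r) * W + \<dots> \<le> ennreal (2 * r) * W + ennreal (128 / kapC * M powr (1 - sC) * AC * r) * W"
        by (intro add_left_mono mult_left_mono rP) simp
      also have "\<dots> = ennreal (2 * r + 128 / kapC * M powr (1 - sC) * AC * r) * W"
        using r kapC AC by (simp add: distrib_right[symmetric] ennreal_plus[symmetric] del: ennreal_plus)
      also have "\<dots> \<le> ennreal (B * r) * W"
      proof (intro mult_right_mono ennreal_leI)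
        have "M powr (1 - sC) \<le> M powr 1" using M sC by (intro powr_mono) auto
        then have "M powr (1 - sC) \<le> M" using M by (simp add: powr_one)
        then have "128 / kapC * M powr (1 - sC) * AC \<le> 128 / kapC * M * AC"
          using kapC AC by (intro mult_right_mono mult_left_mono) auto
        then have "2 + 128 / kapC * M powr (1 - sC) * AC \<le> B" using A by (simp add: B_def)
        then have "(2 + 128 / kapC * M powr (1 - sC) * AC) * r \<le> B * r" using r by (intro mult_right_mono) auto
        then show "2 * r + 128 / kapC * M powr (1 - sC) * AC * r \<le> B * r" by (simp only: distrib_right)
      qed simp
      finally show "(\<integral>\<^sup>+z\<in>bx x0 y0 r. \<Phi> z \<partial>lborel) \<le> ennreal (B * r) * W" .
      have "V \<zeta> \<le> ennreal (2 / (r / A)) * (\<integral>\<^sup>+x. V x \<partial>lborel)"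
        by (rule order_trans[OF V\<zeta>]) (auto intro!: mult_left_mono nn_integral_mono simp: indicator_def)
      also have "\<dots> \<le> ennreal (B / r) * W"
      proof (intro mult_mono VW ennreal_leI)
        have "2 * A \<le> B" using kapC M AC by (simp add: B_def)
        then show "2 / (r / A) \<le> B / r" using r A by (simp add: divide_right_mono)
      qed auto
      finally show "V \<zeta> \<le> ennreal (B / r) * W" .
    qed
  qed
qed

end

text \<open>The deviation of \<open>u x\<close> from the mean is at most the mean over
  \<open>y\<close> of the differences. Averaging once more over \<open>x\<close> counts
  \<open>\<Phi>\<close> twice, which gives the factor \<open>2 / m\<close>. The nested form of
  \<open>osc\<close> allows a null set of exceptional points.\<close>

lemma mean_oscillation_le:
  fixes u :: "'a \<Rightarrow> real"
  assumes A [measurable]: "A \<in> sets M" and m: "emeasure M A = ennreal m" "0 < m"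
    and u [measurable]: "(\<lambda>x. indicator A x * u x) \<in> borel_measurable M" and bdd: "\<And>x. x \<in> A \<Longrightarrow> \<bar>u x\<bar> \<le> K"
    and \<Phi> [measurable]: "\<Phi> \<in> borel_measurable M"
    and osc: "AE x in M. x \<in> A \<longrightarrow> (AE y in M. y \<in> A \<longrightarrow> ennreal \<bar>u x - u y\<bar> \<le> \<Phi> x + \<Phi> y + c0)"
  shows "ennreal ((LINT x:A|M. \<bar>u x - (LINT y:A|M. u y) / measure M A\<bar>) / measure M A)
    \<le> ennreal (2 / m) * (\<integral>\<^sup>+x\<in>A. \<Phi> x \<partial>M) + c0"
proof -
  have mA: "measure M A = m" using m by (simp add: measure_def)
  define uA where "uA = (LINT y:A|M. u y) / m"
  have fin: "emeasure M A < \<infinity>" using m by simp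
  have int: "integrable M (\<lambda>x. indicator A x * (v x :: real))"
    if "(\<lambda>x. indicator A x * v x) \<in> borel_measurable M" "\<And>x. x \<in> A \<Longrightarrow> \<bar>v x\<bar> \<le> K'" for v K'
  proof (rule integrableI_bounded_set[OF A])
    show "AE x in M. x \<in> A \<longrightarrow> norm (indicator A x * v x) \<le> K'" using that(2) by (auto simp: indicator_def)
  qed (use that fin in auto)
  have u_int: "integrable M (\<lambda>x. indicator A x * u x)" by (rule int[OF u bdd])
  have c_int: "integrable M (\<lambda>x. indicator A x * (c :: real))" for c using A fin by (intro integrable_mult_left integrable_real_indicator) auto
  have diff_meas: "(\<lambda>y. indicator A y * (c - u y)) \<in> borel_measurable M" for c :: real
  proof -
    have "(\<lambda>y. indicator A y * c - indicator A y * u y) \<in> borel_measurable M" by measurable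
    then show ?thesis by (simp add: right_diff_distrib)
  qed
  have abs_meas: "(\<lambda>y. indicator A y * \<bar>c - u y\<bar>) \<in> borel_measurable M" for c :: real
  proof -
    have "(\<lambda>y. \<bar>indicator A y * (c - u y)\<bar>) \<in> borel_measurable M" using diff_meas[of c] by (rule borel_measurable_abs)
    then show ?thesis by (simp add: abs_mult)
  qed
  have abs_int: "integrable M (\<lambda>y. indicator A y * \<bar>c - u y\<bar>)" for c
    by (rule int[OF abs_meas, of _ "\<bar>c\<bar> + K"]) (use bdd in fastforce)
  have to_nn: "ennreal (LINT y:A|M. \<bar>c - u y\<bar>) = (\<integral>\<^sup>+y\<in>A. ennreal \<bar>c - u y\<bar> \<partial>M)" for c
  proof -
    have "ennreal (LINT y:A|M. \<bar>c - u y\<bar>) = (\<integral>\<^sup>+y. ennreal (indicator A y * \<bar>c - u y\<bar>) \<partial>M)"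
      unfolding set_lebesgue_integral_def using abs_int[of c] by (subst nn_integral_eq_integral) auto
    also have "\<dots> = (\<integral>\<^sup>+y\<in>A. ennreal \<bar>c - u y\<bar> \<partial>M)"
      by (intro nn_integral_cong) (simp add: indicator_def)
    finally show ?thesis .
  qed
  have dev: "ennreal \<bar>uA - u x\<bar> \<le> ennreal (1 / m) * (\<integral>\<^sup>+y\<in>A. ennreal \<bar>u x - u y\<bar> \<partial>M)" for x
  proof -
    have "(LINT y:A|M. u x - u y) = (LINT y|M. indicator A y * u x - indicator A y * u y)"
      by (simp add: set_lebesgue_integral_def right_diff_distrib)
    also have "\<dots> = m * u x - (LINT y:A|M. u y)"
      using c_int u_int by (subst Bochner_Integration.integral_diff) (auto simp: set_lebesgue_integral_def mA)
    finally have e: "(LINT y:A|M. u x - u y) = m * u x - (LINT y:A|M. u y)" .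
    have "uA - u x = - (LINT y:A|M. u x - u y) / m" unfolding e uA_def using m by (simp add: field_simps)
    then have "\<bar>uA - u x\<bar> = \<bar>LINT y:A|M. u x - u y\<bar> / m" using m by simp
    also have "\<bar>LINT y:A|M. u x - u y\<bar> \<le> (LINT y:A|M. \<bar>u x - u y\<bar>)"
    proof -
      have "\<bar>LINT y|M. indicator A y * (u x - u y)\<bar> \<le> (LINT y|M. \<bar>indicator A y * (u x - u y)\<bar>)"
        by (rule integral_abs_bound)
      then show ?thesis by (simp add: set_lebesgue_integral_def abs_mult)
    qed
    finally have "\<bar>uA - u x\<bar> \<le> 1 / m * (LINT y:A|M. \<bar>u x - u y\<bar>)" using m by (simp add: divide_right_mono)
    then have "ennreal \<bar>uA - u x\<bar> \<le> ennreal (1 / m * (LINT y:A|M. \<bar>u x - u y\<bar>))" by (rule ennreal_leI)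
    also have "\<dots> = ennreal (1 / m) * (\<integral>\<^sup>+y\<in>A. ennreal \<bar>u x - u y\<bar> \<partial>M)"
      unfolding to_nn[symmetric] by (rule ennreal_mult') (use m in simp)
    finally show ?thesis .
  qed
  let ?I = "\<integral>\<^sup>+x\<in>A. \<Phi> x \<partial>M"
  have m1: "ennreal (1 / m) * ennreal m = 1" using m by (simp add: ennreal_mult[symmetric])
  have e1: "ennreal ((LINT x:A|M. \<bar>u x - uA\<bar>) / m) = ennreal (1 / m) * (\<integral>\<^sup>+x\<in>A. ennreal \<bar>uA - u x\<bar> \<partial>M)"
  proof -
    have "(LINT x:A|M. \<bar>u x - uA\<bar>) / m = 1 / m * (LINT x:A|M. \<bar>uA - u x\<bar>)" by (simp add: abs_minus_commute)
    then show ?thesis unfolding to_nn[symmetric] by (simp only:) (rule ennreal_mult', use m in simp)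
  qed
  have "(\<integral>\<^sup>+x\<in>A. ennreal \<bar>uA - u x\<bar> \<partial>M) \<le> (\<integral>\<^sup>+x\<in>A. \<Phi> x + (ennreal (1 / m) * ?I + c0) \<partial>M)"
  proof (rule nn_integral_mono_AE)
    from osc show "AE x in M. ennreal \<bar>uA - u x\<bar> * indicator A x \<le> (\<Phi> x + (ennreal (1 / m) * ?I + c0)) * indicator A x"
    proof eventually_elim
      case (elim x)
      show ?case
      proof (cases "x \<in> A")
        case True
        have "(\<integral>\<^sup>+y\<in>A. ennreal \<bar>u x - u y\<bar> \<partial>M) \<le> (\<integral>\<^sup>+y. (\<Phi> x + c0) * indicator A y + \<Phi> y * indicator A y \<partial>M)"
        proof (rule nn_integral_mono_AE)
          from elim True have "AE y in M. y \<in> A \<longrightarrow> ennreal \<bar>u x - u y\<bar> \<le> \<Phi> x + \<Phi> y + c0" by simp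
          then show "AE y in M. ennreal \<bar>u x - u y\<bar> * indicator A y \<le> (\<Phi> x + c0) * indicator A y + \<Phi> y * indicator A y"
            by eventually_elim (auto simp: indicator_def add_ac)
        qed
        also have "\<dots> = (\<Phi> x + c0) * ennreal m + ?I"
          by (subst nn_integral_add) (auto simp: nn_integral_cmult_indicator m)
        finally have "ennreal \<bar>uA - u x\<bar> \<le> ennreal (1 / m) * ((\<Phi> x + c0) * ennreal m + ?I)"
          using dev[of x] by (meson mult_left_mono order_trans zero_le)
        also have "\<dots> = (ennreal (1 / m) * ennreal m) * (\<Phi> x + c0) + ennreal (1 / m) * ?I"
          by (simp add: distrib_left mult_ac)
        also have "\<dots> = \<Phi> x + (ennreal (1 / m) * ?I + c0)" unfolding m1 by (simp add: add_ac)
        finally show ?thesis using True by simp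
      qed simp
    qed
  qed
  also have "\<dots> = ?I + (ennreal (1 / m) * ?I + c0) * ennreal m"
    unfolding distrib_right[of _ _ "indicator _ _"]
    by (subst nn_integral_add) (auto simp: nn_integral_cmult_indicator m distrib_right[symmetric])
  finally have "ennreal (1 / m) * (\<integral>\<^sup>+x\<in>A. ennreal \<bar>uA - u x\<bar> \<partial>M) \<le> ennreal (1 / m) * (?I + (ennreal (1 / m) * ?I + c0) * ennreal m)"
    by (rule mult_left_mono) simp
  also have "\<dots> = ennreal (1 / m) * ?I + (ennreal (1 / m) * ennreal m) * (ennreal (1 / m) * ?I + c0)"
    by (simp add: distrib_left mult_ac)
  also have "\<dots> = ennreal (2 / m) * ?I + c0"
  proof -
    have "ennreal (2 / m) = ennreal (1 / m) + ennreal (1 / m)" using m by (simp add: ennreal_plus[symmetric] del: ennreal_plus)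
    then show ?thesis unfolding m1 by (simp add: distrib_right add_ac)
  qed
  finally show ?thesis unfolding mA uA_def[symmetric] e1 .
qed

lemma emeasure_square:
  assumes "0 \<le> s"
  shows "emeasure lborel (cbox (pt x y) (pt (x + s) (y + s))) = ennreal (s\<^sup>2)"
  using assms by (simp add: emeasure_lborel_cbox_eq Basis_real2 inner_axis axis_eq_axis power2_eq_square)

section \<open>The space with its length metric: volume of balls and Poincare inequality\<close>

context construction
begin

text \<open>Choosing one constant gives a fixed term with which \<open>quasiconvex_compact\<close>
  can be instantiated.\<close>

definition Lc :: real where
  "Lc = (SOME L. 1 \<le> L \<and> (\<forall>z\<in>S. \<forall>z'\<in>S. joinable (L * dist z z') z z'))"

lemma Lc: "1 \<le> Lc" "z \<in> S \<Longrightarrow> z' \<in> S \<Longrightarrow> joinable (Lc * dist z z') z z'"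
  using someI_ex[of "\<lambda>L. 1 \<le> L \<and> (\<forall>z\<in>S. \<forall>z'\<in>S. joinable (L * dist z z') z z')"] quasiconvex_S
  unfolding Lc_def[symmetric] by auto

sublocale QC: quasiconvex_compact S Lc
  by unfold_locales (use compact_S Lc in \<open>auto simp: joinable_def\<close>)

abbreviation X where "X \<equiv> QC.X"

definition mu :: "(real^2) measure" where "mu = restrict_space lborel S"

lemma space_mu [simp]: "space mu = S" by (simp add: mu_def space_restrict_space)

lemma sets_mu: "sets mu = sets (mborel X)"
  unfolding mu_def QC.sets_mborel_X by (simp add: sets_restrict_space)

lemma in_sets_mu: "A \<in> sets borel \<Longrightarrow> A \<subseteq> S \<Longrightarrow> A \<in> sets mu"
  unfolding mu_def by (subst sets_restrict_space_iff) auto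

lemma emeasure_mu: "A \<subseteq> S \<Longrightarrow> emeasure mu A = emeasure lborel A"
  unfolding mu_def by (subst emeasure_restrict_space) auto

lemma nn_integral_mu: "(\<integral>\<^sup>+z. f z \<partial>mu) = (\<integral>\<^sup>+z\<in>S. f z \<partial>lborel)"
  unfolding mu_def by (subst nn_integral_restrict_space) auto

lemma open_ball: "openin (top_of_set S) (mball_of X z r)"
proof -
  have "openin (mtopology_of X) (mball_of X z r)"
    unfolding mtopology_of_def mball_of_def by (rule Metric_space.openin_mball, rule Metric_space_mspace_mdist)
  then show ?thesis by (simp add: QC.mtopology_X)
qed

lemma ball_subset: "mball_of X z r \<subseteq> S" by auto

lemma borel_ball [measurable]: "mball_of X z r \<in> sets borel"
  using open_ball[of z r] borel_S by (auto simp: openin_open)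

lemma ball_subset_bx: "z \<in> S \<Longrightarrow> mball_of X z r \<subseteq> bx (z $ 1) (z $ 2) r"
proof
  fix w assume z: "z \<in> S" and w: "w \<in> mball_of X z r"
  then have "dist z w < r" using QC.ldist_bounds(1)[of z w] by auto
  then show "w \<in> bx (z $ 1) (z $ 2) r"
    using w nth_diff_le_dist[of w 1 z] nth_diff_le_dist[of w 2 z] by (auto simp: bx_def dist_commute)
qed

lemma bx_subset_ball:
  assumes z: "z \<in> S" and \<rho>: "2 * Lc * \<rho> < r"
  shows "bx (z $ 1) (z $ 2) \<rho> \<subseteq> mball_of X z r"
proof
  fix w assume w: "w \<in> bx (z $ 1) (z $ 2) \<rho>"
  then have wS: "w \<in> S" by (simp add: bx_def)
  have "dist z w \<le> \<bar>z $ 1 - w $ 1\<bar> + \<bar>z $ 2 - w $ 2\<bar>" using dist_pt_le[of "z $ 1" "z $ 2" "w $ 1" "w $ 2"] by simp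
  also have "\<dots> \<le> 2 * \<rho>" using w by (simp add: bx_def abs_minus_commute)
  finally have "Lc * dist z w \<le> Lc * (2 * \<rho>)" using Lc(1) by (intro mult_left_mono) auto
  then have "QC.ldist z w < r" using QC.ldist_bounds(2)[OF z wS] \<rho> by simp
  then show "w \<in> mball_of X z r" using z wS by simp
qed

lemma emeasure_bx_le: "0 \<le> r \<Longrightarrow> emeasure lborel (bx x0 y0 r) \<le> ennreal (4 * r\<^sup>2)"
proof -
  assume r: "0 \<le> r"
  have "emeasure lborel (bx x0 y0 r) \<le> emeasure lborel (cbox (pt (x0 - r) (y0 - r)) (pt (x0 - r + 2 * r) (y0 - r + 2 * r)))"
    by (intro emeasure_mono) (auto simp: bx_def mem_box_cart forall_2 abs_le_iff)
  also have "\<dots> = ennreal (4 * r\<^sup>2)" using r by (subst emeasure_square) (auto simp: power2_eq_square)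
  finally show ?thesis .
qed

lemma square_in_ball:
  assumes R: "0 < R"
  shows "\<exists>B\<ge>1. \<forall>z r. z \<in> S \<and> 0 < r \<and> r \<le> R \<longrightarrow>
    (\<exists>x1 y1. cbox (pt x1 y1) (pt (x1 + r / B) (y1 + r / B)) \<subseteq> mball_of X z r)"
proof -
  obtain B where B: "1 \<le> B" and sq: "\<And>x0 y0 r. fib x0 y0 \<Longrightarrow> 0 < r \<Longrightarrow> r \<le> R \<Longrightarrow>
    \<exists>x1 y1. \<forall>x y. x1 \<le> x \<and> x \<le> x1 + r / B \<and> y1 \<le> y \<and> y \<le> y1 + r / B \<longrightarrow>
     fib x y \<and> \<bar>x - x0\<bar> \<le> B * r \<and> \<bar>y - y0\<bar> \<le> B * r"
    using interior_square[OF R] by metis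
  \<comment> \<open>The interior square is taken at radius \<open>r / k\<close>, so that the box
    containing it has metric radius at most \<open>r / 2\<close>.\<close>
  define k where "k = 4 * Lc * B"
  have k: "1 \<le> k" using Lc(1) B mult_mono[of 1 Lc 1 B] by (simp add: k_def)
  show ?thesis
  proof (rule exI[of _ "k * B"], intro conjI allI impI)
    show "1 \<le> k * B" using k B mult_mono[of 1 k 1 B] by simp
    fix z r assume h: "z \<in> S \<and> 0 < r \<and> r \<le> R"
    have r': "0 < r / k" "r / k \<le> R" using h k by (auto simp: divide_le_eq intro: order_trans[OF _ mult_left_mono[of 1 k R, simplified]])
    have "fib (z $ 1) (z $ 2)" using h by (simp add: S_def)
    from sq[OF this r'] obtain x1 y1 where q: "\<And>x y. x1 \<le> x \<Longrightarrow> x \<le> x1 + r / k / B \<Longrightarrow> y1 \<le> y \<Longrightarrow> y \<le> y1 + r / k / B \<Longrightarrow>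
      fib x y \<and> \<bar>x - z $ 1\<bar> \<le> B * (r / k) \<and> \<bar>y - z $ 2\<bar> \<le> B * (r / k)" by blast
    have "cbox (pt x1 y1) (pt (x1 + r / (k * B)) (y1 + r / (k * B))) \<subseteq> bx (z $ 1) (z $ 2) (B * (r / k))"
      using q by (auto simp: bx_def mem_box_cart forall_2 S_def divide_divide_eq_left)
    also have "\<dots> \<subseteq> mball_of X z r"
    proof (rule bx_subset_ball)
      have e: "2 * Lc * (B * (r / k)) = r / 2" using Lc(1) B by (simp add: k_def)
      show "2 * Lc * (B * (r / k)) < r" unfolding e using h by simp
    qed (use h in simp)
    finally show "\<exists>x1 y1. cbox (pt x1 y1) (pt (x1 + r / (k * B)) (y1 + r / (k * B))) \<subseteq> mball_of X z r" by blast
  qed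
qed

text \<open>An upper bound for the diameter; balls of radius at least \<open>R0\<close> are the
  whole space, which reduces everything to bounded radii.\<close>

definition R0 :: real where "R0 = Lc * (bet + 10)"

lemma R0: "0 < R0" using Lc(1) bet by (simp add: R0_def)

lemma ldist_lt_R0: "z \<in> S \<Longrightarrow> w \<in> S \<Longrightarrow> QC.ldist z w < R0"
proof -
  assume zw: "z \<in> S" "w \<in> S"
  have b: "fib (z $ 1) (z $ 2)" "fib (w $ 1) (w $ 2)" using zw by (auto simp: S_def)
  have "dist z w \<le> \<bar>z $ 1 - w $ 1\<bar> + \<bar>z $ 2 - w $ 2\<bar>" using dist_pt_le[of "z $ 1" "z $ 2" "w $ 1" "w $ 2"] by simp
  also have "\<dots> < bet + 10" using fib_bounds[OF b(1)] fib_bounds[OF b(2)] by linarith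
  finally have "Lc * dist z w < Lc * (bet + 10)" using Lc(1) by simp
  then show ?thesis using QC.ldist_bounds(2)[OF zw] by (simp add: R0_def)
qed

lemma ball_R0: "z \<in> S \<Longrightarrow> R0 \<le> r \<Longrightarrow> mball_of X z r = S"
  using ldist_lt_R0 by fastforce

lemma emeasure_ball_le:
  assumes "z \<in> S" "0 < r"
  shows "emeasure mu (mball_of X z r) \<le> ennreal (4 * r\<^sup>2)"
proof -
  have "emeasure mu (mball_of X z r) = emeasure lborel (mball_of X z r)" by (rule emeasure_mu[OF ball_subset])
  also have "\<dots> \<le> emeasure lborel (bx (z $ 1) (z $ 2) r)"
    by (intro emeasure_mono ball_subset_bx assms) auto
  also have "\<dots> \<le> ennreal (4 * r\<^sup>2)" by (rule emeasure_bx_le) (use assms in simp)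
  finally show ?thesis .
qed

lemma emeasure_ball_ge:
  obtains B where "1 \<le> B" "\<And>z r. z \<in> S \<Longrightarrow> 0 < r \<Longrightarrow> r \<le> R0 \<Longrightarrow> ennreal ((r / B)\<^sup>2) \<le> emeasure mu (mball_of X z r)"
    "\<And>z r. z \<in> S \<Longrightarrow> 0 < r \<Longrightarrow> r \<le> R0 \<Longrightarrow> ennreal (r / B) \<le> mdiam X (mball_of X z r)"
proof -
  obtain B where B: "1 \<le> B" and sq: "\<And>z r. z \<in> S \<Longrightarrow> 0 < r \<Longrightarrow> r \<le> R0 \<Longrightarrow>
    \<exists>x1 y1. cbox (pt x1 y1) (pt (x1 + r / B) (y1 + r / B)) \<subseteq> mball_of X z r"
    using square_in_ball[OF R0] by metis
  show ?thesis
  proof (rule that[OF B])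
    fix z r assume h: "z \<in> S" "0 < r" "r \<le> R0"
    from sq[OF h] obtain x1 y1 where q: "cbox (pt x1 y1) (pt (x1 + r / B) (y1 + r / B)) \<subseteq> mball_of X z r" by blast
    have rB: "0 \<le> r / B" using h B by simp
    have "ennreal ((r / B)\<^sup>2) = emeasure lborel (cbox (pt x1 y1) (pt (x1 + r / B) (y1 + r / B)))"
      by (rule emeasure_square[OF rB, symmetric])
    also have "\<dots> \<le> emeasure lborel (mball_of X z r)" using q by (intro emeasure_mono) auto
    finally show "ennreal ((r / B)\<^sup>2) \<le> emeasure mu (mball_of X z r)" by (simp add: emeasure_mu[OF ball_subset])
    let ?a = "pt x1 y1" and ?b = "pt (x1 + r / B) y1"
    have ab: "?a \<in> mball_of X z r" "?b \<in> mball_of X z r"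
      using q rB by (auto simp: mem_box_cart forall_2 subset_eq simp del: in_mball_of)
    have "r / B \<le> dist ?a ?b" using nth_diff_le_dist[of ?b 1 ?a] rB h B by (simp add: dist_commute)
    also have "\<dots> \<le> mdist X ?a ?b" using QC.ldist_bounds(1)[of ?a ?b] ab by auto
    finally have "ennreal (r / B) \<le> ennreal (mdist X ?a ?b)" by (rule ennreal_leI)
    also have "\<dots> \<le> mdiam X (mball_of X z r)"
      unfolding mdiam_def using ab by (intro SUP_upper2[of ?a] SUP_upper2[of ?b]) auto
    finally show "ennreal (r / B) \<le> mdiam X (mball_of X z r)" .
  qed
qed

lemma ahlfors_regular_X: "ahlfors_regular X mu 2"
proof -
  obtain B where B: "1 \<le> B" and low: "\<And>z r. z \<in> S \<Longrightarrow> 0 < r \<Longrightarrow> r \<le> R0 \<Longrightarrow> ennreal ((r / B)\<^sup>2) \<le> emeasure mu (mball_of X z r)"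
    by (rule emeasure_ball_ge) blast
  show ?thesis
    unfolding ahlfors_regular_def
  proof (intro exI[of _ "B\<^sup>2 + 4"] conjI ballI allI impI)
    show "0 < B\<^sup>2 + 4" by (simp add: add_nonneg_pos)
    fix z r assume z: "z \<in> mspace X" and r: "0 < r" and diam: "ennreal r < mdiam X (mspace X)"
    have "mdiam X (mspace X) \<le> ennreal R0"
      unfolding mdiam_def using ldist_lt_R0 by (intro SUP_least ennreal_leI) (auto simp: less_imp_le)
    then have "ennreal r < ennreal R0" using diam by (rule less_le_trans[rotated])
    then have rR: "r \<le> R0" using r by (simp add: ennreal_less_iff)
    have r2: "r powr 2 = r\<^sup>2" using r by (simp add: powr_numeral)
    have "r\<^sup>2 / (B\<^sup>2 + 4) \<le> r\<^sup>2 / B\<^sup>2" using B by (intro divide_left_mono) (auto simp: add_pos_nonneg)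
    then have "ennreal (r powr 2 / (B\<^sup>2 + 4)) \<le> ennreal ((r / B)\<^sup>2)" unfolding r2 by (simp add: power_divide ennreal_leI)
    also have "\<dots> \<le> emeasure mu (mball_of X z r)" using low z r rR by simp
    finally show "ennreal (r powr 2 / (B\<^sup>2 + 4)) \<le> emeasure mu (mball_of X z r)" .
    have "emeasure mu (mball_of X z r) \<le> ennreal (4 * r\<^sup>2)" using emeasure_ball_le z r by simp
    also have "\<dots> \<le> ennreal ((B\<^sup>2 + 4) * r powr 2)" unfolding r2 by (intro ennreal_leI mult_right_mono) auto
    finally show "emeasure mu (mball_of X z r) \<le> ennreal ((B\<^sup>2 + 4) * r powr 2)" .
  qed
qed

text \<open>The value \<open>t = (i / N) powr (1 / q)\<close> makes the two terms equal. For
  \<open>i = 0\<close> the second term is made arbitrarily small instead.\<close>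

lemma young_optimise:
  fixes W :: ennreal
  assumes q: "1 < q" and W: "\<And>t. 0 < t \<Longrightarrow> W \<le> ennreal (t powr (1 - q)) * ennreal i + ennreal t * ennreal N"
    and i: "0 \<le> i" and N: "0 < N"
  shows "W \<le> ennreal (2 * i powr (1 / q) * N powr (1 - 1 / q))"
proof (cases "i = 0")
  case True
  have "W \<le> 0"
  proof (rule ennreal_le_epsilon)
    fix e :: real assume e: "0 < e"
    have "ennreal (e / N) * ennreal N = ennreal e" using e N by (simp add: ennreal_mult[symmetric])
    then show "W \<le> 0 + ennreal e" using W[of "e / N"] True e N by simp
  qed
  then show ?thesis by simp
next
  case False
  define t where "t = (i / N) powr (1 / q)"
  have t: "0 < t" using False i N by (simp add: t_def)
  have "t powr (1 - q) * i = i powr (1 / q) * N powr (1 - 1 / q)"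
  proof -
    have "t powr (1 - q) = (i / N) powr (1 / q - 1)" using q by (simp add: t_def powr_powr right_diff_distrib diff_divide_distrib)
    also have "\<dots> = i powr (1 / q - 1) * N powr (1 - 1 / q)"
      using i N False by (simp add: powr_divide powr_diff powr_one field_simps)
    finally have "t powr (1 - q) * i = (i powr (1 / q - 1) * i powr 1) * N powr (1 - 1 / q)" using i by (simp add: powr_one)
    then show ?thesis by (simp only: powr_add[symmetric]) simp
  qed
  moreover have "t * N = i powr (1 / q) * N powr (1 - 1 / q)"
    using N i by (simp add: t_def powr_divide powr_diff powr_one)
  ultimately have "ennreal (t powr (1 - q)) * ennreal i + ennreal t * ennreal N = ennreal (2 * i powr (1 / q) * N powr (1 - 1 / q))"
    using t i N by (simp add: ennreal_mult[symmetric] ennreal_plus[symmetric] del: ennreal_plus)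
  then show ?thesis using W[OF t] by simp
qed

text \<open>The core estimates bound the mean oscillation by a multiple of \<open>W / r\<close>,
  where \<open>W\<close> is the integral of \<open>g\<close> against the weight. Hoelder's
  inequality and the weight integral \<open>N0 * r\<^sup>2\<close> bound \<open>W\<close> by a
  multiple of \<open>i powr (1 / q) * (r\<^sup>2) powr (1 - 1 / q)\<close>. Dividing by
  \<open>r\<close> leaves \<open>r\<close> times the \<open>q\<close>-average of \<open>g\<close>,
  because balls have volume comparable with \<open>r\<^sup>2\<close> and diameter at least of order
  \<open>r\<close>.\<close>

lemma poincare_X:
  assumes q: "1 < q" "1 - sC < (1 - sK) * (q - 1)"
  shows "poincare_inequality X mu q"
proof -
  obtain \<Lambda> B1 where \<Lambda>: "6 \<le> \<Lambda>" and B1: "0 < B1" and large: "\<And>x0 y0 r u g. fib x0 y0 \<Longrightarrow> 0 < r \<Longrightarrow> r \<le> R0 \<Longrightarrow> \<theta> * rho x0 \<le> 100 * r \<Longrightarrow>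
    g \<in> borel_measurable borel \<Longrightarrow> upper_along u g (bx x0 y0 (\<Lambda> * r)) \<Longrightarrow>
    (\<exists>\<Phi> c0. \<Phi> \<in> borel_measurable borel \<and>
      (\<forall>z\<in>bx x0 y0 r. \<forall>z'\<in>bx x0 y0 r. 0 < rho (z $ 1) \<and> 0 < rho (z' $ 1) \<longrightarrow> ennreal \<bar>u z - u z'\<bar> \<le> \<Phi> z + \<Phi> z' + c0) \<and>
      (\<integral>\<^sup>+z\<in>bx x0 y0 r. \<Phi> z \<partial>lborel) \<le> ennreal (B1 * r) * (\<integral>\<^sup>+z. g z * ennreal (kw x0 r (z $ 1)) \<partial>lborel) \<and>
      c0 \<le> ennreal (B1 / r) * (\<integral>\<^sup>+z. g z * ennreal (kw x0 r (z $ 1)) \<partial>lborel))"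
  proof -
    from poincare_core_large[OF R0] obtain \<Lambda> B where "6 \<le> \<Lambda>" "0 < B" and H: "\<forall>x0 y0 r u g. fib x0 y0 \<and> 0 < r \<and> r \<le> R0 \<and> \<theta> * rho x0 \<le> 100 * r \<and>
      g \<in> borel_measurable borel \<and> upper_along u g (bx x0 y0 (\<Lambda> * r)) \<longrightarrow>
      (\<exists>\<Phi> c0. \<Phi> \<in> borel_measurable borel \<and>
        (\<forall>z\<in>bx x0 y0 r. \<forall>z'\<in>bx x0 y0 r. 0 < rho (z $ 1) \<and> 0 < rho (z' $ 1) \<longrightarrow> ennreal \<bar>u z - u z'\<bar> \<le> \<Phi> z + \<Phi> z' + c0) \<and>
        (\<integral>\<^sup>+z\<in>bx x0 y0 r. \<Phi> z \<partial>lborel) \<le> ennreal (B * r) * (\<integral>\<^sup>+z. g z * ennreal (kw x0 r (z $ 1)) \<partial>lborel) \<and>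
        c0 \<le> ennreal (B / r) * (\<integral>\<^sup>+z. g z * ennreal (kw x0 r (z $ 1)) \<partial>lborel))"
      by (elim exE conjE) rule
    show ?thesis by (rule that[OF \<open>6 \<le> \<Lambda>\<close> \<open>0 < B\<close>], rule H[rule_format]) simp
  qed
  define B2 where "B2 = max B1 8"
  have B2: "0 < B2" "B1 \<le> B2" "8 \<le> B2" by (auto simp: B2_def)
  have core: "\<exists>\<Phi> c0. \<Phi> \<in> borel_measurable borel \<and>
      (\<forall>z\<in>bx x0 y0 r. \<forall>z'\<in>bx x0 y0 r. 0 < rho (z $ 1) \<and> 0 < rho (z' $ 1) \<longrightarrow> ennreal \<bar>u z - u z'\<bar> \<le> \<Phi> z + \<Phi> z' + c0) \<and>
      (\<integral>\<^sup>+z\<in>bx x0 y0 r. \<Phi> z \<partial>lborel) \<le> ennreal (B2 * r) * (\<integral>\<^sup>+z. g z * ennreal (kw x0 r (z $ 1)) \<partial>lborel) \<and>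
      c0 \<le> ennreal (B2 / r) * (\<integral>\<^sup>+z. g z * ennreal (kw x0 r (z $ 1)) \<partial>lborel)"
    if h: "fib x0 y0" "0 < r" "r \<le> R0" "g \<in> borel_measurable borel" "upper_along u g (bx x0 y0 (\<Lambda> * r))" for x0 y0 r u g
  proof (cases "\<theta> * rho x0 \<le> 100 * r")
    case True
    let ?W = "\<integral>\<^sup>+z. g z * ennreal (kw x0 r (z $ 1)) \<partial>lborel"
    have "ennreal (B1 * r) * ?W \<le> ennreal (B2 * r) * ?W" "ennreal (B1 / r) * ?W \<le> ennreal (B2 / r) * ?W"
      using h(2) B2 by (auto intro!: mult_right_mono ennreal_leI divide_right_mono)
    then show ?thesis using large[OF h(1-3) True h(4,5)] by (meson order_trans)
  next
    case False
    let ?W = "\<integral>\<^sup>+z. g z * ennreal (kw x0 r (z $ 1)) \<partial>lborel"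
    have W: "?W = (\<integral>\<^sup>+z. g z \<partial>lborel)" using False by (simp add: kw_def)
    obtain \<Phi> where \<Phi>: "\<Phi> \<in> borel_measurable borel"
      "\<forall>z\<in>bx x0 y0 r. \<forall>z'\<in>bx x0 y0 r. ennreal \<bar>u z - u z'\<bar> \<le> \<Phi> z + \<Phi> z'"
      "(\<integral>\<^sup>+z\<in>bx x0 y0 r. \<Phi> z \<partial>lborel) \<le> ennreal (8 * r) * (\<integral>\<^sup>+z. g z \<partial>lborel)"
      using poincare_core_small[OF h(1,2) _ h(4,5) \<Lambda>] False by auto
    have "ennreal (8 * r) * ?W \<le> ennreal (B2 * r) * ?W"
      using h(2) B2 by (auto intro!: mult_right_mono ennreal_leI)
    then have "(\<integral>\<^sup>+z\<in>bx x0 y0 r. \<Phi> z \<partial>lborel) \<le> ennreal (B2 * r) * ?W" using \<Phi>(3) unfolding W by (rule order_trans[rotated])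
    then show ?thesis using \<Phi>(1,2) by (intro exI[of _ \<Phi>] exI[of _ 0]) auto
  qed
  obtain Bk where Bk: "0 < Bk" and weight: "\<And>x0 y0 r. fib x0 y0 \<Longrightarrow> 0 < r \<Longrightarrow> r \<le> R0 \<Longrightarrow> \<theta> * rho x0 \<le> 100 * r \<Longrightarrow>
    (\<integral>\<^sup>+z\<in>bx x0 y0 (\<Lambda> * r). ennreal ((1 + (r / rho (z $ 1)) powr (1 - sC)) powr (q / (q - 1))) \<partial>lborel) \<le> ennreal (Bk * r\<^sup>2)"
    using weight_integral[OF q R0, of \<Lambda>] \<Lambda> unfolding bx_def by auto
  define N0 where "N0 = Bk + 4 * \<Lambda>\<^sup>2"
  have N0: "0 < N0" using Bk by (simp add: N0_def add_pos_nonneg)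
  have weight': "(\<integral>\<^sup>+z\<in>bx x0 y0 (\<Lambda> * r). ennreal (kw x0 r (z $ 1) powr (q / (q - 1))) \<partial>lborel) \<le> ennreal (N0 * r\<^sup>2)"
    if h: "fib x0 y0" "0 < r" "r \<le> R0" for x0 y0 r
  proof (cases "\<theta> * rho x0 \<le> 100 * r")
    case True
    then have "(\<integral>\<^sup>+z\<in>bx x0 y0 (\<Lambda> * r). ennreal (kw x0 r (z $ 1) powr (q / (q - 1))) \<partial>lborel) \<le> ennreal (Bk * r\<^sup>2)"
      using weight[OF h True] by (simp add: kw_def)
    also have "\<dots> \<le> ennreal (N0 * r\<^sup>2)" by (intro ennreal_leI mult_right_mono) (auto simp: N0_def)
    finally show ?thesis .
  next
    case False
    then have "(\<integral>\<^sup>+z\<in>bx x0 y0 (\<Lambda> * r). ennreal (kw x0 r (z $ 1) powr (q / (q - 1))) \<partial>lborel) = emeasure lborel (bx x0 y0 (\<Lambda> * r))"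
      by (simp add: kw_def)
    also have "\<dots> \<le> ennreal (4 * (\<Lambda> * r)\<^sup>2)" by (rule emeasure_bx_le) (use \<Lambda> h in auto)
    also have "\<dots> \<le> ennreal (N0 * r\<^sup>2)" using Bk by (intro ennreal_leI) (simp add: N0_def power_mult_distrib distrib_right)
    finally show ?thesis .
  qed
  obtain B where B: "1 \<le> B" and low: "\<And>z r. z \<in> S \<Longrightarrow> 0 < r \<Longrightarrow> r \<le> R0 \<Longrightarrow> ennreal ((r / B)\<^sup>2) \<le> emeasure mu (mball_of X z r)"
    and dlow: "\<And>z r. z \<in> S \<Longrightarrow> 0 < r \<Longrightarrow> r \<le> R0 \<Longrightarrow> ennreal (r / B) \<le> mdiam X (mball_of X z r)"
    by (rule emeasure_ball_ge) blast
  \<comment> \<open>The ball of radius \<open>\<kappa> * r\<close> contains the box of half-side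
    \<open>\<Lambda> * r\<close>, since \<open>2 * Lc * \<Lambda> < \<kappa>\<close>.\<close>
  define \<kappa> where "\<kappa> = 3 * Lc * \<Lambda>"
  have "1 * 6 \<le> Lc * \<Lambda>" using \<Lambda> Lc(1) by (intro mult_mono) auto
  then have \<kappa>: "1 \<le> \<kappa>" by (simp add: \<kappa>_def)
  \<comment> \<open>The first term comes from dividing by the mass of the ball, which is at least
    \<open>(r / B)\<^sup>2\<close>, the second from the constant \<open>c0\<close>.\<close>
  define B3 where "B3 = 2 * B2 * B\<^sup>2 + B2"
  have B3: "0 < B3" using B2 by (simp add: B3_def add_nonneg_pos)
  define Cc where "Cc = 2 * B3 * N0 powr (1 - 1 / q) * B * (4 * \<kappa>\<^sup>2) powr (1 / q)"
  have Cc: "0 < Cc" using B3 N0 B \<kappa> by (simp add: Cc_def)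
  have main: "ennreal ((LINT y:mball_of X x r|mu. \<bar>u y - (LINT y:mball_of X x r|mu. u y) / measure mu (mball_of X x r)\<bar>) / measure mu (mball_of X x r))
     \<le> ennreal Cc * mdiam X (mball_of X x r) *
         epowr ((\<integral>\<^sup>+ y \<in> mball_of X x (\<kappa> * r). epowr (g y) q \<partial>mu) / emeasure mu (mball_of X x (\<kappa> * r))) (1 / q)"
    if x: "x \<in> S" and r: "0 < r" "r \<le> R0"
      and cont: "continuous_map (mtopology_of (submetric X (mball_of X x (\<kappa> * r)))) euclidean u"
      and bdd: "bounded (u ` mball_of X x (\<kappa> * r))"
      and ug: "upper_gradient (submetric X (mball_of X x (\<kappa> * r))) euclidean_metric u g" for x r u g
  proof -
    define A where "A = mball_of X x r"
    define A' where "A' = mball_of X x (\<kappa> * r)"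
    have A_sub: "A \<subseteq> A'" "A' \<subseteq> S"
    proof -
      have "1 * r \<le> \<kappa> * r" using \<kappa> r by (intro mult_right_mono) auto
      then show "A \<subseteq> A'" by (auto simp: A_def A'_def)
    qed (simp add: A'_def ball_subset)
    have [measurable]: "A \<in> sets borel" "A' \<in> sets borel" by (auto simp: A_def A'_def simp del: in_mball_of)
    let ?x0 = "x $ 1" and ?y0 = "x $ 2"
    have fib: "fib ?x0 ?y0" using x by (simp add: S_def)
    let ?b = "bx ?x0 ?y0 (\<Lambda> * r)"
    have b_sub: "?b \<subseteq> A'"
      unfolding A'_def
    proof (rule bx_subset_ball[OF x])
      have "0 < Lc * (\<Lambda> * r)" using Lc(1) \<Lambda> r by simp
      then show "2 * Lc * (\<Lambda> * r) < \<kappa> * r" by (simp add: \<kappa>_def mult_ac)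
    qed
    have A_bx: "A \<subseteq> bx ?x0 ?y0 r" unfolding A_def by (rule ball_subset_bx[OF x])
    have top: "mtopology_of (submetric X A') = top_of_set A'"
      using A_sub(2) by (simp add: mtopology_of_submetric QC.mtopology_X subtopology_subtopology Int_absorb1)
    have setsA': "sets (mborel (submetric X A')) = sets (restrict_space borel A')" by (rule sets_mborel_eq[OF _ top]) simp
    have gm: "g \<in> borel_measurable (restrict_space borel A')"
      using ug setsA' by (auto simp: upper_gradient_def A'_def cong: measurable_cong_sets)
    then have gA' [measurable]: "(\<lambda>z. g z * indicator A' z) \<in> borel_measurable borel"
      by (subst (asm) borel_measurable_restrict_space_iff_ennreal) auto
    \<comment> \<open>The gradient is measurable only on the larger ball: the first indicator makes
      it Borel on the plane, the second confines the integrals of the core estimates to the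
      box.\<close>
    define g' where "g' z = g z * indicator A' z * indicator ?b z" for z
    have g' [measurable]: "g' \<in> borel_measurable borel" unfolding g'_def[abs_def] by measurable
    have g'_eq: "g' z = g z" if "z \<in> ?b" for z using that b_sub by (auto simp: g'_def)
    have along: "upper_along u g' ?b"
      unfolding upper_along_def
    proof (intro allI impI, elim conjE)
      fix L p q' c assume c: "lip_curve NS L p q' c" "\<forall>t\<in>{p..q'}. c t \<in> ?b"
      have "lip_curve X L p q' c" by (rule QC.lip_curve_X[OF c(1)])
      then have "lip_curve (submetric X A') L p q' c" using c(2) b_sub by (auto simp: lip_curve_def)
      from upper_gradient_lip_curve[OF ug[folded A'_def] this]
      have "ennreal \<bar>u (c p) - u (c q')\<bar> \<le> ennreal L * (\<integral>\<^sup>+t\<in>{p..q'}. g (c t) \<partial>lborel)" by (simp add: dist_real_def)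
      also have "(\<integral>\<^sup>+t\<in>{p..q'}. g (c t) \<partial>lborel) = (\<integral>\<^sup>+t\<in>{p..q'}. g' (c t) \<partial>lborel)"
        using c(2) g'_eq by (intro nn_integral_cong) (auto simp: indicator_def)
      finally show "ennreal \<bar>u (c p) - u (c q')\<bar> \<le> ennreal L * (\<integral>\<^sup>+t\<in>{p..q'}. g' (c t) \<partial>lborel)" .
    qed
    define W where "W = (\<integral>\<^sup>+z. g' z * ennreal (kw ?x0 r (z $ 1)) \<partial>lborel)"
    obtain \<Phi> c0 where \<Phi> [measurable]: "\<Phi> \<in> borel_measurable borel"
      and osc: "\<And>z z'. z \<in> bx ?x0 ?y0 r \<Longrightarrow> z' \<in> bx ?x0 ?y0 r \<Longrightarrow> 0 < rho (z $ 1) \<Longrightarrow> 0 < rho (z' $ 1) \<Longrightarrow> ennreal \<bar>u z - u z'\<bar> \<le> \<Phi> z + \<Phi> z' + c0"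
      and I\<Phi>: "(\<integral>\<^sup>+z\<in>bx ?x0 ?y0 r. \<Phi> z \<partial>lborel) \<le> ennreal (B2 * r) * W" and c0: "c0 \<le> ennreal (B2 / r) * W"
      using core[OF fib r g' along] unfolding W_def by blast
    have AE_rho: "AE z in (lborel :: (real^2) measure). 0 < rho (z $ 1)"
    proof -
      have "AE x in lborel. 0 < rho x" unfolding rho_def by (rule RK.AE_notin_C)
      then have n: "(\<integral>\<^sup>+x. indicator {x. \<not> 0 < rho x} x \<partial>lborel) = 0"
        by (subst nn_integral_0_iff_AE) (auto elim!: eventually_mono)
      have "(\<integral>\<^sup>+z. indicator {x. \<not> 0 < rho x} (z $ 1) \<partial>(lborel :: (real^2) measure)) = (\<integral>\<^sup>+y. \<integral>\<^sup>+x. indicator {x. \<not> 0 < rho x} x \<partial>lborel \<partial>(lborel :: real measure))"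
        by (subst nn_integral_real2(2)) auto
      then have "(\<integral>\<^sup>+z. indicator {x. \<not> 0 < rho x} (z $ 1) \<partial>(lborel :: (real^2) measure)) = 0" using n by simp
      then have "AE z in (lborel :: (real^2) measure). indicator {x. \<not> 0 < rho x} (z $ 1) = (0 :: ennreal)"
        by (subst (asm) nn_integral_0_iff_AE) auto
      then show ?thesis by eventually_elim (auto simp: indicator_def split: if_splits)
    qed
    have muA: "emeasure mu A = emeasure lborel A" "emeasure mu A' = emeasure lborel A'" using A_sub by (auto intro: emeasure_mu)
    have "emeasure mu A \<le> ennreal (4 * r\<^sup>2)" unfolding A_def by (rule emeasure_ball_le[OF x r(1)])
    then have finA: "emeasure mu A < top" by (rule le_less_trans) simp
    then obtain m where m: "emeasure mu A = ennreal m" "0 \<le> m" by (cases "emeasure mu A") auto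
    have mlow: "(r / B)\<^sup>2 \<le> m" using low[OF x r] m unfolding A_def[symmetric] by simp
    have rB: "0 < (r / B)\<^sup>2" using r B by simp
    have m0: "0 < m" using mlow rB by linarith
    have A_mu: "A \<in> sets mu" by (rule in_sets_mu) (use A_sub in auto)
    have AE_mu: "AE z in mu. 0 < rho (z $ 1)"
      unfolding mu_def using AE_rho by (subst AE_restrict_space_iff) (auto elim: eventually_mono)
    have lb_mu: "f \<in> borel_measurable mu" if "f \<in> borel_measurable borel" for f :: "real^2 \<Rightarrow> ennreal"
      using that unfolding mu_def by (intro measurable_restrict_space1) simp
    have "ennreal ((LINT x:A|mu. \<bar>u x - (LINT y:A|mu. u y) / measure mu A\<bar>) / measure mu A)
      \<le> ennreal (2 / m) * (\<integral>\<^sup>+x\<in>A. \<Phi> x \<partial>mu) + c0"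
    proof -
      obtain Kb where Kb: "\<And>z. z \<in> A' \<Longrightarrow> \<bar>u z\<bar> \<le> Kb" using bdd unfolding A'_def[symmetric] bounded_iff by auto
      have "continuous_on A' u" using cont unfolding A'_def[symmetric] top by simp
      then have "continuous_on A u" using A_sub(1) by (rule continuous_on_subset)
      then have "(\<lambda>x. indicator A x *\<^sub>R u x) \<in> borel_measurable borel" by (rule borel_measurable_continuous_on_indicator[rotated]) simp
      then have um: "(\<lambda>x. indicator A x * u x) \<in> borel_measurable mu"
        unfolding mu_def by (intro measurable_restrict_space1) simp
      show ?thesis
      proof (rule mean_oscillation_le[OF A_mu m(1) m0 um _ lb_mu[OF \<Phi>]])
        show "\<bar>u x\<bar> \<le> Kb" if "x \<in> A" for x using that A_sub(1) Kb by auto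
        show "AE x in mu. x \<in> A \<longrightarrow> (AE y in mu. y \<in> A \<longrightarrow> ennreal \<bar>u x - u y\<bar> \<le> \<Phi> x + \<Phi> y + c0)"
          using AE_mu
        proof eventually_elim
          case (elim z)
          show ?case
          proof
            assume "z \<in> A"
            show "AE y in mu. y \<in> A \<longrightarrow> ennreal \<bar>u z - u y\<bar> \<le> \<Phi> z + \<Phi> y + c0"
              using AE_mu by eventually_elim (use \<open>z \<in> A\<close> elim A_bx osc in blast)
          qed
        qed
      qed
    qed
    also have "\<dots> \<le> ennreal (2 / m) * (ennreal (B2 * r) * W) + ennreal (B2 / r) * W"
    proof (intro add_mono mult_left_mono c0)
      have "(\<integral>\<^sup>+x\<in>A. \<Phi> x \<partial>mu) = (\<integral>\<^sup>+x. \<Phi> x * indicator A x * indicator S x \<partial>lborel)" by (rule nn_integral_mu)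
      also have "\<dots> \<le> (\<integral>\<^sup>+z\<in>bx ?x0 ?y0 r. \<Phi> z \<partial>lborel)"
        using A_bx by (intro nn_integral_mono) (auto simp: indicator_def)
      finally show "(\<integral>\<^sup>+x\<in>A. \<Phi> x \<partial>mu) \<le> ennreal (B2 * r) * W" using I\<Phi> by (rule order_trans)
    qed simp
    also have "\<dots> = ennreal (2 / m * (B2 * r) + B2 / r) * W"
      using m0 B2 r by (simp add: ennreal_mult[symmetric] mult.assoc[symmetric] distrib_right[symmetric] ennreal_plus[symmetric] del: ennreal_plus)
    also have "\<dots> \<le> ennreal (B3 / r) * W"
    proof (intro mult_right_mono ennreal_leI)
      have "2 / m \<le> 2 / (r / B)\<^sup>2" using mlow rB m0 by (intro divide_left_mono) auto
      then have "2 / m * (B2 * r) \<le> 2 / (r / B)\<^sup>2 * (B2 * r)" using B2 r by (intro mult_right_mono) auto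
      also have "\<dots> = 2 * B2 * B\<^sup>2 / r" using r B by (simp add: power2_eq_square field_simps)
      finally show "2 / m * (B2 * r) + B2 / r \<le> B3 / r" by (simp add: B3_def add_divide_distrib)
    qed simp
    finally have LHS: "ennreal ((LINT x:A|mu. \<bar>u x - (LINT y:A|mu. u y) / measure mu A\<bar>) / measure mu A) \<le> ennreal (B3 / r) * W" .
    define I where "I = (\<integral>\<^sup>+ y \<in> A'. epowr (g y) q \<partial>mu)"
    have kr: "0 < \<kappa> * r" using \<kappa> r by simp
    have mA': "emeasure mu A' \<le> ennreal (4 * (\<kappa> * r)\<^sup>2)" unfolding A'_def by (rule emeasure_ball_le[OF x kr])
    have dA: "ennreal (r / B) \<le> mdiam X A" unfolding A_def by (rule dlow[OF x r])
    have rB': "0 < r / B" using r B by simp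
    have "ennreal (B3 / r) * W \<le> ennreal Cc * mdiam X A * epowr (I / emeasure mu A') (1 / q)"
    proof (cases "I = top")
      case True
      \<comment> \<open>The right-hand side is infinite, since the diameter of the ball is positive
        by \<open>dA\<close>.\<close>
      have "emeasure mu A' < top" using mA' by (rule le_less_trans) simp
      then have "epowr (I / emeasure mu A') (1 / q) = top" using True by (simp add: ennreal_top_divide epowr_def)
      moreover have "ennreal Cc * mdiam X A \<noteq> 0" using Cc dA rB' by (auto simp: ennreal_eq_0_iff)
      ultimately show ?thesis by (simp add: ennreal_mult_top)
    next
      case False
      then obtain i where i: "I = ennreal i" "0 \<le> i" by (cases I) auto
      have "W \<le> ennreal (2 * i powr (1 / q) * (N0 * r\<^sup>2) powr (1 - 1 / q))"
      proof (rule young_optimise[OF q(1)])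
        fix t :: real assume t: "0 < t"
        define k where "k z = kw ?x0 r (z $ 1) * indicator ?b z" for z :: "real^2"
        have k0: "0 \<le> k z" for z using kw_ge_1[of ?x0 r "z $ 1"] by (simp add: k_def indicator_def)
        have [measurable]: "k \<in> borel_measurable borel" unfolding k_def[abs_def] by measurable
        have "W = (\<integral>\<^sup>+z. g' z * ennreal (k z) \<partial>lborel)"
          unfolding W_def by (intro nn_integral_cong) (auto simp: k_def g'_def indicator_def)
        also have "\<dots> \<le> ennreal (t powr (1 - q)) * (\<integral>\<^sup>+z. epowr (g' z) q \<partial>lborel) + ennreal t * (\<integral>\<^sup>+z. ennreal (k z powr (q / (q - 1))) \<partial>lborel)"
          by (rule nn_integral_young[OF q(1) t _ _ k0]) auto
        also have "\<dots> \<le> ennreal (t powr (1 - q)) * ennreal i + ennreal t * ennreal (N0 * r\<^sup>2)"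
        proof (intro add_mono mult_left_mono)
          have "(\<integral>\<^sup>+z. epowr (g' z) q \<partial>lborel) \<le> (\<integral>\<^sup>+z. epowr (g z) q * indicator A' z * indicator S z \<partial>lborel)"
            using b_sub A_sub(2) q by (intro nn_integral_mono) (auto simp: g'_def indicator_def epowr_def)
          also have "\<dots> = ennreal i" unfolding i(1)[symmetric] I_def by (rule nn_integral_mu[symmetric])
          finally show "(\<integral>\<^sup>+z. epowr (g' z) q \<partial>lborel) \<le> ennreal i" .
          have "(\<integral>\<^sup>+z. ennreal (k z powr (q / (q - 1))) \<partial>lborel) = (\<integral>\<^sup>+z\<in>?b. ennreal (kw ?x0 r (z $ 1) powr (q / (q - 1))) \<partial>lborel)"
            using q by (intro nn_integral_cong) (auto simp: k_def indicator_def)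
          also have "\<dots> \<le> ennreal (N0 * r\<^sup>2)" by (rule weight'[OF fib r])
          finally show "(\<integral>\<^sup>+z. ennreal (k z powr (q / (q - 1))) \<partial>lborel) \<le> ennreal (N0 * r\<^sup>2)" .
        qed auto
        finally show "W \<le> ennreal (t powr (1 - q)) * ennreal i + ennreal t * ennreal (N0 * r\<^sup>2)" .
      qed (use i N0 r in auto)
      then have "ennreal (B3 / r) * W \<le> ennreal (B3 / r) * ennreal (2 * i powr (1 / q) * (N0 * r\<^sup>2) powr (1 - 1 / q))"
        by (rule mult_left_mono) simp
      also have "\<dots> = ennreal (B3 / r * (2 * i powr (1 / q) * (N0 * r\<^sup>2) powr (1 - 1 / q)))"
        by (rule ennreal_mult[symmetric]) (use B3 r in auto)
      also have "B3 / r * (2 * i powr (1 / q) * (N0 * r\<^sup>2) powr (1 - 1 / q)) = Cc * (r / B) * ((i / (4 * (\<kappa> * r)\<^sup>2)) powr (1 / q))"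
      proof -
        have r2: "(r\<^sup>2) powr (1 - 1 / q) = r\<^sup>2 / (r\<^sup>2) powr (1 / q)" using r by (simp add: powr_diff powr_one)
        have "(i / (4 * (\<kappa> * r)\<^sup>2)) powr (1 / q) = i powr (1 / q) / ((4 * \<kappa>\<^sup>2) powr (1 / q) * (r\<^sup>2) powr (1 / q))"
          using i by (simp add: powr_divide powr_mult power_mult_distrib)
        moreover have "0 < (4 * \<kappa>\<^sup>2) powr (1 / q)" "0 < (r\<^sup>2) powr (1 / q)" using \<kappa> r by auto
        ultimately show ?thesis
          using r B unfolding Cc_def powr_mult[of N0] r2 by (simp add: field_simps power2_eq_square)
      qed
      also have "ennreal \<dots> \<le> ennreal Cc * mdiam X A * epowr (I / emeasure mu A') (1 / q)"
      proof -
        have pos4: "0 < 4 * (\<kappa> * r)\<^sup>2" using \<kappa> r by simp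
        have ex: "emeasure mu A' = ennreal (measure mu A')" "0 < measure mu A'" "measure mu A' \<le> 4 * (\<kappa> * r)\<^sup>2"
        proof -
          have "emeasure mu A \<le> emeasure mu A'" unfolding muA using A_sub by (intro emeasure_mono) auto
          then have le: "ennreal m \<le> emeasure mu A'" using m by simp
          have fin: "emeasure mu A' < top" using mA' by (rule le_less_trans) simp
          then show e: "emeasure mu A' = ennreal (measure mu A')" by (simp add: emeasure_eq_ennreal_measure)
          show "0 < measure mu A'" using le m0 unfolding e by (auto simp: ennreal_le_iff2)
          show "measure mu A' \<le> 4 * (\<kappa> * r)\<^sup>2" using mA' pos4 unfolding e by (simp add: ennreal_le_iff)
        qed
        have "ennreal ((i / (4 * (\<kappa> * r)\<^sup>2)) powr (1 / q)) \<le> ennreal ((i / measure mu A') powr (1 / q))"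
          using ex i q pos4 by (intro ennreal_leI powr_mono2 divide_left_mono) auto
        also have "\<dots> = epowr (I / emeasure mu A') (1 / q)"
          using ex i by (simp add: epowr_def divide_ennreal)
        finally have "ennreal (Cc * (r / B)) * ennreal ((i / (4 * (\<kappa> * r)\<^sup>2)) powr (1 / q)) \<le> (ennreal Cc * mdiam X A) * epowr (I / emeasure mu A') (1 / q)"
        proof (rule mult_mono[rotated])
          show "ennreal (Cc * (r / B)) \<le> ennreal Cc * mdiam X A"
            using dA Cc rB' by (subst ennreal_mult) (auto intro: mult_left_mono)
        qed auto
        moreover have "0 \<le> Cc * (r / B)" using Cc rB' by (intro mult_nonneg_nonneg) linarith+
        ultimately show ?thesis using ennreal_mult[of "Cc * (r / B)" "(i / (4 * (\<kappa> * r)\<^sup>2)) powr (1 / q)"] by simp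
      qed
      finally show ?thesis .
    qed
    then show ?thesis using LHS unfolding A_def[symmetric] A'_def[symmetric] I_def by (rule order_trans[rotated])
  qed
  show ?thesis
    unfolding poincare_inequality_def Let_def
  proof (rule conjI, use q in simp, rule exI[of _ \<kappa>], rule conjI[OF \<kappa>], rule exI[of _ Cc], rule conjI[OF Cc], intro ballI allI impI)
    fix x r g and u :: "real^2 \<Rightarrow> real" assume x: "x \<in> mspace X" and r: "0 < r"
      and cont: "continuous_map (mtopology_of (submetric X (mball_of X x (\<kappa> * r)))) euclidean u"
      and bdd: "bounded (u ` mball_of X x (\<kappa> * r))"
      and ug: "upper_gradient (submetric X (mball_of X x (\<kappa> * r))) euclidean_metric u g"
    have xS: "x \<in> S" using x by simp
    show "ennreal ((LINT y:mball_of X x r|mu. \<bar>u y - (LINT y:mball_of X x r|mu. u y) / measure mu (mball_of X x r)\<bar>) / measure mu (mball_of X x r))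
     \<le> ennreal Cc * mdiam X (mball_of X x r) *
         epowr ((\<integral>\<^sup>+ y \<in> mball_of X x (\<kappa> * r). epowr (g y) q \<partial>mu) / emeasure mu (mball_of X x (\<kappa> * r))) (1 / q)"
    proof (cases "r \<le> R0")
      case True
      then show ?thesis by (rule main[OF xS r _ cont bdd ug])
    next
      case False
      \<comment> \<open>For larger radii both balls are the whole space and may be replaced by those
        for \<open>R0\<close>.\<close>
      have kR: "R0 \<le> \<kappa> * R0" "R0 \<le> \<kappa> * r"
        using \<kappa> R0 False r mult_right_mono[of 1 \<kappa> R0] mult_mono[of 1 \<kappa> R0 r] by auto
      have b: "mball_of X x r = mball_of X x R0" "mball_of X x (\<kappa> * r) = mball_of X x (\<kappa> * R0)"
        using ball_R0[OF xS, of r] ball_R0[OF xS, of R0] ball_R0[OF xS, of "\<kappa> * r"] ball_R0[OF xS, of "\<kappa> * R0"] kR False by auto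
      show ?thesis unfolding b by (rule main[OF xS R0 order_refl cont[unfolded b] bdd[unfolded b] ug[unfolded b]])
    qed
  qed
qed

end

section \<open>The homeomorphism\<close>

text \<open>A small ball around an isolated point would be that single point, which has mass zero,
  while balls have positive mass.\<close>

lemma metric_measure_spaceI:
  assumes "space \<mu> = mspace M" and sets: "sets \<mu> = sets (mborel M)"
    and pos: "\<And>x r. x \<in> mspace M \<Longrightarrow> 0 < r \<Longrightarrow> 0 < emeasure \<mu> (mball_of M x r)"
    and null: "\<And>x. x \<in> mspace M \<Longrightarrow> emeasure \<mu> {x} = 0"
  shows "metric_measure_space M \<mu>"
  unfolding metric_measure_space_def
proof (intro conjI ballI notI assms(1) sets)
  fix x assume x: "x \<in> mspace M" and op: "openin (mtopology_of M) {x}"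
  have "{x} \<in> sets \<mu>"
    unfolding sets mborel_def using op by (subst sets_measure_of) (auto dest!: openin_subset)
  moreover obtain r where "0 < r" "mball_of M x r \<subseteq> {x}"
    using op Metric_space.openin_mtopology[OF Metric_space_mspace_mdist[of M]]
    unfolding mtopology_of_def mball_of_def by blast
  ultimately have "emeasure \<mu> (mball_of M x r) \<le> emeasure \<mu> {x}" "0 < r" by (auto intro: emeasure_mono)
  then show False using pos[OF x] null[OF x] by (metis le_zero_eq less_irrefl)
qed

lemma dist_real2_mono:
  fixes z w z' w' :: "real^2"
  assumes "\<bar>z $ 1 - w $ 1\<bar> \<le> \<bar>z' $ 1 - w' $ 1\<bar>" "\<bar>z $ 2 - w $ 2\<bar> \<le> \<bar>z' $ 2 - w' $ 2\<bar>"
  shows "dist z w \<le> dist z' w'"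
  unfolding dist_vec_def
proof (rule L2_set_mono)
  fix i :: 2
  show "dist (z $ i) (w $ i) \<le> dist (z' $ i) (w' $ i)"
    using assms exhaust_2[of i] by (auto simp: dist_real_def)
qed auto

section \<open>The map, its image and the exceptional set\<close>

context construction
begin

lemma FK_mono: "x \<le> y \<Longrightarrow> FK x \<le> FK y" unfolding FK_def by (rule cK.fun_mono)

definition fmap :: "real^2 \<Rightarrow> real^2" where "fmap z = pt (z $ 1 + FK (z $ 1)) (z $ 2)"
definition T :: "(real^2) set" where "T = fmap ` S"
definition Y :: "(real^2) metric" where "Y = submetric euclidean_metric T"
definition nu :: "(real^2) measure" where "nu = restrict_space lborel T"
definition E :: "(real^2) set" where "E = {z\<in>S. z $ 1 \<in> K}"

text \<open>Adding the increasing function \<open>FK\<close> can only enlarge horizontal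
  differences. This gives injectivity, and it prevents distant points from coming close in the
  image.\<close>

lemma fmap_expanding: "dist z w \<le> dist (fmap z) (fmap w)"
proof (rule dist_real2_mono)
  show "\<bar>z $ 1 - w $ 1\<bar> \<le> \<bar>fmap z $ 1 - fmap w $ 1\<bar>"
    using FK_mono[of "z $ 1" "w $ 1"] FK_mono[of "w $ 1" "z $ 1"] unfolding fmap_def pt_nth by linarith
qed (simp add: fmap_def)

lemma inj_fmap: "inj fmap"
proof (rule injI)
  fix z w assume "fmap z = fmap w"
  then show "z = w" using fmap_expanding[of z w] by simp
qed

lemma continuous_fmap: "continuous_on UNIV fmap"
  unfolding fmap_def pt_eq_axis by (intro continuous_intros continuous_on_compose2[OF RK.F_cont]) auto

lemma compact_T: "compact T"
  unfolding T_def by (intro compact_continuous_image continuous_on_subset[OF continuous_fmap] compact_S) auto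

lemma mspace_Y [simp]: "mspace Y = T" and mdist_Y [simp]: "mdist Y = dist"
  by (auto simp: Y_def)

lemma mtopology_Y: "mtopology_of Y = top_of_set T"
  by (simp add: Y_def mtopology_of_submetric)

lemma compact_space_Y: "compact_space (mtopology_of Y)"
  unfolding mtopology_Y using compact_T by (simp add: compact_space_subtopology compactin_euclidean_iff)

lemma homeomorphic_fmap: "homeomorphic_map (mtopology_of X) (mtopology_of Y) fmap"
proof (rule continuous_imp_homeomorphic_map)
  show "compact_space (mtopology_of X)" by (rule QC.compact_space_X)
  show "Hausdorff_space (mtopology_of Y)" unfolding mtopology_Y by (simp add: Hausdorff_space_subtopology)
  show "continuous_map (mtopology_of X) (mtopology_of Y) fmap"
    unfolding mtopology_Y QC.mtopology_X using continuous_on_subset[OF continuous_fmap, of S]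
    by (auto simp: continuous_map_in_subtopology T_def)
  show "fmap ` topspace (mtopology_of X) = topspace (mtopology_of Y)" by (simp add: T_def)
  show "inj_on fmap (topspace (mtopology_of X))" using inj_fmap by (rule inj_on_subset) auto
qed

lemma metric_measure_space_X: "metric_measure_space X mu"
proof (rule metric_measure_spaceI)
  obtain B where B: "1 \<le> B" "\<And>z r. z \<in> S \<Longrightarrow> 0 < r \<Longrightarrow> r \<le> R0 \<Longrightarrow> ennreal ((r / B)\<^sup>2) \<le> emeasure mu (mball_of X z r)"
    by (rule emeasure_ball_ge) blast
  show "emeasure mu {z} = 0" if "z \<in> mspace X" for z using that by (subst emeasure_mu) auto
  fix z and r :: real assume "z \<in> mspace X" and r: "0 < r"
  then have z: "z \<in> S" by simp
  have "0 < ennreal ((min r R0 / B)\<^sup>2)" using B(1) r R0 by (simp add: ennreal_less_zero_iff)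
  also have "\<dots> \<le> emeasure mu (mball_of X z (min r R0))" using z r R0 by (intro B(2)) auto
  also have "\<dots> \<le> emeasure mu (mball_of X z r)"
    by (intro emeasure_mono in_sets_mu borel_ball) auto
  finally show "0 < emeasure mu (mball_of X z r)" .
qed (auto simp: sets_mu)

text \<open>That no point is isolated is transported through the homeomorphism, because no lower
  mass bound is available for balls of \<open>Y\<close> centred in the image of
  \<open>E\<close>.\<close>

lemma metric_measure_space_Y: "metric_measure_space Y nu"
  unfolding metric_measure_space_def
proof (intro conjI ballI notI)
  show "space nu = mspace Y" by (simp add: nu_def space_restrict_space)
  have "sets (mborel Y) = sets (restrict_space borel T)"
    using compact_imp_closed[OF compact_T] by (intro sets_mborel_eq mtopology_Y) auto
  then show "sets nu = sets (mborel Y)" by (simp add: nu_def sets_restrict_space)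
  fix w assume "w \<in> mspace Y" and op: "openin (mtopology_of Y) {w}"
  then obtain z where z: "z \<in> S" "w = fmap z" by (auto simp: T_def)
  then have "openin (mtopology_of X) {z}"
    using op homeomorphic_map_openness[OF homeomorphic_fmap, of "{z}"] by simp
  then show False using metric_measure_space_X z by (auto simp: metric_measure_space_def)
qed

lemma fib_K: "x \<in> K \<Longrightarrow> fib x y \<longleftrightarrow> y \<in> C"
proof -
  have "del y \<le> 0 \<longleftrightarrow> y \<in> C" using del_nonneg[of y] del_zero_iff[of y] by linarith
  moreover assume "x \<in> K"
  ultimately show ?thesis using rho_zero_iff[of x] K_subset by (auto simp: fib_def)
qed

lemma E_iff: "z \<in> E \<longleftrightarrow> z $ 1 \<in> K \<and> z $ 2 \<in> C"
  using fib_K by (auto simp: E_def S_def)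

lemma E_subset: "E \<subseteq> S" by (auto simp: E_def)

lemma E_nonempty: "E \<noteq> {}"
proof -
  have "pt 0 0 \<in> E" using zero_in_K zero_in_C by (simp add: E_iff)
  then show ?thesis by blast
qed

lemma closed_E: "closed E"
proof -
  have "E = (\<lambda>z. z $ 1) -` K \<inter> (\<lambda>z. z $ 2) -` C" by (auto simp: E_iff)
  then show ?thesis
    by (auto intro!: closed_Int continuous_closed_vimage RK.closed_C RC.closed_C continuous_intros)
qed

lemma closedin_E: "closedin (mtopology_of X) E"
  unfolding QC.mtopology_X using closed_E E_subset by (auto intro: closed_subset)

text \<open>The ball of radius \<open>rho x0\<close> around \<open>x0\<close> stays within one gap,
  where \<open>rho\<close> is the minimum of two affine functions and \<open>FK\<close> is
  constant.\<close>

lemma rho_concave: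
  assumes x0: "0 \<le> x0" "x0 \<le> 1" "0 < rho x0" and x: "\<bar>x - x0\<bar> < rho x0" and t: "0 \<le> t" "t \<le> 1"
  shows "rho x0 + t * (rho x - rho x0) \<le> rho (x0 + t * (x - x0))" and "FK x = FK x0"
    and "0 \<le> x" "x \<le> 1"
proof -
  obtain p n where g: "gapK p n" "p < x0" "x0 < p + w0 * lam ^ n" by (rule gapK_obtain[OF x0])
  define q where "q = p + w0 * lam ^ n"
  have rho: "rho y = min (y - p) (q - y)" and FK: "FK y = FK p" if "p \<le> y" "y \<le> q" for y
    using g(1) that unfolding gapK_def q_def by blast+
  have r0: "rho x0 = min (x0 - p) (q - x0)" using rho[of x0] g by (simp add: q_def)
  then have xb: "p \<le> x" "x \<le> q" using x by linarith+
  then show "FK x = FK x0" using FK[of x] FK[of x0] g by (simp add: q_def)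
  show "0 \<le> x" "x \<le> 1" using xb g(1) unfolding gapK_def q_def by linarith+
  have rx: "rho x = min (x - p) (q - x)" using rho[OF xb] .
  define y where "y = x0 + t * (x - x0)"
  have e: "y - p = (x0 - p) + t * ((x - p) - (x0 - p))" "q - y = (q - x0) + t * ((q - x) - (q - x0))"
    by (simp_all add: y_def algebra_simps)
  have conv: "A + t * (B - A) \<le> A' + t * (B' - A')" if "A \<le> A'" "B \<le> B'" for A B A' B'
  proof -
    have "(1 - t) * A \<le> (1 - t) * A'" "t * B \<le> t * B'" using that t by (auto intro: mult_left_mono)
    then show ?thesis by (simp add: algebra_simps)
  qed
  have 1: "rho x0 + t * (rho x - rho x0) \<le> y - p" "rho x0 + t * (rho x - rho x0) \<le> q - y"
    unfolding e by (rule conv; simp add: r0 rx)+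
  have "0 \<le> rho x0 + t * (rho x - rho x0)" using conv[of 0 "rho x0" 0 "rho x"] by simp
  then have "p \<le> y" "y \<le> q" using 1 by linarith+
  from rho[OF this] show "rho x0 + t * (rho x - rho x0) \<le> rho (x0 + t * (x - x0))"
    using 1 by (simp add: y_def)
qed

text \<open>Near a point outside \<open>C\<close>, \<open>del\<close> is either affine or a tent
  with its top at that point; in both cases it is affine along each of the two rays from
  \<open>y0\<close>.\<close>

lemma del_conic:
  assumes y0: "0 < del y0"
  obtains e where "0 < e"
    and "\<And>y t. \<bar>y - y0\<bar> < e \<Longrightarrow> 0 \<le> t \<Longrightarrow> t \<le> 1 \<Longrightarrow> del (y0 + t * (y - y0)) = del y0 + t * (del y - del y0)"
proof -
  note thesisI = that
  have linear: thesis if e: "0 < e" and d: "\<And>y. \<bar>y - y0\<bar> < e \<Longrightarrow> del y = A + B * y" for e A B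
  proof (rule thesisI[OF e])
    fix y t :: real assume y: "\<bar>y - y0\<bar> < e" "0 \<le> t" "t \<le> 1"
    have "\<bar>t * (y - y0)\<bar> \<le> \<bar>y - y0\<bar>" using y by (simp add: abs_mult mult_left_le_one_le)
    then have "\<bar>y0 + t * (y - y0) - y0\<bar> < e" using y(1) by linarith
    then show "del (y0 + t * (y - y0)) = del y0 + t * (del y - del y0)"
      using d[of "y0 + t * (y - y0)"] d[of y0] d[of y] y(1) e by (simp add: algebra_simps)
  qed
  from y0 show thesis
  proof (cases rule: del_cases)
    case below
    show ?thesis by (rule linear[of "- y0" 0 "- 1"]) (use below del_outside(1) in auto)
  next
    case above
    show ?thesis by (rule linear[of "y0 - bet" "- bet" 1]) (use above del_outside(2) in auto)
  next
    case (gap p n)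
    define q where "q = p + sqrt a * w0 * a ^ n"
    have d: "del y = min (y - p) (q - y)" if "p \<le> y" "y \<le> q" for y
      using gap(1) that unfolding gapC_def q_def by blast
    have pq: "p < y0" "y0 < q" using gap by (auto simp: q_def)
    \<comment> \<open>The distance to the ends of the gap and, unless \<open>y0\<close> is the
      midpoint, also to the midpoint, where \<open>del\<close> has its kink.\<close>
    define e where "e = (if 2 * y0 = p + q then min (y0 - p) (q - y0) else min (min (y0 - p) (q - y0)) \<bar>y0 - (p + q) / 2\<bar>)"
    have e: "0 < e" "e \<le> y0 - p" "e \<le> q - y0" using pq by (auto simp: e_def)
    show ?thesis
    proof (cases "2 * y0 = p + q")
      case False
      then have e2: "e \<le> \<bar>y0 - (p + q) / 2\<bar>" by (simp add: e_def)
      show ?thesis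
      proof (cases "2 * y0 < p + q")
        case True
        have e2: "2 * e \<le> p + q - 2 * y0" using e2 True by (simp add: abs_if field_simps split: if_splits)
        show ?thesis
        proof (rule linear[of e "- p" 1])
          fix y assume "\<bar>y - y0\<bar> < e"
          then have "p \<le> y" "y \<le> q" "2 * y \<le> p + q" using e e2 True by linarith+
          then show "del y = - p + 1 * y" using d[of y] by simp
        qed (rule e)
      next
        case False
        have e2: "2 * e \<le> 2 * y0 - (p + q)" using e2 False by (simp add: abs_if field_simps split: if_splits)
        show ?thesis
        proof (rule linear[of e q "- 1"])
          fix y assume "\<bar>y - y0\<bar> < e"
          then have "p \<le> y" "y \<le> q" "p + q \<le> 2 * y" using e e2 False by linarith+
          then show "del y = q + - 1 * y" using d[of y] by simp
        qed (rule e)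
      qed
    next
      case True
      have tent: "del y = (q - p) / 2 - \<bar>y - y0\<bar>" if "\<bar>y - y0\<bar> < e" for y
      proof -
        have "p \<le> y" "y \<le> q" using that e by linarith+
        moreover have "y0 = (p + q) / 2" using True by simp
        ultimately show ?thesis by (simp add: d min_def abs_if field_simps)
      qed
      have tent': "del y = del y0 - \<bar>y - y0\<bar>" if "\<bar>y - y0\<bar> < e" for y
        using tent[OF that] tent[of y0] e(1) by simp
      show ?thesis
      proof (rule that[OF e(1)])
        fix y t :: real assume y: "\<bar>y - y0\<bar> < e" "0 \<le> t" "t \<le> 1"
        have "\<bar>y0 + t * (y - y0) - y0\<bar> = t * \<bar>y - y0\<bar>" using y by (simp add: abs_mult)
        moreover have "t * \<bar>y - y0\<bar> \<le> \<bar>y - y0\<bar>" using y by (simp add: mult_left_le_one_le)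
        ultimately show "del (y0 + t * (y - y0)) = del y0 + t * (del y - del y0)"
          using tent'[of "y0 + t * (y - y0)"] tent'[of y] y(1) by simp
      qed
    qed
  qed
qed

text \<open>If \<open>del\<close> is strictly below \<open>rho\<close>, Lipschitz continuity gives a
  full neighbourhood over the unit interval. If they are equal, then along a short segment from
  \<open>z0\<close> the function \<open>del\<close> is affine and \<open>rho\<close> concave, so the
  inequality at the two ends passes to the whole segment.\<close>

lemma locally_star_shaped:
  assumes z0: "z0 \<in> S" "z0 \<notin> E"
  obtains e where "0 < e" "e \<le> rho (z0 $ 1)"
    and "\<And>z t. z \<in> S \<Longrightarrow> dist z0 z < e \<Longrightarrow> 0 \<le> t \<Longrightarrow> t \<le> 1 \<Longrightarrow> z0 + t *\<^sub>R (z - z0) \<in> S"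
proof -
  let ?x = "z0 $ 1" and ?y = "z0 $ 2"
  have x0: "0 \<le> ?x" "?x \<le> 1" "0 < rho ?x" "del ?y \<le> rho ?x"
    using z0 rho_pos_iff[of ?x] by (auto simp: E_def S_def fib_def)
  note conc = rho_concave[OF x0(1-3)]
  have in_S: "z0 + t *\<^sub>R (z - z0) \<in> S"
    if z: "dist z0 z < rho ?x" and t: "0 \<le> t" "t \<le> 1"
      and le: "del (?y + t * (z $ 2 - ?y)) \<le> rho (?x + t * (z $ 1 - ?x))" for z t
  proof -
    have zx: "\<bar>z $ 1 - ?x\<bar> < rho ?x" using z nth_diff_le_dist[of z 1 z0] by (simp add: dist_commute)
    have "\<bar>t * (z $ 1 - ?x)\<bar> \<le> \<bar>z $ 1 - ?x\<bar>" using t by (simp add: abs_mult mult_left_le_one_le)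
    then have "\<bar>?x + t * (z $ 1 - ?x) - ?x\<bar> < rho ?x" using zx by linarith
    from conc(3,4)[OF this t] show ?thesis using le by (simp add: S_def fib_def)
  qed
  show ?thesis
  proof (cases "del ?y < rho ?x")
    case True
    show ?thesis
    proof (rule that[of "(rho ?x - del ?y) / 2"])
      have half: "0 < (A - B) / 2 \<and> (A - B) / 2 \<le> A" if "B < A" "0 \<le> B" for A B :: real using that by auto
      show "0 < (rho ?x - del ?y) / 2" "(rho ?x - del ?y) / 2 \<le> rho ?x" using half[OF True] by auto
      fix z and t :: real assume z: "dist z0 z < (rho ?x - del ?y) / 2" and t: "0 \<le> t" "t \<le> 1"
      have b: "\<bar>z $ 1 - ?x\<bar> < (rho ?x - del ?y) / 2" "\<bar>z $ 2 - ?y\<bar> < (rho ?x - del ?y) / 2"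
        using z nth_diff_le_dist[of z 1 z0] nth_diff_le_dist[of z 2 z0] by (simp_all add: dist_commute)
      define u v where "u = t * (z $ 1 - ?x)" and "v = t * (z $ 2 - ?y)"
      have "\<bar>u\<bar> \<le> \<bar>z $ 1 - ?x\<bar>" "\<bar>v\<bar> \<le> \<bar>z $ 2 - ?y\<bar>"
        using t by (simp_all add: u_def v_def abs_mult mult_left_le_one_le)
      moreover have "\<bar>rho (?x + u) - rho ?x\<bar> \<le> \<bar>u\<bar>" "\<bar>del (?y + v) - del ?y\<bar> \<le> \<bar>v\<bar>"
        using rho_lip[of "?x + u" ?x] del_lip[of "?y + v" ?y] by simp_all
      ultimately have "\<bar>rho (?x + u) - rho ?x\<bar> < (rho ?x - del ?y) / 2" "\<bar>del (?y + v) - del ?y\<bar> < (rho ?x - del ?y) / 2"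
        using b by (meson order_le_less_trans)+
      moreover have "B \<le> A" if "\<bar>A - A'\<bar> < (A' - B') / 2" "\<bar>B - B'\<bar> < (A' - B') / 2" for A B A' B' :: real
        using that abs_ge_minus_self[of "A - A'"] abs_ge_self[of "B - B'"] by (simp add: field_simps)
      ultimately have "del (?y + v) \<le> rho (?x + u)" by blast
      then have "del (?y + t * (z $ 2 - ?y)) \<le> rho (?x + t * (z $ 1 - ?x))" by (simp add: u_def v_def)
      moreover have "dist z0 z < rho ?x" using half[OF True] z by (meson del_nonneg less_le_trans)
      ultimately show "z0 + t *\<^sub>R (z - z0) \<in> S" using in_S t by blast
    qed
  next
    case False
    then have eq: "del ?y = rho ?x" using x0 by simp
    obtain e where e: "0 < e"
      and con: "\<And>y t. \<bar>y - ?y\<bar> < e \<Longrightarrow> 0 \<le> t \<Longrightarrow> t \<le> 1 \<Longrightarrow> del (?y + t * (y - ?y)) = del ?y + t * (del y - del ?y)"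
      by (rule del_conic[of ?y]) (use x0 eq in auto)
    show ?thesis
    proof (rule that[of "min e (rho ?x)"])
      show "0 < min e (rho ?x)" "min e (rho ?x) \<le> rho ?x" using e x0 by auto
      fix z and t :: real assume zS: "z \<in> S" and z: "dist z0 z < min e (rho ?x)" and t: "0 \<le> t" "t \<le> 1"
      have b: "\<bar>z $ 1 - ?x\<bar> < rho ?x" "\<bar>z $ 2 - ?y\<bar> < e"
        using z nth_diff_le_dist[of z 1 z0] nth_diff_le_dist[of z 2 z0] by (simp_all add: dist_commute)
      have "del (z $ 2) \<le> rho (z $ 1)" using zS by (simp add: S_def fib_def)
      then have "t * (del (z $ 2) - del ?y) \<le> t * (rho (z $ 1) - rho ?x)" using t eq by (intro mult_left_mono) auto
      then have "del (?y + t * (z $ 2 - ?y)) \<le> rho (?x + t * (z $ 1 - ?x))"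
        using con[OF b(2) t] conc(1)[OF b(1) t] eq by linarith
      then show "z0 + t *\<^sub>R (z - z0) \<in> S" using in_S[of z t] z t by simp
    qed
  qed
qed

lemma fmap_translation:
  assumes z0: "z0 \<in> S" "dist z0 z < rho (z0 $ 1)"
  shows "fmap z = (fmap z0 - z0) + z"
proof -
  have x0: "0 \<le> z0 $ 1" "z0 $ 1 \<le> 1" "0 < rho (z0 $ 1)"
    using z0 zero_le_dist[of z0 z] by (auto simp: S_def fib_def simp del: zero_le_dist)
  have "\<bar>z $ 1 - z0 $ 1\<bar> < rho (z0 $ 1)" using z0 nth_diff_le_dist[of z 1 z0] by (simp add: dist_commute)
  from rho_concave(2)[OF x0 this, of 0] show ?thesis
    by (simp add: fmap_def vec_eq_iff forall_2)
qed

lemma ldist_local: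
  assumes z: "z0 \<in> S" "z \<in> S" and star: "\<And>t. 0 \<le> t \<Longrightarrow> t \<le> 1 \<Longrightarrow> z0 + t *\<^sub>R (z - z0) \<in> S"
  shows "QC.ldist z0 z = dist z0 z"
proof (rule antisym)
  have "lip_curve NS (dist z0 z) 0 1 (\<lambda>t. z0 + t *\<^sub>R (z - z0))"
    unfolding lip_curve_euclidean
  proof (intro conjI ballI)
    fix s t :: real
    have "dist (z0 + s *\<^sub>R (z - z0)) (z0 + t *\<^sub>R (z - z0)) = norm ((s - t) *\<^sub>R (z - z0))"
      by (simp add: dist_norm scaleR_left_diff_distrib)
    then show "dist (z0 + s *\<^sub>R (z - z0)) (z0 + t *\<^sub>R (z - z0)) \<le> dist z0 z * \<bar>s - t\<bar>"
      by (simp add: dist_norm norm_minus_commute)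
  qed (use star in auto)
  from QC.ldist_le_lip[OF this, of z0 z] show "QC.ldist z0 z \<le> dist z0 z" by simp
qed (rule QC.ldist_bounds(1)[OF z])

text \<open>A geodesic to a point at distance at least \<open>1/2\<close> crosses the sphere. The
  point found on it is the one at which both dilations take the value \<open>r\<close>.\<close>

lemma sphere_point:
  assumes z0: "z0 \<in> S" and r: "0 < r" "r < 1/2"
  obtains z where "z \<in> S" "QC.ldist z0 z = r"
proof -
  have "fib 0 0" "fib 1 0" using fib_K zero_in_K one_in_K zero_in_C by auto
  then have ends: "pt 0 0 \<in> S" "pt 1 0 \<in> S" by auto
  obtain w where w: "w \<in> S" "1/2 \<le> dist z0 w"
  proof (cases "z0 $ 1 \<le> 1/2")
    case True
    then show ?thesis using that[OF ends(2)] nth_diff_le_dist[of z0 1 "pt 1 0"] by simp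
  next
    case False
    then show ?thesis using that[OF ends(1)] nth_diff_le_dist[of z0 1 "pt 0 0"] by simp
  qed
  define D where "D = QC.ldist z0 w"
  have D: "r < D" using QC.ldist_bounds(1)[OF z0 w(1)] w r by (simp add: D_def)
  obtain c where c: "lip_curve NS 1 0 D c" "c 0 = z0" "c D = w"
    unfolding D_def by (rule QC.unit_speed_geodesic[OF z0 w(1)])
  have cX: "lip_curve X 1 0 D c" by (rule QC.lip_curve_X[OF c(1)])
  have cr: "c r \<in> S" using c(1) r D by (simp add: lip_curve_def)
  have "QC.ldist (c s) (c t) \<le> \<bar>s - t\<bar>" if "s \<in> {0..D}" "t \<in> {0..D}" for s t
    using cX that by (simp add: lip_curve_def)
  from this[of 0 r] this[of r D] have "QC.ldist (c 0) (c r) \<le> r" "QC.ldist (c r) (c D) \<le> D - r"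
    using r D by simp_all
  moreover have "mdist X z0 w \<le> mdist X z0 (c r) + mdist X (c r) w"
    using mdist_triangle[of z0 X "c r" w] z0 cr w by simp
  ultimately have "QC.ldist z0 (c r) = r" using c r D by (simp add: D_def)
  then show ?thesis using that cr by blast
qed

text \<open>Near \<open>z0\<close> the map is a translation, and star-shapedness makes the length
  distance to \<open>z0\<close> equal to the Euclidean one. Points farther away do not lower the
  infimum, because the map is expanding.\<close>

lemma metric_distortion_fmap:
  assumes z0: "z0 \<in> S" "z0 \<notin> E"
  shows "metric_distortion X Y fmap z0 = 1"
proof -
  obtain e where e: "0 < e" "e \<le> rho (z0 $ 1)"
    and star: "\<And>z t. z \<in> S \<Longrightarrow> dist z0 z < e \<Longrightarrow> 0 \<le> t \<Longrightarrow> t \<le> 1 \<Longrightarrow> z0 + t *\<^sub>R (z - z0) \<in> S"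
    using locally_star_shaped[OF z0] by blast
  have sym: "QC.ldist z z0 = QC.ldist z0 z" for z using mdist_commute[of X z z0] by simp
  have near: "dist (fmap z) (fmap z0) = dist z0 z" if "dist z0 z < e" for z
  proof -
    have "fmap z = (fmap z0 - z0) + z" by (rule fmap_translation) (use that e z0 in auto)
    then show ?thesis by (simp add: dist_norm norm_minus_commute)
  qed
  have loc: "QC.ldist z0 z = dist z0 z" if "z \<in> S" "dist z0 z < e" for z
    by (rule ldist_local) (use that star z0 in auto)
  have one: "upper_dilation X Y fmap z0 r / lower_dilation X Y fmap z0 r = 1" if r: "0 < r" "r < min e (1/2)" for r
  proof -
    obtain w where w: "w \<in> S" "QC.ldist z0 w = r" by (rule sphere_point[OF z0(1), of r]) (use r in auto)
    have wd: "dist z0 w < e" using QC.ldist_bounds(1)[OF z0(1) w(1)] w r by simp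
    have fw: "dist (fmap w) (fmap z0) = r" using near[OF wd] loc[OF w(1) wd] w by simp
    have up: "upper_dilation X Y fmap z0 r = ennreal r"
      unfolding upper_dilation_def
    proof (rule antisym)
      show "(SUP y\<in>{y \<in> mspace X. mdist X y z0 \<le> r}. ennreal (mdist Y (fmap y) (fmap z0))) \<le> ennreal r"
      proof (rule SUP_least)
        fix y assume "y \<in> {y \<in> mspace X. mdist X y z0 \<le> r}"
        then have y: "y \<in> S" "QC.ldist z0 y \<le> r" by (simp_all add: sym)
        then have "dist z0 y \<le> r" using QC.ldist_bounds(1)[OF z0(1)] by force
        then show "ennreal (mdist Y (fmap y) (fmap z0)) \<le> ennreal r" using near[of y] r by (simp add: ennreal_leI)
      qed
      show "ennreal r \<le> (SUP y\<in>{y \<in> mspace X. mdist X y z0 \<le> r}. ennreal (mdist Y (fmap y) (fmap z0)))"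
        by (rule SUP_upper2[of w]) (use w fw in \<open>auto simp: sym\<close>)
    qed
    have "lower_dilation X Y fmap z0 r = ennreal r"
      unfolding lower_dilation_def
    proof (rule antisym)
      show "(INF y\<in>{y \<in> mspace X. mdist X y z0 \<ge> r}. ennreal (mdist Y (fmap y) (fmap z0))) \<le> ennreal r"
        by (rule INF_lower2[of w]) (use w fw in \<open>auto simp: sym\<close>)
      show "ennreal r \<le> (INF y\<in>{y \<in> mspace X. mdist X y z0 \<ge> r}. ennreal (mdist Y (fmap y) (fmap z0)))"
      proof (rule INF_greatest)
        fix y assume "y \<in> {y \<in> mspace X. mdist X y z0 \<ge> r}"
        then have y: "y \<in> S" "r \<le> QC.ldist z0 y" by (simp_all add: sym)
        have "r \<le> dist z0 y" using loc[OF y(1)] y(2) r by (cases "dist z0 y < e") auto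
        also have "\<dots> \<le> dist (fmap z0) (fmap y)" by (rule fmap_expanding)
        finally show "ennreal r \<le> ennreal (mdist Y (fmap y) (fmap z0))" by (simp add: ennreal_leI dist_commute)
      qed
    qed
    then show ?thesis using up r by (simp add: ennreal_divide_self)
  qed
  have "eventually (\<lambda>r. upper_dilation X Y fmap z0 r / lower_dilation X Y fmap z0 r = 1) (at_right 0)"
    unfolding eventually_at_right_field using one e by (intro exI[of _ "min e (1/2)"]) auto
  then have "metric_distortion X Y fmap z0 = Limsup (at_right (0::real)) (\<lambda>_. 1)"
    unfolding metric_distortion_def by (rule Limsup_eq)
  then show ?thesis by (simp add: Limsup_const)
qed

lemma emeasure_lborel_translate:
  "A \<in> sets borel \<Longrightarrow> emeasure lborel ((\<lambda>z. v + z) ` A) = emeasure lborel (A :: (real^2) set)"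
proof -
  assume A: "A \<in> sets borel"
  have im: "(\<lambda>z. v + z) ` A = (+) (- v) -` A" by (force simp: image_iff)
  have "emeasure lborel A = emeasure (distr lborel borel ((+) (- v))) A"
    unfolding lborel_distr_plus ..
  also have "\<dots> = emeasure lborel ((+) (- v) -` A)" using A by (subst emeasure_distr) auto
  finally show ?thesis by (simp add: im)
qed

text \<open>For radii below \<open>rho (z $ 1)\<close> the ball of \<open>Y\<close> around the image
  of \<open>z\<close> is a translate of \<open>S \<inter> ball z r\<close>: the map is a translation
  there, and its expansion keeps other points out. That set contains the ball of the length metric,
  whose volume is bounded below.\<close>

lemma ahlfors_regular_off_Y: "ahlfors_regular_off Y nu 2 (fmap ` E)"
proof -
  obtain B where B: "1 \<le> B" and low: "\<And>z r. z \<in> S \<Longrightarrow> 0 < r \<Longrightarrow> r \<le> R0 \<Longrightarrow> ennreal ((r / B)\<^sup>2) \<le> emeasure mu (mball_of X z r)"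
    by (rule emeasure_ball_ge) blast
  have main: "ennreal (r powr 2 / (B\<^sup>2 + 4)) \<le> emeasure nu (mball_of Y (fmap z) r) \<and>
      emeasure nu (mball_of Y (fmap z) r) \<le> ennreal ((B\<^sup>2 + 4) * r powr 2)"
    if z: "z \<in> S" and r: "0 < r" "r < min R0 (rho (z $ 1))" for z r
  proof -
    let ?A = "S \<inter> ball z r" and ?v = "fmap z - z"
    have A: "?A \<in> sets borel" by auto
    have ball: "mball_of Y (fmap z) r = (\<lambda>w. ?v + w) ` ?A"
    proof -
      have "fmap w \<in> mball_of Y (fmap z) r \<longleftrightarrow> w \<in> ?A" if w: "w \<in> S" for w
      proof -
        have "dist (fmap z) (fmap w) < r \<longleftrightarrow> dist z w < r"
        proof
          assume "dist z w < r"
          then have "fmap w = ?v + w" using fmap_translation[OF z, of w] r by simp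
          then show "dist (fmap z) (fmap w) < r" using \<open>dist z w < r\<close> by (simp add: dist_norm)
        qed (use fmap_expanding[of z w] in simp)
        then show ?thesis using w z by (auto simp: T_def)
      qed
      then have "mball_of Y (fmap z) r = fmap ` ?A" by (auto simp: T_def)
      also have "\<dots> = (\<lambda>w. ?v + w) ` ?A"
        by (rule image_cong[OF refl], rule fmap_translation[OF z]) (use r in auto)
      finally show ?thesis .
    qed
    have "emeasure nu (mball_of Y (fmap z) r) = emeasure lborel (mball_of Y (fmap z) r)"
      unfolding nu_def using compact_imp_closed[OF compact_T] by (subst emeasure_restrict_space) auto
    then have eq: "emeasure nu (mball_of Y (fmap z) r) = emeasure lborel ?A"
      unfolding ball using emeasure_lborel_translate[OF A] by simp
    have "?A \<subseteq> bx (z $ 1) (z $ 2) r"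
    proof
      fix w assume "w \<in> ?A"
      then show "w \<in> bx (z $ 1) (z $ 2) r"
        using nth_diff_le_dist[of w 1 z] nth_diff_le_dist[of w 2 z] by (auto simp: bx_def dist_commute)
    qed
    then have "emeasure lborel ?A \<le> emeasure lborel (bx (z $ 1) (z $ 2) r)" by (intro emeasure_mono) auto
    also have "\<dots> \<le> ennreal (4 * r\<^sup>2)" using r by (intro emeasure_bx_le) auto
    also have "\<dots> \<le> ennreal ((B\<^sup>2 + 4) * r powr 2)" using r by (intro ennreal_leI) (simp add: distrib_right)
    finally have up: "emeasure lborel ?A \<le> ennreal ((B\<^sup>2 + 4) * r powr 2)" .
    have "ennreal (r powr 2 / (B\<^sup>2 + 4)) \<le> ennreal ((r / B)\<^sup>2)"
    proof (rule ennreal_leI)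
      have "0 < B\<^sup>2" using B by simp
      then have "r\<^sup>2 / (B\<^sup>2 + 4) \<le> r\<^sup>2 / B\<^sup>2" by (intro divide_left_mono mult_pos_pos add_pos_pos) auto
      then show "r powr 2 / (B\<^sup>2 + 4) \<le> (r / B)\<^sup>2" using r by (simp add: power_divide)
    qed
    also have "\<dots> \<le> emeasure mu (mball_of X z r)" using low[OF z, of r] r by simp
    also have "\<dots> = emeasure lborel (mball_of X z r)" by (rule emeasure_mu[OF ball_subset])
    also have "\<dots> \<le> emeasure lborel ?A"
    proof (intro emeasure_mono subsetI)
      fix w assume "w \<in> mball_of X z r"
      then show "w \<in> ?A" using QC.ldist_bounds(1)[OF z, of w] by auto
    qed (use A in simp)
    finally show ?thesis using up eq by simp
  qed
  show ?thesis
    unfolding ahlfors_regular_off_def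
  proof (rule conjI[rotated], rule conjI, goal_cases)
    case 3
    show ?case using E_nonempty by simp
  next
    case 1
    show ?case using E_subset by (auto simp: T_def)
  next
    case 2
    show ?case
    proof (rule exI[of _ "B\<^sup>2 + 4"], rule conjI, rule add_nonneg_pos, simp, simp, rule ballI)
    fix w assume "w \<in> mspace Y - fmap ` E"
    then obtain z where z: "z \<in> S" "z \<notin> E" "w = fmap z" by (auto simp: T_def)
    then have "0 < rho (z $ 1)" by (simp add: rho_pos_iff E_def)
    then show "\<exists>rx>0. \<forall>r. 0 < r \<and> r < rx \<longrightarrow> ennreal (r powr 2 / (B\<^sup>2 + 4)) \<le> emeasure nu (mball_of Y w r) \<and>
        emeasure nu (mball_of Y w r) \<le> ennreal ((B\<^sup>2 + 4) * r powr 2)"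
      using main[OF z(1)] R0 z(3) by (intro exI[of _ "min R0 (rho (z $ 1))"]) auto
    qed
  qed
qed

end

section \<open>Hausdorff measure\<close>

lemma ennreal_half_le:
  assumes "1 \<le> ennreal 2 * x"
  shows "ennreal (1/2) \<le> x"
proof (cases x)
  case (real r)
  then have "ennreal 1 \<le> ennreal (2 * r)" using assms by (simp add: ennreal_mult)
  then have "1 \<le> 2 * r" using real by (subst (asm) ennreal_le_iff) auto
  then show ?thesis unfolding real(2) by (intro ennreal_leI) simp
qed simp

lemma epowr_mono: "x \<le> ennreal d \<Longrightarrow> 0 \<le> d \<Longrightarrow> 0 \<le> e \<Longrightarrow> epowr x e \<le> ennreal (d powr e)"
proof -
  assume x: "x \<le> ennreal d" "0 \<le> d" "0 \<le> e"
  then have "x \<noteq> top" by (metis ennreal_neq_top top.extremum_unique)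
  moreover have "enn2real x \<le> d" using enn2real_mono[OF x(1)] x(2) by simp
  ultimately show ?thesis using x by (simp add: epowr_def ennreal_leI powr_mono2)
qed

lemma hausdorff_content_le:
  assumes J: "finite J" and Q: "\<And>j. j \<in> J \<Longrightarrow> Q j \<subseteq> mspace M" "\<And>j. j \<in> J \<Longrightarrow> mdiam M (Q j) \<le> ennreal d"
    and d: "0 \<le> d" "d \<le> \<delta>" and E: "E \<subseteq> (\<Union>j\<in>J. Q j)" and \<alpha>: "0 < \<alpha>"
  shows "hausdorff_content M \<alpha> \<delta> E \<le> ennreal (real (card J) * d powr \<alpha>)"
proof -
  obtain h where h: "bij_betw h {..<card J} J" using ex_bij_betw_nat_finite[OF J] by (auto simp: atLeast0LessThan)
  define A where "A i = (if i < card J then Q (h i) else {})" for i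
  have hJ: "h i \<in> J" if "i < card J" for i using h that by (auto simp: bij_betw_def)
  have diam_empty: "mdiam M {} = 0" by (simp add: mdiam_def bot_ennreal)
  have "hausdorff_content M \<alpha> \<delta> E \<le> (\<Sum>n. epowr (mdiam M (A n)) \<alpha>)"
    unfolding hausdorff_content_def
  proof (rule INF_lower, intro CollectI conjI allI)
    fix n show "A n \<subseteq> mspace M" using Q(1) hJ by (auto simp: A_def)
    show "mdiam M (A n) \<le> ennreal \<delta>"
      using Q(2)[OF hJ] ennreal_leI[OF d(2)] by (auto simp: A_def diam_empty intro: order_trans)
  next
    show "E \<subseteq> (\<Union>n. A n)"
    proof
      fix z assume "z \<in> E"
      then obtain j where j: "j \<in> J" "z \<in> Q j" using E by auto
      obtain i where "i < card J" "h i = j" using h j(1) unfolding bij_betw_def by (metis imageE lessThan_iff)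
      then have "z \<in> A i" using j by (simp add: A_def)
      then show "z \<in> (\<Union>n. A n)" by blast
    qed
  qed
  also have "\<dots> = (\<Sum>n<card J. epowr (mdiam M (A n)) \<alpha>)"
    by (rule suminf_finite) (use \<alpha> in \<open>auto simp: A_def diam_empty epowr_def\<close>)
  also have "\<dots> \<le> (\<Sum>n<card J. ennreal (d powr \<alpha>))"
    by (intro sum_mono epowr_mono) (use Q(2)[OF hJ] d \<alpha> in \<open>auto simp: A_def\<close>)
  also have "\<dots> = ennreal (real (card J) * d powr \<alpha>)"
    by (simp add: ennreal_mult ennreal_of_nat_eq_real_of_nat)
  finally show ?thesis .
qed

lemma mdiam_leI: "(\<And>x y. x \<in> A \<Longrightarrow> y \<in> A \<Longrightarrow> mdist M x y \<le> d) \<Longrightarrow> mdiam M A \<le> ennreal d"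
  unfolding mdiam_def by (intro SUP_least ennreal_leI)

context construction
begin

lemma power_lam_dim: "(lam ^ n) powr (sK + sC) = (1/2) ^ (n * (m + 1))"
proof -
  have "(lam ^ n) powr sC = ((a ^ (m * n)) powr sC)" by (simp add: lam_pow)
  also have "\<dots> = (1/2) ^ (m * n)" by (rule cC.a_power_powr_cdim)
  finally show ?thesis
    by (simp add: powr_add cK.a_power_powr_cdim power_add mult.commute)
qed

text \<open>Level \<open>n\<close> of \<open>K\<close> and level \<open>m * n\<close> of
  \<open>C\<close> both have intervals of relative length \<open>lam ^ n\<close>, so
  \<open>E\<close> is covered by \<open>2 ^ (n * (m + 1))\<close> nearly square pieces; the power of
  their size is exactly the inverse of their number.\<close>

lemma hausdorff_E_finite: "hausdorff_measure X (sK + sC) E < top"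
proof -
  define D where "D = Lc * (1 + bet)"
  have D: "0 < D" using Lc(1) bet by (simp add: D_def add_pos_pos)
  have dim: "0 < sK + sC" using cK.cdim_bounds cC.cdim_bounds by simp
  have "hausdorff_content X (sK + sC) \<delta> E \<le> ennreal (D powr (sK + sC))" if \<delta>: "0 < \<delta>" for \<delta>
  proof -
    have "(\<lambda>n. D * lam ^ n) \<longlonglongrightarrow> D * 0" using lam by (intro tendsto_mult LIMSEQ_realpow_zero tendsto_const) auto
    then obtain n where n: "D * lam ^ n < \<delta>"
      using order_tendstoD(2)[of "\<lambda>n. D * lam ^ n" 0 sequentially \<delta>] \<delta> by (auto simp: eventually_sequentially)
    define J where "J = cantor_ends lam n \<times> cantor_ends a (m * n)"
    define Q where "Q j = {z\<in>E. fst j \<le> z $ 1 \<and> z $ 1 \<le> fst j + lam ^ n \<and>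
      bet * snd j \<le> z $ 2 \<and> z $ 2 \<le> bet * snd j + bet * lam ^ n}" for j
    have J: "finite J" "card J = 2 ^ (n * (m + 1))"
      by (simp_all add: J_def cK.finite_ends cC.finite_ends card_cartesian_product cK.card_ends_eq cC.card_ends_eq
        power_add[symmetric] mult.commute)
    have "hausdorff_content X (sK + sC) \<delta> E \<le> ennreal (real (card J) * (D * lam ^ n) powr (sK + sC))"
    proof (rule hausdorff_content_le[OF J(1), where Q = Q])
      fix j assume "j \<in> J"
      show "Q j \<subseteq> mspace X" using E_subset by (auto simp: Q_def)
      show "mdiam X (Q j) \<le> ennreal (D * lam ^ n)"
      proof (rule mdiam_leI)
        fix z w assume zw: "z \<in> Q j" "w \<in> Q j"
        then have S: "z \<in> S" "w \<in> S" using E_subset by (auto simp: Q_def)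
        have "\<bar>z $ 1 - w $ 1\<bar> \<le> lam ^ n" "\<bar>z $ 2 - w $ 2\<bar> \<le> bet * lam ^ n"
          using zw unfolding Q_def by (simp_all add: abs_le_iff)
        then have "dist z w \<le> (1 + bet) * lam ^ n"
          using dist_pt_le[of "z $ 1" "z $ 2" "w $ 1" "w $ 2"] unfolding distrib_right pt_eta by linarith
        then have "Lc * dist z w \<le> Lc * ((1 + bet) * lam ^ n)" using Lc(1) by (intro mult_left_mono) auto
        then show "mdist X z w \<le> D * lam ^ n"
          using QC.ldist_bounds(2)[OF S] by (simp add: D_def mult.assoc)
      qed
    next
      show "0 \<le> D * lam ^ n" "D * lam ^ n \<le> \<delta>" using D lam n by auto
      show "E \<subseteq> (\<Union>j\<in>J. Q j)"
      proof
        fix z assume z: "z \<in> E"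
        then have "z $ 1 \<in> cantor_level lam n" "z $ 2 \<in> C" by (auto simp: E_iff K_def cantor_set_def)
        moreover from this obtain y where y: "y \<in> cantor_set a" "z $ 2 = bet * y" by (auto simp: C_def)
        moreover have "y \<in> cantor_level a (m * n)" using y by (auto simp: cantor_set_def)
        ultimately obtain l k where lk: "l \<in> cantor_ends lam n" "l \<le> z $ 1" "z $ 1 \<le> l + lam ^ n"
          "k \<in> cantor_ends a (m * n)" "k \<le> y" "y \<le> k + a ^ (m * n)" by (auto simp: cantor_level_def)
        have "bet * y \<le> bet * (k + lam ^ n)" "bet * k \<le> bet * y"
          using lk bet by (auto intro: mult_left_mono simp: lam_pow)
        then have "z \<in> Q (l, k)" "(l, k) \<in> J" using lk z y by (auto simp: Q_def J_def distrib_left)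
        then show "z \<in> (\<Union>j\<in>J. Q j)" by blast
      qed
    qed (rule dim)
    also have "real (card J) * (D * lam ^ n) powr (sK + sC) = D powr (sK + sC)"
    proof -
      have "(D * lam ^ n) powr (sK + sC) = D powr (sK + sC) * (1/2) ^ (n * (m + 1))"
        by (simp add: powr_mult power_lam_dim)
      then show ?thesis unfolding J(2) by (simp add: power_one_over)
    qed
    finally show ?thesis .
  qed
  then have "hausdorff_measure X (sK + sC) E \<le> ennreal (D powr (sK + sC))"
    unfolding hausdorff_measure_def by (intro SUP_least) auto
  then show ?thesis by (rule le_less_trans) simp
qed

lemma emeasure_MC_C: "emeasure MC C = 1" and emeasure_MK_K: "emeasure (interval_measure FK) K = 1"
proof -
  have "emeasure MC C = emeasure MC {0..bet}"
  proof (rule emeasure_eq_AE)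
    show "AE c in MC. c \<in> C \<longleftrightarrow> c \<in> {0..bet}" using AE_MC_in_C by eventually_elim (use C_subset in auto)
  qed (use RC.closed_C in auto)
  then show "emeasure MC C = 1"
    using bet by (simp add: emeasure_MC_Icc FC_def cC.fun_outside)
  have "emeasure (interval_measure FK) K = emeasure (interval_measure FK) {0..1}"
  proof (rule emeasure_eq_AE)
    show "AE x in interval_measure FK. x \<in> K \<longleftrightarrow> x \<in> {0..1}" using RK.AE_in_C by eventually_elim (use K_subset in auto)
  qed (use RK.closed_C in auto)
  also have "\<dots> = ennreal (FK 1 - FK 0)" by (rule RK.emeasure_Icc) simp
  finally show "emeasure (interval_measure FK) K = 1" by (simp add: FK_def cK.fun_outside)
qed

text \<open>The mass distribution principle for the product of the two Cantor measures, whose mass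
  on a square of half-side \<open>d\<close> is at most \<open>c * d powr (sK + sC)\<close>.\<close>

lemma hausdorff_E_pos: "0 < hausdorff_measure X (sK + sC) E"
proof -
  define AK where "AK = (1 - 2 * lam) powr (- sK)"
  define c where "c = AK * 2 powr sK * (AC * 2 powr sC)"
  have c: "0 < c" using lam AC by (simp add: c_def AK_def)
  let ?MK = "interval_measure FK"
  interpret MC: sigma_finite_measure MC by (rule sigma_finite_MC)
  have rect: "emeasure (?MK \<Otimes>\<^sub>M MC) ({x - d..x + d} \<times> {y - d..y + d}) \<le> ennreal (c * d powr (sK + sC))"
    if d: "0 \<le> d" for x y d
  proof -
    have "emeasure (?MK \<Otimes>\<^sub>M MC) ({x - d..x + d} \<times> {y - d..y + d}) = emeasure ?MK {x - d..x + d} * emeasure MC {y - d..y + d}"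
      by (rule MC.emeasure_pair_measure_Times) auto
    also have "\<dots> \<le> ennreal (AK * (2 * d) powr sK) * ennreal (AC * (2 * d) powr sC)"
      using RK.emeasure_ball[OF d, of x] emeasure_MC_ball[OF d, of y] unfolding AK_def by (rule mult_mono) auto
    also have "\<dots> = ennreal (c * d powr (sK + sC))"
      using AC lam by (subst ennreal_mult[symmetric]) (auto simp: c_def AK_def powr_mult powr_add mult_ac)
    finally show ?thesis .
  qed
  \<comment> \<open>One scale is enough, as the measure is a supremum over scales; the bound 1 only
    ensures that the covering sets have finite diameter.\<close>
  have "ennreal (1 / c) \<le> hausdorff_content X (sK + sC) 1 E"
    unfolding hausdorff_content_def
  proof (rule INF_greatest)
    fix A assume "A \<in> {A :: nat \<Rightarrow> (real^2) set. (\<forall>n. A n \<subseteq> mspace X \<and> mdiam X (A n) \<le> ennreal 1) \<and> E \<subseteq> (\<Union>n. A n)}"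
    then have A: "\<And>n. A n \<subseteq> S" "\<And>n. mdiam X (A n) \<le> ennreal 1" "E \<subseteq> (\<Union>n. A n)" by auto
    have "\<exists>R. R \<in> sets (?MK \<Otimes>\<^sub>M MC) \<and> (\<forall>z\<in>A n. (z $ 1, z $ 2) \<in> R) \<and>
        emeasure (?MK \<Otimes>\<^sub>M MC) R \<le> ennreal c * epowr (mdiam X (A n)) (sK + sC)" for n
    proof (cases "A n = {}")
      case False
      then obtain z where z: "z \<in> A n" by auto
      define d where "d = enn2real (mdiam X (A n))"
      have fin: "mdiam X (A n) \<noteq> top" using A(2)[of n] by (metis ennreal_neq_top top.extremum_unique)
      then have d: "0 \<le> d" "mdiam X (A n) = ennreal d" by (simp_all add: d_def less_top)
      show ?thesis
      proof (intro exI conjI ballI)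
        show "{z $ 1 - d..z $ 1 + d} \<times> {z $ 2 - d..z $ 2 + d} \<in> sets (?MK \<Otimes>\<^sub>M MC)" by (intro pair_measureI) auto
        show "emeasure (?MK \<Otimes>\<^sub>M MC) ({z $ 1 - d..z $ 1 + d} \<times> {z $ 2 - d..z $ 2 + d})
            \<le> ennreal c * epowr (mdiam X (A n)) (sK + sC)"
          using rect[OF d(1), of "z $ 1" "z $ 2"] c fin
          by (simp add: epowr_def d_def ennreal_mult[symmetric])
        fix w assume w: "w \<in> A n"
        have "ennreal (mdist X z w) \<le> mdiam X (A n)" unfolding mdiam_def by (intro SUP_upper2[OF z] SUP_upper w)
        then have "QC.ldist z w \<le> d" using d by simp
        then have "dist z w \<le> d" using QC.ldist_bounds(1)[of z w] A(1) z w by force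
        then show "(w $ 1, w $ 2) \<in> {z $ 1 - d..z $ 1 + d} \<times> {z $ 2 - d..z $ 2 + d}"
          using nth_diff_le_dist[of z 1 w] nth_diff_le_dist[of z 2 w] by (simp add: abs_le_iff)
      qed
    qed (intro exI[of _ "{}"], auto)
    then obtain R where R: "\<And>n. R n \<in> sets (?MK \<Otimes>\<^sub>M MC)" "\<And>n z. z \<in> A n \<Longrightarrow> (z $ 1, z $ 2) \<in> R n"
        "\<And>n. emeasure (?MK \<Otimes>\<^sub>M MC) (R n) \<le> ennreal c * epowr (mdiam X (A n)) (sK + sC)" by metis
    have "K \<times> C \<subseteq> (\<Union>n. R n)"
    proof
      fix p assume "p \<in> K \<times> C"
      then have "pt (fst p) (snd p) \<in> E" by (auto simp: E_iff)
      then obtain n where "pt (fst p) (snd p) \<in> A n" using A(3) by blast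
      from R(2)[OF this] show "p \<in> (\<Union>n. R n)" by auto
    qed
    moreover have "emeasure (?MK \<Otimes>\<^sub>M MC) (K \<times> C) = 1"
      using RK.closed_C RC.closed_C
      by (subst MC.emeasure_pair_measure_Times) (auto simp: emeasure_MC_C emeasure_MK_K)
    moreover have "emeasure (?MK \<Otimes>\<^sub>M MC) (K \<times> C) \<le> emeasure (?MK \<Otimes>\<^sub>M MC) (\<Union>n. R n)"
      by (rule emeasure_mono) (use R(1) calculation(1) in auto)
    ultimately have "1 \<le> emeasure (?MK \<Otimes>\<^sub>M MC) (\<Union>n. R n)" by simp
    also have "\<dots> \<le> (\<Sum>n. emeasure (?MK \<Otimes>\<^sub>M MC) (R n))"
      by (rule emeasure_subadditive_countably) (use R(1) in auto)
    also have "\<dots> \<le> (\<Sum>n. ennreal c * epowr (mdiam X (A n)) (sK + sC))"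
      by (intro suminf_le R(3)) auto
    also have "\<dots> = ennreal c * (\<Sum>n. epowr (mdiam X (A n)) (sK + sC))" by simp
    finally have "ennreal (1 / c) * 1 \<le> ennreal (1 / c) * (ennreal c * (\<Sum>n. epowr (mdiam X (A n)) (sK + sC)))"
      by (intro mult_left_mono) auto
    then show "ennreal (1 / c) \<le> (\<Sum>n. epowr (mdiam X (A n)) (sK + sC))"
      using c by (simp add: mult.assoc[symmetric] ennreal_mult[symmetric])
  qed
  also have "\<dots> \<le> hausdorff_measure X (sK + sC) E" unfolding hausdorff_measure_def by (rule SUP_upper) simp
  finally show ?thesis using c by (meson divide_pos_pos ennreal_less_zero_iff less_le_trans zero_less_one)
qed

section \<open>Failure of absolute continuity\<close>

definition strand :: "real \<Rightarrow> real \<Rightarrow> real \<Rightarrow> real^2" where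
  "strand c \<tau> x = pt x (c + \<tau> * rho x)"

lemma strand_curve:
  assumes "c \<in> C" "\<bar>\<tau>\<bar> \<le> 1/2" "0 \<le> x1" "x1 \<le> x2" "x2 \<le> 1"
  shows "lip_curve X 2 x1 x2 (strand c \<tau>)"
  unfolding strand_def[abs_def] by (rule QC.lip_curve_X, rule graph_curve) (use assms in auto)

lemma strand_stretch: "l \<in> cantor_ends lam n \<Longrightarrow> (1/2) ^ n \<le> dist (fmap (strand c \<tau> l)) (fmap (strand c \<tau> (l + lam ^ n)))"
proof -
  assume "l \<in> cantor_ends lam n"
  then have "FK (l + lam ^ n) - FK l = (1/2) ^ n" unfolding FK_def by (rule cK.fun_ends)
  moreover have "0 \<le> lam ^ n" using lam by simp
  moreover have "\<bar>fmap (strand c \<tau> (l + lam ^ n)) $ 1 - fmap (strand c \<tau> l) $ 1\<bar> \<le> dist (fmap (strand c \<tau> (l + lam ^ n))) (fmap (strand c \<tau> l))"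
    by (rule nth_diff_le_dist)
  ultimately show ?thesis
    unfolding dist_commute[of "fmap (strand c \<tau> l)"] by (simp add: fmap_def strand_def)
qed

text \<open>Over the \<open>2 ^ n\<close> intervals of level \<open>n\<close> of \<open>K\<close>
  the curve has total length at most \<open>2 * (2 * lam) ^ n\<close>, which tends to zero, while
  the end points of their images are at total distance at least 1.\<close>

lemma not_abs_continuous_strand:
  assumes c: "c \<in> C" "\<bar>\<tau>\<bar> \<le> 1/2"
  shows "\<not> abs_continuous_path X Y fmap (0, 1, strand c \<tau>)"
proof
  let ?g = "strand c \<tau>"
  assume ac: "abs_continuous_path X Y fmap (0, 1, ?g)"
  interpret rectifiable_path X 0 1 ?g
    by unfold_locales (rule lip_curve_rectifiable[OF strand_curve[OF c]], auto)
  let ?h = "fmap \<circ> arclength_param X (0, 1, ?g)"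
  have "abs_continuous_interval Y 0 (arc 1) ?h"
    using ac unfolding abs_continuous_path_def path_len_total .
  note ac' = this[unfolded abs_continuous_interval_def, rule_format, OF zero_less_one]
  obtain \<delta> where \<delta>: "0 < \<delta>" and ac\<delta>: "\<forall>(n::nat) s t.
        (\<forall>i<n. 0 \<le> s i \<and> s i \<le> t i \<and> t i \<le> arc 1) \<and>
        (\<forall>i<n. \<forall>j<n. i \<noteq> j \<longrightarrow> {s i<..<t i} \<inter> {s j<..<t j} = {}) \<and>
        (\<Sum>i<n. t i - s i) < \<delta> \<longrightarrow> (\<Sum>i<n. dist (?h (s i)) (?h (t i))) < 1"
    using ac' unfolding mdist_Y by (elim exE conjE) (rule that)
  have AC: "(\<Sum>i<n. dist (?h (s i)) (?h (t i))) < 1"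
    if "\<And>i. i < n \<Longrightarrow> 0 \<le> s i \<and> s i \<le> t i \<and> t i \<le> arc 1"
      "\<And>i j. i < n \<Longrightarrow> j < n \<Longrightarrow> i \<noteq> j \<Longrightarrow> {s i<..<t i} \<inter> {s j<..<t j} = {}"
      "(\<Sum>i<n. t i - s i) < \<delta>" for n :: nat and s t
    by (rule ac\<delta>[THEN spec, THEN spec, THEN spec, THEN mp]) (intro conjI allI impI that)
  have "(\<lambda>n. 2 * (2 * lam) ^ n) \<longlonglongrightarrow> 2 * 0" using lam by (intro tendsto_mult LIMSEQ_realpow_zero tendsto_const) auto
  then obtain n where n: "2 * (2 * lam) ^ n < \<delta>"
    using order_tendstoD(2)[of "\<lambda>n. 2 * (2 * lam) ^ n" 0 sequentially \<delta>] \<delta> by (auto simp: eventually_sequentially)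
  obtain e where e: "bij_betw e {..<(2::nat) ^ n} (cantor_ends lam n)"
    using ex_bij_betw_nat_finite[OF cK.finite_ends, of n] by (auto simp: atLeast0LessThan cK.card_ends_eq)
  have ends: "e i \<in> cantor_ends lam n" if "i < 2 ^ n" for i :: nat using e that by (auto simp: bij_betw_def)
  have b: "0 \<le> e i" "e i + lam ^ n \<le> 1" if "i < 2 ^ n" for i :: nat using cK.ends_bounds[OF ends[OF that]] by auto
  have ln: "0 \<le> lam ^ n" using lam by simp
  have "(\<Sum>i<2 ^ n. dist (?h (arc (e i))) (?h (arc (e i + lam ^ n)))) < 1"
  proof (rule AC)
    fix i :: nat assume i: "i < 2 ^ n"
    show "0 \<le> arc (e i) \<and> arc (e i) \<le> arc (e i + lam ^ n) \<and> arc (e i + lam ^ n) \<le> arc 1"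
      using b[OF i] ln by (auto intro!: arc_mono)
    fix j :: nat assume j: "j < 2 ^ n" and ij: "i \<noteq> j"
    have ne: "e i \<noteq> e j" using e i j ij by (auto simp: bij_betw_def inj_on_def)
    have sep: "arc (e i + lam ^ n) \<le> arc (e j)" if "e i < e j" "i < 2 ^ n" "j < 2 ^ n" for i j
      using cK.ends_separated[OF ends[OF that(2)] ends[OF that(3)] that(1)] b[OF that(2)] b[OF that(3)] ln
      by (intro arc_mono) auto
    show "{arc (e i)<..<arc (e i + lam ^ n)} \<inter> {arc (e j)<..<arc (e j + lam ^ n)} = {}"
      using sep[of i j] sep[of j i] ne i j by (cases "e i < e j") auto
  next
    have "arc (e i + lam ^ n) - arc (e i) \<le> 2 * lam ^ n" if i: "i < 2 ^ n" for i
    proof -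
      have "ennreal (arc (e i + lam ^ n) - arc (e i)) = path_len X (e i, e i + lam ^ n, ?g)"
        using path_len_between[of "e i" "e i + lam ^ n"] b[OF i] ln by simp
      also have "\<dots> \<le> ennreal (2 * (e i + lam ^ n - e i))"
        by (rule path_len_lip_curve, rule strand_curve[OF c]) (use b[OF i] ln in auto)
      finally show ?thesis using ln by simp
    qed
    then have "(\<Sum>i<2 ^ n. arc (e i + lam ^ n) - arc (e i)) \<le> (\<Sum>i<(2::nat) ^ n. 2 * lam ^ n)"
      by (intro sum_mono) auto
    also have "\<dots> = 2 * (2 * lam) ^ n" by (simp add: power_mult_distrib)
    finally show "(\<Sum>i<2 ^ n. arc (e i + lam ^ n) - arc (e i)) < \<delta>" using n by simp
  qed
  moreover have "(\<Sum>i<(2::nat) ^ n. (1/2) ^ n) \<le> (\<Sum>i<2 ^ n. dist (?h (arc (e i))) (?h (arc (e i + lam ^ n))))"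
  proof (rule sum_mono)
    fix i :: nat assume "i \<in> {..<2 ^ n}"
    then have i: "i < 2 ^ n" by simp
    show "(1/2) ^ n \<le> dist (?h (arc (e i))) (?h (arc (e i + lam ^ n)))"
      using strand_stretch[OF ends[OF i], of c \<tau>] b[OF i] ln by (simp add: arclength_param_arc)
  qed
  ultimately show False by (simp add: power_one_over)
qed

section \<open>Modulus\<close>

text \<open>\<open>pencil\<close> followed by Hoelder's inequality, with the weight integrated over
  a box at scale 1 that contains all of \<open>S\<close>. The centre lies over \<open>0\<close>,
  where \<open>rho\<close> vanishes, so this scale counts as large. The indicator of
  \<open>S\<close> turns \<open>g\<close> into a Borel function on the plane, and \<open>t\<close>
  stays free because the two applications need different values.\<close>

lemma strand_bound:
  assumes q: "1 < q" "1 - sC < (1 - sK) * (q - 1)"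
  shows "\<exists>B>0. \<forall>g\<in>borel_measurable (mborel X). \<forall>t>0.
    (\<integral>\<^sup>+c. (\<integral>\<^sup>+\<tau>\<in>{-1/2..1/2}. (\<integral>\<^sup>+x\<in>{0..1}. g (strand c \<tau> x) * indicator S (strand c \<tau> x) \<partial>lborel) \<partial>lborel) \<partial>MC)
      \<le> ennreal AC * (ennreal (t powr (1 - q)) * (\<integral>\<^sup>+z. epowr (g z) q \<partial>mu) + ennreal t * ennreal B)"
proof -
  let ?k = "\<lambda>z :: real^2. 1 + (1 / rho (z $ 1)) powr (1 - sC)"
  let ?Q = "{z\<in>S. \<bar>z $ 1 - 0\<bar> \<le> (bet + 10) * 1 \<and> \<bar>z $ 2 - 0\<bar> \<le> (bet + 10) * 1}"
  obtain B where B: "0 < B" and wt: "\<And>x0 y0 r. fib x0 y0 \<Longrightarrow> 0 < r \<Longrightarrow> r \<le> 1 \<Longrightarrow> \<theta> * rho x0 \<le> 100 * r \<Longrightarrow>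
    (\<integral>\<^sup>+z\<in>{z\<in>S. \<bar>z $ 1 - x0\<bar> \<le> (bet + 10) * r \<and> \<bar>z $ 2 - y0\<bar> \<le> (bet + 10) * r}.
        ennreal ((1 + (r / rho (z $ 1)) powr (1 - sC)) powr (q / (q - 1))) \<partial>lborel) \<le> ennreal (B * r\<^sup>2)"
    using weight_integral[OF q, of 1 "bet + 10"] bet by auto
  have "rho 0 = 0" using zero_in_K rho_zero_iff by blast
  then have "(\<integral>\<^sup>+z\<in>?Q. ennreal (?k z powr (q / (q - 1))) \<partial>lborel) \<le> ennreal (B * 1\<^sup>2)"
    using fib_K[OF zero_in_K] zero_in_C by (intro wt) auto
  moreover have "?Q = S"
  proof -
    have "\<bar>z $ 1\<bar> \<le> bet + 10 \<and> \<bar>z $ 2\<bar> \<le> bet + 10" if "z \<in> S" for z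
      using fib_bounds[of "z $ 1" "z $ 2"] that bet unfolding S_def by (auto simp: abs_le_iff)
    then show ?thesis by auto
  qed
  ultimately have weight: "(\<integral>\<^sup>+z. ennreal (?k z powr (q / (q - 1))) \<partial>mu) \<le> ennreal B" by (simp add: nn_integral_mu)
  show ?thesis
  proof (rule exI[of _ B], intro conjI[OF B] ballI allI impI)
    fix g :: "real^2 \<Rightarrow> ennreal" and t :: real
    assume g: "g \<in> borel_measurable (mborel X)" and t: "0 < t"
    have gmu [measurable]: "g \<in> borel_measurable mu" using g by (simp add: measurable_cong_sets[OF sets_mu refl])
    have kmu [measurable]: "?k \<in> borel_measurable mu"
      unfolding mu_def by (rule measurable_restrict_space1) measurable
    define G where "G x y = g (pt x y) * indicator S (pt x y)" for x y
    have gS [measurable]: "(\<lambda>z. g z * indicator S z) \<in> borel_measurable borel"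
    proof -
      have "g \<in> borel_measurable (restrict_space borel S)"
        using g by (simp add: measurable_cong_sets[OF QC.sets_mborel_X refl])
      then show ?thesis by (subst (asm) borel_measurable_restrict_space_iff_ennreal) auto
    qed
    have "(\<lambda>p. (\<lambda>z. g z * indicator S z) (pt (fst p) (snd p))) \<in> borel_measurable (borel \<Otimes>\<^sub>M borel)"
      by (rule measurable_compose[OF _ gS]) measurable
    then have Gm: "case_prod G \<in> borel_measurable (borel \<Otimes>\<^sub>M borel)" by (simp add: G_def case_prod_unfold)
    have "(\<integral>\<^sup>+c. (\<integral>\<^sup>+\<tau>\<in>{-1/2..1/2}. (\<integral>\<^sup>+x\<in>{0..1}. g (strand c \<tau> x) * indicator S (strand c \<tau> x) \<partial>lborel) \<partial>lborel) \<partial>MC)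
        \<le> ennreal AC * (\<integral>\<^sup>+x\<in>{0..1}. ennreal (rho x powr (sC - 1)) * (\<integral>\<^sup>+y. G x y \<partial>lborel) \<partial>lborel)"
      using pencil[OF Gm] by (simp add: G_def strand_def)
    also have "(\<integral>\<^sup>+x\<in>{0..1}. ennreal (rho x powr (sC - 1)) * (\<integral>\<^sup>+y. G x y \<partial>lborel) \<partial>lborel)
        \<le> (\<integral>\<^sup>+x. (\<integral>\<^sup>+y. ennreal (rho x powr (sC - 1)) * G x y \<partial>lborel) \<partial>lborel)"
    proof (rule nn_integral_mono)
      fix x
      have "(\<lambda>y. G x y) \<in> borel_measurable borel"
        unfolding G_def by (rule measurable_compose[OF _ gS]) measurable
      then have "(\<integral>\<^sup>+y. ennreal (rho x powr (sC - 1)) * G x y \<partial>lborel) = ennreal (rho x powr (sC - 1)) * (\<integral>\<^sup>+y. G x y \<partial>lborel)"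
        by (intro nn_integral_cmult) auto
      then show "ennreal (rho x powr (sC - 1)) * (\<integral>\<^sup>+y. G x y \<partial>lborel) * indicator {0..1} x
          \<le> (\<integral>\<^sup>+y. ennreal (rho x powr (sC - 1)) * G x y \<partial>lborel)" by (auto simp: indicator_def)
    qed
    also have "\<dots> = (\<integral>\<^sup>+z. ennreal (rho (z $ 1) powr (sC - 1)) * (g z * indicator S z) \<partial>lborel)"
      by (subst nn_integral_real2(1)) (auto simp: G_def)
    also have "\<dots> = (\<integral>\<^sup>+z. g z * ennreal (rho (z $ 1) powr (sC - 1)) \<partial>mu)"
      unfolding nn_integral_mu by (intro nn_integral_cong) (simp add: mult_ac)
    also have "\<dots> \<le> (\<integral>\<^sup>+z. g z * ennreal (?k z) \<partial>mu)"
    proof (intro nn_integral_mono mult_left_mono ennreal_leI)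
      fix z :: "real^2"
      have "rho (z $ 1) powr (sC - 1) = (1 / rho (z $ 1)) powr (1 - sC)"
        using powr_minus_divide[of "rho (z $ 1)" "1 - sC"] by (simp add: powr_divide)
      then show "rho (z $ 1) powr (sC - 1) \<le> ?k z" by simp
    qed auto
    also have "\<dots> \<le> ennreal (t powr (1 - q)) * (\<integral>\<^sup>+z. epowr (g z) q \<partial>mu)
        + ennreal t * (\<integral>\<^sup>+z. ennreal (?k z powr (q / (q - 1))) \<partial>mu)"
      by (rule nn_integral_young[OF q(1) t gmu kmu]) (simp add: add_nonneg_nonneg)
    also have "\<dots> \<le> ennreal (t powr (1 - q)) * (\<integral>\<^sup>+z. epowr (g z) q \<partial>mu) + ennreal t * ennreal B"
      by (intro add_left_mono mult_left_mono weight) auto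
    finally show "(\<integral>\<^sup>+c. (\<integral>\<^sup>+\<tau>\<in>{-1/2..1/2}. (\<integral>\<^sup>+x\<in>{0..1}. g (strand c \<tau> x) * indicator S (strand c \<tau> x) \<partial>lborel) \<partial>lborel) \<partial>MC)
      \<le> ennreal AC * (ennreal (t powr (1 - q)) * (\<integral>\<^sup>+z. epowr (g z) q \<partial>mu) + ennreal t * ennreal B)"
      by (simp add: mult_left_mono)
  qed
qed

lemma strand_in_S: "c \<in> C \<Longrightarrow> \<bar>\<tau>\<bar> \<le> 1/2 \<Longrightarrow> 0 \<le> x \<Longrightarrow> x \<le> 1 \<Longrightarrow> strand c \<tau> x \<in> S"
  using fib_graph[of c \<tau> x] by (simp add: strand_def)

text \<open>The Cantor measure has total mass 1 on \<open>C\<close> and the range of slopes has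
  length 1, so this is an average over a probability measure.\<close>

lemma strand_average:
  assumes G: "\<And>c \<tau>. c \<in> C \<Longrightarrow> \<bar>\<tau>\<bar> \<le> 1/2 \<Longrightarrow> b \<le> G c \<tau>"
  shows "b \<le> (\<integral>\<^sup>+c. (\<integral>\<^sup>+\<tau>\<in>{-1/2..1/2::real}. G c \<tau> \<partial>lborel) \<partial>MC)"
proof -
  have "b = b * emeasure MC C" by (simp add: emeasure_MC_C)
  also have "\<dots> = (\<integral>\<^sup>+c\<in>C. b \<partial>MC)" using RC.closed_C by (subst nn_integral_cmult_indicator) auto
  also have "\<dots> \<le> (\<integral>\<^sup>+c. (\<integral>\<^sup>+\<tau>\<in>{-1/2..1/2}. G c \<tau> \<partial>lborel) \<partial>MC)"
  proof (rule nn_integral_mono)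
    fix c
    have "b * indicator C c = (\<integral>\<^sup>+\<tau>\<in>{-1/2..1/2::real}. b * indicator C c \<partial>lborel)"
      by (subst nn_integral_cmult_indicator) auto
    also have "\<dots> \<le> (\<integral>\<^sup>+\<tau>\<in>{-1/2..1/2}. G c \<tau> \<partial>lborel)"
      by (intro nn_integral_mono) (use G in \<open>auto simp: indicator_def abs_le_iff\<close>)
    finally show "b * indicator C c \<le> (\<integral>\<^sup>+\<tau>\<in>{-1/2..1/2}. G c \<tau> \<partial>lborel)" .
  qed
  finally show ?thesis .
qed

definition strands :: "(real^2) cpath set" where
  "strands = {(0, 1, strand c \<tau>) | c \<tau>. c \<in> C \<and> \<bar>\<tau>\<bar> \<le> 1/2}"

lemma strands_rectifiable: "\<gamma> \<in> strands \<Longrightarrow> rectifiable X \<gamma>"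
  unfolding strands_def using lip_curve_rectifiable[OF strand_curve] by fastforce

lemma strands_not_abs_continuous: "\<gamma> \<in> strands \<Longrightarrow> \<not> abs_continuous_path X Y fmap \<gamma>"
  unfolding strands_def using not_abs_continuous_strand by blast

lemma modulus_strands_pos:
  assumes q: "1 < q" "1 - sC < (1 - sK) * (q - 1)"
  shows "0 < modulus X mu q strands"
proof -
  obtain B where B: "0 < B" and bound: "\<forall>g\<in>borel_measurable (mborel X). \<forall>t>0.
    (\<integral>\<^sup>+c. (\<integral>\<^sup>+\<tau>\<in>{-1/2..1/2}. (\<integral>\<^sup>+x\<in>{0..1}. g (strand c \<tau> x) * indicator S (strand c \<tau> x) \<partial>lborel) \<partial>lborel) \<partial>MC)
      \<le> ennreal AC * (ennreal (t powr (1 - q)) * (\<integral>\<^sup>+z. epowr (g z) q \<partial>mu) + ennreal t * ennreal B)"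
    using strand_bound[OF q] by (elim exE conjE) (rule that)
  \<comment> \<open>With this value the second term of \<open>strand_bound\<close> is
    \<open>1/4\<close>. Every curve contributes at least \<open>1/2\<close>, since its Lipschitz
    constant is 2, so \<open>1/4\<close> is left for the term with \<open>g\<close>.\<close>
  define t where "t = 1 / (4 * AC * B)"
  have t: "0 < t" using AC B by (simp add: t_def)
  define c0 where "c0 = 1 / (4 * AC * t powr (1 - q))"
  have c0: "0 < c0" using AC t by (simp add: c0_def)
  have "ennreal c0 \<le> modulus X mu q strands"
    unfolding modulus_def
  proof (rule INF_greatest)
    fix g assume "g \<in> {g. g \<in> borel_measurable (mborel X) \<and> (\<forall>\<gamma>\<in>strands. rectifiable X \<gamma> \<longrightarrow> 1 \<le> line_integral X \<gamma> g)}"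
    then have g: "g \<in> borel_measurable (mborel X)" and adm: "\<And>\<gamma>. \<gamma> \<in> strands \<Longrightarrow> 1 \<le> line_integral X \<gamma> g"
      using strands_rectifiable by auto
    have one: "ennreal (1/2) \<le> (\<integral>\<^sup>+x\<in>{0..1}. g (strand c \<tau> x) * indicator S (strand c \<tau> x) \<partial>lborel)"
      if c: "c \<in> C" "\<bar>\<tau>\<bar> \<le> 1/2" for c \<tau>
    proof -
      have "1 \<le> line_integral X (0, 1, strand c \<tau>) g" by (rule adm) (use c in \<open>unfold strands_def, blast\<close>)
      also have "\<dots> \<le> ennreal 2 * (\<integral>\<^sup>+x\<in>{0..1}. g (strand c \<tau> x) \<partial>lborel)"
        by (rule line_integral_le_lip_curve[OF strand_curve[OF c] g]) auto
      also have "(\<integral>\<^sup>+x\<in>{0..1}. g (strand c \<tau> x) \<partial>lborel) = (\<integral>\<^sup>+x\<in>{0..1}. g (strand c \<tau> x) * indicator S (strand c \<tau> x) \<partial>lborel)"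
        by (intro nn_integral_cong) (use strand_in_S[OF c] in \<open>auto simp: indicator_def\<close>)
      finally show ?thesis by (rule ennreal_half_le)
    qed
    let ?I = "\<integral>\<^sup>+z. epowr (g z) q \<partial>mu"
    have le: "ennreal (1/2) \<le> ennreal AC * (ennreal (t powr (1 - q)) * ?I + ennreal t * ennreal B)"
      using strand_average[of "ennreal (1/2)", OF one] bound[rule_format, OF g t] by (rule order_trans)
    show "ennreal c0 \<le> ?I"
    proof (cases ?I)
      case (real i)
      have "ennreal (1/2) \<le> ennreal (AC * (t powr (1 - q) * i + t * B))"
        using le real AC t B by (simp add: ennreal_mult ennreal_plus)
      moreover have "0 \<le> AC * (t powr (1 - q) * i + t * B)" using AC t B real by simp
      ultimately have "1/2 \<le> AC * (t powr (1 - q) * i + t * B)" using ennreal_le_iff by blast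
      moreover have "AC * (t * B) = 1/4" using AC B by (simp add: t_def)
      ultimately have "1/4 \<le> AC * t powr (1 - q) * i" by (simp add: distrib_left)
      then have "c0 \<le> i" using AC t by (simp add: c0_def field_simps)
      then show ?thesis using real by (simp add: ennreal_leI)
    qed simp
  qed
  then show ?thesis using c0 by (meson ennreal_less_zero_iff less_le_trans)
qed

text \<open>Compactness: finitely many of the balls given by local integrability cover the
  space.\<close>

lemma Lq_loc_integrable:
  assumes "Lq_loc X mu q g"
  shows "(\<integral>\<^sup>+z. epowr (g z) q \<partial>mu) < top"
proof -
  from assms have g: "g \<in> borel_measurable (mborel X)"
    and "\<And>z. z \<in> S \<Longrightarrow> \<exists>r>0. (\<integral>\<^sup>+y\<in>mball_of X z r. epowr (g y) q \<partial>mu) < top" by (auto simp: Lq_loc_def)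
  then obtain r where r: "\<And>z. z \<in> S \<Longrightarrow> 0 < r z" "\<And>z. z \<in> S \<Longrightarrow> (\<integral>\<^sup>+y\<in>mball_of X z (r z). epowr (g y) q \<partial>mu) < top" by metis
  have [measurable]: "g \<in> borel_measurable mu" using g by (simp add: measurable_cong_sets[OF sets_mu refl])
  have [measurable]: "mball_of X z s \<in> sets mu" for z s by (intro in_sets_mu borel_ball) auto
  have "compactin (mtopology_of X) S" using QC.compact_space_X by (simp add: compact_space_def)
  moreover have "\<forall>U\<in>(\<lambda>z. mball_of X z (r z)) ` S. openin (mtopology_of X) U"
    using open_ball by (auto simp: QC.mtopology_X)
  moreover have "S \<subseteq> \<Union> ((\<lambda>z. mball_of X z (r z)) ` S)"
  proof
    fix z assume "z \<in> S"
    then have "z \<in> mball_of X z (r z)" using r(1) mdist_self[of z X] by simp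
    then show "z \<in> \<Union> ((\<lambda>z. mball_of X z (r z)) ` S)" using \<open>z \<in> S\<close> by blast
  qed
  ultimately obtain \<F> where \<F>: "finite \<F>" "\<F> \<subseteq> (\<lambda>z. mball_of X z (r z)) ` S" "S \<subseteq> \<Union> \<F>"
    unfolding compactin_def by (elim conjE allE[of _ "(\<lambda>z. mball_of X z (r z)) ` S"]) blast
  obtain D where D: "finite D" "D \<subseteq> S" "S \<subseteq> (\<Union>z\<in>D. mball_of X z (r z))"
    using finite_subset_image[OF \<F>(1,2)] \<F>(3) by blast
  have "(\<integral>\<^sup>+y. epowr (g y) q \<partial>mu) \<le> (\<integral>\<^sup>+y. (\<Sum>z\<in>D. epowr (g y) q * indicator (mball_of X z (r z)) y) \<partial>mu)"
  proof (rule nn_integral_mono)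
    fix y assume "y \<in> space mu"
    then obtain z where z: "z \<in> D" "y \<in> mball_of X z (r z)" using D(3) by auto
    have "epowr (g y) q = epowr (g y) q * indicator (mball_of X z (r z)) y" using z(2) by simp
    also have "\<dots> \<le> (\<Sum>z\<in>D. epowr (g y) q * indicator (mball_of X z (r z)) y)"
      by (rule member_le_sum[OF z(1)]) (use D(1) in auto)
    finally show "epowr (g y) q \<le> (\<Sum>z\<in>D. epowr (g y) q * indicator (mball_of X z (r z)) y)" .
  qed
  also have "\<dots> = (\<Sum>z\<in>D. \<integral>\<^sup>+y\<in>mball_of X z (r z). epowr (g y) q \<partial>mu)" by (rule nn_integral_sum) measurable
  also have "\<dots> < top" using D r(2) by (simp add: ennreal_sum_less_top subset_eq)
  finally show ?thesis .
qed

text \<open>If \<open>g\<close> were a locally \<open>L^q\<close> upper gradient,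
  \<open>strand_bound\<close> would give a curve of the pencil along which \<open>g\<close> is
  integrable. The measure with density \<open>g\<close> along this curve has mass at least
  \<open>1/2\<close> on every level set of \<open>K\<close>, because the map stretches these to
  total length 1. By continuity from above it would charge \<open>K\<close>, which is a null
  set.\<close>

lemma fmap_not_N1q:
  assumes q: "1 < q" "1 - sC < (1 - sK) * (q - 1)"
  shows "fmap \<notin> N1q_loc X mu Y q"
proof
  assume "fmap \<in> N1q_loc X mu Y q"
  then obtain g where ug: "upper_gradient X Y fmap g" and Lq: "Lq_loc X mu q g" by (auto simp: N1q_loc_def)
  have g: "g \<in> borel_measurable (mborel X)" using ug by (simp add: upper_gradient_def)
  let ?J = "\<lambda>c \<tau>. \<integral>\<^sup>+x\<in>{0..1}. g (strand c \<tau> x) * indicator S (strand c \<tau> x) \<partial>lborel"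
  obtain B where "0 < B" and B: "\<forall>g\<in>borel_measurable (mborel X). \<forall>t>0.
    (\<integral>\<^sup>+c. (\<integral>\<^sup>+\<tau>\<in>{-1/2..1/2}. (\<integral>\<^sup>+x\<in>{0..1}. g (strand c \<tau> x) * indicator S (strand c \<tau> x) \<partial>lborel) \<partial>lborel) \<partial>MC)
      \<le> ennreal AC * (ennreal (t powr (1 - q)) * (\<integral>\<^sup>+z. epowr (g z) q \<partial>mu) + ennreal t * ennreal B)"
    using strand_bound[OF q] by (elim exE conjE) (rule that)
  have "(\<integral>\<^sup>+c. (\<integral>\<^sup>+\<tau>\<in>{-1/2..1/2}. ?J c \<tau> \<partial>lborel) \<partial>MC)
      \<le> ennreal AC * (ennreal (1 powr (1 - q)) * (\<integral>\<^sup>+z. epowr (g z) q \<partial>mu) + ennreal 1 * ennreal B)"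
    by (rule B[rule_format, OF g zero_less_one])
  also have "\<dots> < top" using Lq_loc_integrable[OF Lq] by (simp add: ennreal_mult_less_top)
  finally have fin: "(\<integral>\<^sup>+c. (\<integral>\<^sup>+\<tau>\<in>{-1/2..1/2}. ?J c \<tau> \<partial>lborel) \<partial>MC) < top" .
  have "\<exists>c\<in>C. \<exists>\<tau>. \<bar>\<tau>\<bar> \<le> 1/2 \<and> ?J c \<tau> < top"
  proof (rule ccontr)
    assume *: "\<not> ?thesis"
    have "top \<le> ?J c \<tau>" if "c \<in> C" "\<bar>\<tau>\<bar> \<le> 1/2" for c \<tau>
      using * that by (simp only: not_less Bex_def not_ex de_Morgan_conj) blast
    from strand_average[of top ?J, OF this] show False using fin by simp
  qed
  then obtain c \<tau> where c: "c \<in> C" "\<bar>\<tau>\<bar> \<le> 1/2" and J: "?J c \<tau> < top" by blast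
  let ?h = "\<lambda>x. g (strand c \<tau> x) * indicator {0..1} x"
  have hm [measurable]: "?h \<in> borel_measurable borel"
    by (rule measurable_along_curve[OF strand_curve[OF c] g]) auto
  have "(\<integral>\<^sup>+x. ?h x \<partial>lborel) = ?J c \<tau>"
    by (intro nn_integral_cong) (use strand_in_S[OF c] in \<open>auto simp: indicator_def\<close>)
  then have hfin: "(\<integral>\<^sup>+x. ?h x \<partial>lborel) < top" using J by simp
  define D where "D = density lborel ?h"
  have em: "emeasure D A = (\<integral>\<^sup>+x\<in>A. ?h x \<partial>lborel)" if "A \<in> sets borel" for A
    unfolding D_def using that by (subst emeasure_density) auto
  have setsD [simp]: "sets D = sets borel" by (simp add: D_def)
  have level [measurable]: "cantor_level lam n \<in> sets borel" for n
    unfolding cantor_level_def using cK.finite_ends by (intro sets.finite_UN) auto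
  have half: "ennreal (1/2) \<le> emeasure D (cantor_level lam n)" for n
  proof -
    have piece: "ennreal ((1/2) ^ n) \<le> ennreal 2 * emeasure D {l..l + lam ^ n}" if l: "l \<in> cantor_ends lam n" for l
    proof -
      have b: "0 \<le> l" "l + lam ^ n \<le> 1" "0 \<le> lam ^ n" using cK.ends_bounds[OF l] lam by auto
      have "ennreal ((1/2) ^ n) \<le> ennreal (mdist Y (fmap (strand c \<tau> l)) (fmap (strand c \<tau> (l + lam ^ n))))"
        using strand_stretch[OF l, of c \<tau>] by (simp add: ennreal_leI)
      also have "\<dots> \<le> ennreal 2 * (\<integral>\<^sup>+x\<in>{l..l + lam ^ n}. g (strand c \<tau> x) \<partial>lborel)"
        by (rule upper_gradient_lip_curve[OF ug strand_curve[OF c]]) (use b in auto)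
      also have "(\<integral>\<^sup>+x\<in>{l..l + lam ^ n}. g (strand c \<tau> x) \<partial>lborel) = emeasure D {l..l + lam ^ n}"
        by (subst em) (use b in \<open>auto simp: indicator_def intro!: nn_integral_cong\<close>)
      finally show ?thesis .
    qed
    have disj: "disjoint_family_on (\<lambda>l. {l..l + lam ^ n}) (cantor_ends lam n)"
      unfolding disjoint_family_on_def
    proof (intro ballI impI)
      fix l l' assume l: "l \<in> cantor_ends lam n" "l' \<in> cantor_ends lam n" "l \<noteq> l'"
      then show "{l..l + lam ^ n} \<inter> {l'..l' + lam ^ n} = {}"
        using cK.ends_separated[OF l(1,2)] cK.ends_separated[OF l(2,1)] by (cases "l < l'") auto
    qed
    have "1 = (\<Sum>l\<in>cantor_ends lam n. ennreal ((1/2) ^ n))"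
      by (simp add: cK.card_ends_eq power_one_over ennreal_of_nat_eq_real_of_nat ennreal_mult[symmetric] ennreal_1[symmetric] del: ennreal_1)
    also have "\<dots> \<le> (\<Sum>l\<in>cantor_ends lam n. ennreal 2 * emeasure D {l..l + lam ^ n})" by (intro sum_mono piece)
    also have "\<dots> = ennreal 2 * (\<Sum>l\<in>cantor_ends lam n. emeasure D {l..l + lam ^ n})" by (rule sum_distrib_left[symmetric])
    also have "(\<Sum>l\<in>cantor_ends lam n. emeasure D {l..l + lam ^ n}) = emeasure D (cantor_level lam n)"
      unfolding cantor_level_def by (rule sum_emeasure) (use disj cK.finite_ends in auto)
    finally show ?thesis by (rule ennreal_half_le)
  qed
  have "(\<lambda>n. emeasure D (cantor_level lam n)) \<longlonglongrightarrow> emeasure D (\<Inter>n. cantor_level lam n)"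
  proof (rule Lim_emeasure_decseq)
    show "range (cantor_level lam) \<subseteq> sets D" by auto
    show "decseq (cantor_level lam)" unfolding decseq_def using cK.level_antimono by blast
    fix n
    have "emeasure D (cantor_level lam n) \<le> emeasure D UNIV" by (intro emeasure_mono) auto
    also have "\<dots> = (\<integral>\<^sup>+x. ?h x \<partial>lborel)" by (subst em) auto
    finally show "emeasure D (cantor_level lam n) \<noteq> \<infinity>" using hfin by (auto simp: top_unique)
  qed
  moreover have "emeasure D (\<Inter>n. cantor_level lam n) = 0"
  proof -
    have "K \<in> null_sets lborel" using RK.null_C RK.closed_C by auto
    then have "K \<in> null_sets D"
      unfolding D_def by (subst null_sets_density_iff) (auto intro: AE_not_in AE_mp)
    then show ?thesis unfolding K_def cantor_set_def by (rule null_setsD1)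
  qed
  ultimately have "(\<lambda>n. emeasure D (cantor_level lam n)) \<longlonglongrightarrow> 0" by simp
  then have "ennreal (1/2) \<le> 0" by (rule LIMSEQ_le_const) (use half in auto)
  then show False by simp
qed

end

theorem theorem1p3:
  fixes p \<epsilon> :: real
  assumes "1 < p" and "p < 2" and "0 < \<epsilon>"
  shows "\<exists>(S :: (real^2) set) (T :: (real^2) set)
      (X :: (real^2) metric) (Y :: (real^2) metric)
      (\<mu> :: (real^2) measure) (\<nu> :: (real^2) measure)
      (E :: (real^2) set) (f :: real^2 \<Rightarrow> real^2).
    compact S \<and> compact T \<and>
    mspace X = S \<and>
    (\<forall>x\<in>S. \<forall>y\<in>S. ennreal (mdist X x y) = length_dist (submetric euclidean_metric S) x y) \<and>
    (\<exists>L\<ge>1. \<forall>x\<in>S. \<forall>y\<in>S. dist x y / L \<le> mdist X x y \<and> mdist X x y \<le> L * dist x y) \<and>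
    Y = submetric euclidean_metric T \<and>
    \<mu> = restrict_space lborel S \<and>
    \<nu> = restrict_space lborel T \<and>
    metric_measure_space X \<mu> \<and> metric_measure_space Y \<nu> \<and>
    compact_space (mtopology_of X) \<and> compact_space (mtopology_of Y) \<and>
    closedin (mtopology_of X) E \<and>
    homeomorphic_map (mtopology_of X) (mtopology_of Y) f \<and>
    geodesic_space X \<and> ahlfors_regular X \<mu> 2 \<and>
    ahlfors_regular_off Y \<nu> 2 (f ` E) \<and>
    0 < hausdorff_measure X (2 - p) E \<and> hausdorff_measure X (2 - p) E < top \<and>
    (\<forall>x\<in>mspace X - E. metric_distortion X Y f x = 1) \<and>
    poincare_inequality X \<mu> (p + \<epsilon>) \<and>
    (\<forall>q\<ge>p + \<epsilon>. \<exists>\<Gamma>. (\<forall>\<gamma>\<in>\<Gamma>. rectifiable X \<gamma> \<and> \<not> abs_continuous_path X Y f \<gamma>) \<and>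
                   0 < modulus X \<mu> q \<Gamma>) \<and>
    (\<forall>q\<ge>p + \<epsilon>. f \<notin> N1q_loc X \<mu> Y q)"
proof -
  define s where "s = 2 - p"
  have s: "0 < s" "s < 1" using assms by (auto simp: s_def)
  \<comment> \<open>\<open>m\<close> is so large that
    \<open>cK.cdim * (p + \<epsilon>) < \<epsilon>\<close>, where \<open>cK.cdim\<close> will be
    \<open>s / (real m + 1)\<close>.\<close>
  obtain m :: nat where m_large: "real m > (2 + (p + \<epsilon>)) / \<epsilon>" using reals_Archimedean2 by blast
  have "0 < (2 + (p + \<epsilon>)) / \<epsilon>" using assms by (simp add: add_pos_pos)
  then have m0: "0 < real m" using m_large by linarith
  \<comment> \<open>The dimension of \<open>C\<close>: with \<open>d / m\<close> for
    \<open>K\<close> the two dimensions add up to \<open>s\<close>.\<close>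
  define d where "d = s * real m / (real m + 1)"
  have d: "0 < d" "d < 1"
  proof -
    show "0 < d" using s m0 by (simp add: d_def)
    have "s * real m < 1 * (real m + 1)" using s m0 by (intro mult_strict_mono) auto
    then show "d < 1" using m0 by (simp add: d_def)
  qed
  \<comment> \<open>The ratio for which the Cantor set has similarity dimension
    \<open>d\<close>.\<close>
  define a where "a = (1/2::real) powr (1 / d)"
  have a: "0 < a" "a < 1/2"
  proof -
    show "0 < a" by (simp add: a_def)
    have "(1/2::real) powr (1 / d) < (1/2) powr 1" using d by (intro powr_less_mono') auto
    then show "a < 1/2" by (simp add: a_def)
  qed
  interpret construction a m by unfold_locales (use a m0 in auto)
  have "ln (1 / a) = ln 2 / d" using d by (simp add: a_def ln_div ln_powr)
  then have dimC: "cC.cdim = d" using d by (simp add: cC.cdim_def)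
  have "cK.cdim = d / real m" using dim_relation dimC m0 by (simp add: field_simps)
  then have dimK: "cK.cdim = s / (real m + 1)" using m0 by (simp add: d_def)
  have dim: "cK.cdim + cC.cdim = 2 - p"
  proof -
    have "s / (real m + 1) + s * real m / (real m + 1) = s * (real m + 1) / (real m + 1)"
      by (simp add: add_divide_distrib[symmetric] algebra_simps)
    then show ?thesis unfolding dimC dimK d_def using m0 by (simp add: s_def)
  qed
  \<comment> \<open>Substituting \<open>cC.cdim = 2 - p - cK.cdim\<close>, the condition at
    \<open>q = p + \<epsilon>\<close> becomes
    \<open>cK.cdim * (p + \<epsilon>) < \<epsilon>\<close>; larger \<open>q\<close> only increase
    the right-hand side.\<close>
  have q: "1 < q" "1 - cC.cdim < (1 - cK.cdim) * (q - 1)" if pq: "p + \<epsilon> \<le> q" for q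
  proof -
    show "1 < q" using that assms by simp
    have k: "cC.cdim = s - cK.cdim" using dim by (simp add: s_def)
    have "cK.cdim * (p + \<epsilon>) < \<epsilon>"
    proof -
      have "s * (p + \<epsilon>) \<le> 1 * (p + \<epsilon>)" using s assms by (intro mult_right_mono) auto
      also have "\<dots> < \<epsilon> * (real m + 1)"
        using m_large assms by (simp add: field_simps)
      finally show ?thesis unfolding dimK using m0 by (simp add: field_simps)
    qed
    then have "1 - cC.cdim < (1 - cK.cdim) * (p + \<epsilon> - 1)"
      unfolding k by (simp add: s_def algebra_simps)
    also have "\<dots> \<le> (1 - cK.cdim) * (q - 1)" using pq cK.cdim_bounds by (intro mult_left_mono) auto
    finally show "1 - cC.cdim < (1 - cK.cdim) * (q - 1)" .
  qed
  have bilip: "\<exists>L\<ge>1. \<forall>x\<in>S. \<forall>y\<in>S. dist x y / L \<le> mdist X x y \<and> mdist X x y \<le> L * dist x y"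
  proof (intro exI[of _ Lc] conjI ballI)
    fix x y assume xy: "x \<in> S" "y \<in> S"
    have "dist x y / Lc \<le> dist x y / 1" using Lc(1) by (intro divide_left_mono) auto
    then show "dist x y / Lc \<le> mdist X x y" "mdist X x y \<le> Lc * dist x y"
      using QC.ldist_bounds[OF xy] by auto
  qed (rule Lc)
  show ?thesis
    by (rule exI[of _ S], rule exI[of _ T], rule exI[of _ X], rule exI[of _ Y], rule exI[of _ mu], rule exI[of _ nu],
        rule exI[of _ E], rule exI[of _ fmap], intro conjI)
      (use compact_S compact_T bilip QC.length_dist_ldist metric_measure_space_X metric_measure_space_Y
        QC.compact_space_X compact_space_Y closedin_E homeomorphic_fmap QC.geodesic_X ahlfors_regular_X
        ahlfors_regular_off_Y hausdorff_E_pos hausdorff_E_finite metric_distortion_fmap poincare_X[OF q[OF order_refl]]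
        strands_rectifiable strands_not_abs_continuous modulus_strands_pos[OF q] fmap_not_N1q[OF q]
        in \<open>auto simp: dim[symmetric] Y_def[symmetric] mu_def[symmetric] nu_def[symmetric] intro!: exI[of _ strands]\<close>)
qed

end
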